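(* Let $H$ be a finite-dimensional Hopf algebra over a field $k$ and let $A$ be a finite-dimensional (nonzero, unital) left $H$-module algebra. Then the minimum odd depth of $H$ in the smash product $A\# H$ satisfies $$d_{\mathrm{odd}}(H, A \# H) = 2\, d(A, {}_H\mathcal{M}) + 1 .$$
   Context: $A\# H$ is $A\otimes_k H$ as a vector space with multiplication $(a\# h)(b\# g)=a(h_{(1)}.b)\# h_{(2)}g$ (Sweedler notation); $H$ is identified with the subalgebra $1_A\# H$. Depth of a module: for a left module $W$ over $H$, tensor powers $W^{\otimes m}$ over $k$ carry the diagonal action, and $T_n(W)=W\oplus W^{\otimes 2}\oplus\cdots\oplus W^{\otimes n}$. $W$ has depth $n\geq 1$ if $T_{n+1}(W)$ is isomorphic to a direct summand of $q\cdot T_n(W)$ ($q$ copies) for some positive integer $q$; $W$ has depth $0$ if $W$ is isomorphic to a direct sum of copies of the trivial module $k_\varepsilon$. $d(W,{}_H\mathcal{M})$ is the least $n\ge 0$ such that $W$ has depth $n$ ($\infty$ if there is none). Here ${}_H\mathcal M$ is the category of finite-dimensional left $H$-modules. Depth of a subalgebra: modules $X, Y$ are similar if each is isomorphic to a direct summand of a finite direct sum of copies of the other. For a unital subalgebra $B\subseteq C$ of finite-dimensional algebras let $C^{\otimes_B n}$ be the $n$-fold tensor product of $C$ over $B$, $C^{\otimes_B 0}=B$. The extension has depth $2n+1$ ($n\ge 0$) if $C^{\otimes_B(n+1)}$ and $C^{\otimes_B n}$ are similar as $B$-$B$-bimodules, and depth $2n$ ($n\ge 1$) if they are similar as $B$-$C$-bimodules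 or as $C$-$B$-bimodules. Depth $m$ implies depth $m+1$. The minimum depth $d(B,C)$ is the least $m\geq 1$ such that $B\subseteq C$ has depth $m$ ($\infty$ if there is none), and $d_{\mathrm{odd}}(B,C)=2\lceil \frac{d(B,C)-1}{2}\rceil+1$ is the least odd integer greater than or equal to $d(B,C)$ ($\infty$ if $d(B,C)=\infty$). *)

theory Defs
  imports "HOL-Algebra.AbelCoset" "Jordan_Normal_Form.Missing_VectorSpace" "HOL-Library.Extended_Nat"
begin

section \<open>Vector spaces given by generators and relations\<close>

text \<open>
  The \<open>mult\<close> and \<open>one\<close> fields of a record used only as a module are irrelevant and left undefined.
\<close>

definition free_module :: "('k, 'r) ring_scheme \<Rightarrow> 's set \<Rightarrow> ('k, 's \<Rightarrow> 'k) module" where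
  "free_module K S =
    \<lparr>carrier = {f. f \<in> S \<rightarrow> carrier K \<and> (\<forall>s. s \<notin> S \<longrightarrow> f s = \<zero>\<^bsub>K\<^esub>) \<and> finite {s. f s \<noteq> \<zero>\<^bsub>K\<^esub>}},
     mult = undefined, one = undefined,
     zero = (\<lambda>_. \<zero>\<^bsub>K\<^esub>),
     add = (\<lambda>f g s. f s \<oplus>\<^bsub>K\<^esub> g s),
     smult = (\<lambda>c f s. c \<otimes>\<^bsub>K\<^esub> f s)\<rparr>"

definition free_gen :: "('k, 'r) ring_scheme \<Rightarrow> 's \<Rightarrow> 's \<Rightarrow> 'k" where
  "free_gen K s = (\<lambda>t. if t = s then \<one>\<^bsub>K\<^esub> else \<zero>\<^bsub>K\<^esub>)"

definition quotient_module :: "('k, 'v, 'e) module_scheme \<Rightarrow> 'v set \<Rightarrow> ('k, 'v set) module" where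
  "quotient_module V U =
    \<lparr>carrier = a_rcosets\<^bsub>V\<^esub> U,
     mult = undefined, one = undefined,
     zero = U,
     add = set_add V,
     smult = (\<lambda>c X. \<Union>x\<in>X. U +>\<^bsub>V\<^esub> (c \<odot>\<^bsub>V\<^esub> x))\<rparr>"

definition presented ::
    "('k, 'r) ring_scheme \<Rightarrow> 's set \<Rightarrow> ('s \<Rightarrow> 'k) set \<Rightarrow> ('k, ('s \<Rightarrow> 'k) set) module" where
  "presented K S R = quotient_module (free_module K S) (LinearCombinations.module.span K (free_module K S) R)"

definition pgen ::
    "('k, 'r) ring_scheme \<Rightarrow> 's set \<Rightarrow> ('s \<Rightarrow> 'k) set \<Rightarrow> 's \<Rightarrow> ('s \<Rightarrow> 'k) set" where
  "pgen K S R s = LinearCombinations.module.span K (free_module K S) R +>\<^bsub>free_module K S\<^esub> free_gen K s"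

text \<open>
  The linear map into \<open>Z\<close> with value \<open>f s\<close> on the class of each generator \<open>s\<close>, evaluated at the
  coset \<open>X\<close>.  It is only meaningful if the linear extension of \<open>f\<close> kills the relations, so that
  the image of a coset is a singleton.
\<close>

definition lift ::
    "('k, 'r) ring_scheme \<Rightarrow> ('k, 'z, 'e) module_scheme \<Rightarrow> ('s \<Rightarrow> 'z) \<Rightarrow> ('s \<Rightarrow> 'k) set \<Rightarrow> 'z" where
  "lift K Z f X = the_elem ((\<lambda>x. \<Oplus>\<^bsub>Z\<^esub>s\<in>{s. x s \<noteq> \<zero>\<^bsub>K\<^esub>}. x s \<odot>\<^bsub>Z\<^esub> f s) ` X)"


section \<open>Tensor products over the ground field\<close>

definition tensor_rels ::
    "('k, 'r) ring_scheme \<Rightarrow> ('k, 'v, 'e) module_scheme \<Rightarrow> ('k, 'w, 'f) module_scheme \<Rightarrow>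
     ('v \<times> 'w \<Rightarrow> 'k) set" where
  "tensor_rels K V W =
    (let F = free_module K (carrier V \<times> carrier W); d = free_gen K in
      {d (v \<oplus>\<^bsub>V\<^esub> v', w) \<ominus>\<^bsub>F\<^esub> (d (v, w) \<oplus>\<^bsub>F\<^esub> d (v', w)) | v v' w.
          v \<in> carrier V \<and> v' \<in> carrier V \<and> w \<in> carrier W} \<union>
      {d (v, w \<oplus>\<^bsub>W\<^esub> w') \<ominus>\<^bsub>F\<^esub> (d (v, w) \<oplus>\<^bsub>F\<^esub> d (v, w')) | v w w'.
          v \<in> carrier V \<and> w \<in> carrier W \<and> w' \<in> carrier W} \<union>
      {d (c \<odot>\<^bsub>V\<^esub> v, w) \<ominus>\<^bsub>F\<^esub> c \<odot>\<^bsub>F\<^esub> d (v, w) | c v w.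
          c \<in> carrier K \<and> v \<in> carrier V \<and> w \<in> carrier W} \<union>
      {d (v, c \<odot>\<^bsub>W\<^esub> w) \<ominus>\<^bsub>F\<^esub> c \<odot>\<^bsub>F\<^esub> d (v, w) | c v w.
          c \<in> carrier K \<and> v \<in> carrier V \<and> w \<in> carrier W})"

definition tensor ::
    "('k, 'r) ring_scheme \<Rightarrow> ('k, 'v, 'e) module_scheme \<Rightarrow> ('k, 'w, 'f) module_scheme \<Rightarrow>
     ('k, ('v \<times> 'w \<Rightarrow> 'k) set) module" where
  "tensor K V W = presented K (carrier V \<times> carrier W) (tensor_rels K V W)"

definition tens ::
    "('k, 'r) ring_scheme \<Rightarrow> ('k, 'v, 'e) module_scheme \<Rightarrow> ('k, 'w, 'f) module_scheme \<Rightarrow>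
     'v \<Rightarrow> 'w \<Rightarrow> ('v \<times> 'w \<Rightarrow> 'k) set" where
  "tens K V W v w = pgen K (carrier V \<times> carrier W) (tensor_rels K V W) (v, w)"

definition tuples :: "('k, 'v, 'e) module_scheme \<Rightarrow> nat \<Rightarrow> 'v list set" where
  "tuples V n = {xs. length xs = n \<and> set xs \<subseteq> carrier V}"

definition multilinear_rels ::
    "('k, 'r) ring_scheme \<Rightarrow> ('k, 'v, 'e) module_scheme \<Rightarrow> nat \<Rightarrow> ('v list \<Rightarrow> 'k) set" where
  "multilinear_rels K V n =
    (let F = free_module K (tuples V n); d = free_gen K in
      {d (xs[i := x \<oplus>\<^bsub>V\<^esub> y]) \<ominus>\<^bsub>F\<^esub> (d (xs[i := x]) \<oplus>\<^bsub>F\<^esub> d (xs[i := y])) | xs i x y.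
          xs \<in> tuples V n \<and> i < n \<and> x \<in> carrier V \<and> y \<in> carrier V} \<union>
      {d (xs[i := c \<odot>\<^bsub>V\<^esub> x]) \<ominus>\<^bsub>F\<^esub> c \<odot>\<^bsub>F\<^esub> d (xs[i := x]) | xs i c x.
          xs \<in> tuples V n \<and> i < n \<and> c \<in> carrier K \<and> x \<in> carrier V})"

definition tpow ::
    "('k, 'r) ring_scheme \<Rightarrow> ('k, 'v, 'e) module_scheme \<Rightarrow> nat \<Rightarrow> ('k, ('v list \<Rightarrow> 'k) set) module" where
  "tpow K V n = presented K (tuples V n) (multilinear_rels K V n)"

definition tpow_gen ::
    "('k, 'r) ring_scheme \<Rightarrow> ('k, 'v, 'e) module_scheme \<Rightarrow> 'v list \<Rightarrow> ('v list \<Rightarrow> 'k) set" where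
  "tpow_gen K V xs = pgen K (tuples V (length xs)) (multilinear_rels K V (length xs)) xs"


section \<open>Spaces with operators\<close>

text \<open>
  A vector space with a family of operators indexed by \<open>'i\<close>.  A left \<open>H\<close>-module is a space with
  operators indexed by the elements of \<open>H\<close>.  A bimodule has index type \<open>'c + 'c\<close>, where \<open>Inl c\<close>
  is the left action of \<open>c\<close> and \<open>Inr c\<close> is the right action of \<open>c\<close>.  Module notions are taken
  relative to a set \<open>I\<close> of indices, so restriction of scalars amounts to shrinking \<open>I\<close>:
  \<open>B\<close>-\<open>C\<close>-bimodule maps are the linear maps commuting with the operators in \<open>Sum_Type.Plus B C\<close>.
\<close>

record ('k, 'v, 'i) opmod = "('k, 'v) module" +
  act :: "'i \<Rightarrow> 'v \<Rightarrow> 'v"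

definition with_act :: "('k, 'v) module \<Rightarrow> ('i \<Rightarrow> 'v \<Rightarrow> 'v) \<Rightarrow> ('k, 'v, 'i) opmod" where
  "with_act V a = module.extend V (opmod.fields a)"

definition op_hom ::
    "('k, 'r) ring_scheme \<Rightarrow> 'i set \<Rightarrow> ('k, 'v, 'i) opmod \<Rightarrow> ('k, 'w, 'i) opmod \<Rightarrow> ('v \<Rightarrow> 'w) set" where
  "op_hom K I M N =
    {f \<in> LinearCombinations.module_hom K M N. \<forall>i\<in>I. \<forall>x\<in>carrier M. f (act M i x) = act N i (f x)}"

definition op_isomorphic ::
    "('k, 'r) ring_scheme \<Rightarrow> 'i set \<Rightarrow> ('k, 'v, 'i) opmod \<Rightarrow> ('k, 'w, 'i) opmod \<Rightarrow> bool" where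
  "op_isomorphic K I M N \<longleftrightarrow> (\<exists>f\<in>op_hom K I M N. bij_betw f (carrier M) (carrier N))"

definition op_submodule ::
    "('k, 'r) ring_scheme \<Rightarrow> 'i set \<Rightarrow> 'v set \<Rightarrow> ('k, 'v, 'i) opmod \<Rightarrow> bool" where
  "op_submodule K I P N \<longleftrightarrow> LinearCombinations.submodule K P N \<and> (\<forall>i\<in>I. \<forall>x\<in>P. act N i x \<in> P)"

definition iso_to_summand ::
    "('k, 'r) ring_scheme \<Rightarrow> 'i set \<Rightarrow> ('k, 'v, 'i) opmod \<Rightarrow> ('k, 'w, 'i) opmod \<Rightarrow> bool" where
  "iso_to_summand K I M N \<longleftrightarrow>
    (\<exists>P Q. op_submodule K I P N \<and> op_submodule K I Q N \<and>
       P \<inter> Q = {\<zero>\<^bsub>N\<^esub>} \<and> set_add N P Q = carrier N \<and>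
       op_isomorphic K I M (N\<lparr>carrier := P\<rparr>))"

definition dsum :: "'j set \<Rightarrow> ('j \<Rightarrow> ('k, 'v, 'i) opmod) \<Rightarrow> ('k, 'j \<Rightarrow> 'v, 'i) opmod" where
  "dsum J M =
    \<lparr>carrier = (\<Pi>\<^sub>E j\<in>J. carrier (M j)),
     mult = undefined, one = undefined,
     zero = (\<lambda>j\<in>J. \<zero>\<^bsub>M j\<^esub>),
     add = (\<lambda>x y. \<lambda>j\<in>J. x j \<oplus>\<^bsub>M j\<^esub> y j),
     smult = (\<lambda>c x. \<lambda>j\<in>J. c \<odot>\<^bsub>M j\<^esub> x j),
     act = (\<lambda>i x. \<lambda>j\<in>J. act (M j) i (x j))\<rparr>"

definition copies :: "nat \<Rightarrow> ('k, 'v, 'i) opmod \<Rightarrow> ('k, nat \<Rightarrow> 'v, 'i) opmod" where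
  "copies q M = dsum {..<q} (\<lambda>_. M)"

definition similar ::
    "('k, 'r) ring_scheme \<Rightarrow> 'i set \<Rightarrow> ('k, 'v, 'i) opmod \<Rightarrow> ('k, 'w, 'i) opmod \<Rightarrow> bool" where
  "similar K I M N \<longleftrightarrow>
    (\<exists>q. iso_to_summand K I M (copies q N)) \<and> (\<exists>q. iso_to_summand K I N (copies q M))"


section \<open>Algebras and Hopf algebras\<close>

locale assoc_algebra = vectorspace K C + ring C for K and C (structure) +
  assumes smult_mult: "\<lbrakk>c \<in> carrier K; x \<in> carrier C; y \<in> carrier C\<rbrakk> \<Longrightarrow>
      (c \<odot> x) \<otimes> y = c \<odot> (x \<otimes> y)"
    and mult_smult: "\<lbrakk>c \<in> carrier K; x \<in> carrier C; y \<in> carrier C\<rbrakk> \<Longrightarrow>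
      x \<otimes> (c \<odot> y) = c \<odot> (x \<otimes> y)"

definition ground :: "('k, 'r) ring_scheme \<Rightarrow> ('k, 'k) module" where
  "ground K = \<lparr>carrier = carrier K, mult = mult K, one = one K, zero = zero K, add = add K,
     smult = mult K\<rparr>"

record ('k, 'h) hopf = "('k, 'h) module" +
  comult :: "'h \<Rightarrow> ('h \<times> 'h \<Rightarrow> 'k) set"
  counit :: "'h \<Rightarrow> 'k"
  antipode :: "'h \<Rightarrow> 'h"

text \<open>
  Sweedler notation: for a bilinear \<open>f\<close> with values in \<open>Z\<close>, \<open>sweedler K H Z (\<lambda>h1 h2. f h1 h2) h\<close>
  is the sum \<open>f(h1, h2)\<close> over the components of the comultiplication of \<open>h\<close>.
\<close>

definition sweedler ::
    "('k, 'r) ring_scheme \<Rightarrow> ('k, 'h) hopf \<Rightarrow> ('k, 'z, 'e) module_scheme \<Rightarrow>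
     ('h \<Rightarrow> 'h \<Rightarrow> 'z) \<Rightarrow> 'h \<Rightarrow> 'z" where
  "sweedler K H Z f h = lift K Z (\<lambda>(a, b). f a b) (comult H h)"

locale hopf_algebra = assoc_algebra K H
  for K :: "('k, 'r) ring_scheme" and H :: "('k, 'h) hopf" (structure) +
  assumes comult_linear: "comult H \<in> LinearCombinations.module_hom K H (tensor K H H)"
    and counit_linear: "counit H \<in> LinearCombinations.module_hom K H (ground K)"
    and antipode_linear: "antipode H \<in> LinearCombinations.module_hom K H H"
    and coassoc: "h \<in> carrier H \<Longrightarrow>
      (let HH = tensor K H H; HHH = tensor K H HH;
           t = (\<lambda>a b c. tens K H HH a (tens K H H b c)) in
        sweedler K H HHH (\<lambda>h1 h2. sweedler K H HHH (\<lambda>h11 h12. t h11 h12 h2) h1) h =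
        sweedler K H HHH (\<lambda>h1 h2. sweedler K H HHH (\<lambda>h21 h22. t h1 h21 h22) h2) h)"
    and counit_left: "h \<in> carrier H \<Longrightarrow> sweedler K H H (\<lambda>h1 h2. counit H h1 \<odot> h2) h = h"
    and counit_right: "h \<in> carrier H \<Longrightarrow> sweedler K H H (\<lambda>h1 h2. counit H h2 \<odot> h1) h = h"
    and comult_one: "comult H \<one> = tens K H H \<one> \<one>"
    and comult_mult: "\<lbrakk>g \<in> carrier H; h \<in> carrier H\<rbrakk> \<Longrightarrow>
      comult H (g \<otimes> h) =
        sweedler K H (tensor K H H)
          (\<lambda>g1 g2. sweedler K H (tensor K H H) (\<lambda>h1 h2. tens K H H (g1 \<otimes> h1) (g2 \<otimes> h2)) h) g"
    and counit_one: "counit H \<one> = \<one>\<^bsub>K\<^esub>"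
    and counit_mult: "\<lbrakk>g \<in> carrier H; h \<in> carrier H\<rbrakk> \<Longrightarrow>
      counit H (g \<otimes> h) = counit H g \<otimes>\<^bsub>K\<^esub> counit H h"
    and antipode_left: "h \<in> carrier H \<Longrightarrow>
      sweedler K H H (\<lambda>h1 h2. antipode H h1 \<otimes> h2) h = counit H h \<odot> \<one>"
    and antipode_right: "h \<in> carrier H \<Longrightarrow>
      sweedler K H H (\<lambda>h1 h2. h1 \<otimes> antipode H h2) h = counit H h \<odot> \<one>"

locale left_module = assoc_algebra K H + W: vectorspace K W
  for K :: "('k, 'r) ring_scheme" and H :: "('k, 'h, 'e) module_scheme" (structure)
    and W :: "('k, 'w, 'h) opmod" +
  assumes act_closed: "\<lbrakk>h \<in> carrier H; w \<in> carrier W\<rbrakk> \<Longrightarrow> act W h w \<in> carrier W"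
    and act_add_left: "\<lbrakk>g \<in> carrier H; h \<in> carrier H; w \<in> carrier W\<rbrakk> \<Longrightarrow>
      act W (g \<oplus> h) w = act W g w \<oplus>\<^bsub>W\<^esub> act W h w"
    and act_add_right: "\<lbrakk>h \<in> carrier H; v \<in> carrier W; w \<in> carrier W\<rbrakk> \<Longrightarrow>
      act W h (v \<oplus>\<^bsub>W\<^esub> w) = act W h v \<oplus>\<^bsub>W\<^esub> act W h w"
    and act_smult_left: "\<lbrakk>c \<in> carrier K; h \<in> carrier H; w \<in> carrier W\<rbrakk> \<Longrightarrow>
      act W (c \<odot> h) w = c \<odot>\<^bsub>W\<^esub> act W h w"
    and act_smult_right: "\<lbrakk>c \<in> carrier K; h \<in> carrier H; w \<in> carrier W\<rbrakk> \<Longrightarrow>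
      act W h (c \<odot>\<^bsub>W\<^esub> w) = c \<odot>\<^bsub>W\<^esub> act W h w"
    and act_mult: "\<lbrakk>g \<in> carrier H; h \<in> carrier H; w \<in> carrier W\<rbrakk> \<Longrightarrow>
      act W (g \<otimes> h) w = act W g (act W h w)"
    and act_one: "w \<in> carrier W \<Longrightarrow> act W \<one> w = w"

locale module_algebra = hopf_algebra K H + left_module K H A + A: assoc_algebra K A
  for K :: "('k, 'r) ring_scheme" and H :: "('k, 'h) hopf" (structure)
    and A :: "('k, 'a, 'h) opmod" +
  assumes act_product: "\<lbrakk>h \<in> carrier H; a \<in> carrier A; b \<in> carrier A\<rbrakk> \<Longrightarrow>
      act A h (a \<otimes>\<^bsub>A\<^esub> b) = sweedler K H A (\<lambda>h1 h2. act A h1 a \<otimes>\<^bsub>A\<^esub> act A h2 b) h"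
    and act_unit: "h \<in> carrier H \<Longrightarrow> act A h \<one>\<^bsub>A\<^esub> = counit H h \<odot>\<^bsub>A\<^esub> \<one>\<^bsub>A\<^esub>"

definition smash ::
    "('k, 'r) ring_scheme \<Rightarrow> ('k, 'h) hopf \<Rightarrow> ('k, 'a, 'h) opmod \<Rightarrow> ('k, ('a \<times> 'h \<Rightarrow> 'k) set) module" where
  "smash K H A =
    (let T = tensor K A H in
      T\<lparr>mult := (\<lambda>X Y.
           lift K T (\<lambda>(a, h).
             lift K T (\<lambda>(b, g).
               sweedler K H T (\<lambda>h1 h2. tens K A H (a \<otimes>\<^bsub>A\<^esub> act A h1 b) (h2 \<otimes>\<^bsub>H\<^esub> g)) h) Y) X),
         one := tens K A H \<one>\<^bsub>A\<^esub> \<one>\<^bsub>H\<^esub>\<rparr>)"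

definition smash_copy ::
    "('k, 'r) ring_scheme \<Rightarrow> ('k, 'h) hopf \<Rightarrow> ('k, 'a, 'h) opmod \<Rightarrow> ('a \<times> 'h \<Rightarrow> 'k) set set" where
  "smash_copy K H A = tens K A H \<one>\<^bsub>A\<^esub> ` carrier H"


section \<open>Depth of a module\<close>

text \<open>The diagonal action on a pure tensor, in Sweedler notation:
  \<open>h.(w \<otimes> ws) = (h1.w) \<otimes> (h2.ws)\<close>, and the action on the zeroth power is through the counit.\<close>

primrec diag_act ::
    "('k, 'r) ring_scheme \<Rightarrow> ('k, 'h) hopf \<Rightarrow> ('k, 'w, 'h) opmod \<Rightarrow> 'w list \<Rightarrow> 'h \<Rightarrow>
     ('w list \<Rightarrow> 'k) set" where
  "diag_act K H W [] = (\<lambda>h. counit H h \<odot>\<^bsub>tpow K W 0\<^esub> tpow_gen K W [])"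
| "diag_act K H W (w # ws) =
    (let T = tpow K W (Suc (length ws)) in
      sweedler K H T
        (\<lambda>h1 h2. lift K T (\<lambda>vs. tpow_gen K W (act W h1 w # vs)) (diag_act K H W ws h2)))"

definition tpow_module ::
    "('k, 'r) ring_scheme \<Rightarrow> ('k, 'h) hopf \<Rightarrow> ('k, 'w, 'h) opmod \<Rightarrow> nat \<Rightarrow>
     ('k, ('w list \<Rightarrow> 'k) set, 'h) opmod" where
  "tpow_module K H W n =
    with_act (tpow K W n) (\<lambda>h. lift K (tpow K W n) (\<lambda>ws. diag_act K H W ws h))"

definition truncated_tensor ::
    "('k, 'r) ring_scheme \<Rightarrow> ('k, 'h) hopf \<Rightarrow> ('k, 'w, 'h) opmod \<Rightarrow> nat \<Rightarrow>
     ('k, nat \<Rightarrow> ('w list \<Rightarrow> 'k) set, 'h) opmod" where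
  "truncated_tensor K H W n = dsum {1..n} (tpow_module K H W)"

definition trivial_module ::
    "('k, 'r) ring_scheme \<Rightarrow> ('k, 'h) hopf \<Rightarrow> ('k, 'k, 'h) opmod" where
  "trivial_module K H = with_act (ground K) (\<lambda>h c. counit H h \<otimes>\<^bsub>K\<^esub> c)"

definition has_module_depth ::
    "('k, 'r) ring_scheme \<Rightarrow> ('k, 'h) hopf \<Rightarrow> ('k, 'w, 'h) opmod \<Rightarrow> nat \<Rightarrow> bool" where
  "has_module_depth K H W n \<longleftrightarrow>
    (if n = 0
     then \<exists>q. op_isomorphic K (carrier H) W (copies q (trivial_module K H))
     else \<exists>q>0. iso_to_summand K (carrier H)
            (truncated_tensor K H W (n + 1)) (copies q (truncated_tensor K H W n)))"

text \<open>The infimum of the empty set in \<^typ>\<open>enat\<close> is \<open>\<infinity>\<close>.\<close>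

definition module_depth ::
    "('k, 'r) ring_scheme \<Rightarrow> ('k, 'h) hopf \<Rightarrow> ('k, 'w, 'h) opmod \<Rightarrow> enat" where
  "module_depth K H W = Inf {enat n | n. has_module_depth K H W n}"


section \<open>Depth of a subalgebra\<close>

definition balance_rels ::
    "('k, 'r) ring_scheme \<Rightarrow> ('k, 'c) module \<Rightarrow> 'c set \<Rightarrow> nat \<Rightarrow> ('c list \<Rightarrow> 'k) set" where
  "balance_rels K C B n =
    (let F = free_module K (tuples C n); d = free_gen K in
      {d (xs[i := xs ! i \<otimes>\<^bsub>C\<^esub> b]) \<ominus>\<^bsub>F\<^esub> d (xs[Suc i := b \<otimes>\<^bsub>C\<^esub> xs ! Suc i]) | xs i b.
          xs \<in> tuples C n \<and> Suc i < n \<and> b \<in> B})"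

text \<open>The tensor power of \<open>C\<close> over \<open>B\<close> as a \<open>C\<close>-\<open>C\<close>-bimodule, for \<open>n \<ge> 1\<close>.\<close>

definition tpow_over ::
    "('k, 'r) ring_scheme \<Rightarrow> ('k, 'c) module \<Rightarrow> 'c set \<Rightarrow> nat \<Rightarrow>
     ('k, ('c list \<Rightarrow> 'k) set, 'c + 'c) opmod" where
  "tpow_over K C B n =
    (let S = tuples C n; R = multilinear_rels K C n \<union> balance_rels K C B n;
         T = presented K S R in
      with_act T
        (case_sum
          (\<lambda>c. lift K T (\<lambda>xs. pgen K S R (xs[0 := c \<otimes>\<^bsub>C\<^esub> xs ! 0])))
          (\<lambda>c. lift K T (\<lambda>xs. pgen K S R (xs[n - 1 := xs ! (n - 1) \<otimes>\<^bsub>C\<^esub> c])))))"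

definition regular_bimodule ::
    "('k, 'c) module \<Rightarrow> 'c set \<Rightarrow> ('k, 'c, 'c + 'c) opmod" where
  "regular_bimodule C B =
    with_act (C\<lparr>carrier := B\<rparr>) (case_sum (\<lambda>b x. b \<otimes>\<^bsub>C\<^esub> x) (\<lambda>b x. x \<otimes>\<^bsub>C\<^esub> b))"

text \<open>Depth \<open>1\<close> is separate because the zeroth tensor power is \<open>B\<close>, which has another type than
  the higher ones.\<close>

definition has_depth ::
    "('k, 'r) ring_scheme \<Rightarrow> 'c set \<Rightarrow> ('k, 'c) module \<Rightarrow> nat \<Rightarrow> bool" where
  "has_depth K B C m \<longleftrightarrow>
    m = 1 \<and> similar K (Sum_Type.Plus B B) (tpow_over K C B 1) (regular_bimodule C B) \<or>
    (\<exists>n\<ge>1. m = 2 * n + 1 \<and>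
       similar K (Sum_Type.Plus B B) (tpow_over K C B (n + 1)) (tpow_over K C B n)) \<or>
    (\<exists>n\<ge>1. m = 2 * n \<and>
       (similar K (Sum_Type.Plus B (carrier C)) (tpow_over K C B (n + 1)) (tpow_over K C B n) \<or>
        similar K (Sum_Type.Plus (carrier C) B) (tpow_over K C B (n + 1)) (tpow_over K C B n)))"

definition min_depth ::
    "('k, 'r) ring_scheme \<Rightarrow> 'c set \<Rightarrow> ('k, 'c) module \<Rightarrow> enat" where
  "min_depth K B C = Inf {enat m | m. 1 \<le> m \<and> has_depth K B C m}"

definition odd_min_depth ::
    "('k, 'r) ring_scheme \<Rightarrow> 'c set \<Rightarrow> ('k, 'c) module \<Rightarrow> enat" where
  "odd_min_depth K B C =
    (case min_depth K B C of
       enat m \<Rightarrow> enat (2 * nat \<lceil>(real m - 1) / 2\<rceil> + 1)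
     | \<infinity> \<Rightarrow> \<infinity>)"

end

theory Submission
  imports Defs
begin

text \<open>
  Write \<open>C\<close> for the smash product.  As an \<open>H\<close>-\<open>H\<close>-bimodule the \<open>n\<close>-fold tensor power of \<open>C\<close> over
  \<open>H\<close> is induced from the \<open>n\<close>-fold tensor power \<open>X\<close> of \<open>A\<close>: it is \<open>X \<otimes> H\<close> with
  \<open>h.(x \<otimes> g).g' = h1.x \<otimes> h2 g g'\<close>, and for \<open>n = 0\<close> the module \<open>X\<close> is the trivial one.
  The functors \<open>X \<mapsto> X \<otimes> H\<close> and \<open>Y \<mapsto> Y \<otimes>\<^sub>H k\<close> are additive and the second undoes the first, so
  divisibility (being a summand of a finite direct sum of copies) holds between induced
  bimodules if and only if it holds between the modules they are induced from.  For \<open>n \<ge> 1\<close> the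
  unit and the multiplication of \<open>A\<close> make each tensor power of \<open>A\<close> a summand of the next one; so
  depth \<open>2n + 1\<close> of the extension and depth \<open>n\<close> of \<open>A\<close> both say that the \<open>(n+1)\<close>-st tensor power of
  \<open>A\<close> divides the \<open>n\<close>-th.  For \<open>n = 0\<close>, divisibility of \<open>A\<close> by the trivial module
  makes the action trivial, so \<open>A\<close> is a sum of trivial modules.  Finally depth \<open>2n\<close> implies depth
  \<open>2n + 1\<close> by restriction of scalars.
\<close>

section \<open>Linear maps\<close>

text \<open>An isomorphism from the \<open>n\<close>-fold power of \<open>C\<close> onto X \<otimes>
  H would need nested Sweedler sums on tuples, an inverse, and compatibility checks for both. The
  proof keeps only three facts about it: the map x \<mapsto> x \<otimes> 1, the spanning of the
  target by the right translates of its image, and, for each functional \<xi> on H, the map id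
  \<otimes> \<xi>, whose target is X alone. Taking the counit for \<xi> yields the projection to Y
  \<otimes> k over H. Taking the coordinates of a basis of H rebuilds f \<otimes> id from f; this is
  where H being finite-dimensional enters.

  The comparison with \<open>B\<close> itself at depth 1 requires h \<mapsto> 1 # h to be injective,
  and for that the unit of \<open>A\<close> must be nonzero. The same condition settles an asymmetry
  at depth zero: similarity asks that the trivial module and \<open>A\<close> divide each other,
  whereas module depth 0 asks that \<open>A\<close> be a sum of \<open>q\<close> trivial modules;
  for nonzero \<open>A\<close> the number \<open>q\<close> is positive and the trivial module is
  itself a summand of \<open>A\<close>.\<close>

lemma module_record_cong:
  assumes "Module.module K V" "carrier W = carrier V" "add W = add V" "zero W = zero V" "smult W = smult V"
  shows "Module.module K W"
proof -
  interpret Module.module K V by fact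
  show ?thesis
    by (rule module_criteria)
      (auto simp: assms(2-) R.is_cring M.a_assoc M.a_comm M.a_lcomm smult_assoc1 smult_l_distr smult_r_distr
        intro!: bexI[of _ "\<ominus>\<^bsub>V\<^esub> _"] M.r_neg)
qed

locale ground_field = field K for K :: "('k, 'r) ring_scheme"
begin

abbreviation vsp :: "('k, 'v, 'e) module_scheme \<Rightarrow> bool" where
  "vsp V \<equiv> vectorspace K V"

abbreviation lin ::
    "('k, 'v, 'e) module_scheme \<Rightarrow> ('k, 'w, 'f) module_scheme \<Rightarrow> ('v \<Rightarrow> 'w) \<Rightarrow> bool" where
  "lin V W f \<equiv> f \<in> LinearCombinations.module_hom K V W"

lemma vsI: "Module.module K V \<Longrightarrow> vsp V"
  by (simp add: vectorspace_def field_axioms)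

lemma vs_module: "vsp V \<Longrightarrow> Module.module K V"
  by (simp add: vectorspace_def)

lemma vs_abelian_group: "vsp V \<Longrightarrow> abelian_group V"
  by (simp add: vectorspace_def Module.module_def)

lemma vs_abelian_monoid: "vsp V \<Longrightarrow> abelian_monoid V"
  using vs_abelian_group abelian_group_def by blast

lemma vs_record_cong:
  assumes "vsp V" "carrier W = carrier V" "add W = add V" "zero W = zero V" "smult W = smult V"
  shows "vsp W"
  by (rule vsI, rule module_record_cong[OF vs_module[OF assms(1)] assms(2-)])

lemma vs_closed [simp, intro]:
  assumes "vsp V"
  shows "\<zero>\<^bsub>V\<^esub> \<in> carrier V"
    and "x \<in> carrier V \<Longrightarrow> y \<in> carrier V \<Longrightarrow> x \<oplus>\<^bsub>V\<^esub> y \<in> carrier V"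
    and "x \<in> carrier V \<Longrightarrow> y \<in> carrier V \<Longrightarrow> x \<ominus>\<^bsub>V\<^esub> y \<in> carrier V"
    and "c \<in> carrier K \<Longrightarrow> x \<in> carrier V \<Longrightarrow> c \<odot>\<^bsub>V\<^esub> x \<in> carrier V"
proof -
  interpret vectorspace K V by fact
  show "\<zero>\<^bsub>V\<^esub> \<in> carrier V"
    and "x \<in> carrier V \<Longrightarrow> y \<in> carrier V \<Longrightarrow> x \<oplus>\<^bsub>V\<^esub> y \<in> carrier V"
    and "x \<in> carrier V \<Longrightarrow> y \<in> carrier V \<Longrightarrow> x \<ominus>\<^bsub>V\<^esub> y \<in> carrier V"
    and "c \<in> carrier K \<Longrightarrow> x \<in> carrier V \<Longrightarrow> c \<odot>\<^bsub>V\<^esub> x \<in> carrier V"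
    by auto
qed

lemma vs_simps [simp]:
  assumes "vsp V"
  shows "x \<in> carrier V \<Longrightarrow> \<zero>\<^bsub>V\<^esub> \<oplus>\<^bsub>V\<^esub> x = x"
    and "x \<in> carrier V \<Longrightarrow> x \<oplus>\<^bsub>V\<^esub> \<zero>\<^bsub>V\<^esub> = x"
    and "x \<in> carrier V \<Longrightarrow> \<zero>\<^bsub>K\<^esub> \<odot>\<^bsub>V\<^esub> x = \<zero>\<^bsub>V\<^esub>"
    and "c \<in> carrier K \<Longrightarrow> c \<odot>\<^bsub>V\<^esub> \<zero>\<^bsub>V\<^esub> = \<zero>\<^bsub>V\<^esub>"
    and "x \<in> carrier V \<Longrightarrow> \<one>\<^bsub>K\<^esub> \<odot>\<^bsub>V\<^esub> x = x"
    and "x \<in> carrier V \<Longrightarrow> x \<ominus>\<^bsub>V\<^esub> x = \<zero>\<^bsub>V\<^esub>"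
proof -
  interpret vectorspace K V by fact
  show "x \<in> carrier V \<Longrightarrow> \<zero>\<^bsub>V\<^esub> \<oplus>\<^bsub>V\<^esub> x = x"
    and "x \<in> carrier V \<Longrightarrow> x \<oplus>\<^bsub>V\<^esub> \<zero>\<^bsub>V\<^esub> = x"
    and "x \<in> carrier V \<Longrightarrow> \<zero>\<^bsub>K\<^esub> \<odot>\<^bsub>V\<^esub> x = \<zero>\<^bsub>V\<^esub>"
    and "c \<in> carrier K \<Longrightarrow> c \<odot>\<^bsub>V\<^esub> \<zero>\<^bsub>V\<^esub> = \<zero>\<^bsub>V\<^esub>"
    and "x \<in> carrier V \<Longrightarrow> \<one>\<^bsub>K\<^esub> \<odot>\<^bsub>V\<^esub> x = x"
    and "x \<in> carrier V \<Longrightarrow> x \<ominus>\<^bsub>V\<^esub> x = \<zero>\<^bsub>V\<^esub>"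
    by (auto simp: a_minus_def M.r_neg)
qed

lemma vs_assoc:
  "vsp V \<Longrightarrow> x \<in> carrier V \<Longrightarrow> y \<in> carrier V \<Longrightarrow> z \<in> carrier V \<Longrightarrow>
    (x \<oplus>\<^bsub>V\<^esub> y) \<oplus>\<^bsub>V\<^esub> z = x \<oplus>\<^bsub>V\<^esub> (y \<oplus>\<^bsub>V\<^esub> z)"
  by (rule abelian_monoid.a_assoc[OF vs_abelian_monoid])

lemma vs_comm:
  "vsp V \<Longrightarrow> x \<in> carrier V \<Longrightarrow> y \<in> carrier V \<Longrightarrow> x \<oplus>\<^bsub>V\<^esub> y = y \<oplus>\<^bsub>V\<^esub> x"
  by (rule abelian_monoid.a_comm[OF vs_abelian_monoid])

lemma vs_lcomm:
  "vsp V \<Longrightarrow> x \<in> carrier V \<Longrightarrow> y \<in> carrier V \<Longrightarrow> z \<in> carrier V \<Longrightarrow>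
    x \<oplus>\<^bsub>V\<^esub> (y \<oplus>\<^bsub>V\<^esub> z) = y \<oplus>\<^bsub>V\<^esub> (x \<oplus>\<^bsub>V\<^esub> z)"
  by (rule abelian_monoid.a_lcomm[OF vs_abelian_monoid])

lemma vs_add_smult:
  "vsp V \<Longrightarrow> a \<in> carrier K \<Longrightarrow> b \<in> carrier K \<Longrightarrow> x \<in> carrier V \<Longrightarrow>
    (a \<oplus>\<^bsub>K\<^esub> b) \<odot>\<^bsub>V\<^esub> x = a \<odot>\<^bsub>V\<^esub> x \<oplus>\<^bsub>V\<^esub> b \<odot>\<^bsub>V\<^esub> x"
  by (rule Module.module.smult_l_distr[OF vs_module])

lemma vs_smult_add:
  "vsp V \<Longrightarrow> a \<in> carrier K \<Longrightarrow> x \<in> carrier V \<Longrightarrow> y \<in> carrier V \<Longrightarrow>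
    a \<odot>\<^bsub>V\<^esub> (x \<oplus>\<^bsub>V\<^esub> y) = a \<odot>\<^bsub>V\<^esub> x \<oplus>\<^bsub>V\<^esub> a \<odot>\<^bsub>V\<^esub> y"
  by (rule Module.module.smult_r_distr[OF vs_module])

lemma vs_mult_smult:
  "vsp V \<Longrightarrow> a \<in> carrier K \<Longrightarrow> b \<in> carrier K \<Longrightarrow> x \<in> carrier V \<Longrightarrow>
    (a \<otimes>\<^bsub>K\<^esub> b) \<odot>\<^bsub>V\<^esub> x = a \<odot>\<^bsub>V\<^esub> (b \<odot>\<^bsub>V\<^esub> x)"
  by (rule Module.module.smult_assoc1[OF vs_module])

lemma vs_smult_commute:
  "vsp V \<Longrightarrow> a \<in> carrier K \<Longrightarrow> b \<in> carrier K \<Longrightarrow> x \<in> carrier V \<Longrightarrow>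
    a \<odot>\<^bsub>V\<^esub> (b \<odot>\<^bsub>V\<^esub> x) = b \<odot>\<^bsub>V\<^esub> (a \<odot>\<^bsub>V\<^esub> x)"
  by (metis vs_mult_smult m_comm)

lemma vs_minus:
  assumes "vsp V" "x \<in> carrier V" "y \<in> carrier V"
  shows "x \<ominus>\<^bsub>V\<^esub> y = x \<oplus>\<^bsub>V\<^esub> (\<ominus>\<^bsub>K\<^esub> \<one>\<^bsub>K\<^esub>) \<odot>\<^bsub>V\<^esub> y"
  by (simp add: a_minus_def module.smult_minus_1[OF vs_module[OF assms(1)] assms(3)])

lemma vs_eq_iff_minus:
  assumes "vsp V" "x \<in> carrier V" "y \<in> carrier V"
  shows "x \<ominus>\<^bsub>V\<^esub> y = \<zero>\<^bsub>V\<^esub> \<longleftrightarrow> x = y"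
proof -
  interpret V: abelian_group V by (rule vs_abelian_group[OF assms(1)])
  show ?thesis
    using V.minus_equality[of x "\<ominus>\<^bsub>V\<^esub> y"] assms by (auto simp: a_minus_def V.r_neg)
qed

lemma finsum_closed:
  "vsp V \<Longrightarrow> (\<And>i. i \<in> I \<Longrightarrow> f i \<in> carrier V) \<Longrightarrow> finsum V f I \<in> carrier V"
  by (rule abelian_monoid.finsum_closed[OF vs_abelian_monoid]) auto

lemma finsum_cong:
  "vsp V \<Longrightarrow> I = J \<Longrightarrow> (\<And>i. i \<in> J \<Longrightarrow> f i = g i) \<Longrightarrow> (\<And>i. i \<in> J \<Longrightarrow> g i \<in> carrier V) \<Longrightarrow>
    finsum V f I = finsum V g J"
  by (rule abelian_monoid.finsum_cong'[OF vs_abelian_monoid]) auto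

lemma finsum_insert:
  "vsp V \<Longrightarrow> finite I \<Longrightarrow> i \<notin> I \<Longrightarrow> (\<And>j. j \<in> insert i I \<Longrightarrow> f j \<in> carrier V) \<Longrightarrow>
    finsum V f (insert i I) = f i \<oplus>\<^bsub>V\<^esub> finsum V f I"
  by (rule abelian_monoid.finsum_insert[OF vs_abelian_monoid]) auto

lemma finsum_empty [simp]: "vsp V \<Longrightarrow> finsum V f {} = \<zero>\<^bsub>V\<^esub>"
  by (rule abelian_monoid.finsum_empty[OF vs_abelian_monoid])

lemma finsum_add:
  "vsp V \<Longrightarrow> (\<And>i. i \<in> I \<Longrightarrow> f i \<in> carrier V) \<Longrightarrow> (\<And>i. i \<in> I \<Longrightarrow> g i \<in> carrier V) \<Longrightarrow>
    finsum V (\<lambda>i. f i \<oplus>\<^bsub>V\<^esub> g i) I = finsum V f I \<oplus>\<^bsub>V\<^esub> finsum V g I"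
  by (rule abelian_monoid.finsum_addf[OF vs_abelian_monoid]) auto

lemma finsum_mono_neutral:
  assumes "vsp V" "finite J" "I \<subseteq> J" "\<And>i. i \<in> J - I \<Longrightarrow> f i = \<zero>\<^bsub>V\<^esub>" "\<And>i. i \<in> J \<Longrightarrow> f i \<in> carrier V"
  shows "finsum V f I = finsum V f J"
  using comm_monoid.finprod_mono_neutral_cong_left[OF
      abelian_monoid.a_comm_monoid[OF vs_abelian_monoid[OF assms(1)]], of J I f f] assms(2-)
  by (auto simp: finsum_def)

lemma finsum_single:
  assumes "vsp V" "finite I" "i \<in> I" "\<And>j. j \<in> I \<Longrightarrow> j \<noteq> i \<Longrightarrow> f j = \<zero>\<^bsub>V\<^esub>" "f i \<in> carrier V"
  shows "finsum V f I = f i"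
proof -
  have "finsum V f {i} = finsum V f I"
    using assms by (intro finsum_mono_neutral) (auto, metis vs_closed(1))
  then show ?thesis
    using assms finsum_insert[of V "{}" i f] by simp
qed

lemma linI:
  "(\<And>x. x \<in> carrier V \<Longrightarrow> f x \<in> carrier W) \<Longrightarrow>
   (\<And>x y. x \<in> carrier V \<Longrightarrow> y \<in> carrier V \<Longrightarrow> f (x \<oplus>\<^bsub>V\<^esub> y) = f x \<oplus>\<^bsub>W\<^esub> f y) \<Longrightarrow>
   (\<And>c x. c \<in> carrier K \<Longrightarrow> x \<in> carrier V \<Longrightarrow> f (c \<odot>\<^bsub>V\<^esub> x) = c \<odot>\<^bsub>W\<^esub> f x) \<Longrightarrow> lin V W f"
  by (auto simp: LinearCombinations.module_hom_def)

lemma lin_closed: "lin V W f \<Longrightarrow> x \<in> carrier V \<Longrightarrow> f x \<in> carrier W"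
  by (auto simp: LinearCombinations.module_hom_def)

lemma lin_add:
  "lin V W f \<Longrightarrow> x \<in> carrier V \<Longrightarrow> y \<in> carrier V \<Longrightarrow> f (x \<oplus>\<^bsub>V\<^esub> y) = f x \<oplus>\<^bsub>W\<^esub> f y"
  by (auto simp: LinearCombinations.module_hom_def)

lemma lin_smult:
  "lin V W f \<Longrightarrow> c \<in> carrier K \<Longrightarrow> x \<in> carrier V \<Longrightarrow> f (c \<odot>\<^bsub>V\<^esub> x) = c \<odot>\<^bsub>W\<^esub> f x"
  by (auto simp: LinearCombinations.module_hom_def)

lemma lin_zero: "vsp V \<Longrightarrow> vsp W \<Longrightarrow> lin V W f \<Longrightarrow> f \<zero>\<^bsub>V\<^esub> = \<zero>\<^bsub>W\<^esub>"
  using mod_hom.f0_is_0[of K V W f] by (simp add: mod_hom_def mod_hom_axioms_def vs_module)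

lemma lin_minus:
  "vsp V \<Longrightarrow> vsp W \<Longrightarrow> lin V W f \<Longrightarrow> x \<in> carrier V \<Longrightarrow> y \<in> carrier V \<Longrightarrow>
    f (x \<ominus>\<^bsub>V\<^esub> y) = f x \<ominus>\<^bsub>W\<^esub> f y"
  using mod_hom.f_minus[of K V W f] by (simp add: mod_hom_def mod_hom_axioms_def vs_module)

lemma lin_finsum:
  assumes "vsp V" "vsp W" "lin V W f" "\<And>i. i \<in> I \<Longrightarrow> g i \<in> carrier V"
  shows "f (finsum V g I) = finsum W (\<lambda>i. f (g i)) I"
proof (cases "finite I")
  case True
  from this assms(4) show ?thesis
  proof induction
    case empty
    then show ?case using assms lin_zero by simp
  next
    case (insert i I)
    then have "f (finsum V g (insert i I)) = f (g i) \<oplus>\<^bsub>W\<^esub> f (finsum V g I)"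
      using assms(1-3) by (subst finsum_insert) (auto simp: lin_add finsum_closed)
    also have "\<dots> = finsum W (\<lambda>i. f (g i)) (insert i I)"
      using insert assms(1-3) by (subst finsum_insert) (auto simp: lin_closed)
    finally show ?case .
  qed
next
  case False
  then show ?thesis
    using assms(1-3) lin_zero
    by (simp add: finsum_def finprod_def)
qed

lemma lin_id [intro]: "lin V V (\<lambda>x. x)"
  by (auto intro!: linI)

lemma lin_comp: "lin V W f \<Longrightarrow> lin W Z g \<Longrightarrow> lin V Z (\<lambda>x. g (f x))"
  by (auto intro!: linI simp: lin_closed lin_add lin_smult)

lemma lin_const_zero: "vsp W \<Longrightarrow> lin V W (\<lambda>_. \<zero>\<^bsub>W\<^esub>)"
  by (auto intro!: linI)

lemma lin_add_fun: "vsp W \<Longrightarrow> lin V W f \<Longrightarrow> lin V W g \<Longrightarrow> lin V W (\<lambda>x. f x \<oplus>\<^bsub>W\<^esub> g x)"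
  by (rule linI) (simp_all add: lin_closed lin_add lin_smult vs_assoc vs_lcomm vs_smult_add)

lemma lin_smult_fun: "vsp W \<Longrightarrow> c \<in> carrier K \<Longrightarrow> lin V W f \<Longrightarrow> lin V W (\<lambda>x. c \<odot>\<^bsub>W\<^esub> f x)"
  by (rule linI) (simp_all add: lin_closed lin_add lin_smult vs_smult_add vs_smult_commute)

lemma lin_cong:
  assumes "vsp V" "lin V W f" "\<And>x. x \<in> carrier V \<Longrightarrow> f x = g x"
  shows "lin V W g"
  by (rule linI) (simp_all add: assms(3)[symmetric] assms(1) lin_closed[OF assms(2)]
      lin_add[OF assms(2)] lin_smult[OF assms(2)])

lemma lin_finsum_fun:
  assumes "vsp V" "vsp W" "finite I" "\<And>i. i \<in> I \<Longrightarrow> lin V W (f i)"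
  shows "lin V W (\<lambda>x. finsum W (\<lambda>i. f i x) I)"
  using assms(3,4)
proof induction
  case empty
  then show ?case using assms(2) by (simp add: lin_const_zero)
next
  case (insert i I)
  have "lin V W (\<lambda>x. f i x \<oplus>\<^bsub>W\<^esub> finsum W (\<lambda>i. f i x) I)"
    using insert assms(2) by (intro lin_add_fun) auto
  then show ?case
    by (rule lin_cong[OF assms(1)])
      (subst finsum_insert, use insert assms(2) in \<open>auto intro!: lin_closed[OF insert.prems]\<close>)
qed

lemma lin_record_cong:
  assumes "carrier V' = carrier V" "add V' = add V" "smult V' = smult V"
    "carrier W' = carrier W" "add W' = add W" "smult W' = smult W"
  shows "lin V' W' f \<longleftrightarrow> lin V W f"
  by (simp add: LinearCombinations.module_hom_def assms)

section \<open>Subspaces\<close>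

abbreviation subm :: "'v set \<Rightarrow> ('k, 'v, 'e) module_scheme \<Rightarrow> bool" where
  "subm U V \<equiv> LinearCombinations.submodule K U V"

lemma submI:
  assumes "vsp V" "U \<subseteq> carrier V" "\<zero>\<^bsub>V\<^esub> \<in> U" "\<And>x y. x \<in> U \<Longrightarrow> y \<in> U \<Longrightarrow> x \<oplus>\<^bsub>V\<^esub> y \<in> U"
    "\<And>c x. c \<in> carrier K \<Longrightarrow> x \<in> U \<Longrightarrow> c \<odot>\<^bsub>V\<^esub> x \<in> U"
  shows "subm U V"
  using assms vs_module by (auto simp: LinearCombinations.submodule_def)

lemma submD:
  assumes "subm U V"
  shows "U \<subseteq> carrier V" "\<zero>\<^bsub>V\<^esub> \<in> U" "\<And>x y. x \<in> U \<Longrightarrow> y \<in> U \<Longrightarrow> x \<oplus>\<^bsub>V\<^esub> y \<in> U"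
    "\<And>c x. c \<in> carrier K \<Longrightarrow> x \<in> U \<Longrightarrow> c \<odot>\<^bsub>V\<^esub> x \<in> U"
  using assms by (auto simp: LinearCombinations.submodule_def)

lemma subm_vs:
  assumes "vsp V" "subm U V"
  shows "vsp (V\<lparr>carrier := U\<rparr>)"
  by (rule vsI, rule module.submodule_is_module[OF vs_module[OF assms(1)] assms(2)])

text \<open>Together with an induction principle for generators this shows that linear maps agreeing
  on generators are equal.\<close>

lemma subm_equalizer:
  assumes "vsp V" "vsp W" "lin V W f" "lin V W g"
  shows "subm {x \<in> carrier V. f x = g x} V"
  using assms
  by (intro submI) (auto simp: lin_zero lin_add lin_smult)

lemma subm_kernel:
  assumes "vsp V" "vsp W" "lin V W f"
  shows "subm {x \<in> carrier V. f x = \<zero>\<^bsub>W\<^esub>} V"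
  using assms
  by (intro submI) (auto simp: lin_zero lin_add lin_smult)

lemma subm_finsum:
  assumes "vsp V" "subm U V" "\<And>i. i \<in> I \<Longrightarrow> f i \<in> U"
  shows "finsum V f I \<in> U"
proof (cases "finite I")
  case True
  from this assms(3) show ?thesis
  proof induction
    case empty
    then show ?case using assms submD by simp
  next
    case (insert i I)
    moreover have "\<And>j. j \<in> insert i I \<Longrightarrow> f j \<in> carrier V"
      using insert.prems submD(1)[OF assms(2)] by blast
    ultimately show ?case
      using assms(1,2) by (subst finsum_insert) (auto simp: submD(3))
  qed
next
  case False
  then show ?thesis
    using assms(2) submD(2) by (simp add: finsum_def finprod_def)
qed

section \<open>Presented vector spaces\<close>

text \<open>The sum inside \<open>lift\<close>: when \<open>f\<close> respects the relations,
  \<open>lift K Z f\<close> sends a coset to the common value of \<open>lin_ext Z f\<close> on its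
  representatives.\<close>

definition lin_ext :: "('k, 'z, 'e) module_scheme \<Rightarrow> ('s \<Rightarrow> 'z) \<Rightarrow> ('s \<Rightarrow> 'k) \<Rightarrow> 'z" where
  "lin_ext Z f x = (\<Oplus>\<^bsub>Z\<^esub>s\<in>{s. x s \<noteq> \<zero>\<^bsub>K\<^esub>}. x s \<odot>\<^bsub>Z\<^esub> f s)"

lemma free_module_sel:
  "zero (free_module K S) = (\<lambda>_. \<zero>\<^bsub>K\<^esub>)"
  "add (free_module K S) = (\<lambda>f g s. f s \<oplus>\<^bsub>K\<^esub> g s)"
  "smult (free_module K S) = (\<lambda>c f s. c \<otimes>\<^bsub>K\<^esub> f s)"
  by (simp_all add: free_module_def)

lemma free_carrierD:
  assumes "x \<in> carrier (free_module K S)"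
  shows "finite {s. x s \<noteq> \<zero>\<^bsub>K\<^esub>}" "{s. x s \<noteq> \<zero>\<^bsub>K\<^esub>} \<subseteq> S" "x s \<in> carrier K"
proof -
  show "finite {s. x s \<noteq> \<zero>\<^bsub>K\<^esub>}" "{s. x s \<noteq> \<zero>\<^bsub>K\<^esub>} \<subseteq> S"
    using assms by (auto simp: free_module_def)
  show "x s \<in> carrier K"
    using assms by (cases "s \<in> S") (auto simp: free_module_def)
qed

lemma free_carrierI:
  "finite {s. x s \<noteq> \<zero>\<^bsub>K\<^esub>} \<Longrightarrow> {s. x s \<noteq> \<zero>\<^bsub>K\<^esub>} \<subseteq> S \<Longrightarrow> (\<And>s. x s \<in> carrier K) \<Longrightarrow>
    x \<in> carrier (free_module K S)"
  by (auto simp: free_module_def)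

lemma vs_free [simp]: "vsp (free_module K S)"
proof (rule vsI, rule module_criteria, goal_cases)
  case 4
  show ?case
  proof
    fix v assume v: "v \<in> carrier (free_module K S)"
    show "\<exists>w\<in>carrier (free_module K S). v \<oplus>\<^bsub>free_module K S\<^esub> w = \<zero>\<^bsub>free_module K S\<^esub>"
    proof (rule bexI[of _ "\<lambda>s. \<ominus>\<^bsub>K\<^esub> v s"])
      show "v \<oplus>\<^bsub>free_module K S\<^esub> (\<lambda>s. \<ominus>\<^bsub>K\<^esub> v s) = \<zero>\<^bsub>free_module K S\<^esub>"
        using free_carrierD[OF v] by (simp add: r_neg free_module_sel)
      have "{s. \<ominus>\<^bsub>K\<^esub> v s \<noteq> \<zero>\<^bsub>K\<^esub>} \<subseteq> {s. v s \<noteq> \<zero>\<^bsub>K\<^esub>}"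
        by auto
      then show "(\<lambda>s. \<ominus>\<^bsub>K\<^esub> v s) \<in> carrier (free_module K S)"
        using free_carrierD[OF v] by (intro free_carrierI) (auto intro: finite_subset)
    qed
  qed
next
  case 3
  show ?case
  proof (intro allI impI, elim conjE)
    fix v w assume v: "v \<in> carrier (free_module K S)" "w \<in> carrier (free_module K S)"
    have "{s. v s \<oplus>\<^bsub>K\<^esub> w s \<noteq> \<zero>\<^bsub>K\<^esub>} \<subseteq> {s. v s \<noteq> \<zero>\<^bsub>K\<^esub>} \<union> {s. w s \<noteq> \<zero>\<^bsub>K\<^esub>}"
      by auto
    then show "v \<oplus>\<^bsub>free_module K S\<^esub> w \<in> carrier (free_module K S)"
      unfolding free_module_sel using free_carrierD[OF v(1)] free_carrierD[OF v(2)]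
      by (intro free_carrierI) (auto intro: finite_subset)
  qed
next
  case 5
  show ?case
  proof (intro allI impI, elim conjE)
    fix c v assume v: "c \<in> carrier K" "v \<in> carrier (free_module K S)"
    have "{s. c \<otimes>\<^bsub>K\<^esub> v s \<noteq> \<zero>\<^bsub>K\<^esub>} \<subseteq> {s. v s \<noteq> \<zero>\<^bsub>K\<^esub>}"
      using v(1) by auto
    then show "c \<odot>\<^bsub>free_module K S\<^esub> v \<in> carrier (free_module K S)"
      unfolding free_module_sel using free_carrierD[OF v(2)] v(1)
      by (intro free_carrierI) (auto intro: finite_subset)
  qed
next
  case 2
  show ?case by (auto intro: free_carrierI simp: free_module_sel)
qed (auto simp: is_cring fun_eq_iff free_module_sel free_carrierD(3) a_ac m_ac l_distr r_distr
    intro: free_carrierI)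

lemma free_gen_closed [simp]: "s \<in> S \<Longrightarrow> free_gen K s \<in> carrier (free_module K S)"
  by (rule free_carrierI) (auto simp: free_gen_def intro: finite_subset[of _ "{s}"])

text \<open>The support of a sum or a multiple can be smaller than the supports it comes from.
  Linearity therefore compares sums over one larger finite set, where the extra terms
  vanish.\<close>

lemma lin_ext_superset:
  assumes "vsp Z" "f \<in> S \<rightarrow> carrier Z" "x \<in> carrier (free_module K S)"
    "finite T" "{s. x s \<noteq> \<zero>\<^bsub>K\<^esub>} \<subseteq> T" "T \<subseteq> S"
  shows "lin_ext Z f x = (\<Oplus>\<^bsub>Z\<^esub>s\<in>T. x s \<odot>\<^bsub>Z\<^esub> f s)"
  unfolding lin_ext_def
proof (rule finsum_mono_neutral)
  fix i assume "i \<in> T - {s. x s \<noteq> \<zero>\<^bsub>K\<^esub>}"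
  then show "x i \<odot>\<^bsub>Z\<^esub> f i = \<zero>\<^bsub>Z\<^esub>"
    using assms by (metis (mono_tags, lifting) CollectI Diff_iff Pi_mem in_mono vs_simps(3))
next
  fix i assume "i \<in> T"
  then show "x i \<odot>\<^bsub>Z\<^esub> f i \<in> carrier Z"
    using assms free_carrierD[OF assms(3)] by (auto simp: Pi_iff)
qed (use assms in auto)

lemma lin_ext_lin:
  assumes "vsp Z" "f \<in> S \<rightarrow> carrier Z"
  shows "lin (free_module K S) Z (lin_ext Z f)"
proof (rule linI)
  fix x assume x: "x \<in> carrier (free_module K S)"
  note X = free_carrierD[OF x]
  show "lin_ext Z f x \<in> carrier Z"
    unfolding lin_ext_def using assms X by (intro finsum_closed) auto
  {
    fix y assume y: "y \<in> carrier (free_module K S)"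
    note Y = free_carrierD[OF y]
    let ?F = "free_module K S"
    let ?T = "{s. x s \<noteq> \<zero>\<^bsub>K\<^esub>} \<union> {s. y s \<noteq> \<zero>\<^bsub>K\<^esub>}"
    have T: "finite ?T" "?T \<subseteq> S"
      using X Y by auto
    have "lin_ext Z f (x \<oplus>\<^bsub>?F\<^esub> y) = (\<Oplus>\<^bsub>Z\<^esub>s\<in>?T. (x \<oplus>\<^bsub>?F\<^esub> y) s \<odot>\<^bsub>Z\<^esub> f s)"
      using assms T x y
      by (intro lin_ext_superset[of _ _ S] vs_closed) (auto simp: free_module_sel)
    also have "\<dots> = (\<Oplus>\<^bsub>Z\<^esub>s\<in>?T. x s \<odot>\<^bsub>Z\<^esub> f s \<oplus>\<^bsub>Z\<^esub> y s \<odot>\<^bsub>Z\<^esub> f s)"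
      using X Y T assms
      by (intro finsum_cong) (auto simp: free_module_sel vs_add_smult Pi_iff intro!: vs_closed)
    also have "\<dots> = (\<Oplus>\<^bsub>Z\<^esub>s\<in>?T. x s \<odot>\<^bsub>Z\<^esub> f s) \<oplus>\<^bsub>Z\<^esub> (\<Oplus>\<^bsub>Z\<^esub>s\<in>?T. y s \<odot>\<^bsub>Z\<^esub> f s)"
      using X Y T assms by (intro finsum_add) (auto intro!: vs_closed)
    also have "\<dots> = lin_ext Z f x \<oplus>\<^bsub>Z\<^esub> lin_ext Z f y"
      using assms T x y lin_ext_superset[of Z f S _ ?T] by auto
    finally show "lin_ext Z f (x \<oplus>\<^bsub>?F\<^esub> y) = lin_ext Z f x \<oplus>\<^bsub>Z\<^esub> lin_ext Z f y" .
  }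
  fix c assume c: "c \<in> carrier K"
  let ?F = "free_module K S"
  let ?T = "{s. x s \<noteq> \<zero>\<^bsub>K\<^esub>}"
  have "lin_ext Z f (c \<odot>\<^bsub>?F\<^esub> x) = (\<Oplus>\<^bsub>Z\<^esub>s\<in>?T. (c \<odot>\<^bsub>?F\<^esub> x) s \<odot>\<^bsub>Z\<^esub> f s)"
    using assms X x c
    by (intro lin_ext_superset[of _ _ S] vs_closed) (auto simp: free_module_sel)
  also have "\<dots> = (\<Oplus>\<^bsub>Z\<^esub>s\<in>?T. c \<odot>\<^bsub>Z\<^esub> (x s \<odot>\<^bsub>Z\<^esub> f s))"
    using X assms c
    by (intro finsum_cong) (auto simp: free_module_sel vs_mult_smult Pi_iff subset_iff intro!: vs_closed)
  also have "\<dots> = c \<odot>\<^bsub>Z\<^esub> lin_ext Z f x"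
    unfolding lin_ext_def using X assms c
    by (intro lin_finsum[OF assms(1) assms(1), of "\<lambda>z. c \<odot>\<^bsub>Z\<^esub> z", symmetric] lin_smult_fun)
      (auto intro!: vs_closed)
  finally show "lin_ext Z f (c \<odot>\<^bsub>?F\<^esub> x) = c \<odot>\<^bsub>Z\<^esub> lin_ext Z f x" .
qed

lemma lin_ext_gen:
  assumes "vsp Z" "f s \<in> carrier Z"
  shows "lin_ext Z f (free_gen K s) = f s"
proof -
  have "{t. free_gen K s t \<noteq> \<zero>\<^bsub>K\<^esub>} = {s}"
    by (auto simp: free_gen_def)
  then have "lin_ext Z f (free_gen K s) = (\<Oplus>\<^bsub>Z\<^esub>t\<in>{s}. free_gen K s t \<odot>\<^bsub>Z\<^esub> f t)"
    by (simp add: lin_ext_def)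
  also have "\<dots> = f s"
    using assms by (subst finsum_single[of Z _ s]) (auto simp: free_gen_def)
  finally show ?thesis .
qed

text \<open>Every \<open>x\<close> is the finite combination
  \<open>lin_ext (free_module K S) (free_gen K) x\<close> of generators, and a subspace is closed
  under such combinations.\<close>

lemma free_module_induct:
  assumes "subm U (free_module K S)" "\<And>s. s \<in> S \<Longrightarrow> free_gen K s \<in> U"
  shows "carrier (free_module K S) \<subseteq> U"
proof
  fix x assume x: "x \<in> carrier (free_module K S)"
  let ?F = "free_module K S"
  note X = free_carrierD[OF x]
  \<comment> \<open>Sums in the free module are computed pointwise; this reduces the expansion of
    \<open>x\<close> to a sum in the field with a single surviving term.\<close>
  have fin: "(finsum ?F g I) t = (\<Oplus>\<^bsub>K\<^esub>i\<in>I. g i t)"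
    if "finite I" "\<And>i. i \<in> I \<Longrightarrow> g i \<in> carrier ?F" for g :: "'a \<Rightarrow> 'a \<Rightarrow> 'k" and I :: "'a set" and t
    using that
  proof induction
    case empty
    then show ?case using finsum_empty[OF vs_free, of S g] by (simp add: free_module_sel)
  next
    case (insert i I)
    have "finsum ?F g (insert i I) = g i \<oplus>\<^bsub>?F\<^esub> finsum ?F g I"
      using insert by (intro finsum_insert) auto
    moreover have "g j t \<in> carrier K" if "j \<in> insert i I" for j
      by (rule free_carrierD(3)[OF insert.prems[OF that]])
    ultimately show ?case
      using insert by (subst add.finprod_insert) (auto simp: free_module_sel)
  qed
  have "lin_ext ?F (free_gen K) x = x"
  proof
    fix t
    have "lin_ext ?F (free_gen K) x t =
        (\<Oplus>\<^bsub>K\<^esub>s\<in>{s. x s \<noteq> \<zero>\<^bsub>K\<^esub>}. (x s \<odot>\<^bsub>?F\<^esub> free_gen K s) t)"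
      unfolding lin_ext_def using X by (intro fin vs_closed) auto
    also have "\<dots> = (\<Oplus>\<^bsub>K\<^esub>s\<in>{s. x s \<noteq> \<zero>\<^bsub>K\<^esub>}. if t = s then x s else \<zero>\<^bsub>K\<^esub>)"
      using X by (intro add.finprod_cong') (auto simp: free_gen_def free_module_sel)
    also have "\<dots> = x t"
      using X add.finprod_singleton[of t "{s. x s \<noteq> \<zero>\<^bsub>K\<^esub>}" x]
      by (cases "x t = \<zero>\<^bsub>K\<^esub>") (auto intro!: add.finprod_one_eqI)
    finally show "lin_ext ?F (free_gen K) x t = x t" .
  qed
  moreover have "lin_ext ?F (free_gen K) x \<in> U"
    unfolding lin_ext_def
  proof (rule subm_finsum[OF vs_free assms(1)])
    fix s assume "s \<in> {s. x s \<noteq> \<zero>\<^bsub>K\<^esub>}"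
    then show "x s \<odot>\<^bsub>?F\<^esub> free_gen K s \<in> U"
      using X assms(2) submD(4)[OF assms(1)] by blast
  qed
  ultimately show "x \<in> U" by simp
qed

section \<open>Quotient spaces\<close>

context
  fixes V :: "('k, 'v, 'e) module_scheme" and U :: "'v set"
  assumes V: "vsp V" and U: "subm U V"
begin

lemma quotient_abelian_subgroup: "abelian_subgroup U V"
proof -
  interpret V: abelian_group V by (rule vs_abelian_group[OF V])
  interpret M: Module.module K V by (rule vs_module[OF V])
  show ?thesis
  proof (rule abelian_subgroupI3)
    show "additive_subgroup U V"
    proof (rule additive_subgroup.intro, rule V.add.subgroupI)
      show "U \<subseteq> carrier V" "U \<noteq> {}"
        using submD[OF U] by auto
      fix a b assume "a \<in> U" "b \<in> U"
      then show "a \<oplus>\<^bsub>V\<^esub> b \<in> U"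
        using submD[OF U] by auto
      from \<open>a \<in> U\<close> show "\<ominus>\<^bsub>V\<^esub> a \<in> U"
        by (metis submD(1,4)[OF U] M.smult_minus_1 add.inv_closed one_closed subsetD)
    qed
  qed (rule vs_abelian_group[OF V])
qed

lemma quotient_carrier:
  "carrier (quotient_module V U) = (\<lambda>x. U +>\<^bsub>V\<^esub> x) ` carrier V"
  by (auto simp: quotient_module_def A_RCOSETS_def RCOSETS_def a_r_coset_def)

lemma quotient_add:
  "x \<in> carrier V \<Longrightarrow> y \<in> carrier V \<Longrightarrow>
    (U +>\<^bsub>V\<^esub> x) \<oplus>\<^bsub>quotient_module V U\<^esub> (U +>\<^bsub>V\<^esub> y) = U +>\<^bsub>V\<^esub> (x \<oplus>\<^bsub>V\<^esub> y)"
  by (simp add: quotient_module_def abelian_subgroup.a_rcos_sum[OF quotient_abelian_subgroup])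

lemma coset_mem: "y \<in> U +>\<^bsub>V\<^esub> x \<longleftrightarrow> (\<exists>u\<in>U. y = u \<oplus>\<^bsub>V\<^esub> x)"
  by (auto simp: a_r_coset_def r_coset_def)

lemma coset_eqI:
  "x \<in> carrier V \<Longrightarrow> u \<in> U \<Longrightarrow> U +>\<^bsub>V\<^esub> (u \<oplus>\<^bsub>V\<^esub> x) = U +>\<^bsub>V\<^esub> x"
  by (metis coset_mem abelian_subgroup.a_repr_independence'[OF quotient_abelian_subgroup])

text \<open>The scalar multiple is defined as a union over representatives. All cosets in this union
  coincide and the union is not empty, so it is that one coset.\<close>

lemma quotient_smult:
  assumes "c \<in> carrier K" "x \<in> carrier V"
  shows "c \<odot>\<^bsub>quotient_module V U\<^esub> (U +>\<^bsub>V\<^esub> x) = U +>\<^bsub>V\<^esub> (c \<odot>\<^bsub>V\<^esub> x)"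
proof -
  have *: "U +>\<^bsub>V\<^esub> (c \<odot>\<^bsub>V\<^esub> y) = U +>\<^bsub>V\<^esub> (c \<odot>\<^bsub>V\<^esub> x)" if y: "y \<in> U +>\<^bsub>V\<^esub> x" for y
  proof -
    obtain u where u: "u \<in> U" "y = u \<oplus>\<^bsub>V\<^esub> x"
      using y unfolding coset_mem by blast
    moreover have "u \<in> carrier V"
      using u submD(1)[OF U] by auto
    ultimately show ?thesis
      using coset_eqI[of "c \<odot>\<^bsub>V\<^esub> x" "c \<odot>\<^bsub>V\<^esub> u"] submD(4)[OF U assms(1)] assms V
      by (simp add: vs_smult_add)
  qed
  have "x \<in> U +>\<^bsub>V\<^esub> x"
    unfolding coset_mem using submD(2)[OF U] V assms by (intro bexI[of _ "\<zero>\<^bsub>V\<^esub>"]) simp_all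
  then have "U +>\<^bsub>V\<^esub> x \<noteq> {}"
    by blast
  have "c \<odot>\<^bsub>quotient_module V U\<^esub> (U +>\<^bsub>V\<^esub> x) = (\<Union>y\<in>U +>\<^bsub>V\<^esub> x. U +>\<^bsub>V\<^esub> (c \<odot>\<^bsub>V\<^esub> y))"
    by (simp add: quotient_module_def)
  also have "\<dots> = (\<Union>y\<in>U +>\<^bsub>V\<^esub> x. U +>\<^bsub>V\<^esub> (c \<odot>\<^bsub>V\<^esub> x))"
    by (rule SUP_cong[OF refl *])
  also have "\<dots> = U +>\<^bsub>V\<^esub> (c \<odot>\<^bsub>V\<^esub> x)"
    using \<open>U +>\<^bsub>V\<^esub> x \<noteq> {}\<close> by simp
  finally show ?thesis .
qed

lemma quotient_zero: "\<zero>\<^bsub>quotient_module V U\<^esub> = U +>\<^bsub>V\<^esub> \<zero>\<^bsub>V\<^esub>"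
  using abelian_group.a_coset_add_zero[OF vs_abelian_group[OF V] submD(1)[OF U]]
  by (simp add: quotient_module_def)

lemma quotient_proj_lin: "lin V (quotient_module V U) (\<lambda>x. U +>\<^bsub>V\<^esub> x)"
  by (rule linI) (auto simp: quotient_carrier quotient_add quotient_smult)

lemma quotient_vs: "vsp (quotient_module V U)"
proof (rule vsI, rule module_criteria, goal_cases)
  case 4
  show ?case
  proof
    fix X assume "X \<in> carrier (quotient_module V U)"
    then obtain x where x: "x \<in> carrier V" "X = U +>\<^bsub>V\<^esub> x"
      by (auto simp: quotient_carrier)
    then have "\<ominus>\<^bsub>V\<^esub> x \<in> carrier V" "x \<oplus>\<^bsub>V\<^esub> \<ominus>\<^bsub>V\<^esub> x = \<zero>\<^bsub>V\<^esub>"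
      using abelian_group.a_inv_closed[OF vs_abelian_group[OF V]]
        abelian_group.r_neg[OF vs_abelian_group[OF V]] by simp_all
    then show "\<exists>Y\<in>carrier (quotient_module V U). X \<oplus>\<^bsub>quotient_module V U\<^esub> Y = \<zero>\<^bsub>quotient_module V U\<^esub>"
      using x by (auto simp: quotient_carrier quotient_zero quotient_add
          intro!: bexI[of _ "\<ominus>\<^bsub>V\<^esub> x"])
  qed
qed (use V in \<open>auto simp: is_cring quotient_carrier quotient_add quotient_smult quotient_zero vs_assoc
      vs_lcomm vs_smult_add vs_add_smult vs_mult_smult vs_comm\<close>)

lemma quotient_proj_eq_zero: "u \<in> U \<Longrightarrow> U +>\<^bsub>V\<^esub> u = \<zero>\<^bsub>quotient_module V U\<^esub>"
  using coset_eqI[of "\<zero>\<^bsub>V\<^esub>" u] V submD(1)[OF U] by (auto simp: quotient_zero subset_iff)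

end

section \<open>The universal property of generators and relations\<close>

context
  fixes S :: "'s set" and R :: "('s \<Rightarrow> 'k) set"
  assumes R: "R \<subseteq> carrier (free_module K S)"
begin

abbreviation (input) "Sp \<equiv> LinearCombinations.module.span K (free_module K S) R"

lemma span_subm: "subm Sp (free_module K S)"
  by (rule LinearCombinations.module.span_is_submodule[OF vs_module[OF vs_free] R])

lemma span_minimal:
  "subm N (free_module K S) \<Longrightarrow> R \<subseteq> N \<Longrightarrow> Sp \<subseteq> N"
  by (rule LinearCombinations.module.span_is_subset[OF vs_module[OF vs_free]])

lemma span_superset: "R \<subseteq> Sp"
  by (rule LinearCombinations.module.in_own_span[OF vs_module[OF vs_free] R])

lemma presented_vs [intro]: "vsp (presented K S R)"
  unfolding presented_def by (rule quotient_vs[OF vs_free span_subm])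

lemma presented_proj_lin:
  "lin (free_module K S) (presented K S R) (\<lambda>x. Sp +>\<^bsub>free_module K S\<^esub> x)"
  unfolding presented_def by (rule quotient_proj_lin[OF vs_free span_subm])

lemma pgen_closed: "s \<in> S \<Longrightarrow> pgen K S R s \<in> carrier (presented K S R)"
  unfolding pgen_def by (rule lin_closed[OF presented_proj_lin]) auto

text \<open>The linear extension of \<open>pgen\<close> is the quotient projection, since both agree
  on \<open>free_gen\<close>. It sends a relation to its own coset, which is zero.\<close>

lemma presented_rel:
  assumes "r \<in> R"
  shows "lin_ext (presented K S R) (pgen K S R) r = \<zero>\<^bsub>presented K S R\<^esub>"
proof -
  let ?F = "free_module K S" and ?P = "presented K S R"
  have "carrier ?F \<subseteq> {x \<in> carrier ?F. lin_ext ?P (pgen K S R) x = Sp +>\<^bsub>?F\<^esub> x}"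
    by (intro free_module_induct subm_equalizer[OF vs_free presented_vs]
        lin_ext_lin[OF presented_vs] presented_proj_lin)
      (auto simp: pgen_closed lin_ext_gen presented_vs pgen_def[symmetric])
  then have "lin_ext ?P (pgen K S R) r = Sp +>\<^bsub>?F\<^esub> r"
    using assms R by blast
  also have "\<dots> = \<zero>\<^bsub>?P\<^esub>"
    unfolding presented_def
    using assms span_superset by (intro quotient_proj_eq_zero[OF vs_free span_subm]) blast
  finally show ?thesis .
qed

lemma presented_induct:
  assumes "subm U (presented K S R)" "\<And>s. s \<in> S \<Longrightarrow> pgen K S R s \<in> U"
  shows "carrier (presented K S R) \<subseteq> U"
proof -
  let ?F = "free_module K S" and ?P = "presented K S R"
  have "subm {x \<in> carrier ?F. Sp +>\<^bsub>?F\<^esub> x \<in> U} ?F"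
    using submD[OF assms(1)] vs_free
    by (intro submI) (simp_all add: lin_zero[OF vs_free presented_vs presented_proj_lin]
        lin_add[OF presented_proj_lin] lin_smult[OF presented_proj_lin])
  then have "carrier ?F \<subseteq> {x \<in> carrier ?F. Sp +>\<^bsub>?F\<^esub> x \<in> U}"
    by (rule free_module_induct) (use assms(2) in \<open>auto simp: pgen_def\<close>)
  then show ?thesis
    by (auto simp: presented_def quotient_carrier[OF vs_free span_subm])
qed

lemma presented_hom_ext:
  assumes "vsp Z" "lin (presented K S R) Z f" "lin (presented K S R) Z g"
    "\<And>s. s \<in> S \<Longrightarrow> f (pgen K S R s) = g (pgen K S R s)" "x \<in> carrier (presented K S R)"
  shows "f x = g x"
proof -
  have "carrier (presented K S R) \<subseteq> {x \<in> carrier (presented K S R). f x = g x}"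
    by (rule presented_induct[OF subm_equalizer[OF presented_vs assms(1-3)]])
      (simp add: pgen_closed assms(4))
  then show ?thesis
    using assms(5) by blast
qed

context
  fixes Z :: "('k, 'z, 'e) module_scheme" and f :: "'s \<Rightarrow> 'z"
  assumes Z: "vsp Z" and f: "\<And>s. s \<in> S \<Longrightarrow> f s \<in> carrier Z"
    and rel: "\<And>r. r \<in> R \<Longrightarrow> lin_ext Z f r = \<zero>\<^bsub>Z\<^esub>"
begin

text \<open>The kernel of \<open>lin_ext Z f\<close> is a subspace containing the relations, hence
  their span. So \<open>lin_ext Z f\<close> is constant on cosets, and \<open>the_elem\<close> is
  applied to a singleton.\<close>

lemma lift_coset:
  assumes "x \<in> carrier (free_module K S)"
  shows "lift K Z f (Sp +>\<^bsub>free_module K S\<^esub> x) = lin_ext Z f x"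
proof -
  let ?F = "free_module K S"
  have f': "f \<in> S \<rightarrow> carrier Z"
    using f by auto
  have "Sp \<subseteq> {x \<in> carrier ?F. lin_ext Z f x = \<zero>\<^bsub>Z\<^esub>}"
    using span_minimal[OF subm_kernel[OF vs_free Z lin_ext_lin[OF Z f']]] rel R by auto
  then have K: "u \<in> carrier ?F" "lin_ext Z f u = \<zero>\<^bsub>Z\<^esub>" if "u \<in> Sp" for u
    using that by blast+
  have *: "lin_ext Z f y = lin_ext Z f x" if y: "y \<in> Sp +>\<^bsub>?F\<^esub> x" for y
  proof -
    obtain u where "u \<in> Sp" "y = u \<oplus>\<^bsub>?F\<^esub> x"
      using y unfolding coset_mem[OF vs_free span_subm] by blast
    then show ?thesis
      using K lin_add[OF lin_ext_lin[OF Z f']] lin_closed[OF lin_ext_lin[OF Z f'] assms] Z assms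
      by simp
  qed
  have x: "x \<in> Sp +>\<^bsub>?F\<^esub> x"
    unfolding coset_mem[OF vs_free span_subm]
    using submD(2)[OF span_subm] assms by (intro bexI[of _ "\<zero>\<^bsub>?F\<^esub>"]) simp_all
  have "lin_ext Z f ` (Sp +>\<^bsub>?F\<^esub> x) = (\<lambda>_. lin_ext Z f x) ` (Sp +>\<^bsub>?F\<^esub> x)"
    by (rule image_cong[OF refl *])
  also have "\<dots> = {lin_ext Z f x}"
    by (rule image_constant[OF x])
  finally show ?thesis
    by (simp add: lift_def lin_ext_def[abs_def])
qed

lemma lift_lin: "lin (presented K S R) Z (lift K Z f)"
proof -
  have f': "f \<in> S \<rightarrow> carrier Z"
    using f by auto
  note L = lin_ext_lin[OF Z f']
  note q = quotient_add[OF vs_free span_subm] quotient_smult[OF vs_free span_subm]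
  show ?thesis
    unfolding presented_def
    by (rule linI; unfold quotient_carrier[OF vs_free span_subm]; elim imageE)
      (simp_all add: q lift_coset lin_closed[OF L] lin_add[OF L] lin_smult[OF L])
qed

lemma lift_pgen: "s \<in> S \<Longrightarrow> lift K Z f (pgen K S R s) = f s"
  by (simp add: pgen_def lift_coset lin_ext_gen Z f)

end

text \<open>Each representative has its support in \<open>S\<close>, so the two sums agree
  representative by representative. This allows rewriting under \<open>lift\<close> before either
  map is known to respect the relations.\<close>

lemma lift_cong:
  assumes "vsp Z" "X \<in> carrier (presented K S R)" "\<And>s. s \<in> S \<Longrightarrow> f s = g s"
    "\<And>s. s \<in> S \<Longrightarrow> g s \<in> carrier Z"
  shows "lift K Z f X = lift K Z g X"
proof -
  have "(\<Oplus>\<^bsub>Z\<^esub>s\<in>{s. x s \<noteq> \<zero>\<^bsub>K\<^esub>}. x s \<odot>\<^bsub>Z\<^esub> f s) = (\<Oplus>\<^bsub>Z\<^esub>s\<in>{s. x s \<noteq> \<zero>\<^bsub>K\<^esub>}. x s \<odot>\<^bsub>Z\<^esub> g s)"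
    if x: "x \<in> X" for x
  proof -
    obtain y where y: "y \<in> carrier (free_module K S)" "X = Sp +>\<^bsub>free_module K S\<^esub> y"
      using assms(2) by (auto simp: presented_def quotient_carrier[OF vs_free span_subm])
    with x obtain u where "u \<in> Sp" "x = u \<oplus>\<^bsub>free_module K S\<^esub> y"
      unfolding y coset_mem[OF vs_free span_subm] by blast
    with y have "x \<in> carrier (free_module K S)"
      using submD(1)[OF span_subm] by (simp add: subset_iff)
    from free_carrierD[OF this] show ?thesis
      using assms by (intro finsum_cong) auto
  qed
  then show ?thesis
    by (simp add: lift_def)
qed

end

end

context ground_field
begin

text \<open>Each linearity equation in \<open>u\<close> equates two maps linear in \<open>x\<close>,
  so it is enough to compare them at generators, where it is the linearity of \<open>f\<close>.
  Nested lifts, as in the smash product and in iterated Sweedler sums, are handled this way.\<close>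

lemma presented_lift_param:
  assumes "R \<subseteq> carrier (free_module K S)" "vsp U" "vsp Z"
    "\<And>u s. u \<in> carrier U \<Longrightarrow> s \<in> S \<Longrightarrow> f u s \<in> carrier Z"
    "\<And>u r. u \<in> carrier U \<Longrightarrow> r \<in> R \<Longrightarrow> lin_ext Z (f u) r = \<zero>\<^bsub>Z\<^esub>"
    "\<And>s. s \<in> S \<Longrightarrow> lin U Z (\<lambda>u. f u s)"
    "x \<in> carrier (presented K S R)"
  shows "lin U Z (\<lambda>u. lift K Z (f u) x)"
proof (rule linI)
  have L: "lin (presented K S R) Z (lift K Z (f u))" if "u \<in> carrier U" for u
    using assms(4,5) that by (intro lift_lin[OF assms(1,3)])
  have G: "lift K Z (f u) (pgen K S R s) = f u s" if "u \<in> carrier U" "s \<in> S" for u s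
    using assms(4,5) that by (intro lift_pgen[OF assms(1,3)])
  fix u assume u: "u \<in> carrier U"
  show "lift K Z (f u) x \<in> carrier Z"
    by (rule lin_closed[OF L[OF u] assms(7)])
  show "lift K Z (f (u \<oplus>\<^bsub>U\<^esub> v)) x = lift K Z (f u) x \<oplus>\<^bsub>Z\<^esub> lift K Z (f v) x"
    if v: "v \<in> carrier U" for v
    by (rule presented_hom_ext[OF assms(1,3) L lin_add_fun[OF assms(3) L L] _ assms(7)])
      (use u v assms(2) in \<open>simp_all add: G lin_add[OF assms(6)]\<close>)
  show "lift K Z (f (c \<odot>\<^bsub>U\<^esub> u)) x = c \<odot>\<^bsub>Z\<^esub> lift K Z (f u) x" if c: "c \<in> carrier K" for c
    by (rule presented_hom_ext[OF assms(1,3) L lin_smult_fun[OF assms(3) c L] _ assms(7)])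
      (use u c assms(2) in \<open>simp_all add: G lin_smult[OF assms(6)]\<close>)
qed

text \<open>Relations occur in three shapes: additivity, homogeneity, and identification of two
  generators. This lemma and the next two evaluate a map on each of them.\<close>

lemma lin_ext_rel_add:
  assumes "vsp Z" "\<And>s. s \<in> S \<Longrightarrow> f s \<in> carrier Z" "a \<in> S" "b \<in> S" "c \<in> S"
  shows "lin_ext Z f (free_gen K a \<ominus>\<^bsub>free_module K S\<^esub>
      (free_gen K b \<oplus>\<^bsub>free_module K S\<^esub> free_gen K c)) = f a \<ominus>\<^bsub>Z\<^esub> (f b \<oplus>\<^bsub>Z\<^esub> f c)"
proof -
  have L: "lin (free_module K S) Z (lin_ext Z f)"
    using assms by (intro lin_ext_lin) auto
  show ?thesis
    using assms by (simp add: lin_minus[OF vs_free assms(1) L] lin_add[OF L] lin_ext_gen)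
qed

lemma lin_ext_rel_smult:
  assumes "vsp Z" "\<And>s. s \<in> S \<Longrightarrow> f s \<in> carrier Z" "a \<in> S" "b \<in> S" "c \<in> carrier K"
  shows "lin_ext Z f (free_gen K a \<ominus>\<^bsub>free_module K S\<^esub> c \<odot>\<^bsub>free_module K S\<^esub> free_gen K b) =
    f a \<ominus>\<^bsub>Z\<^esub> c \<odot>\<^bsub>Z\<^esub> f b"
proof -
  have L: "lin (free_module K S) Z (lin_ext Z f)"
    using assms by (intro lin_ext_lin) auto
  show ?thesis
    using assms by (simp add: lin_minus[OF vs_free assms(1) L] lin_smult[OF L] lin_ext_gen)
qed

lemma lin_ext_rel_diff:
  assumes "vsp Z" "\<And>s. s \<in> S \<Longrightarrow> f s \<in> carrier Z" "a \<in> S" "b \<in> S"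
  shows "lin_ext Z f (free_gen K a \<ominus>\<^bsub>free_module K S\<^esub> free_gen K b) = f a \<ominus>\<^bsub>Z\<^esub> f b"
proof -
  have L: "lin (free_module K S) Z (lin_ext Z f)"
    using assms by (intro lin_ext_lin) auto
  show ?thesis
    using assms by (simp add: lin_minus[OF vs_free assms(1) L] lin_ext_gen)
qed

section \<open>Bilinear maps and tensor products\<close>

definition bilin ::
    "('k, 'v, 'e) module_scheme \<Rightarrow> ('k, 'w, 'f) module_scheme \<Rightarrow> ('k, 'z, 'g) module_scheme \<Rightarrow>
     ('v \<Rightarrow> 'w \<Rightarrow> 'z) \<Rightarrow> bool" where
  "bilin V W Z f \<longleftrightarrow> (\<forall>v\<in>carrier V. lin W Z (f v)) \<and> (\<forall>w\<in>carrier W. lin V Z (\<lambda>v. f v w))"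

lemma bilinI:
  "(\<And>v. v \<in> carrier V \<Longrightarrow> lin W Z (\<lambda>w. f v w)) \<Longrightarrow>
   (\<And>w. w \<in> carrier W \<Longrightarrow> lin V Z (\<lambda>v. f v w)) \<Longrightarrow> bilin V W Z (\<lambda>v w. f v w)"
  by (auto simp: bilin_def)

lemma bilin_lin2: "bilin V W Z f \<Longrightarrow> v \<in> carrier V \<Longrightarrow> lin W Z (\<lambda>w. f v w)"
  by (auto simp: bilin_def)

lemma bilin_lin1: "bilin V W Z f \<Longrightarrow> w \<in> carrier W \<Longrightarrow> lin V Z (\<lambda>v. f v w)"
  by (auto simp: bilin_def)

lemma bilin_comp2: "bilin V W Z f \<Longrightarrow> v \<in> carrier V \<Longrightarrow> lin U W g \<Longrightarrow> lin U Z (\<lambda>u. f v (g u))"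
  by (rule lin_comp[OF _ bilin_lin2])

lemma bilin_comp1: "bilin V W Z f \<Longrightarrow> w \<in> carrier W \<Longrightarrow> lin U V g \<Longrightarrow> lin U Z (\<lambda>u. f (g u) w)"
  using lin_comp[OF _ bilin_lin1] .

lemma bilin_closed:
  "bilin V W Z f \<Longrightarrow> v \<in> carrier V \<Longrightarrow> w \<in> carrier W \<Longrightarrow> f v w \<in> carrier Z"
  using lin_closed bilin_lin2 by fastforce

lemma tensor_rels_subset:
  assumes "vsp V" "vsp W"
  shows "tensor_rels K V W \<subseteq> carrier (free_module K (carrier V \<times> carrier W))"
  using assms by (auto simp: tensor_rels_def Let_def intro!: vs_closed vs_free free_gen_closed)

lemma tensor_vs [simp, intro]: "vsp V \<Longrightarrow> vsp W \<Longrightarrow> vsp (tensor K V W)"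
  unfolding tensor_def by (intro presented_vs tensor_rels_subset)

context
  fixes V :: "('k, 'v, 'e) module_scheme" and W :: "('k, 'w, 'f) module_scheme"
  assumes V: "vsp V" and W: "vsp W"
begin

lemma tensor_rels_vanish:
  fixes Z :: "('k, 'z, 'g) module_scheme"
  assumes Z: "vsp Z" and f: "bilin V W Z f" and r: "r \<in> tensor_rels K V W"
  shows "lin_ext Z (case_prod f) r = \<zero>\<^bsub>Z\<^esub>"
proof -
  let ?S = "carrier V \<times> carrier W"
  have cl: "\<And>s. s \<in> ?S \<Longrightarrow> case_prod f s \<in> carrier Z"
    using f bilin_closed by auto
  note rels = lin_ext_rel_add[of Z ?S "case_prod f", OF Z cl] lin_ext_rel_smult[of Z ?S "case_prod f", OF Z cl]
  show ?thesis
    using r V W Z cl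
    by (auto simp: tensor_rels_def Let_def rels lin_add[OF bilin_lin1[OF f]] lin_add[OF bilin_lin2[OF f]]
        lin_smult[OF bilin_lin1[OF f]] lin_smult[OF bilin_lin2[OF f]])
qed

lemma tensor_rel_zero:
  "r \<in> tensor_rels K V W \<Longrightarrow>
    lin_ext (tensor K V W) (pgen K (carrier V \<times> carrier W) (tensor_rels K V W)) r = \<zero>\<^bsub>tensor K V W\<^esub>"
  unfolding tensor_def by (rule presented_rel[OF tensor_rels_subset[OF V W]])

lemma tens_closed: "v \<in> carrier V \<Longrightarrow> w \<in> carrier W \<Longrightarrow> tens K V W v w \<in> carrier (tensor K V W)"
  unfolding tensor_def tens_def by (rule pgen_closed[OF tensor_rels_subset[OF V W]]) auto

lemma tens_bilin: "bilin V W (tensor K V W) (tens K V W)"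
proof -
  let ?S = "carrier V \<times> carrier W" and ?T = "tensor K V W"
  have T: "vsp ?T"
    using V W by blast
  have cl: "\<And>s. s \<in> ?S \<Longrightarrow> pgen K ?S (tensor_rels K V W) s \<in> carrier ?T"
    using tens_closed by (auto simp: tens_def)
  note rels = lin_ext_rel_add[of ?T ?S "pgen K ?S (tensor_rels K V W)", OF T cl]
    lin_ext_rel_smult[of ?T ?S "pgen K ?S (tensor_rels K V W)", OF T cl]
  show ?thesis
  proof (intro bilinI linI)
    fix v v' w assume a: "v \<in> carrier V" "v' \<in> carrier V" "w \<in> carrier W"
    have "free_gen K (v \<oplus>\<^bsub>V\<^esub> v', w) \<ominus>\<^bsub>free_module K ?S\<^esub>
        (free_gen K (v, w) \<oplus>\<^bsub>free_module K ?S\<^esub> free_gen K (v', w)) \<in> tensor_rels K V W"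
      using a unfolding tensor_rels_def Let_def by blast
    from tensor_rel_zero[OF this] show "tens K V W (v \<oplus>\<^bsub>V\<^esub> v') w = tens K V W v w \<oplus>\<^bsub>?T\<^esub> tens K V W v' w"
      using a V W T cl by (simp add: rels vs_eq_iff_minus tens_def)
  next
    fix v w w' assume a: "v \<in> carrier V" "w \<in> carrier W" "w' \<in> carrier W"
    have "free_gen K (v, w \<oplus>\<^bsub>W\<^esub> w') \<ominus>\<^bsub>free_module K ?S\<^esub>
        (free_gen K (v, w) \<oplus>\<^bsub>free_module K ?S\<^esub> free_gen K (v, w')) \<in> tensor_rels K V W"
      using a unfolding tensor_rels_def Let_def by blast
    from tensor_rel_zero[OF this] show "tens K V W v (w \<oplus>\<^bsub>W\<^esub> w') = tens K V W v w \<oplus>\<^bsub>?T\<^esub> tens K V W v w'"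
      using a V W T cl by (simp add: rels vs_eq_iff_minus tens_def)
  next
    fix c v w assume a: "c \<in> carrier K" "v \<in> carrier V" "w \<in> carrier W"
    have "free_gen K (c \<odot>\<^bsub>V\<^esub> v, w) \<ominus>\<^bsub>free_module K ?S\<^esub>
        c \<odot>\<^bsub>free_module K ?S\<^esub> free_gen K (v, w) \<in> tensor_rels K V W"
      using a unfolding tensor_rels_def Let_def by blast
    from tensor_rel_zero[OF this] show "tens K V W (c \<odot>\<^bsub>V\<^esub> v) w = c \<odot>\<^bsub>?T\<^esub> tens K V W v w"
      using a V W T cl by (simp add: rels vs_eq_iff_minus tens_def)
  next
    fix c v w assume a: "c \<in> carrier K" "v \<in> carrier V" "w \<in> carrier W"
    have "free_gen K (v, c \<odot>\<^bsub>W\<^esub> w) \<ominus>\<^bsub>free_module K ?S\<^esub>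
        c \<odot>\<^bsub>free_module K ?S\<^esub> free_gen K (v, w) \<in> tensor_rels K V W"
      using a unfolding tensor_rels_def Let_def by blast
    from tensor_rel_zero[OF this] show "tens K V W v (c \<odot>\<^bsub>W\<^esub> w) = c \<odot>\<^bsub>?T\<^esub> tens K V W v w"
      using a V W T cl by (simp add: rels vs_eq_iff_minus tens_def)
  qed (simp_all add: tens_closed)
qed

lemma tensor_lift_lin:
  assumes "vsp Z" "bilin V W Z f"
  shows "lin (tensor K V W) Z (lift K Z (\<lambda>(a, b). f a b))"
  unfolding tensor_def
  by (rule lift_lin[OF tensor_rels_subset[OF V W] assms(1)])
    (use assms bilin_closed tensor_rels_vanish in auto)

lemma tensor_lift_tens:
  assumes "vsp Z" "bilin V W Z f" "v \<in> carrier V" "w \<in> carrier W"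
  shows "lift K Z (\<lambda>(a, b). f a b) (tens K V W v w) = f v w"
  unfolding tens_def
  by (subst lift_pgen[OF tensor_rels_subset[OF V W] assms(1)])
    (use assms bilin_closed tensor_rels_vanish in auto)

lemma tensor_hom_ext:
  assumes "vsp Z" "lin (tensor K V W) Z f" "lin (tensor K V W) Z g"
    "\<And>v w. v \<in> carrier V \<Longrightarrow> w \<in> carrier W \<Longrightarrow> f (tens K V W v w) = g (tens K V W v w)"
    "t \<in> carrier (tensor K V W)"
  shows "f t = g t"
proof (rule presented_hom_ext[OF tensor_rels_subset[OF V W] assms(1)])
  fix s assume "s \<in> carrier V \<times> carrier W"
  then show "f (pgen K (carrier V \<times> carrier W) (tensor_rels K V W) s) =
      g (pgen K (carrier V \<times> carrier W) (tensor_rels K V W) s)"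
    by (elim SigmaE) (simp add: assms(4)[unfolded tens_def])
qed (use assms(2,3,5) in \<open>simp_all only: tensor_def\<close>)

lemma tensor_induct:
  assumes "subm U (tensor K V W)"
    "\<And>v w. v \<in> carrier V \<Longrightarrow> w \<in> carrier W \<Longrightarrow> tens K V W v w \<in> U"
  shows "carrier (tensor K V W) \<subseteq> U"
  unfolding tensor_def
proof (rule presented_induct[OF tensor_rels_subset[OF V W]])
  fix s assume "s \<in> carrier V \<times> carrier W"
  then show "pgen K (carrier V \<times> carrier W) (tensor_rels K V W) s \<in> U"
    by (elim SigmaE) (simp add: assms(2)[unfolded tens_def])
qed (use assms(1) in \<open>simp only: tensor_def\<close>)

lemma tensor_lift_param:
  assumes "vsp U" "vsp Z" "\<And>u. u \<in> carrier U \<Longrightarrow> bilin V W Z (f u)"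
    "\<And>v w. v \<in> carrier V \<Longrightarrow> w \<in> carrier W \<Longrightarrow> lin U Z (\<lambda>u. f u v w)" "t \<in> carrier (tensor K V W)"
  shows "lin U Z (\<lambda>u. lift K Z (\<lambda>(a, b). f u a b) t)"
  by (rule presented_lift_param[OF tensor_rels_subset[OF V W] assms(1,2)])
    (use assms(4,5) in \<open>auto simp: tensor_def bilin_closed[OF assms(3)]
      tensor_rels_vanish[OF assms(2) assms(3)]\<close>)

lemma tensor_lift_cong:
  assumes "vsp Z" "t \<in> carrier (tensor K V W)"
    "\<And>v w. v \<in> carrier V \<Longrightarrow> w \<in> carrier W \<Longrightarrow> f v w = g v w"
    "\<And>v w. v \<in> carrier V \<Longrightarrow> w \<in> carrier W \<Longrightarrow> g v w \<in> carrier Z"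
  shows "lift K Z (\<lambda>(a, b). f a b) t = lift K Z (\<lambda>(a, b). g a b) t"
  by (rule lift_cong[OF tensor_rels_subset[OF V W] assms(1)])
    (use assms in \<open>auto simp: tensor_def\<close>)

end

section \<open>Multilinear maps and tensor powers\<close>

definition mlin ::
    "('k, 'v, 'e) module_scheme \<Rightarrow> nat \<Rightarrow> ('k, 'z, 'g) module_scheme \<Rightarrow> ('v list \<Rightarrow> 'z) \<Rightarrow> bool" where
  "mlin V n Z f \<longleftrightarrow> (\<forall>xs\<in>tuples V n. f xs \<in> carrier Z) \<and>
    (\<forall>xs\<in>tuples V n. \<forall>i<n. lin V Z (\<lambda>x. f (xs[i := x])))"

lemma mlinI:
  "(\<And>xs. xs \<in> tuples V n \<Longrightarrow> f xs \<in> carrier Z) \<Longrightarrow>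
   (\<And>xs i. xs \<in> tuples V n \<Longrightarrow> i < n \<Longrightarrow> lin V Z (\<lambda>x. f (xs[i := x]))) \<Longrightarrow> mlin V n Z f"
  by (auto simp: mlin_def)

lemma mlin_closed: "mlin V n Z f \<Longrightarrow> xs \<in> tuples V n \<Longrightarrow> f xs \<in> carrier Z"
  by (auto simp: mlin_def)

lemma mlin_lin: "mlin V n Z f \<Longrightarrow> xs \<in> tuples V n \<Longrightarrow> i < n \<Longrightarrow> lin V Z (\<lambda>x. f (xs[i := x]))"
  by (auto simp: mlin_def)

lemma tuples_update [simp]: "xs \<in> tuples V n \<Longrightarrow> x \<in> carrier V \<Longrightarrow> xs[i := x] \<in> tuples V n"
  using set_update_subset_insert[of xs i x] by (auto simp: tuples_def)

lemma tuples_Cons [simp]: "x # xs \<in> tuples V (Suc n) \<longleftrightarrow> x \<in> carrier V \<and> xs \<in> tuples V n"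
  by (auto simp: tuples_def)

lemma tuples_0 [simp]: "tuples V 0 = {[]}"
  by (auto simp: tuples_def)

lemma tuples_SucE:
  assumes "xs \<in> tuples V (Suc n)"
  obtains y ys where "xs = y # ys" "y \<in> carrier V" "ys \<in> tuples V n"
  using assms by (cases xs) (auto simp: tuples_def)

lemma tuples_length: "xs \<in> tuples V n \<Longrightarrow> length xs = n"
  by (auto simp: tuples_def)

lemma tuples_nth [simp]: "xs \<in> tuples V n \<Longrightarrow> i < n \<Longrightarrow> xs ! i \<in> carrier V"
  by (auto simp: tuples_def)

text \<open>Separating the head from the tail makes multilinearity provable for functions defined by
  recursion over the list.\<close>

lemma mlin_ConsI:
  assumes "\<And>xs. xs \<in> tuples V n \<Longrightarrow> lin V Z (\<lambda>x. f (x # xs))"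
    "\<And>x. x \<in> carrier V \<Longrightarrow> mlin V n Z (\<lambda>xs. f (x # xs))"
  shows "mlin V (Suc n) Z f"
proof (rule mlinI)
  fix xs i assume xs: "xs \<in> tuples V (Suc n)" and i: "i < Suc n"
  then obtain y ys where "xs = y # ys" "y \<in> carrier V" "ys \<in> tuples V n"
    by (auto elim: tuples_SucE)
  then show "lin V Z (\<lambda>x. f (xs[i := x]))"
    using i assms(1) mlin_lin[OF assms(2)] by (cases i) auto
next
  fix xs assume "xs \<in> tuples V (Suc n)"
  then show "f xs \<in> carrier Z"
    using mlin_closed[OF assms(2)] by (auto elim!: tuples_SucE)
qed

lemma mlin_0: "f [] \<in> carrier Z \<Longrightarrow> mlin V 0 Z f"
  by (rule mlinI) auto

lemma mlin_Cons_lin: "mlin V (Suc n) Z f \<Longrightarrow> xs \<in> tuples V n \<Longrightarrow> vsp V \<Longrightarrow> lin V Z (\<lambda>x. f (x # xs))"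
  using mlin_lin[of V "Suc n" Z f "\<zero>\<^bsub>V\<^esub> # xs" 0] by simp

lemma mlin_Cons_mlin: "mlin V (Suc n) Z f \<Longrightarrow> x \<in> carrier V \<Longrightarrow> mlin V n Z (\<lambda>xs. f (x # xs))"
  using mlin_lin[of V "Suc n" Z f "x # xs" "Suc i" for xs i]
  by (intro mlinI) (auto intro: mlin_closed)

lemma mlin_comp: "mlin V n Z f \<Longrightarrow> lin Z Z' g \<Longrightarrow> mlin V n Z' (\<lambda>xs. g (f xs))"
  by (rule mlinI) (auto intro: mlin_closed lin_closed lin_comp mlin_lin)

text \<open>
  The pairs in \<open>E\<close> are identified in addition to the multilinear relations: \<open>E = {}\<close> gives the tensor
  powers over the ground field, and the balancing pairs give those over a subalgebra.
\<close>

definition diff_rels :: "'s set \<Rightarrow> ('s \<times> 's) set \<Rightarrow> ('s \<Rightarrow> 'k) set" where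
  "diff_rels S E = {free_gen K a \<ominus>\<^bsub>free_module K S\<^esub> free_gen K b | a b. (a, b) \<in> E}"

definition mrels :: "('k, 'v, 'e) module_scheme \<Rightarrow> nat \<Rightarrow> ('v list \<times> 'v list) set \<Rightarrow> ('v list \<Rightarrow> 'k) set" where
  "mrels V n E = multilinear_rels K V n \<union> diff_rels (tuples V n) E"

context
  fixes V :: "('k, 'v, 'e) module_scheme" and n :: nat and E :: "('v list \<times> 'v list) set"
  assumes V: "vsp V" and E: "E \<subseteq> tuples V n \<times> tuples V n"
begin

abbreviation (input) "MT \<equiv> presented K (tuples V n) (mrels V n E)"
abbreviation (input) "mgen \<equiv> pgen K (tuples V n) (mrels V n E)"

lemma mrels_subset: "mrels V n E \<subseteq> carrier (free_module K (tuples V n))"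
  using V E
  by (auto simp: mrels_def multilinear_rels_def diff_rels_def Let_def
      intro!: vs_closed vs_free free_gen_closed tuples_update)

lemma mrels_vanish:
  fixes Z :: "('k, 'z, 'g) module_scheme"
  assumes Z: "vsp Z" and f: "mlin V n Z f" "\<And>a b. (a, b) \<in> E \<Longrightarrow> f a = f b" and r: "r \<in> mrels V n E"
  shows "lin_ext Z f r = \<zero>\<^bsub>Z\<^esub>"
proof -
  let ?S = "tuples V n"
  note cl = mlin_closed[OF f(1)]
  note rels = lin_ext_rel_add[of Z ?S f, OF Z cl] lin_ext_rel_smult[of Z ?S f, OF Z cl]
    lin_ext_rel_diff[of Z ?S f, OF Z cl]
  show ?thesis
    using r V E Z cl f(2)
    by (auto simp: mrels_def multilinear_rels_def diff_rels_def Let_def rels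
        lin_add[OF mlin_lin[OF f(1)]] lin_smult[OF mlin_lin[OF f(1)]])
qed

lemma MT_vs: "vsp MT"
  by (rule presented_vs[OF mrels_subset])

lemma mgen_closed: "xs \<in> tuples V n \<Longrightarrow> mgen xs \<in> carrier MT"
  by (rule pgen_closed[OF mrels_subset])

lemma mgen_mlin: "mlin V n MT mgen"
proof -
  let ?S = "tuples V n"
  note rels = lin_ext_rel_add[of MT ?S mgen, OF MT_vs mgen_closed]
    lin_ext_rel_smult[of MT ?S mgen, OF MT_vs mgen_closed]
  show ?thesis
  proof (intro mlinI linI)
    fix xs i x y assume a: "xs \<in> ?S" "i < n" "x \<in> carrier V" "y \<in> carrier V"
    have "free_gen K (xs[i := x \<oplus>\<^bsub>V\<^esub> y]) \<ominus>\<^bsub>free_module K ?S\<^esub>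
        (free_gen K (xs[i := x]) \<oplus>\<^bsub>free_module K ?S\<^esub> free_gen K (xs[i := y])) \<in> mrels V n E"
      using a unfolding mrels_def multilinear_rels_def Let_def by blast
    from presented_rel[OF mrels_subset this]
    show "mgen (xs[i := x \<oplus>\<^bsub>V\<^esub> y]) = mgen (xs[i := x]) \<oplus>\<^bsub>MT\<^esub> mgen (xs[i := y])"
      using a V by (simp add: rels vs_eq_iff_minus[OF MT_vs] mgen_closed MT_vs)
  next
    fix xs i x c assume a: "xs \<in> ?S" "i < n" "x \<in> carrier V" "c \<in> carrier K"
    have "free_gen K (xs[i := c \<odot>\<^bsub>V\<^esub> x]) \<ominus>\<^bsub>free_module K ?S\<^esub>
        c \<odot>\<^bsub>free_module K ?S\<^esub> free_gen K (xs[i := x]) \<in> mrels V n E"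
      using a unfolding mrels_def multilinear_rels_def Let_def by blast
    from presented_rel[OF mrels_subset this]
    show "mgen (xs[i := c \<odot>\<^bsub>V\<^esub> x]) = c \<odot>\<^bsub>MT\<^esub> mgen (xs[i := x])"
      using a V by (simp add: rels vs_eq_iff_minus[OF MT_vs] mgen_closed MT_vs)
  qed (simp_all add: mgen_closed)
qed

lemma mgen_diff:
  assumes "(a, b) \<in> E"
  shows "mgen a = mgen b"
proof -
  have "free_gen K a \<ominus>\<^bsub>free_module K (tuples V n)\<^esub> free_gen K b \<in> mrels V n E"
    using assms unfolding mrels_def diff_rels_def by blast
  from presented_rel[OF mrels_subset this] assms E show ?thesis
    by (auto simp: lin_ext_rel_diff[of MT "tuples V n" mgen, OF MT_vs mgen_closed]
        vs_eq_iff_minus[OF MT_vs] mgen_closed)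
qed

lemma MT_hom_ext:
  assumes "vsp Z" "lin MT Z f" "lin MT Z g"
    "\<And>xs. xs \<in> tuples V n \<Longrightarrow> f (mgen xs) = g (mgen xs)" "t \<in> carrier MT"
  shows "f t = g t"
  by (rule presented_hom_ext[OF mrels_subset assms])

lemma MT_induct:
  assumes "subm U MT" "\<And>xs. xs \<in> tuples V n \<Longrightarrow> mgen xs \<in> U"
  shows "carrier MT \<subseteq> U"
  by (rule presented_induct[OF mrels_subset assms])

lemma MT_lift_lin:
  assumes "vsp Z" "mlin V n Z f" "\<And>a b. (a, b) \<in> E \<Longrightarrow> f a = f b"
  shows "lin MT Z (lift K Z f)"
  by (rule lift_lin[OF mrels_subset assms(1)])
    (simp_all add: mlin_closed[OF assms(2)] mrels_vanish[OF assms(1-3)])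

lemma MT_lift_gen:
  assumes "vsp Z" "mlin V n Z f" "\<And>a b. (a, b) \<in> E \<Longrightarrow> f a = f b" "xs \<in> tuples V n"
  shows "lift K Z f (mgen xs) = f xs"
  by (rule lift_pgen[OF mrels_subset assms(1)])
    (simp_all add: mlin_closed[OF assms(2)] mrels_vanish[OF assms(1-3)] assms(4))

lemma MT_lift_param:
  assumes "vsp U" "vsp Z" "\<And>u. u \<in> carrier U \<Longrightarrow> mlin V n Z (f u)"
    "\<And>u a b. u \<in> carrier U \<Longrightarrow> (a, b) \<in> E \<Longrightarrow> f u a = f u b"
    "\<And>xs. xs \<in> tuples V n \<Longrightarrow> lin U Z (\<lambda>u. f u xs)" "t \<in> carrier MT"
  shows "lin U Z (\<lambda>u. lift K Z (f u) t)"
  by (rule presented_lift_param[OF mrels_subset assms(1,2)])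
    (simp_all add: mlin_closed[OF assms(3)] mrels_vanish[OF assms(2-4)] assms(5,6))

end

lemma mrels_empty: "mrels V n {} = multilinear_rels K V n"
  by (simp add: mrels_def diff_rels_def)

context
  fixes V :: "('k, 'v, 'e) module_scheme"
  assumes V: "vsp V"
begin

lemma tpow_eq: "tpow K V n = presented K (tuples V n) (mrels V n {})"
  by (simp add: mrels_empty tpow_def)

lemma tpow_vs: "vsp (tpow K V n)"
  unfolding tpow_eq by (rule MT_vs[OF V]) simp

lemma tpow_gen_eq: "xs \<in> tuples V n \<Longrightarrow> tpow_gen K V xs = pgen K (tuples V n) (mrels V n {}) xs"
  by (simp add: tpow_gen_def mrels_empty tuples_length)

lemma tpow_gen_mlin: "mlin V n (tpow K V n) (tpow_gen K V)"
proof -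
  have m: "mlin V n (tpow K V n) (pgen K (tuples V n) (mrels V n {}))"
    unfolding tpow_eq by (rule mgen_mlin[OF V]) simp
  show ?thesis
  proof (rule mlinI)
    fix xs assume xs: "xs \<in> tuples V n"
    then show "tpow_gen K V xs \<in> carrier (tpow K V n)"
      using mlin_closed[OF m xs] by (simp add: tpow_gen_eq)
    show "lin V (tpow K V n) (\<lambda>x. tpow_gen K V (xs[i := x]))" if "i < n" for i
      by (rule lin_cong[OF V mlin_lin[OF m xs that]]) (simp add: tpow_gen_eq[OF tuples_update[OF xs]])
  qed
qed

lemma tpow_hom_ext:
  assumes "vsp Z" "lin (tpow K V n) Z f" "lin (tpow K V n) Z g"
    "\<And>xs. xs \<in> tuples V n \<Longrightarrow> f (tpow_gen K V xs) = g (tpow_gen K V xs)" "t \<in> carrier (tpow K V n)"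
  shows "f t = g t"
  by (rule MT_hom_ext[OF V empty_subsetI assms(1) assms(2,3)[unfolded tpow_eq] _ assms(5)[unfolded tpow_eq]])
    (simp add: tpow_gen_eq[symmetric] assms(4))

lemma tpow_lift_lin:
  assumes "vsp Z" "mlin V n Z f"
  shows "lin (tpow K V n) Z (lift K Z f)"
  unfolding tpow_eq by (rule MT_lift_lin[OF V empty_subsetI assms]) simp

lemma tpow_lift_gen:
  assumes "vsp Z" "mlin V n Z f" "xs \<in> tuples V n"
  shows "lift K Z f (tpow_gen K V xs) = f xs"
  unfolding tpow_gen_eq[OF assms(3)]
  by (rule MT_lift_gen[OF V empty_subsetI assms(1,2) _ assms(3)]) simp

lemma tpow_lift_param:
  assumes "vsp U" "vsp Z" "\<And>u. u \<in> carrier U \<Longrightarrow> mlin V n Z (f u)"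
    "\<And>xs. xs \<in> tuples V n \<Longrightarrow> lin U Z (\<lambda>u. f u xs)" "t \<in> carrier (tpow K V n)"
  shows "lin U Z (\<lambda>u. lift K Z (f u) t)"
  by (rule MT_lift_param[OF V empty_subsetI assms(1-3) _ assms(4) assms(5)[unfolded tpow_eq]]) simp_all

end

end

section \<open>Spaces with the same underlying vector space\<close>

text \<open>Attaching operators or a multiplication changes the record but not its linear structure.
  The relation lets linear statements pass between such records, whose types may differ.\<close>

definition same_space :: "('k, 'v, 'e) module_scheme \<Rightarrow> ('k, 'v, 'f) module_scheme \<Rightarrow> bool" where
  "same_space V W \<longleftrightarrow> carrier V = carrier W \<and> add V = add W \<and> zero V = zero W \<and> smult V = smult W"

lemma same_space_finsum:
  fixes V :: "('k, 'v, 'e) module_scheme" and W :: "('k, 'v, 'f) module_scheme"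
  assumes "same_space V W"
  shows "finsum V = finsum W"
  by (intro ext) (use assms in \<open>simp add: finsum_def finprod_def same_space_def\<close>)

lemma same_space_lift: "same_space V W \<Longrightarrow> lift K V = lift K W"
  by (simp add: lift_def fun_eq_iff same_space_finsum[of V W]) (simp add: same_space_def)

lemma same_space_sweedler: "same_space V W \<Longrightarrow> sweedler K H V = sweedler K H W"
  by (simp add: sweedler_def fun_eq_iff same_space_lift[of V W])

lemma same_space_with_act [simp]: "same_space (with_act V a) V"
  by (simp add: same_space_def with_act_def module.extend_def opmod.fields_def)

lemma act_with_act [simp]: "act (with_act V a) = a"
  by (simp add: with_act_def module.extend_def opmod.fields_def)

context ground_field
begin

lemma same_space_vsp: "same_space V W \<Longrightarrow> vsp W \<Longrightarrow> vsp V"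
  by (rule vs_record_cong) (auto simp: same_space_def)

lemma same_space_lin1: "same_space V V' \<Longrightarrow> lin V' W f \<Longrightarrow> lin V W f"
  by (subst lin_record_cong[of V V' W W f]) (auto simp: same_space_def)

lemma same_space_lin2: "same_space W W' \<Longrightarrow> lin V W' f \<Longrightarrow> lin V W f"
  by (subst lin_record_cong[of V V W W' f]) (auto simp: same_space_def)

end

locale hopf_ground = ground_field K for K :: "('k, 'r) ring_scheme" +
  fixes H :: "('k, 'h) hopf"
  assumes hopf: "hopf_algebra K H"
begin

section \<open>Calculus of Sweedler sums\<close>

lemma H_algebra: "assoc_algebra K H"
  using hopf by (rule hopf_algebra.axioms)

lemma algebra_vs: "assoc_algebra K C \<Longrightarrow> vsp C"
  by (rule assoc_algebra.axioms)

lemma algebra_ring: "assoc_algebra K C \<Longrightarrow> ring C"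
  by (rule assoc_algebra.axioms)

lemma algebra_mult_bilin:
  assumes "assoc_algebra K C"
  shows "bilin C C C (mult C)"
  using ring.ring_simprules(5,13,23)[OF algebra_ring[OF assms]] assoc_algebra.smult_mult[OF assms]
    assoc_algebra.mult_smult[OF assms]
  by (intro bilinI linI) auto

lemma H_vs [simp]: "vsp H"
  by (rule algebra_vs[OF H_algebra])

lemma H_ring: "ring H"
  by (rule algebra_ring[OF H_algebra])

lemma H_closed [simp]:
  "\<one>\<^bsub>H\<^esub> \<in> carrier H" "x \<in> carrier H \<Longrightarrow> y \<in> carrier H \<Longrightarrow> x \<otimes>\<^bsub>H\<^esub> y \<in> carrier H"
  using ring.ring_simprules(5,6)[OF H_ring] by auto

lemma H_simps [simp]:
  "x \<in> carrier H \<Longrightarrow> \<one>\<^bsub>H\<^esub> \<otimes>\<^bsub>H\<^esub> x = x" "x \<in> carrier H \<Longrightarrow> x \<otimes>\<^bsub>H\<^esub> \<one>\<^bsub>H\<^esub> = x"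
  using ring.ring_simprules(12)[OF H_ring] ring.is_monoid[OF H_ring]
  by (auto intro: monoid.r_one monoid.l_one)

lemma H_assoc:
  "x \<in> carrier H \<Longrightarrow> y \<in> carrier H \<Longrightarrow> z \<in> carrier H \<Longrightarrow> (x \<otimes>\<^bsub>H\<^esub> y) \<otimes>\<^bsub>H\<^esub> z = x \<otimes>\<^bsub>H\<^esub> (y \<otimes>\<^bsub>H\<^esub> z)"
  using ring.is_monoid[OF H_ring] monoid.m_assoc by fastforce

lemmas H_mult_lin1 = bilin_comp1[OF algebra_mult_bilin[OF H_algebra]]
lemmas H_mult_lin2 = bilin_comp2[OF algebra_mult_bilin[OF H_algebra]]

lemma HH_vs [simp]: "vsp (tensor K H H)"
  by auto

lemma comult_lin: "lin H (tensor K H H) (comult H)"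
  by (rule hopf_algebra.comult_linear[OF hopf])

lemma comult_closed [simp]: "h \<in> carrier H \<Longrightarrow> comult H h \<in> carrier (tensor K H H)"
  by (rule lin_closed[OF comult_lin])

lemma counit_lin: "lin H (ground K) (counit H)"
  by (rule hopf_algebra.counit_linear[OF hopf])

lemma ground_sel [simp]:
  "carrier (ground K) = carrier K" "add (ground K) = add K" "zero (ground K) = zero K"
  "smult (ground K) = mult K"
  by (simp_all add: ground_def)

lemma ground_vs [simp]: "vsp (ground K)"
  by (rule vsI, rule module_criteria)
    (auto simp: is_cring a_ac m_ac l_distr r_distr intro!: bexI[of _ "\<ominus>\<^bsub>K\<^esub> _"] r_neg)

lemma counit_closed [simp]: "h \<in> carrier H \<Longrightarrow> counit H h \<in> carrier K"
  using lin_closed[OF counit_lin] by simp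

lemma smult_lin1: "vsp Z \<Longrightarrow> lin V (ground K) f \<Longrightarrow> z \<in> carrier Z \<Longrightarrow> lin V Z (\<lambda>x. f x \<odot>\<^bsub>Z\<^esub> z)"
  by (rule linI) (simp_all add: lin_add[of f V "ground K"] lin_smult[of f V "ground K"]
      lin_closed[of f V "ground K", simplified] vs_add_smult vs_mult_smult)

lemmas smult_lin2 = lin_smult_fun

abbreviation sw :: "('k, 'z, 'e) module_scheme \<Rightarrow> ('h \<Rightarrow> 'h \<Rightarrow> 'z) \<Rightarrow> 'h \<Rightarrow> 'z" where
  "sw Z f h \<equiv> sweedler K H Z f h"

lemma sw_lin:
  assumes "vsp Z" "lin V H g" "bilin H H Z (\<lambda>a b. f a b)"
  shows "lin V Z (\<lambda>x. sw Z (\<lambda>a b. f a b) (g x))"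
  unfolding sweedler_def
  by (rule lin_comp[OF lin_comp[OF assms(2) comult_lin] tensor_lift_lin[OF H_vs H_vs assms(1,3)]])

lemma sw_closed: "vsp Z \<Longrightarrow> h \<in> carrier H \<Longrightarrow> bilin H H Z (\<lambda>a b. f a b) \<Longrightarrow> sw Z (\<lambda>a b. f a b) h \<in> carrier Z"
  using lin_closed[OF sw_lin[OF _ lin_id]] by blast

lemma sw_cong:
  assumes "vsp Z" "h \<in> carrier H" "bilin H H Z (\<lambda>a b. g a b)"
    "\<And>a b. a \<in> carrier H \<Longrightarrow> b \<in> carrier H \<Longrightarrow> f a b = g a b"
  shows "sw Z (\<lambda>a b. f a b) h = sw Z (\<lambda>a b. g a b) h"
  unfolding sweedler_def using assms bilin_closed[OF assms(3)]
  by (intro tensor_lift_cong[OF H_vs H_vs assms(1)]) simp_all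

lemma sw_cong':
  assumes "vsp Z" "h \<in> carrier H" "bilin H H Z (\<lambda>a b. f a b)"
    "\<And>a b. a \<in> carrier H \<Longrightarrow> b \<in> carrier H \<Longrightarrow> f a b = g a b"
  shows "sw Z (\<lambda>a b. f a b) h = sw Z (\<lambda>a b. g a b) h"
  by (rule sw_cong[OF assms(1-3), symmetric]) (simp add: assms(4))

lemma sw_param:
  assumes "vsp U" "vsp Z" "h \<in> carrier H" "\<And>u. u \<in> carrier U \<Longrightarrow> bilin H H Z (\<lambda>a b. f u a b)"
    "\<And>a b. a \<in> carrier H \<Longrightarrow> b \<in> carrier H \<Longrightarrow> lin U Z (\<lambda>u. f u a b)"
  shows "lin U Z (\<lambda>u. sw Z (\<lambda>a b. f u a b) h)"
  unfolding sweedler_def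
  by (rule tensor_lift_param[OF H_vs H_vs assms(1,2,4,5)]) (use assms(3) in simp_all)

lemma sw_param2:
  assumes "vsp U" "vsp V" "vsp Z" "h \<in> carrier H"
    "\<And>u v. u \<in> carrier U \<Longrightarrow> v \<in> carrier V \<Longrightarrow> bilin H H Z (\<lambda>a b. f u v a b)"
    "\<And>a b. a \<in> carrier H \<Longrightarrow> b \<in> carrier H \<Longrightarrow> bilin U V Z (\<lambda>u v. f u v a b)"
  shows "bilin U V Z (\<lambda>u v. sw Z (\<lambda>a b. f u v a b) h)"
  by (rule bilinI; rule sw_param)
    (simp_all add: assms(1-5) bilin_lin1[OF assms(6)] bilin_lin2[OF assms(6)])

lemma bilin_lin_comp:
  assumes "bilin V W Z f" "lin Z Z' g"
  shows "bilin V W Z' (\<lambda>v w. g (f v w))"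
  by (rule bilinI) (use lin_comp[OF bilin_lin2[OF assms(1)] assms(2)] lin_comp[OF bilin_lin1[OF assms(1)] assms(2)] in simp_all)

lemma sw_hom:
  assumes "vsp Z" "vsp Z'" "lin Z Z' \<phi>" "h \<in> carrier H" "bilin H H Z (\<lambda>a b. f a b)"
  shows "\<phi> (sw Z (\<lambda>a b. f a b) h) = sw Z' (\<lambda>a b. \<phi> (f a b)) h"
proof -
  have b: "bilin H H Z' (\<lambda>a b. \<phi> (f a b))"
    by (rule bilin_lin_comp[OF assms(5,3)])
  show ?thesis
    unfolding sweedler_def
    by (rule tensor_hom_ext[OF H_vs H_vs assms(2) lin_comp[OF tensor_lift_lin[OF H_vs H_vs assms(1,5)] assms(3)]
            tensor_lift_lin[OF H_vs H_vs assms(2) b]])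
      (simp_all add: tensor_lift_tens[OF H_vs H_vs assms(1,5)] tensor_lift_tens[OF H_vs H_vs assms(2) b] assms(4))
qed

text \<open>Two coproducts of independent elements may be expanded in either order. One of them is
  replaced by an arbitrary tensor, which makes the claim linear in that tensor and reduces it to
  pure tensors.\<close>

lemma sw_swap:
  assumes "vsp Z" "g \<in> carrier H" "h \<in> carrier H"
    "\<And>a b. a \<in> carrier H \<Longrightarrow> b \<in> carrier H \<Longrightarrow> bilin H H Z (\<lambda>c d. f a b c d)"
    "\<And>c d. c \<in> carrier H \<Longrightarrow> d \<in> carrier H \<Longrightarrow> bilin H H Z (\<lambda>a b. f a b c d)"
  shows "sw Z (\<lambda>a b. sw Z (\<lambda>c d. f a b c d) h) g = sw Z (\<lambda>c d. sw Z (\<lambda>a b. f a b c d) g) h"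
proof -
  have b: "bilin H H Z (\<lambda>c d. sw Z (\<lambda>a b. f a b c d) g)"
    by (rule sw_param2) (simp_all add: assms)
  have b': "bilin H H Z (\<lambda>a b. lift K Z (\<lambda>(c, d). f a b c d) t)" if "t \<in> carrier (tensor K H H)" for t
    by (rule bilinI; rule tensor_lift_param[OF H_vs H_vs])
      (simp_all add: assms(1,4) that bilin_lin1[OF assms(5)] bilin_lin2[OF assms(5)])
  \<comment> \<open>Generalization from \<open>comult H h\<close> to an arbitrary \<open>t\<close>;
    on a pure tensor the inner lift is simply \<open>f a b c d\<close>.\<close>
  have "sw Z (\<lambda>a b. lift K Z (\<lambda>(c, d). f a b c d) t) g = lift K Z (\<lambda>(c, d). sw Z (\<lambda>a b. f a b c d) g) t"
    if "t \<in> carrier (tensor K H H)" for t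
  proof (rule tensor_hom_ext[OF H_vs H_vs assms(1) _ _ _ that])
    show "lin (tensor K H H) Z (\<lambda>t. sw Z (\<lambda>a b. lift K Z (\<lambda>(c, d). f a b c d) t) g)"
      using assms b' by (intro sw_param tensor_lift_lin[OF H_vs H_vs]) auto
    show "lin (tensor K H H) Z (lift K Z (\<lambda>(c, d). sw Z (\<lambda>a b. f a b c d) g))"
      using tensor_lift_lin[OF H_vs H_vs assms(1) b] by simp
    fix c d assume cd: "c \<in> carrier H" "d \<in> carrier H"
    show "sw Z (\<lambda>a b. lift K Z (\<lambda>(c, d). f a b c d) (tens K H H c d)) g =
        lift K Z (\<lambda>(c, d). sw Z (\<lambda>a b. f a b c d) g) (tens K H H c d)"
      using cd tensor_lift_tens[OF H_vs H_vs assms(1) b cd]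
      by (simp, intro sw_cong assms) (simp_all add: tensor_lift_tens[OF H_vs H_vs assms(1) assms(4)])
  qed
  from this[of "comult H h"] show ?thesis
    using assms(3) by (simp add: sweedler_def[of K H Z _ h])
qed

lemma sw_one: "vsp Z \<Longrightarrow> bilin H H Z (\<lambda>a b. f a b) \<Longrightarrow> sw Z (\<lambda>a b. f a b) \<one>\<^bsub>H\<^esub> = f \<one>\<^bsub>H\<^esub> \<one>\<^bsub>H\<^esub>"
  by (simp add: sweedler_def hopf_algebra.comult_one[OF hopf] tensor_lift_tens[of H H])

text \<open>The multiplicativity axiom is an equation in \<open>tensor K H H\<close>. The lift of
  \<open>f\<close> is a linear map out of that space and passes through both Sweedler sums.\<close>

lemma sw_mult:
  assumes "vsp Z" "g \<in> carrier H" "h \<in> carrier H" "bilin H H Z (\<lambda>a b. f a b)"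
  shows "sw Z (\<lambda>a b. f a b) (g \<otimes>\<^bsub>H\<^esub> h) =
    sw Z (\<lambda>a b. sw Z (\<lambda>c d. f (a \<otimes>\<^bsub>H\<^esub> c) (b \<otimes>\<^bsub>H\<^esub> d)) h) g"
proof -
  let ?T = "tensor K H H" and ?l = "lift K Z (\<lambda>(a, b). f a b)"
  note tb = tens_bilin[OF H_vs H_vs]
  note l = tensor_lift_lin[OF H_vs H_vs assms(1,4)]
  have b1: "bilin H H ?T (\<lambda>c d. tens K H H (a \<otimes>\<^bsub>H\<^esub> c) (b \<otimes>\<^bsub>H\<^esub> d))"
    if "a \<in> carrier H" "b \<in> carrier H" for a b
    using that by (intro bilinI bilin_comp1[OF tb] bilin_comp2[OF tb] H_mult_lin2 lin_id) auto
  have b2: "bilin H H ?T (\<lambda>a b. tens K H H (a \<otimes>\<^bsub>H\<^esub> c) (b \<otimes>\<^bsub>H\<^esub> d))"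
    if "c \<in> carrier H" "d \<in> carrier H" for c d
    using that by (intro bilinI bilin_comp1[OF tb] bilin_comp2[OF tb] H_mult_lin1 lin_id) auto
  have b3: "bilin H H ?T (\<lambda>a b. sw ?T (\<lambda>c d. tens K H H (a \<otimes>\<^bsub>H\<^esub> c) (b \<otimes>\<^bsub>H\<^esub> d)) h)"
    by (rule sw_param2) (simp_all add: b1 b2 assms)
  have b4: "bilin H H Z (\<lambda>a b. ?l (sw ?T (\<lambda>c d. tens K H H (a \<otimes>\<^bsub>H\<^esub> c) (b \<otimes>\<^bsub>H\<^esub> d)) h))"
    by (rule bilin_lin_comp[OF b3 l])
  have e: "?l (sw ?T (\<lambda>c d. tens K H H (a \<otimes>\<^bsub>H\<^esub> c) (b \<otimes>\<^bsub>H\<^esub> d)) h) =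
      sw Z (\<lambda>c d. f (a \<otimes>\<^bsub>H\<^esub> c) (b \<otimes>\<^bsub>H\<^esub> d)) h" if "a \<in> carrier H" "b \<in> carrier H" for a b
  proof -
    have "bilin H H Z (\<lambda>c d. f (a \<otimes>\<^bsub>H\<^esub> c) (b \<otimes>\<^bsub>H\<^esub> d))"
      using that by (intro bilinI bilin_comp1[OF assms(4)] bilin_comp2[OF assms(4)] H_mult_lin2 lin_id) auto
    then show ?thesis
      using that assms
      by (subst sw_hom[OF HH_vs assms(1) l assms(3) b1[OF that]])
        (auto intro!: sw_cong tensor_lift_tens[OF H_vs H_vs])
  qed
  have "sw Z (\<lambda>a b. f a b) (g \<otimes>\<^bsub>H\<^esub> h) =
      ?l (sw ?T (\<lambda>a b. sw ?T (\<lambda>c d. tens K H H (a \<otimes>\<^bsub>H\<^esub> c) (b \<otimes>\<^bsub>H\<^esub> d)) h) g)"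
    unfolding sweedler_def[of K H Z]
    by (simp only: hopf_algebra.comult_mult[OF hopf assms(2,3)])
  also have "\<dots> = sw Z (\<lambda>a b. ?l (sw ?T (\<lambda>c d. tens K H H (a \<otimes>\<^bsub>H\<^esub> c) (b \<otimes>\<^bsub>H\<^esub> d)) h)) g"
    by (rule sw_hom[OF HH_vs assms(1) l assms(2) b3])
  also have "\<dots> = sw Z (\<lambda>a b. sw Z (\<lambda>c d. f (a \<otimes>\<^bsub>H\<^esub> c) (b \<otimes>\<^bsub>H\<^esub> d)) h) g"
    by (rule sw_cong'[OF assms(1,2) b4 e])
  finally show ?thesis .
qed

end

section \<open>Splitting off the first tensor factor\<close>

context ground_field
begin

lemmas tpow_gen_closed = mlin_closed[OF tpow_gen_mlin]

text \<open>This is the expression in the recursive case of \<open>diag_act\<close>, so the diagonal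
  action unfolds in terms of \<open>tcons\<close>.\<close>

definition tcons :: "('k, 'v, 'e) module_scheme \<Rightarrow> nat \<Rightarrow> 'v \<Rightarrow> ('v list \<Rightarrow> 'k) set \<Rightarrow> ('v list \<Rightarrow> 'k) set" where
  "tcons V n x t = lift K (tpow K V (Suc n)) (\<lambda>vs. tpow_gen K V (x # vs)) t"

text \<open>The universal property of the identification of the next tensor power with
  \<open>V\<close> tensored with the previous one: a bilinear \<open>f\<close> induces a map out of
  the longer power.\<close>

definition tlift ::
    "('k, 'v, 'e) module_scheme \<Rightarrow> ('k, 'z, 'f) module_scheme \<Rightarrow> ('v \<Rightarrow> ('v list \<Rightarrow> 'k) set \<Rightarrow> 'z) \<Rightarrow>
     ('v list \<Rightarrow> 'k) set \<Rightarrow> 'z" where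
  "tlift V Z f = lift K Z (\<lambda>xs. f (hd xs) (tpow_gen K V (tl xs)))"

context
  fixes V :: "('k, 'v, 'e) module_scheme"
  assumes V: "vsp V"
begin

lemma tcons_gen:
  assumes "x \<in> carrier V" "xs \<in> tuples V n"
  shows "tcons V n x (tpow_gen K V xs) = tpow_gen K V (x # xs)"
  unfolding tcons_def
  by (rule tpow_lift_gen[OF V tpow_vs[OF V] mlin_Cons_mlin[OF tpow_gen_mlin[OF V]]]) (fact assms)+

lemma tcons_bilin: "bilin V (tpow K V n) (tpow K V (Suc n)) (tcons V n)"
  unfolding tcons_def
  by (rule bilinI; (rule tpow_lift_lin[OF V tpow_vs[OF V] mlin_Cons_mlin[OF tpow_gen_mlin[OF V]]] |
      rule tpow_lift_param[OF V V tpow_vs[OF V] mlin_Cons_mlin[OF tpow_gen_mlin[OF V]] mlin_Cons_lin[OF tpow_gen_mlin[OF V] _ V]]);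
      assumption)

lemma tlift_mlin:
  assumes "vsp Z" "bilin V (tpow K V n) Z f"
  shows "mlin V (Suc n) Z (\<lambda>xs. f (hd xs) (tpow_gen K V (tl xs)))"
  by (rule mlin_ConsI)
    (simp_all add: bilin_lin1[OF assms(2)] tpow_gen_closed[OF V]
      mlin_comp[OF tpow_gen_mlin[OF V] bilin_lin2[OF assms(2)]])

lemma tlift_lin:
  assumes "vsp Z" "bilin V (tpow K V n) Z f"
  shows "lin (tpow K V (Suc n)) Z (tlift V Z f)"
  unfolding tlift_def by (rule tpow_lift_lin[OF V assms(1) tlift_mlin[OF assms]])

lemma tlift_tcons:
  assumes "vsp Z" "bilin V (tpow K V n) Z f" "x \<in> carrier V" "t \<in> carrier (tpow K V n)"
  shows "tlift V Z f (tcons V n x t) = f x t"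
proof (rule tpow_hom_ext[OF V assms(1) _ bilin_lin2[OF assms(2,3)] _ assms(4)])
  show "lin (tpow K V n) Z (\<lambda>t. tlift V Z f (tcons V n x t))"
    by (rule lin_comp[OF bilin_lin2[OF tcons_bilin assms(3)] tlift_lin[OF assms(1,2)]])
  fix xs assume xs: "xs \<in> tuples V n"
  then show "tlift V Z f (tcons V n x (tpow_gen K V xs)) = f x (tpow_gen K V xs)"
    unfolding tcons_gen[OF assms(3) xs] tlift_def
    by (subst tpow_lift_gen[OF V assms(1) tlift_mlin[OF assms(1,2)]]) (simp_all add: assms(3))
qed

lemma tlift_param:
  assumes "vsp U" "vsp Z" "\<And>u. u \<in> carrier U \<Longrightarrow> bilin V (tpow K V n) Z (f u)"
    "\<And>x t. x \<in> carrier V \<Longrightarrow> t \<in> carrier (tpow K V n) \<Longrightarrow> lin U Z (\<lambda>u. f u x t)"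
    "t \<in> carrier (tpow K V (Suc n))"
  shows "lin U Z (\<lambda>u. tlift V Z (f u) t)"
  unfolding tlift_def
proof (rule tpow_lift_param[OF V assms(1,2) tlift_mlin[OF assms(2,3)] _ assms(5)])
  fix xs assume "xs \<in> tuples V (Suc n)"
  then show "lin U Z (\<lambda>u. f u (hd xs) (tpow_gen K V (tl xs)))"
    by (rule tuples_SucE) (simp add: assms(4) tpow_gen_closed[OF V])
qed

end

lemmas tcons_lin1 = bilin_comp1[OF tcons_bilin]
lemmas tcons_lin2 = bilin_comp2[OF tcons_bilin]

lemma same_space_bilin2: "same_space W W' \<Longrightarrow> bilin V W' Z f \<Longrightarrow> bilin V W Z f"
  unfolding bilin_def by (auto intro: same_space_lin1 simp: same_space_def)

lemma same_space_bilin3: "same_space Z Z' \<Longrightarrow> bilin V W Z' f \<Longrightarrow> bilin V W Z f"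
  unfolding bilin_def by (auto intro: same_space_lin2)

end

section \<open>Coassociativity and counit for Sweedler sums\<close>

context hopf_ground
begin

definition trilin :: "('k, 'z, 'e) module_scheme \<Rightarrow> ('h \<Rightarrow> 'h \<Rightarrow> 'h \<Rightarrow> 'z) \<Rightarrow> bool" where
  "trilin Z f \<longleftrightarrow> (\<forall>a\<in>carrier H. bilin H H Z (f a)) \<and>
    (\<forall>b\<in>carrier H. \<forall>c\<in>carrier H. lin H Z (\<lambda>a. f a b c))"

lemma trilinI:
  "(\<And>a b. a \<in> carrier H \<Longrightarrow> b \<in> carrier H \<Longrightarrow> lin H Z (\<lambda>c. f a b c)) \<Longrightarrow>
   (\<And>a c. a \<in> carrier H \<Longrightarrow> c \<in> carrier H \<Longrightarrow> lin H Z (\<lambda>b. f a b c)) \<Longrightarrow>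
   (\<And>b c. b \<in> carrier H \<Longrightarrow> c \<in> carrier H \<Longrightarrow> lin H Z (\<lambda>a. f a b c)) \<Longrightarrow> trilin Z (\<lambda>a b c. f a b c)"
  by (simp add: trilin_def bilin_def)

lemma trilin_bilin:
  assumes "trilin Z (\<lambda>a b c. f a b c)"
  shows "a \<in> carrier H \<Longrightarrow> bilin H H Z (\<lambda>b c. f a b c)"
    and "b \<in> carrier H \<Longrightarrow> bilin H H Z (\<lambda>a c. f a b c)"
    and "c \<in> carrier H \<Longrightarrow> bilin H H Z (\<lambda>a b. f a b c)"
  using assms by (simp_all add: trilin_def bilin_def)

lemma trilin_lin1: "trilin Z (\<lambda>a b c. f a b c) \<Longrightarrow> b \<in> carrier H \<Longrightarrow> c \<in> carrier H \<Longrightarrow> lin H Z (\<lambda>a. f a b c)"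
  by (simp add: trilin_def)

lemma trilin_swL:
  assumes "vsp Z" "trilin Z (\<lambda>a b c. f a b c)"
  shows "bilin H H Z (\<lambda>a b. sw Z (\<lambda>c d. f c d b) a)"
  by (rule bilinI; (rule sw_lin[OF assms(1) lin_id] | rule sw_param[OF H_vs assms(1)]))
    (simp_all add: trilin_bilin[OF assms(2)] bilin_lin2[OF trilin_bilin(1)[OF assms(2)]])

lemma trilin_swR:
  assumes "vsp Z" "trilin Z (\<lambda>a b c. f a b c)"
  shows "bilin H H Z (\<lambda>a b. sw Z (\<lambda>c d. f a c d) b)"
  by (rule bilinI; (rule sw_lin[OF assms(1) lin_id] | rule sw_param[OF H_vs assms(1)]))
    (simp_all add: trilin_bilin[OF assms(2)] trilin_lin1[OF assms(2)])

text \<open>The coassociativity axiom is an equation in a threefold tensor product. A trilinear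
  \<open>f\<close> induces a linear map out of that product, and applying it to both sides gives the
  statement for every target.\<close>

lemma sw_coassoc:
  assumes Z: "vsp Z" and h: "h \<in> carrier H" and f: "trilin Z (\<lambda>a b c. f a b c)"
  shows "sw Z (\<lambda>a b. sw Z (\<lambda>c d. f c d b) a) h = sw Z (\<lambda>a b. sw Z (\<lambda>c d. f a c d) b) h"
proof -
  let ?T = "tensor K H H" let ?U = "tensor K H ?T"
  let ?t = "\<lambda>a b c. tens K H ?T a (tens K H H b c)"
  \<comment> \<open>The map out of H \<otimes> (H \<otimes> H) with value \<open>f a b c\<close> on
    pure tensors.\<close>
  define \<phi> where "\<phi> = lift K Z (\<lambda>(a, u). lift K Z (\<lambda>(b, c). f a b c) u)"
  have U: "vsp ?U"
    by auto
  note tb = tens_bilin[OF H_vs H_vs] and ub = tens_bilin[OF H_vs HH_vs]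
  have t: "trilin ?U ?t"
    by (rule trilinI; (rule bilin_comp2[OF ub] | rule bilin_comp1[OF ub]))
      (simp_all add: bilin_lin1[OF tb] bilin_lin2[OF tb] bilin_closed[OF tb] lin_id)
  have b: "bilin H ?T Z (\<lambda>a u. lift K Z (\<lambda>(b, c). f a b c) u)"
    by (rule bilinI; (rule tensor_lift_lin[OF H_vs H_vs Z] | rule tensor_lift_param[OF H_vs H_vs H_vs Z]))
      (simp_all add: trilin_bilin[OF f] trilin_lin1[OF f])
  have \<phi>: "lin ?U Z \<phi>"
    unfolding \<phi>_def by (rule tensor_lift_lin[OF H_vs HH_vs Z b])
  have \<phi>t: "\<phi> (?t a b' c) = f a b' c" if "a \<in> carrier H" "b' \<in> carrier H" "c \<in> carrier H" for a b' c
    unfolding \<phi>_def using that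
    by (simp add: tensor_lift_tens[OF H_vs HH_vs Z b] bilin_closed[OF tb]
        tensor_lift_tens[OF H_vs H_vs Z trilin_bilin(1)[OF f]])
  have \<phi>f: "trilin Z (\<lambda>a b c. \<phi> (?t a b c))"
    by (rule trilinI; rule lin_comp[OF _ \<phi>])
      (simp_all only: trilin_lin1[OF t] bilin_lin1[OF trilin_bilin(1)[OF t]] bilin_lin2[OF trilin_bilin(1)[OF t]])
  have c: "\<phi> (sw ?U (\<lambda>a b. sw ?U (\<lambda>c d. ?t c d b) a) h) = \<phi> (sw ?U (\<lambda>a b. sw ?U (\<lambda>c d. ?t a c d) b) h)"
    using hopf_algebra.coassoc[OF hopf h] by (simp add: Let_def)
  have "\<phi> (sw ?U (\<lambda>a b. sw ?U (\<lambda>c d. ?t c d b) a) h) = sw Z (\<lambda>a b. \<phi> (sw ?U (\<lambda>c d. ?t c d b) a)) h"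
    by (rule sw_hom[OF U Z \<phi> h trilin_swL[OF U t]])
  also have "\<dots> = sw Z (\<lambda>a b. sw Z (\<lambda>c d. f c d b) a) h"
  proof (rule sw_cong[OF Z h trilin_swL[OF Z f]])
    fix a b assume ab: "a \<in> carrier H" "b \<in> carrier H"
    show "\<phi> (sw ?U (\<lambda>c d. ?t c d b) a) = sw Z (\<lambda>c d. f c d b) a"
      unfolding sw_hom[OF U Z \<phi> ab(1) trilin_bilin(3)[OF t ab(2)]]
      by (rule sw_cong[OF Z ab(1) trilin_bilin(3)[OF f ab(2)]]) (simp add: \<phi>t ab)
  qed
  finally have 1: "\<phi> (sw ?U (\<lambda>a b. sw ?U (\<lambda>c d. ?t c d b) a) h) = sw Z (\<lambda>a b. sw Z (\<lambda>c d. f c d b) a) h" .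
  have "\<phi> (sw ?U (\<lambda>a b. sw ?U (\<lambda>c d. ?t a c d) b) h) = sw Z (\<lambda>a b. \<phi> (sw ?U (\<lambda>c d. ?t a c d) b)) h"
    by (rule sw_hom[OF U Z \<phi> h trilin_swR[OF U t]])
  also have "\<dots> = sw Z (\<lambda>a b. sw Z (\<lambda>c d. f a c d) b) h"
  proof (rule sw_cong[OF Z h trilin_swR[OF Z f]])
    fix a b assume ab: "a \<in> carrier H" "b \<in> carrier H"
    show "\<phi> (sw ?U (\<lambda>c d. ?t a c d) b) = sw Z (\<lambda>c d. f a c d) b"
      unfolding sw_hom[OF U Z \<phi> ab(2) trilin_bilin(1)[OF t ab(1)]]
      by (rule sw_cong[OF Z ab(2) trilin_bilin(1)[OF f ab(1)]]) (simp add: \<phi>t ab)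
  qed
  finally show ?thesis
    using 1 c by simp
qed

lemma counit_smult_bilin:
  assumes "vsp Z" "lin H Z \<phi>"
  shows "bilin H H Z (\<lambda>a b. counit H a \<odot>\<^bsub>Z\<^esub> \<phi> b)" "bilin H H Z (\<lambda>a b. counit H b \<odot>\<^bsub>Z\<^esub> \<phi> a)"
  by (rule bilinI; (rule smult_lin1[OF assms(1) counit_lin] | rule smult_lin2[OF assms(1)]);
      simp add: lin_closed[OF assms(2)] assms(2))+

text \<open>The axiom lives in \<open>H\<close>; applying the linear map \<phi> moves it to any
  target, so that Sweedler sums collapse there.\<close>

lemma sw_counit_left:
  assumes "vsp Z" "h \<in> carrier H" "lin H Z \<phi>"
  shows "sw Z (\<lambda>a b. counit H a \<odot>\<^bsub>Z\<^esub> \<phi> b) h = \<phi> h"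
proof -
  have "\<phi> h = \<phi> (sw H (\<lambda>a b. counit H a \<odot>\<^bsub>H\<^esub> b) h)"
    by (simp add: hopf_algebra.counit_left[OF hopf assms(2)])
  also have "\<dots> = sw Z (\<lambda>a b. \<phi> (counit H a \<odot>\<^bsub>H\<^esub> b)) h"
    by (rule sw_hom[OF H_vs assms(1,3,2) counit_smult_bilin(1)[OF H_vs lin_id]])
  also have "\<dots> = sw Z (\<lambda>a b. counit H a \<odot>\<^bsub>Z\<^esub> \<phi> b) h"
    by (rule sw_cong[OF assms(1,2) counit_smult_bilin(1)[OF assms(1,3)]]) (simp add: lin_smult[OF assms(3)])
  finally show ?thesis by simp
qed

lemma sw_counit_right:
  assumes "vsp Z" "h \<in> carrier H" "lin H Z \<phi>"
  shows "sw Z (\<lambda>a b. counit H b \<odot>\<^bsub>Z\<^esub> \<phi> a) h = \<phi> h"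
proof -
  have "\<phi> h = \<phi> (sw H (\<lambda>a b. counit H b \<odot>\<^bsub>H\<^esub> a) h)"
    by (simp add: hopf_algebra.counit_right[OF hopf assms(2)])
  also have "\<dots> = sw Z (\<lambda>a b. \<phi> (counit H b \<odot>\<^bsub>H\<^esub> a)) h"
    by (rule sw_hom[OF H_vs assms(1,3,2) counit_smult_bilin(2)[OF H_vs lin_id]])
  also have "\<dots> = sw Z (\<lambda>a b. counit H b \<odot>\<^bsub>Z\<^esub> \<phi> a) h"
    by (rule sw_cong[OF assms(1,2) counit_smult_bilin(2)[OF assms(1,3)]]) (simp add: lin_smult[OF assms(3)])
  finally show ?thesis by simp
qed

section \<open>Modules and the diagonal action\<close>

abbreviation lmod :: "('k, 'w, 'h) opmod \<Rightarrow> bool" where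
  "lmod W \<equiv> left_module K H W"

lemma lmodI:
  assumes "vsp W" "bilin H W W (act W)"
    "\<And>g h w. g \<in> carrier H \<Longrightarrow> h \<in> carrier H \<Longrightarrow> w \<in> carrier W \<Longrightarrow>
      act W (g \<otimes>\<^bsub>H\<^esub> h) w = act W g (act W h w)"
    "\<And>w. w \<in> carrier W \<Longrightarrow> act W \<one>\<^bsub>H\<^esub> w = w"
  shows "lmod W"
  by (intro left_module.intro left_module_axioms.intro H_algebra assms)
    (simp_all add: bilin_closed[OF assms(2)] lin_add[OF bilin_lin1[OF assms(2)]] lin_add[OF bilin_lin2[OF assms(2)]]
      lin_smult[OF bilin_lin1[OF assms(2)]] lin_smult[OF bilin_lin2[OF assms(2)]])

lemma lmod_vs: "lmod W \<Longrightarrow> vsp W"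
  by (rule left_module.axioms)

lemma lmod_bilin: "lmod W \<Longrightarrow> bilin H W W (act W)"
  by (intro bilinI linI) (simp_all add: left_module.act_closed left_module.act_add_left
      left_module.act_add_right left_module.act_smult_left left_module.act_smult_right)

lemmas act_closed = bilin_closed[OF lmod_bilin]
lemmas act_lin1 = bilin_comp1[OF lmod_bilin]
lemmas act_lin2 = bilin_comp2[OF lmod_bilin]

abbreviation TP :: "('k, 'w, 'h) opmod \<Rightarrow> nat \<Rightarrow> ('k, ('w list \<Rightarrow> 'k) set, 'h) opmod" where
  "TP W n \<equiv> tpow_module K H W n"

lemma TP_same: "same_space (TP W n) (tpow K W n)"
  by (simp add: tpow_module_def)

lemma TP_carrier: "carrier (TP W n) = carrier (tpow K W n)"
  using TP_same[of W n] by (simp add: same_space_def)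

context
  fixes W :: "('k, 'w, 'h) opmod"
  assumes W: "lmod W"
begin

lemmas Wvs = lmod_vs[OF W]

lemma TP_vs: "vsp (TP W n)"
  by (rule same_space_vsp[OF TP_same tpow_vs[OF Wvs]])

lemma TP_tcons: "bilin W (TP W n) (TP W (Suc n)) (tcons W n)"
  by (rule same_space_bilin2[OF TP_same same_space_bilin3[OF TP_same tcons_bilin[OF Wvs]]])

lemmas TP_tcons_lin1 = bilin_comp1[OF TP_tcons]
lemmas TP_tcons_lin2 = bilin_comp2[OF TP_tcons]
lemmas TP_tcons_closed = bilin_closed[OF TP_tcons]

lemma TP_gen_closed: "xs \<in> tuples W n \<Longrightarrow> tpow_gen K W xs \<in> carrier (TP W n)"
  by (simp add: TP_carrier tpow_gen_closed[OF Wvs])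

lemma TP_hom_ext:
  assumes "vsp Z" "lin (TP W n) Z f" "lin (TP W n) Z g"
    "\<And>xs. xs \<in> tuples W n \<Longrightarrow> f (tpow_gen K W xs) = g (tpow_gen K W xs)" "t \<in> carrier (TP W n)"
  shows "f t = g t"
  by (rule tpow_hom_ext[OF Wvs assms(1) same_space_lin1[OF _ assms(2)] same_space_lin1[OF _ assms(3)] assms(4)])
    (use assms(5) in \<open>simp_all add: TP_carrier same_space_def tpow_module_def with_act_def module.defs opmod.defs\<close>)

lemma TP_Suc_hom_ext:
  assumes "vsp Z" "lin (TP W (Suc n)) Z f" "lin (TP W (Suc n)) Z g"
    "\<And>x t. x \<in> carrier W \<Longrightarrow> t \<in> carrier (TP W n) \<Longrightarrow> f (tcons W n x t) = g (tcons W n x t)"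
    "t \<in> carrier (TP W (Suc n))"
  shows "f t = g t"
proof (rule TP_hom_ext[OF assms(1-3) _ assms(5)])
  fix xs assume "xs \<in> tuples W (Suc n)"
  then obtain y ys where y: "xs = y # ys" "y \<in> carrier W" "ys \<in> tuples W n"
    by (rule tuples_SucE)
  then show "f (tpow_gen K W xs) = g (tpow_gen K W xs)"
    using assms(4)[OF y(2) TP_gen_closed[OF y(3)]] by (simp add: tcons_gen[OF Wvs])
qed

lemma diag_act_Cons:
  assumes "ws \<in> tuples W n"
  shows "diag_act K H W (w # ws) h =
    sw (TP W (Suc n)) (\<lambda>a b. tcons W n (act W a w) (diag_act K H W ws b)) h"
  using assms
  by (simp add: Let_def tuples_length tcons_def same_space_sweedler[OF TP_same])

text \<open>Linearity in the tuple and linearity in \<open>h\<close> are proved simultaneously: the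
  Sweedler sum for a longer tuple has a meaning only if its integrand is bilinear, and this uses
  both properties of the shorter tuple.\<close>

lemma diag_act_lin:
  "(\<forall>h\<in>carrier H. mlin W n (TP W n) (\<lambda>ws. diag_act K H W ws h)) \<and>
   (\<forall>ws\<in>tuples W n. lin H (TP W n) (\<lambda>h. diag_act K H W ws h))"
proof (induction n)
  case 0
  have c: "counit H h \<odot>\<^bsub>tpow K W 0\<^esub> tpow_gen K W [] = counit H h \<odot>\<^bsub>TP W 0\<^esub> tpow_gen K W []" for h
    using TP_same[of W 0] by (simp add: same_space_def)
  show ?case
    using TP_gen_closed[of "[]" 0]
    by (auto simp: c TP_vs intro!: mlin_0 smult_lin1[OF TP_vs counit_lin] vs_closed)
next
  case (Suc n)
  then have m: "h \<in> carrier H \<Longrightarrow> mlin W n (TP W n) (\<lambda>ws. diag_act K H W ws h)"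
    and l: "ws \<in> tuples W n \<Longrightarrow> lin H (TP W n) (\<lambda>h. diag_act K H W ws h)" for h ws
    by auto
  have b: "bilin H H (TP W (Suc n)) (\<lambda>a b. tcons W n (act W a w) (diag_act K H W ws b))"
    if "w \<in> carrier W" "ws \<in> tuples W n" for w ws
    using that mlin_closed[OF m]
    by (intro bilinI TP_tcons_lin1 TP_tcons_lin2 act_lin1[OF W] l lin_id act_closed[OF W]) auto
  show ?case
  proof (intro conjI ballI)
    fix h assume h: "h \<in> carrier H"
    show "mlin W (Suc n) (TP W (Suc n)) (\<lambda>ws. diag_act K H W ws h)"
    proof (rule mlin_ConsI)
      fix ws assume ws: "ws \<in> tuples W n"
      show "lin W (TP W (Suc n)) (\<lambda>w. diag_act K H W (w # ws) h)"
        unfolding diag_act_Cons[OF ws]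
        using ws h mlin_closed[OF m]
        by (intro sw_param[OF Wvs TP_vs] b TP_tcons_lin1 act_lin2[OF W] lin_id) auto
    next
      fix w assume w: "w \<in> carrier W"
      show "mlin W n (TP W (Suc n)) (\<lambda>ws. diag_act K H W (w # ws) h)"
      proof (rule mlinI)
        fix ws assume ws: "ws \<in> tuples W n"
        show "diag_act K H W (w # ws) h \<in> carrier (TP W (Suc n))"
          unfolding diag_act_Cons[OF ws] by (rule sw_closed[OF TP_vs h b[OF w ws]])
        fix i assume i: "i < n"
        have "lin W (TP W (Suc n))
            (\<lambda>x. sw (TP W (Suc n)) (\<lambda>a b. tcons W n (act W a w) (diag_act K H W (ws[i := x]) b)) h)"
          using ws w h i mlin_lin[OF m]
          by (intro sw_param[OF Wvs TP_vs] b TP_tcons_lin2 act_closed[OF W]) auto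
        then show "lin W (TP W (Suc n)) (\<lambda>x. diag_act K H W (w # ws[i := x]) h)"
          by (rule lin_cong[OF Wvs]) (rule diag_act_Cons[symmetric], use ws in simp)
      qed
    qed
  next
    fix ws assume "ws \<in> tuples W (Suc n)"
    then obtain v vs where v: "ws = v # vs" "v \<in> carrier W" "vs \<in> tuples W n"
      by (rule tuples_SucE)
    show "lin H (TP W (Suc n)) (\<lambda>h. diag_act K H W ws h)"
      unfolding v(1) diag_act_Cons[OF v(3)] by (rule sw_lin[OF TP_vs lin_id b[OF v(2,3)]])
  qed
qed

lemma diag_act_mlin: "h \<in> carrier H \<Longrightarrow> mlin W n (tpow K W n) (\<lambda>ws. diag_act K H W ws h)"
  using diag_act_lin[of n] TP_same[of W n]
  by (auto simp: mlin_def same_space_def LinearCombinations.module_hom_def)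

lemma diag_act_lin_H: "ws \<in> tuples W n \<Longrightarrow> lin H (tpow K W n) (\<lambda>h. diag_act K H W ws h)"
  using diag_act_lin[of n] TP_same[of W n]
  by (auto simp: same_space_def LinearCombinations.module_hom_def)

lemma TP_act: "act (TP W n) h = lift K (tpow K W n) (\<lambda>ws. diag_act K H W ws h)"
  by (simp add: tpow_module_def)

lemma TP_act_bilin: "bilin H (TP W n) (TP W n) (act (TP W n))"
proof (rule same_space_bilin2[OF TP_same same_space_bilin3[OF TP_same]])
  show "bilin H (tpow K W n) (tpow K W n) (act (TP W n))"
    unfolding bilin_def TP_act
    by (intro conjI ballI tpow_lift_lin[OF Wvs tpow_vs[OF Wvs] diag_act_mlin]
        tpow_lift_param[OF Wvs H_vs tpow_vs[OF Wvs] diag_act_mlin diag_act_lin_H])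
qed

lemma TP_act_gen: "h \<in> carrier H \<Longrightarrow> ws \<in> tuples W n \<Longrightarrow> act (TP W n) h (tpow_gen K W ws) = diag_act K H W ws h"
  unfolding TP_act by (rule tpow_lift_gen[OF Wvs tpow_vs[OF Wvs] diag_act_mlin])

lemmas TP_act_lin1 = bilin_comp1[OF TP_act_bilin]
lemmas TP_act_lin2 = bilin_comp2[OF TP_act_bilin]
lemmas TP_act_closed = bilin_closed[OF TP_act_bilin]

lemma TP_act_nil: "h \<in> carrier H \<Longrightarrow>
    act (TP W 0) h (tpow_gen K W []) = counit H h \<odot>\<^bsub>TP W 0\<^esub> tpow_gen K W []"
  using TP_same[of W 0] by (simp add: TP_act_gen same_space_def)

lemma TP_diag_bilin:
  assumes "w \<in> carrier W" "t \<in> carrier (TP W n)"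
  shows "bilin H H (TP W (Suc n)) (\<lambda>a b. tcons W n (act W a w) (act (TP W n) b t))"
  using assms
  by (intro bilinI TP_tcons_lin1 TP_tcons_lin2 act_lin1[OF W] TP_act_lin1 lin_id act_closed[OF W] TP_act_closed)

text \<open>The definition gives the diagonal action on pure tensors; linearity in \<open>t\<close>
  extends the recursion to the whole power.\<close>

lemma TP_act_tcons:
  assumes "h \<in> carrier H" "w \<in> carrier W" "t \<in> carrier (TP W n)"
  shows "act (TP W (Suc n)) h (tcons W n w t) =
    sw (TP W (Suc n)) (\<lambda>a b. tcons W n (act W a w) (act (TP W n) b t)) h"
proof (rule TP_hom_ext[OF TP_vs _ _ _ assms(3)])
  show "lin (TP W n) (TP W (Suc n)) (\<lambda>t. act (TP W (Suc n)) h (tcons W n w t))"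
    using assms by (intro TP_act_lin2 TP_tcons_lin2 lin_id)
  show "lin (TP W n) (TP W (Suc n)) (\<lambda>t. sw (TP W (Suc n)) (\<lambda>a b. tcons W n (act W a w) (act (TP W n) b t)) h)"
    using assms by (intro sw_param[OF TP_vs TP_vs] TP_diag_bilin TP_tcons_lin2 TP_act_lin2 lin_id act_closed[OF W])
  fix ws assume ws: "ws \<in> tuples W n"
  have "diag_act K H W (w # ws) h = sw (TP W (Suc n)) (\<lambda>a b. tcons W n (act W a w) (act (TP W n) b (tpow_gen K W ws))) h"
    unfolding diag_act_Cons[OF ws]
    by (rule sw_cong[OF TP_vs assms(1) TP_diag_bilin[OF assms(2) TP_gen_closed[OF ws]]])
      (simp add: TP_act_gen ws)
  then show "act (TP W (Suc n)) h (tcons W n w (tpow_gen K W ws)) =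
      sw (TP W (Suc n)) (\<lambda>a b. tcons W n (act W a w) (act (TP W n) b (tpow_gen K W ws))) h"
    using assms ws by (simp add: tcons_gen[OF Wvs] TP_act_gen del: diag_act.simps)
qed

text \<open>The action of a product on \<open>tcons\<close> is expanded by multiplicativity of the
  comultiplication, and exchanging the two Sweedler sums regroups it into successive actions. On the
  zeroth power the claim is multiplicativity of the counit.\<close>

lemma TP_lmod: "lmod (TP W n)"
proof (rule lmodI[OF TP_vs TP_act_bilin])
  fix g h t assume gh: "g \<in> carrier H" "h \<in> carrier H" and t: "t \<in> carrier (TP W n)"
  from gh t show "act (TP W n) (g \<otimes>\<^bsub>H\<^esub> h) t = act (TP W n) g (act (TP W n) h t)"
  proof (induction n arbitrary: g h t)
    case 0
    note gh = 0(1,2)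
    show ?case
    proof (rule TP_hom_ext[OF TP_vs TP_act_lin2[OF _ lin_id] TP_act_lin2[OF _ TP_act_lin2[OF _ lin_id]] _ 0(3)])
      fix xs assume "xs \<in> tuples W 0"
      then have xs: "xs = []" by simp
      have n: "tpow_gen K W [] \<in> carrier (TP W 0)"
        by (rule TP_gen_closed) simp
      show "act (TP W 0) (g \<otimes>\<^bsub>H\<^esub> h) (tpow_gen K W xs) = act (TP W 0) g (act (TP W 0) h (tpow_gen K W xs))"
        unfolding xs using gh n
        by (simp add: TP_act_nil lin_smult[OF bilin_lin2[OF TP_act_bilin]] hopf_algebra.counit_mult[OF hopf]
            vs_mult_smult[OF TP_vs] vs_smult_commute[OF TP_vs])
    qed (use gh in simp_all)
  next
    case (Suc n)
    note gh = Suc.prems(1,2)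
    show ?case
    proof (rule TP_Suc_hom_ext[OF TP_vs TP_act_lin2[OF _ lin_id] TP_act_lin2[OF _ TP_act_lin2[OF _ lin_id]] _ Suc.prems(3)])
      fix w t assume w: "w \<in> carrier W" and t: "t \<in> carrier (TP W n)"
      let ?Z = "TP W (Suc n)"
      let ?f = "\<lambda>a b c d. tcons W n (act W a (act W c w)) (act (TP W n) b (act (TP W n) d t))"
      have b1: "bilin H H ?Z (\<lambda>a b. ?f a b c d)" if "c \<in> carrier H" "d \<in> carrier H" for c d
        using that w t by (intro TP_diag_bilin act_closed[OF W] TP_act_closed)
      have b2: "bilin H H ?Z (\<lambda>c d. ?f a b c d)" if "a \<in> carrier H" "b \<in> carrier H" for a b
        using that w t
        by (intro bilinI TP_tcons_lin1 TP_tcons_lin2 act_lin1[OF W] act_lin2[OF W] TP_act_lin1 TP_act_lin2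
            lin_id act_closed[OF W] TP_act_closed)
      have "act ?Z (g \<otimes>\<^bsub>H\<^esub> h) (tcons W n w t) =
          sw ?Z (\<lambda>a b. sw ?Z (\<lambda>c d. tcons W n (act W (a \<otimes>\<^bsub>H\<^esub> c) w) (act (TP W n) (b \<otimes>\<^bsub>H\<^esub> d) t)) h) g"
        using gh w t by (simp add: TP_act_tcons sw_mult[OF TP_vs gh TP_diag_bilin])
      also have "\<dots> = sw ?Z (\<lambda>a b. sw ?Z (\<lambda>c d. ?f a b c d) h) g"
      proof (rule sw_cong[OF TP_vs gh(1) sw_param2[OF H_vs H_vs TP_vs gh(2) b2 b1]])
        fix a b assume ab: "a \<in> carrier H" "b \<in> carrier H"
        show "sw ?Z (\<lambda>c d. tcons W n (act W (a \<otimes>\<^bsub>H\<^esub> c) w) (act (TP W n) (b \<otimes>\<^bsub>H\<^esub> d) t)) h =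
            sw ?Z (\<lambda>c d. ?f a b c d) h"
          by (rule sw_cong[OF TP_vs gh(2) b2[OF ab]])
            (simp add: left_module.act_mult[OF W] ab w t Suc.IH)
      qed
      \<comment> \<open>After the exchange the inner sum over the components of \<open>g\<close> is
        a diagonal action on a single \<open>tcons\<close>.\<close>
      also have "\<dots> = sw ?Z (\<lambda>c d. sw ?Z (\<lambda>a b. ?f a b c d) g) h"
        by (rule sw_swap[OF TP_vs gh b2 b1])
      also have "\<dots> = sw ?Z (\<lambda>c d. act ?Z g (tcons W n (act W c w) (act (TP W n) d t))) h"
        by (rule sw_cong'[OF TP_vs gh(2) sw_param2[OF H_vs H_vs TP_vs gh(1) b1 b2]])
          (simp_all add: TP_act_tcons gh act_closed[OF W] TP_act_closed w t)
      also have "\<dots> = act ?Z g (act ?Z h (tcons W n w t))"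
        using gh w t
        by (simp add: TP_act_tcons[OF gh(2)] sw_hom[OF TP_vs TP_vs bilin_lin2[OF TP_act_bilin] _ TP_diag_bilin])
      finally show "act ?Z (g \<otimes>\<^bsub>H\<^esub> h) (tcons W n w t) = act ?Z g (act ?Z h (tcons W n w t))" .
    qed (use gh in simp_all)
  qed
next
  fix t assume "t \<in> carrier (TP W n)"
  then show "act (TP W n) \<one>\<^bsub>H\<^esub> t = t"
  proof (induction n arbitrary: t)
    case 0
    show ?case
    proof (rule TP_hom_ext[OF TP_vs TP_act_lin2[OF _ lin_id] lin_id _ 0])
      fix xs assume "xs \<in> tuples W 0"
      then show "act (TP W 0) \<one>\<^bsub>H\<^esub> (tpow_gen K W xs) = tpow_gen K W xs"
        using TP_gen_closed[of "[]" 0]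
        by (simp add: TP_act_nil hopf_algebra.counit_one[OF hopf] TP_vs)
    qed simp
  next
    case (Suc n)
    show ?case
    proof (rule TP_Suc_hom_ext[OF TP_vs TP_act_lin2[OF _ lin_id] lin_id _ Suc.prems])
      fix w t assume w: "w \<in> carrier W" and t: "t \<in> carrier (TP W n)"
      show "act (TP W (Suc n)) \<one>\<^bsub>H\<^esub> (tcons W n w t) = tcons W n w t"
        using w t by (simp add: TP_act_tcons sw_one[OF TP_vs TP_diag_bilin] left_module.act_one[OF W] Suc.IH)
    qed simp
  qed
qed

end

end

section \<open>The smash product\<close>

locale smash_ground = hopf_ground K H for K :: "('k, 'r) ring_scheme" and H :: "('k, 'h) hopf" +
  fixes A :: "('k, 'a, 'h) opmod"
  assumes module_algebra: "module_algebra K H A"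
begin

lemma A_lmod: "lmod A"
  by (rule module_algebra.axioms(2)[OF module_algebra])

lemma A_algebra: "assoc_algebra K A"
  by (rule module_algebra.axioms(3)[OF module_algebra])

lemma A_vs [simp]: "vsp A"
  by (rule lmod_vs[OF A_lmod])

lemma A_ring: "ring A"
  by (rule algebra_ring[OF A_algebra])

lemma A_closed [simp]:
  "\<one>\<^bsub>A\<^esub> \<in> carrier A" "x \<in> carrier A \<Longrightarrow> y \<in> carrier A \<Longrightarrow> x \<otimes>\<^bsub>A\<^esub> y \<in> carrier A"
  using ring.ring_simprules(5,6)[OF A_ring] by auto

lemma A_simps [simp]:
  "x \<in> carrier A \<Longrightarrow> \<one>\<^bsub>A\<^esub> \<otimes>\<^bsub>A\<^esub> x = x" "x \<in> carrier A \<Longrightarrow> x \<otimes>\<^bsub>A\<^esub> \<one>\<^bsub>A\<^esub> = x"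
  using ring.ring_simprules(12)[OF A_ring] ring.is_monoid[OF A_ring]
  by (auto intro: monoid.r_one monoid.l_one)

lemmas A_mult_lin1 = bilin_comp1[OF algebra_mult_bilin[OF A_algebra]]
lemmas A_mult_lin2 = bilin_comp2[OF algebra_mult_bilin[OF A_algebra]]

lemmas A_act_closed = act_closed[OF A_lmod]
lemmas A_act_lin1 = act_lin1[OF A_lmod]
lemmas A_act_lin2 = act_lin2[OF A_lmod]

abbreviation T where "T \<equiv> tensor K A H"
abbreviation C where "C \<equiv> smash K H A"
abbreviation sm where "sm \<equiv> tens K A H"

lemma T_vs [simp]: "vsp T"
  by auto

lemma C_same: "same_space C T"
  by (simp add: same_space_def smash_def Let_def)

lemma C_carrier: "carrier C = carrier T"
  using C_same by (simp add: same_space_def)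

lemma C_vs [simp]: "vsp C"
  by (rule same_space_vsp[OF C_same T_vs])

lemma sm_bilin: "bilin A H C sm"
  by (rule same_space_bilin3[OF C_same tens_bilin[OF A_vs H_vs]])

lemmas sm_lin1 = bilin_comp1[OF sm_bilin]
lemmas sm_lin2 = bilin_comp2[OF sm_bilin]
lemmas sm_closed [simp] = bilin_closed[OF sm_bilin]

lemma T_same: "same_space T C"
  using C_same by (simp add: same_space_def)

lemma C_hom_ext:
  assumes "vsp Z" "lin C Z f" "lin C Z g"
    "\<And>a h. a \<in> carrier A \<Longrightarrow> h \<in> carrier H \<Longrightarrow> f (sm a h) = g (sm a h)"
    "c \<in> carrier C"
  shows "f c = g c"
  by (rule tensor_hom_ext[OF A_vs H_vs assms(1) same_space_lin1[OF T_same assms(2)]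
        same_space_lin1[OF T_same assms(3)] assms(4)])
    (use assms(5) in \<open>simp_all add: C_carrier\<close>)

lemma C_induct:
  assumes "subm U C" "\<And>a h. a \<in> carrier A \<Longrightarrow> h \<in> carrier H \<Longrightarrow> sm a h \<in> U"
  shows "carrier C \<subseteq> U"
proof -
  have "subm U T"
    using submD[OF assms(1)] C_same by (intro submI) (simp_all add: same_space_def)
  then show ?thesis
    unfolding C_carrier by (rule tensor_induct[OF A_vs H_vs]) (rule assms(2))
qed

lemma C_lift_lin:
  assumes "vsp Z" "bilin A H Z (\<lambda>a b. f a b)"
  shows "lin C Z (lift K Z (\<lambda>(a, b). f a b))"
  by (rule same_space_lin1[OF C_same tensor_lift_lin[OF A_vs H_vs assms]])

lemma C_lift_sm:
  assumes "vsp Z" "bilin A H Z (\<lambda>a b. f a b)" "a \<in> carrier A" "h \<in> carrier H"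
  shows "lift K Z (\<lambda>(a, b). f a b) (sm a h) = f a h"
  by (rule tensor_lift_tens[OF A_vs H_vs assms])

lemma C_lift_param:
  assumes "vsp U" "vsp Z" "\<And>u. u \<in> carrier U \<Longrightarrow> bilin A H Z (f u)"
    "\<And>v w. v \<in> carrier A \<Longrightarrow> w \<in> carrier H \<Longrightarrow> lin U Z (\<lambda>u. f u v w)" "t \<in> carrier C"
  shows "lin U Z (\<lambda>u. lift K Z (\<lambda>(a, b). f u a b) t)"
  by (rule tensor_lift_param[OF A_vs H_vs assms(1-4)]) (use assms(5) in \<open>simp_all add: C_carrier\<close>)

definition smash_prod :: "'a \<Rightarrow> 'h \<Rightarrow> 'a \<Rightarrow> 'h \<Rightarrow> ('a \<times> 'h \<Rightarrow> 'k) set" where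
  "smash_prod a h b g = sw C (\<lambda>h1 h2. sm (a \<otimes>\<^bsub>A\<^esub> act A h1 b) (h2 \<otimes>\<^bsub>H\<^esub> g)) h"

lemma C_mult: "X \<otimes>\<^bsub>C\<^esub> Y = lift K C (\<lambda>(a, h). lift K C (\<lambda>(b, g). smash_prod a h b g) Y) X"
  unfolding smash_prod_def same_space_lift[OF C_same] same_space_sweedler[OF C_same]
  by (simp add: smash_def Let_def)

lemma smash_prod_inner:
  assumes "a \<in> carrier A" "b \<in> carrier A" "g \<in> carrier H"
  shows "bilin H H C (\<lambda>h1 h2. sm (a \<otimes>\<^bsub>A\<^esub> act A h1 b) (h2 \<otimes>\<^bsub>H\<^esub> g))"
  using assms
  by (intro bilinI sm_lin1 sm_lin2 A_mult_lin2 A_act_lin1 H_mult_lin1 lin_id A_closed H_closed A_act_closed)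

lemma smash_prod_bilin1:
  assumes "b \<in> carrier A" "g \<in> carrier H"
  shows "bilin A H C (\<lambda>a h. smash_prod a h b g)"
  unfolding smash_prod_def using assms
  by (intro bilinI sw_lin[OF C_vs lin_id] sw_param[OF A_vs C_vs] smash_prod_inner sm_lin1 A_mult_lin1 lin_id
      A_closed H_closed A_act_closed)

lemma smash_prod_bilin2:
  assumes "a \<in> carrier A" "h \<in> carrier H"
  shows "bilin A H C (\<lambda>b g. smash_prod a h b g)"
  unfolding smash_prod_def using assms
  by (intro bilinI sw_param[OF A_vs C_vs] sw_param[OF H_vs C_vs] smash_prod_inner sm_lin1 sm_lin2
      A_mult_lin2 A_act_lin2 H_mult_lin2 lin_id A_closed H_closed A_act_closed)

lemma smash_prod_outer:
  assumes "Y \<in> carrier C"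
  shows "bilin A H C (\<lambda>a h. lift K C (\<lambda>(b, g). smash_prod a h b g) Y)"
  using assms
  by (intro bilinI C_lift_param[OF A_vs C_vs] C_lift_param[OF H_vs C_vs] smash_prod_bilin2
      bilin_lin1[OF smash_prod_bilin1] bilin_lin2[OF smash_prod_bilin1])

lemma C_mult_bilin: "bilin C C C (mult C)"
  unfolding C_mult[abs_def]
  by (intro bilinI C_lift_lin[OF C_vs] smash_prod_outer C_lift_param[OF C_vs C_vs] smash_prod_bilin2)

lemmas C_mult_lin1 = bilin_comp1[OF C_mult_bilin]
lemmas C_mult_lin2 = bilin_comp2[OF C_mult_bilin]

lemma sm_mult:
  assumes "a \<in> carrier A" "h \<in> carrier H" "b \<in> carrier A" "g \<in> carrier H"
  shows "sm a h \<otimes>\<^bsub>C\<^esub> sm b g = sw C (\<lambda>h1 h2. sm (a \<otimes>\<^bsub>A\<^esub> act A h1 b) (h2 \<otimes>\<^bsub>H\<^esub> g)) h"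
  using assms
  by (simp add: C_mult C_lift_sm[OF C_vs smash_prod_outer] C_lift_sm[OF C_vs smash_prod_bilin2] flip: smash_prod_def)

section \<open>Left and right multiplication by the Hopf algebra\<close>

definition Lm :: "'h \<Rightarrow> ('a \<times> 'h \<Rightarrow> 'k) set \<Rightarrow> ('a \<times> 'h \<Rightarrow> 'k) set" where
  "Lm h c = sm \<one>\<^bsub>A\<^esub> h \<otimes>\<^bsub>C\<^esub> c"

definition Rm :: "('a \<times> 'h \<Rightarrow> 'k) set \<Rightarrow> 'h \<Rightarrow> ('a \<times> 'h \<Rightarrow> 'k) set" where
  "Rm c h = c \<otimes>\<^bsub>C\<^esub> sm \<one>\<^bsub>A\<^esub> h"

lemma Lm_bilin: "bilin H C C Lm"
  unfolding Lm_def by (intro bilinI C_mult_lin1 C_mult_lin2 sm_lin2 lin_id sm_closed A_closed)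

lemma Rm_bilin: "bilin C H C Rm"
  unfolding Rm_def by (intro bilinI C_mult_lin1 C_mult_lin2 sm_lin2 lin_id sm_closed A_closed)

lemmas Lm_lin1 = bilin_comp1[OF Lm_bilin]
lemmas Lm_lin2 = bilin_comp2[OF Lm_bilin]
lemmas Lm_closed [simp] = bilin_closed[OF Lm_bilin]
lemmas Rm_lin1 = bilin_comp1[OF Rm_bilin]
lemmas Rm_lin2 = bilin_comp2[OF Rm_bilin]
lemmas Rm_closed [simp] = bilin_closed[OF Rm_bilin]

lemma Lm_inner:
  assumes "b \<in> carrier A" "g \<in> carrier H"
  shows "bilin H H C (\<lambda>h1 h2. sm (act A h1 b) (h2 \<otimes>\<^bsub>H\<^esub> g))"
  using assms by (intro bilinI sm_lin1 sm_lin2 A_act_lin1 H_mult_lin1 lin_id H_closed A_act_closed)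

lemma Lm_sm:
  assumes "h \<in> carrier H" "b \<in> carrier A" "g \<in> carrier H"
  shows "Lm h (sm b g) = sw C (\<lambda>h1 h2. sm (act A h1 b) (h2 \<otimes>\<^bsub>H\<^esub> g)) h"
  unfolding Lm_def sm_mult[OF A_closed(1) assms(1-3)]
  by (rule sw_cong[OF C_vs assms(1) Lm_inner]) (simp_all add: assms A_act_closed)

text \<open>The action on the unit of \<open>A\<close> is through the counit, and the counit axiom
  then removes the Sweedler sum. Right multiplication thus changes only the Hopf algebra
  component.\<close>

lemma Rm_sm:
  assumes "a \<in> carrier A" "h \<in> carrier H" "g \<in> carrier H"
  shows "Rm (sm a h) g = sm a (h \<otimes>\<^bsub>H\<^esub> g)"
proof -
  have l: "lin H C (\<lambda>h. sm a (h \<otimes>\<^bsub>H\<^esub> g))"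
    using assms by (intro sm_lin2 H_mult_lin1 lin_id)
  have "Rm (sm a h) g = sw C (\<lambda>h1 h2. sm (a \<otimes>\<^bsub>A\<^esub> act A h1 \<one>\<^bsub>A\<^esub>) (h2 \<otimes>\<^bsub>H\<^esub> g)) h"
    using assms by (simp add: Rm_def sm_mult)
  also have "\<dots> = sw C (\<lambda>h1 h2. counit H h1 \<odot>\<^bsub>C\<^esub> sm a (h2 \<otimes>\<^bsub>H\<^esub> g)) h"
    by (rule sw_cong[OF C_vs assms(2) counit_smult_bilin(1)[OF C_vs l]])
      (simp add: assms module_algebra.act_unit[OF module_algebra] lin_smult[OF bilin_lin1[OF sm_bilin]]
        lin_smult[OF bilin_lin2[OF algebra_mult_bilin[OF A_algebra]]])
  also have "\<dots> = sm a (h \<otimes>\<^bsub>H\<^esub> g)"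
    by (rule sw_counit_left[OF C_vs assms(2) l])
  finally show ?thesis .
qed

lemma Rm_Rm:
  assumes "c \<in> carrier C" "g \<in> carrier H" "g' \<in> carrier H"
  shows "Rm (Rm c g) g' = Rm c (g \<otimes>\<^bsub>H\<^esub> g')"
  by (rule C_hom_ext[OF C_vs Rm_lin1[OF _ Rm_lin1[OF _ lin_id]] Rm_lin1[OF _ lin_id] _ assms(1)])
    (simp_all add: assms Rm_sm H_assoc)

text \<open>With \<open>Rm_Rm\<close> this is the part of associativity of the smash product that
  later arguments use. On generators it reduces to associativity in \<open>H\<close>, because
  \<open>Rm\<close> changes only the second component.\<close>

lemma Lm_Rm:
  assumes "c \<in> carrier C" "h \<in> carrier H" "g \<in> carrier H"
  shows "Lm h (Rm c g) = Rm (Lm h c) g"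
proof (rule C_hom_ext[OF C_vs Lm_lin2[OF _ Rm_lin1[OF _ lin_id]] Rm_lin1[OF _ Lm_lin2[OF _ lin_id]] _ assms(1)])
  fix a k assume ak: "a \<in> carrier A" "k \<in> carrier H"
  have "Rm (Lm h (sm a k)) g = sw C (\<lambda>h1 h2. Rm (sm (act A h1 a) (h2 \<otimes>\<^bsub>H\<^esub> k)) g) h"
    using assms ak by (simp add: Lm_sm sw_hom[OF C_vs C_vs bilin_lin1[OF Rm_bilin] _ Lm_inner])
  also have "\<dots> = sw C (\<lambda>h1 h2. sm (act A h1 a) (h2 \<otimes>\<^bsub>H\<^esub> (k \<otimes>\<^bsub>H\<^esub> g))) h"
    by (rule sw_cong[OF C_vs assms(2) Lm_inner]) (simp_all add: assms ak Rm_sm H_assoc A_act_closed)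
  also have "\<dots> = Lm h (Rm (sm a k) g)"
    using assms ak by (simp add: Rm_sm Lm_sm)
  finally show "Lm h (Rm (sm a k) g) = Rm (Lm h (sm a k)) g" ..
qed (use assms in simp_all)

section \<open>The coefficient maps of the smash product\<close>

abbreviation X where "X n \<equiv> TP A n"

lemmas X_vs = TP_vs[OF A_lmod]
lemmas X_tcons_lin1 = TP_tcons_lin1[OF A_lmod]
lemmas X_tcons_lin2 = TP_tcons_lin2[OF A_lmod]
lemmas X_tcons_closed = TP_tcons_closed[OF A_lmod]
lemmas X_act_lin1 = TP_act_lin1[OF A_lmod]
lemmas X_act_lin2 = TP_act_lin2[OF A_lmod]
lemmas X_act_closed = TP_act_closed[OF A_lmod]

text \<open>
  If \<open>\<eta> h\<close> is the coefficient of \<open>y\<close> with respect to the functional \<open>\<xi>(h _)\<close>, then \<open>st n c \<eta>\<close> is the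
  coefficient of \<open>c \<otimes> y\<close> with respect to \<open>\<xi>\<close>.  It comes from the isomorphism
  \<open>(a # h) \<otimes> (x \<otimes> g) \<mapsto> (a \<otimes> h1.x) \<otimes> h2 g\<close> by applying \<open>\<xi>\<close> to the last factor.
\<close>

definition st ::
    "nat \<Rightarrow> ('a \<times> 'h \<Rightarrow> 'k) set \<Rightarrow> ('h \<Rightarrow> ('a list \<Rightarrow> 'k) set) \<Rightarrow> ('a list \<Rightarrow> 'k) set" where
  "st n c \<eta> = lift K (X (Suc n))
    (\<lambda>(a, h). sw (X (Suc n)) (\<lambda>h1 h2. tcons A n a (act (X n) h1 (\<eta> h2))) h) c"

lemma st_inner:
  assumes "lin H (X n) \<eta>" "a \<in> carrier A"
  shows "bilin H H (X (Suc n)) (\<lambda>h1 h2. tcons A n a (act (X n) h1 (\<eta> h2)))"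
  using assms lin_closed[OF assms(1)]
  by (intro bilinI X_tcons_lin2 X_act_lin1 X_act_lin2 lin_id assms(1))

lemma st_outer:
  assumes "lin H (X n) \<eta>"
  shows "bilin A H (X (Suc n)) (\<lambda>a h. sw (X (Suc n)) (\<lambda>h1 h2. tcons A n a (act (X n) h1 (\<eta> h2))) h)"
  by (intro bilinI sw_lin[OF X_vs lin_id] sw_param[OF A_vs X_vs] st_inner[OF assms] X_tcons_lin1 lin_id
      X_act_closed lin_closed[OF assms])

lemma st_lin: "lin H (X n) \<eta> \<Longrightarrow> lin C (X (Suc n)) (\<lambda>c. st n c \<eta>)"
  unfolding st_def by (rule C_lift_lin[OF X_vs st_outer])

lemma st_sm:
  assumes "lin H (X n) \<eta>" "a \<in> carrier A" "h \<in> carrier H"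
  shows "st n (sm a h) \<eta> = sw (X (Suc n)) (\<lambda>h1 h2. tcons A n a (act (X n) h1 (\<eta> h2))) h"
  unfolding st_def by (rule C_lift_sm[OF X_vs st_outer[OF assms(1)] assms(2,3)])

lemma st_param:
  assumes "vsp U" "bilin U H (X n) \<eta>" "c \<in> carrier C"
  shows "lin U (X (Suc n)) (\<lambda>u. st n c (\<eta> u))"
  unfolding st_def
  by (intro C_lift_param[OF assms(1) X_vs _ _ assms(3)] st_outer bilin_lin2[OF assms(2)]
      sw_param[OF assms(1) X_vs] st_inner X_tcons_lin2 X_act_lin2 bilin_lin1[OF assms(2)])

lemma st_cong:
  assumes "lin H (X n) \<eta>" "\<And>h. h \<in> carrier H \<Longrightarrow> \<eta> h = \<eta>' h" "c \<in> carrier C"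
  shows "st n c \<eta> = st n c \<eta>'"
proof -
  have l: "lin H (X n) \<eta>'"
    by (rule lin_cong[OF H_vs assms(1,2)])
  show ?thesis
    by (rule C_hom_ext[OF X_vs st_lin[OF assms(1)] st_lin[OF l] _ assms(3)])
      (simp add: st_sm[OF l] st_sm[OF assms(1)], rule sw_cong[OF X_vs _ st_inner[OF l]], simp_all add: assms(2))
qed

text \<open>Three components of the iterated coproduct of \<open>b\<close> appear: one acts on
  \<open>a\<close>, one acts on the coefficient, one moves into \<eta>. The left side groups the
  last two, the right side the first two as a diagonal action; coassociativity identifies the
  groupings.\<close>

lemma st_Lm:
  assumes \<eta>: "lin H (X n) \<eta>" and c: "c \<in> carrier C" and b: "b \<in> carrier H"
  shows "st n (Lm b c) \<eta> =
    sw (X (Suc n)) (\<lambda>b1 b2. act (X (Suc n)) b1 (st n c (\<lambda>h. \<eta> (b2 \<otimes>\<^bsub>H\<^esub> h)))) b"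
proof -
  let ?Z = "X (Suc n)"
  have e1: "lin H (X n) (\<lambda>h. \<eta> (b2 \<otimes>\<^bsub>H\<^esub> h))" if "b2 \<in> carrier H" for b2
    using that by (intro lin_comp[OF H_mult_lin2 \<eta>] lin_id)
  have e2: "bilin H H (X n) (\<lambda>b2 h. \<eta> (b2 \<otimes>\<^bsub>H\<^esub> h))"
    by (intro bilinI lin_comp[OF H_mult_lin2 \<eta>] lin_comp[OF H_mult_lin1 \<eta>] lin_id)
  have sc: "st n c (\<lambda>h. \<eta> (b2 \<otimes>\<^bsub>H\<^esub> h)) \<in> carrier ?Z" if "b2 \<in> carrier H" "c \<in> carrier C" for b2 c
    by (rule lin_closed[OF st_lin[OF e1[OF that(1)]] that(2)])
  have rb: "bilin H H ?Z (\<lambda>b1 b2. act ?Z b1 (st n c (\<lambda>h. \<eta> (b2 \<otimes>\<^bsub>H\<^esub> h))))"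
    if "c \<in> carrier C" for c
    using that by (intro bilinI X_act_lin1 X_act_lin2 lin_id st_param[OF H_vs e2] sc)
  show ?thesis
  proof (rule C_hom_ext[OF X_vs lin_comp[OF Lm_lin2[OF b lin_id] st_lin[OF \<eta>]] _ _ c])
    show "lin C ?Z (\<lambda>c. sw ?Z (\<lambda>b1 b2. act ?Z b1 (st n c (\<lambda>h. \<eta> (b2 \<otimes>\<^bsub>H\<^esub> h)))) b)"
      by (intro sw_param[OF C_vs X_vs b] rb X_act_lin2 st_lin e1)
    fix a g assume a: "a \<in> carrier A" and g: "g \<in> carrier H"
    \<comment> \<open>The letters \<open>x\<close>, \<open>y\<close>, \<open>z\<close> stand for the
      three components of \<open>b\<close>, and \<open>g1\<close>, \<open>g2\<close> for those of
      \<open>g\<close>.\<close>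
    let ?f = "\<lambda>x y z g1 g2. tcons A n (act A x a) (act (X n) (y \<otimes>\<^bsub>H\<^esub> g1) (\<eta> (z \<otimes>\<^bsub>H\<^esub> g2)))"
    let ?F = "\<lambda>x y z. sw ?Z (\<lambda>g1 g2. ?f x y z g1 g2) g"
    note cl = lin_closed[OF \<eta>] A_act_closed X_act_closed H_closed
    have f: "bilin H H ?Z (\<lambda>g1 g2. ?f x y z g1 g2)" if "x \<in> carrier H" "y \<in> carrier H" "z \<in> carrier H" for x y z
      using that a
      by (intro bilinI X_tcons_lin2 X_act_lin1 X_act_lin2 H_mult_lin2 lin_comp[OF H_mult_lin2 \<eta>] lin_id cl)
    have F: "trilin ?Z ?F"
      using a g
      by (intro trilinI sw_param[OF H_vs X_vs] f X_tcons_lin1 X_tcons_lin2 A_act_lin1 X_act_lin1 X_act_lin2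
          H_mult_lin1 lin_comp[OF H_mult_lin1 \<eta>] lin_id cl)
    have "st n (Lm b (sm a g)) \<eta> = sw ?Z (\<lambda>b1 b2. st n (sm (act A b1 a) (b2 \<otimes>\<^bsub>H\<^esub> g)) \<eta>) b"
      using a g b by (simp add: Lm_sm sw_hom[OF C_vs X_vs st_lin[OF \<eta>] b Lm_inner])
    also have "\<dots> = sw ?Z (\<lambda>x b2. sw ?Z (\<lambda>y z. ?F x y z) b2) b"
    proof (rule sw_cong[OF X_vs b trilin_swR[OF X_vs F]])
      fix b1 b2 assume b12: "b1 \<in> carrier H" "b2 \<in> carrier H"
      show "st n (sm (act A b1 a) (b2 \<otimes>\<^bsub>H\<^esub> g)) \<eta> = sw ?Z (\<lambda>y z. ?F b1 y z) b2"
        using a g b12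
        by (simp add: st_sm[OF \<eta>] A_act_closed sw_mult[OF X_vs b12(2) g st_inner[OF \<eta> A_act_closed]])
    qed
    also have "\<dots> = sw ?Z (\<lambda>b1 z. sw ?Z (\<lambda>x y. ?F x y z) b1) b"
      by (rule sw_coassoc[OF X_vs b F, symmetric])
    also have "\<dots> = sw ?Z (\<lambda>b1 b2. act ?Z b1 (st n (sm a g) (\<lambda>h. \<eta> (b2 \<otimes>\<^bsub>H\<^esub> h)))) b"
    proof (rule sw_cong[OF X_vs b rb[OF sm_closed[OF a g]]])
      fix b1 b2 assume b12: "b1 \<in> carrier H" "b2 \<in> carrier H"
      let ?e = "\<lambda>x y g1 g2. tcons A n (act A x a) (act (X n) y (act (X n) g1 (\<eta> (b2 \<otimes>\<^bsub>H\<^esub> g2))))"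
      have e1': "bilin H H ?Z (\<lambda>x y. ?e x y g1 g2)" if "g1 \<in> carrier H" "g2 \<in> carrier H" for g1 g2
        using that a b12
        by (intro bilinI X_tcons_lin1 X_tcons_lin2 A_act_lin1 X_act_lin1 lin_id cl)
      have e2': "bilin H H ?Z (\<lambda>g1 g2. ?e x y g1 g2)" if "x \<in> carrier H" "y \<in> carrier H" for x y
        using that a b12
        by (intro bilinI X_tcons_lin2 X_act_lin1 X_act_lin2 lin_comp[OF H_mult_lin2 \<eta>] lin_id cl)
      have "act ?Z b1 (st n (sm a g) (\<lambda>h. \<eta> (b2 \<otimes>\<^bsub>H\<^esub> h))) =
          sw ?Z (\<lambda>g1 g2. act ?Z b1 (tcons A n a (act (X n) g1 (\<eta> (b2 \<otimes>\<^bsub>H\<^esub> g2))))) g"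
        using a g b12
        by (simp add: st_sm[OF e1] sw_hom[OF X_vs X_vs bilin_lin2[OF TP_act_bilin[OF A_lmod]] g st_inner[OF e1]])
      also have "\<dots> = sw ?Z (\<lambda>g1 g2. sw ?Z (\<lambda>x y. ?e x y g1 g2) b1) g"
        by (rule sw_cong[OF X_vs g sw_param2[OF H_vs H_vs X_vs b12(1) e1' e2']])
          (simp_all add: TP_act_tcons[OF A_lmod] a b12 cl)
      also have "\<dots> = sw ?Z (\<lambda>x y. sw ?Z (\<lambda>g1 g2. ?e x y g1 g2) g) b1"
        by (rule sw_swap[OF X_vs g b12(1) e1' e2'])
      also have "\<dots> = sw ?Z (\<lambda>x y. ?F x y b2) b1"
      proof (rule sw_cong[OF X_vs b12(1) trilin_bilin(3)[OF F b12(2)]])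
        fix x y assume xy: "x \<in> carrier H" "y \<in> carrier H"
        show "sw ?Z (\<lambda>g1 g2. ?e x y g1 g2) g = ?F x y b2"
          by (rule sw_cong[OF X_vs g f]) (simp_all add: xy b12 left_module.act_mult[OF TP_lmod[OF A_lmod]] cl)
      qed
      finally show "sw ?Z (\<lambda>x y. ?F x y b2) b1 = act ?Z b1 (st n (sm a g) (\<lambda>h. \<eta> (b2 \<otimes>\<^bsub>H\<^esub> h)))" ..
    qed
    finally show "st n (Lm b (sm a g)) \<eta> = sw ?Z (\<lambda>b1 b2. act ?Z b1 (st n (sm a g) (\<lambda>h. \<eta> (b2 \<otimes>\<^bsub>H\<^esub> h)))) b" .
  qed
qed

text \<open>Since the coproduct of \<open>h\<close> times \<open>b\<close> is the product of
  coproducts, one component of \<open>b\<close> acts on the coefficient before \<open>h\<close>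
  does, and the other multiplies the argument of \<eta>. This change of \<eta> has the same form as
  the right side of \<open>st_Lm\<close>, which is what makes balancing work.\<close>

lemma st_Rm:
  assumes \<eta>: "lin H (X n) \<eta>" and c: "c \<in> carrier C" and b: "b \<in> carrier H"
  shows "st n (Rm c b) \<eta> = st n c (\<lambda>h. sw (X n) (\<lambda>b1 b2. act (X n) b1 (\<eta> (h \<otimes>\<^bsub>H\<^esub> b2))) b)"
proof -
  let ?Z = "X (Suc n)" and ?\<zeta> = "\<lambda>h. sw (X n) (\<lambda>b1 b2. act (X n) b1 (\<eta> (h \<otimes>\<^bsub>H\<^esub> b2))) b"
  note cl = lin_closed[OF \<eta>] X_act_closed H_closed
  have i: "bilin H H (X n) (\<lambda>b1 b2. act (X n) b1 (\<eta> (h \<otimes>\<^bsub>H\<^esub> b2)))" if "h \<in> carrier H" for h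
    using that by (intro bilinI X_act_lin1 X_act_lin2 lin_comp[OF H_mult_lin2 \<eta>] lin_id cl)
  have \<zeta>: "lin H (X n) ?\<zeta>"
    using b by (intro sw_param[OF H_vs X_vs] i X_act_lin2 lin_comp[OF H_mult_lin1 \<eta>] lin_id)
  show ?thesis
  proof (rule C_hom_ext[OF X_vs lin_comp[OF Rm_lin1[OF b lin_id] st_lin[OF \<eta>]] st_lin[OF \<zeta>] _ c])
    fix a h assume a: "a \<in> carrier A" and h: "h \<in> carrier H"
    have t: "lin (X n) ?Z (\<lambda>t. tcons A n a (act (X n) h1 t))" if "h1 \<in> carrier H" for h1
      using that a by (intro X_tcons_lin2 X_act_lin2 lin_id)
    have "st n (Rm (sm a h) b) \<eta> =
        sw ?Z (\<lambda>h1 h2. sw ?Z (\<lambda>b1 b2. tcons A n a (act (X n) (h1 \<otimes>\<^bsub>H\<^esub> b1) (\<eta> (h2 \<otimes>\<^bsub>H\<^esub> b2)))) b) h"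
      using a h b by (simp add: Rm_sm st_sm[OF \<eta>] sw_mult[OF X_vs h b st_inner[OF \<eta> a]])
    also have "\<dots> = sw ?Z (\<lambda>h1 h2. tcons A n a (act (X n) h1 (?\<zeta> h2))) h"
    proof (rule sw_cong[OF X_vs h st_inner[OF \<zeta> a]])
      fix h1 h2 assume h12: "h1 \<in> carrier H" "h2 \<in> carrier H"
      show "sw ?Z (\<lambda>b1 b2. tcons A n a (act (X n) (h1 \<otimes>\<^bsub>H\<^esub> b1) (\<eta> (h2 \<otimes>\<^bsub>H\<^esub> b2)))) b =
          tcons A n a (act (X n) h1 (?\<zeta> h2))"
        unfolding sw_hom[OF X_vs X_vs t[OF h12(1)] b i[OF h12(2)]]
        by (rule sw_cong[OF X_vs b bilin_lin_comp[OF i t]])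
          (simp_all add: h12 left_module.act_mult[OF TP_lmod[OF A_lmod]] cl)
    qed
    also have "\<dots> = st n (sm a h) ?\<zeta>"
      by (rule st_sm[OF \<zeta> a h, symmetric])
    finally show "st n (Rm (sm a h) b) \<eta> = st n (sm a h) ?\<zeta>" .
  qed
qed

end

context ground_field
begin

lemma mlin_update:
  assumes V: "vsp V" and f: "mlin V n Z f" and g: "lin V V g" and i: "i < n"
  shows "mlin V n Z (\<lambda>xs. f (xs[i := g (xs ! i)]))"
proof (rule mlinI)
  fix xs assume xs: "xs \<in> tuples V n"
  then have u: "xs[i := g (xs ! i)] \<in> tuples V n"
    by (simp add: lin_closed[OF g] i)
  then show "f (xs[i := g (xs ! i)]) \<in> carrier Z"
    by (rule mlin_closed[OF f])
  fix j assume j: "j < n"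
  show "lin V Z (\<lambda>x. f (xs[j := x, i := g (xs[j := x] ! i)]))"
  proof (cases "j = i")
    case True
    then show ?thesis
      using lin_comp[OF g mlin_lin[OF f xs i]] i tuples_length[OF xs] by simp
  next
    case False
    then have "xs[j := x, i := g (xs[j := x] ! i)] = xs[i := g (xs ! i), j := x]" for x
      by (simp add: list_update_swap)
    then show ?thesis
      using mlin_lin[OF f u j] by simp
  qed
qed

end

context smash_ground
begin

section \<open>Tensor powers of the smash product over the Hopf algebra\<close>

definition bal :: "nat \<Rightarrow> (('a \<times> 'h \<Rightarrow> 'k) set list \<Rightarrow> 'z) \<Rightarrow> bool" where
  "bal n f \<longleftrightarrow> (\<forall>xs\<in>tuples C n. \<forall>i. \<forall>h\<in>carrier H. Suc i < n \<longrightarrow>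
    f (xs[i := Rm (xs ! i) h]) = f (xs[Suc i := Lm h (xs ! Suc i)]))"

text \<open>The pairs behind \<open>balance_rels\<close>, indexed by elements of \<open>H\<close>
  instead of its copy in \<open>C\<close>, so that balancing is expressed by \<open>Rm\<close> and
  \<open>Lm\<close>.\<close>

definition bal_pairs :: "nat \<Rightarrow> (('a \<times> 'h \<Rightarrow> 'k) set list \<times> ('a \<times> 'h \<Rightarrow> 'k) set list) set" where
  "bal_pairs n = {(xs[i := Rm (xs ! i) h], xs[Suc i := Lm h (xs ! Suc i)]) | xs i h.
    xs \<in> tuples C n \<and> Suc i < n \<and> h \<in> carrier H}"

abbreviation Y where "Y n \<equiv> tpow_over K C (smash_copy K H A) n"

definition yg :: "nat \<Rightarrow> ('a \<times> 'h \<Rightarrow> 'k) set list \<Rightarrow> (('a \<times> 'h \<Rightarrow> 'k) set list \<Rightarrow> 'k) set" where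
  "yg n = pgen K (tuples C n) (mrels C n (bal_pairs n))"

lemma bal_pairs_subset: "bal_pairs n \<subseteq> tuples C n \<times> tuples C n"
  by (auto simp: bal_pairs_def)

lemma balD: "bal n f \<Longrightarrow> xs \<in> tuples C n \<Longrightarrow> Suc i < n \<Longrightarrow> h \<in> carrier H \<Longrightarrow>
    f (xs[i := Rm (xs ! i) h]) = f (xs[Suc i := Lm h (xs ! Suc i)])"
  by (simp add: bal_def)

lemma balI: "(\<And>xs i h. xs \<in> tuples C n \<Longrightarrow> Suc i < n \<Longrightarrow> h \<in> carrier H \<Longrightarrow>
    f (xs[i := Rm (xs ! i) h]) = f (xs[Suc i := Lm h (xs ! Suc i)])) \<Longrightarrow> bal n f"
  by (simp add: bal_def)

lemma bal_pairsD: "bal n f \<Longrightarrow> (a, b) \<in> bal_pairs n \<Longrightarrow> f a = f b"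
  by (auto simp: bal_pairs_def balD)

lemma balance_rels_eq: "balance_rels K C (smash_copy K H A) n = diff_rels (tuples C n) (bal_pairs n)"
  unfolding balance_rels_def diff_rels_def bal_pairs_def Let_def smash_copy_def Rm_def Lm_def by blast

lemma mrels_eq: "multilinear_rels K C n \<union> balance_rels K C (smash_copy K H A) n = mrels C n (bal_pairs n)"
  by (simp add: mrels_def balance_rels_eq)

lemma Y_same: "same_space (Y n) (presented K (tuples C n) (mrels C n (bal_pairs n)))"
  by (simp add: tpow_over_def Let_def mrels_eq)

lemma Y_same': "same_space (presented K (tuples C n) (mrels C n (bal_pairs n))) (Y n)"
  using Y_same[of n] by (simp add: same_space_def)

lemma Y_carrier: "carrier (Y n) = carrier (presented K (tuples C n) (mrels C n (bal_pairs n)))"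
  using Y_same[of n] by (simp add: same_space_def)

lemma Y_vs: "vsp (Y n)"
  by (rule same_space_vsp[OF Y_same MT_vs[OF C_vs bal_pairs_subset]])

lemma yg_closed: "xs \<in> tuples C n \<Longrightarrow> yg n xs \<in> carrier (Y n)"
  unfolding Y_carrier yg_def by (rule mgen_closed[OF C_vs bal_pairs_subset])

lemma yg_mlin: "mlin C n (Y n) (yg n)"
  using mgen_mlin[OF C_vs bal_pairs_subset, of n] unfolding yg_def mlin_def Y_carrier
  by (simp add: same_space_lin2[OF Y_same])

lemma yg_bal: "bal n (yg n)"
proof (rule balI)
  fix xs i h assume "xs \<in> tuples C n" "Suc i < n" "h \<in> carrier H"
  then have "(xs[i := Rm (xs ! i) h], xs[Suc i := Lm h (xs ! Suc i)]) \<in> bal_pairs n"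
    unfolding bal_pairs_def by blast
  then show "yg n (xs[i := Rm (xs ! i) h]) = yg n (xs[Suc i := Lm h (xs ! Suc i)])"
    unfolding yg_def by (rule mgen_diff[OF C_vs bal_pairs_subset])
qed

lemma Y_hom_ext:
  assumes "vsp Z" "lin (Y n) Z f" "lin (Y n) Z g"
    "\<And>xs. xs \<in> tuples C n \<Longrightarrow> f (yg n xs) = g (yg n xs)" "t \<in> carrier (Y n)"
  shows "f t = g t"
  by (rule MT_hom_ext[OF C_vs bal_pairs_subset assms(1) same_space_lin1[OF Y_same' assms(2)]
        same_space_lin1[OF Y_same' assms(3)] assms(4)[unfolded yg_def] assms(5)[unfolded Y_carrier]])

lemma Y_induct:
  assumes "subm U (Y n)" "\<And>xs. xs \<in> tuples C n \<Longrightarrow> yg n xs \<in> U"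
  shows "carrier (Y n) \<subseteq> U"
proof -
  have "subm U (presented K (tuples C n) (mrels C n (bal_pairs n)))"
    using submD[OF assms(1)] Y_same'[of n] MT_vs[OF C_vs bal_pairs_subset]
    by (intro submI) (simp_all add: same_space_def)
  then show ?thesis
    unfolding Y_carrier by (rule MT_induct[OF C_vs bal_pairs_subset]) (rule assms(2)[unfolded yg_def])
qed

lemma Y_lift_lin:
  assumes "vsp Z" "mlin C n Z f" "bal n f"
  shows "lin (Y n) Z (lift K Z f)"
  by (rule same_space_lin1[OF Y_same MT_lift_lin[OF C_vs bal_pairs_subset assms(1,2) bal_pairsD[OF assms(3)]]])

lemma Y_lift_gen:
  assumes "vsp Z" "mlin C n Z f" "bal n f" "xs \<in> tuples C n"
  shows "lift K Z f (yg n xs) = f xs"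
  unfolding yg_def
  by (rule MT_lift_gen[OF C_vs bal_pairs_subset assms(1,2) bal_pairsD[OF assms(3)] assms(4)])

lemma Y_lift_param:
  assumes "vsp U" "vsp Z" "\<And>u. u \<in> carrier U \<Longrightarrow> mlin C n Z (f u)"
    "\<And>u. u \<in> carrier U \<Longrightarrow> bal n (f u)"
    "\<And>xs. xs \<in> tuples C n \<Longrightarrow> lin U Z (\<lambda>u. f u xs)" "t \<in> carrier (Y n)"
  shows "lin U Z (\<lambda>u. lift K Z (f u) t)"
  by (rule MT_lift_param[OF C_vs bal_pairs_subset assms(1-3) bal_pairsD[OF assms(4)] assms(5)
        assms(6)[unfolded Y_carrier]])

section \<open>The two actions of the Hopf algebra on the tensor powers\<close>

definition yl :: "nat \<Rightarrow> 'h \<Rightarrow> (('a \<times> 'h \<Rightarrow> 'k) set list \<Rightarrow> 'k) set \<Rightarrow> (('a \<times> 'h \<Rightarrow> 'k) set list \<Rightarrow> 'k) set" where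
  "yl n h y = act (Y n) (Inl (sm \<one>\<^bsub>A\<^esub> h)) y"

definition yr :: "nat \<Rightarrow> (('a \<times> 'h \<Rightarrow> 'k) set list \<Rightarrow> 'k) set \<Rightarrow> 'h \<Rightarrow> (('a \<times> 'h \<Rightarrow> 'k) set list \<Rightarrow> 'k) set" where
  "yr n y h = act (Y n) (Inr (sm \<one>\<^bsub>A\<^esub> h)) y"

lemma yl_eq: "yl n h y = lift K (Y n) (\<lambda>xs. yg n (xs[0 := Lm h (xs ! 0)])) y"
  unfolding yl_def same_space_lift[OF Y_same]
  by (simp add: tpow_over_def Let_def yg_def mrels_eq Lm_def)

lemma yr_eq: "yr n y h = lift K (Y n) (\<lambda>xs. yg n (xs[n - 1 := Rm (xs ! (n - 1)) h])) y"
  unfolding yr_def same_space_lift[OF Y_same]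
  by (simp add: tpow_over_def Let_def yg_def mrels_eq Rm_def)

text \<open>The action touches position 0 and the relation touches \<open>i\<close> and
  \<open>Suc i\<close>. They meet only at \<open>i = 0\<close>, where \<open>Lm_Rm\<close> applies;
  otherwise the updates are at distinct positions.\<close>

lemma yl_bal:
  assumes "0 < n" "h \<in> carrier H"
  shows "bal n (\<lambda>xs. yg n (xs[0 := Lm h (xs ! 0)]))"
proof (rule balI)
  fix xs i k assume xs: "xs \<in> tuples C n" and i: "Suc i < n" and k: "k \<in> carrier H"
  let ?xs = "xs[0 := Lm h (xs ! 0)]"
  have t: "?xs \<in> tuples C n"
    using assms xs by simp
  have n: "length xs = n"
    by (rule tuples_length[OF xs])
  have "(xs[i := Rm (xs ! i) k])[0 := Lm h (xs[i := Rm (xs ! i) k] ! 0)] = ?xs[i := Rm (?xs ! i) k]"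
    using assms xs n i k Lm_Rm[of "xs ! 0" h k] by (cases i) (simp_all add: list_update_swap)
  moreover have "(xs[Suc i := Lm k (xs ! Suc i)])[0 := Lm h (xs[Suc i := Lm k (xs ! Suc i)] ! 0)] =
      ?xs[Suc i := Lm k (?xs ! Suc i)]"
    by (simp add: list_update_swap)
  ultimately show "yg n ((xs[i := Rm (xs ! i) k])[0 := Lm h (xs[i := Rm (xs ! i) k] ! 0)]) =
      yg n ((xs[Suc i := Lm k (xs ! Suc i)])[0 := Lm h (xs[Suc i := Lm k (xs ! Suc i)] ! 0)])"
    using balD[OF yg_bal t i k] by simp
qed

text \<open>Mirror image of \<open>yl_bal\<close>: the action and the relation meet only where
  \<open>Suc i\<close> is the last position.\<close>

lemma yr_bal:
  assumes "0 < n" "h \<in> carrier H"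
  shows "bal n (\<lambda>xs. yg n (xs[n - 1 := Rm (xs ! (n - 1)) h]))"
proof (rule balI)
  fix xs i k assume xs: "xs \<in> tuples C n" and i: "Suc i < n" and k: "k \<in> carrier H"
  let ?xs = "xs[n - 1 := Rm (xs ! (n - 1)) h]"
  have t: "?xs \<in> tuples C n"
    using assms xs by simp
  have n: "length xs = n"
    by (rule tuples_length[OF xs])
  have "(xs[i := Rm (xs ! i) k])[n - 1 := Rm (xs[i := Rm (xs ! i) k] ! (n - 1)) h] = ?xs[i := Rm (?xs ! i) k]"
    using i by (simp add: list_update_swap)
  moreover have "(xs[Suc i := Lm k (xs ! Suc i)])[n - 1 := Rm (xs[Suc i := Lm k (xs ! Suc i)] ! (n - 1)) h] =
      ?xs[Suc i := Lm k (?xs ! Suc i)]"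
    using assms xs n i k Lm_Rm[of "xs ! (n - 1)" k h]
    by (cases "Suc i = n - 1") (simp_all add: list_update_swap)
  ultimately show "yg n ((xs[i := Rm (xs ! i) k])[n - 1 := Rm (xs[i := Rm (xs ! i) k] ! (n - 1)) h]) =
      yg n ((xs[Suc i := Lm k (xs ! Suc i)])[n - 1 := Rm (xs[Suc i := Lm k (xs ! Suc i)] ! (n - 1)) h])"
    using balD[OF yg_bal t i k] by simp
qed

lemma yl_mlin: "0 < n \<Longrightarrow> h \<in> carrier H \<Longrightarrow> mlin C n (Y n) (\<lambda>xs. yg n (xs[0 := Lm h (xs ! 0)]))"
  by (intro mlin_update[OF C_vs yg_mlin] Lm_lin2 lin_id)

lemma yr_mlin: "0 < n \<Longrightarrow> h \<in> carrier H \<Longrightarrow> mlin C n (Y n) (\<lambda>xs. yg n (xs[n - 1 := Rm (xs ! (n - 1)) h]))"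
  by (intro mlin_update[OF C_vs yg_mlin] Rm_lin1 lin_id) auto

context
  fixes n :: nat
  assumes n: "0 < n"
begin

lemma yl_gen: "h \<in> carrier H \<Longrightarrow> xs \<in> tuples C n \<Longrightarrow> yl n h (yg n xs) = yg n (xs[0 := Lm h (xs ! 0)])"
  unfolding yl_eq by (rule Y_lift_gen[OF Y_vs yl_mlin[OF n] yl_bal[OF n]])

lemma yr_gen: "h \<in> carrier H \<Longrightarrow> xs \<in> tuples C n \<Longrightarrow> yr n (yg n xs) h = yg n (xs[n - 1 := Rm (xs ! (n - 1)) h])"
  unfolding yr_eq by (rule Y_lift_gen[OF Y_vs yr_mlin[OF n] yr_bal[OF n]])

lemma yl_bilin: "bilin H (Y n) (Y n) (yl n)"
proof (rule bilinI)
  fix h assume h: "h \<in> carrier H"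
  show "lin (Y n) (Y n) (\<lambda>y. yl n h y)"
    unfolding yl_eq by (rule Y_lift_lin[OF Y_vs yl_mlin[OF n h] yl_bal[OF n h]])
next
  fix y assume y: "y \<in> carrier (Y n)"
  show "lin H (Y n) (\<lambda>h. yl n h y)"
    unfolding yl_eq
  proof (rule Y_lift_param[OF H_vs Y_vs yl_mlin[OF n] yl_bal[OF n] _ y])
    fix xs assume xs: "xs \<in> tuples C n"
    show "lin H (Y n) (\<lambda>h. yg n (xs[0 := Lm h (xs ! 0)]))"
      by (rule lin_comp[OF Lm_lin1[OF tuples_nth[OF xs n] lin_id] mlin_lin[OF yg_mlin xs n]])
  qed
qed

lemma yr_bilin: "bilin (Y n) H (Y n) (yr n)"
proof (rule bilinI)
  fix h assume h: "h \<in> carrier H"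
  show "lin (Y n) (Y n) (\<lambda>y. yr n y h)"
    unfolding yr_eq by (rule Y_lift_lin[OF Y_vs yr_mlin[OF n h] yr_bal[OF n h]])
next
  fix y assume y: "y \<in> carrier (Y n)"
  have n': "n - 1 < n"
    using n by simp
  show "lin H (Y n) (\<lambda>h. yr n y h)"
    unfolding yr_eq
  proof (rule Y_lift_param[OF H_vs Y_vs yr_mlin[OF n] yr_bal[OF n] _ y])
    fix xs assume xs: "xs \<in> tuples C n"
    show "lin H (Y n) (\<lambda>h. yg n (xs[n - 1 := Rm (xs ! (n - 1)) h]))"
      by (rule lin_comp[OF Rm_lin2[OF tuples_nth[OF xs n'] lin_id] mlin_lin[OF yg_mlin xs n']])
  qed
qed

lemmas yl_lin2 = bilin_comp2[OF yl_bilin]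
lemmas yr_lin1 = bilin_comp1[OF yr_bilin]
lemmas yr_lin2 = bilin_comp2[OF yr_bilin]
lemmas yr_closed = bilin_closed[OF yr_bilin]

lemma yr_yr:
  assumes "y \<in> carrier (Y n)" "h \<in> carrier H" "g \<in> carrier H"
  shows "yr n (yr n y h) g = yr n y (h \<otimes>\<^bsub>H\<^esub> g)"
  by (rule Y_hom_ext[OF Y_vs yr_lin1[OF _ yr_lin1[OF _ lin_id]] yr_lin1[OF _ lin_id] _ assms(1)])
    (use n in \<open>simp_all add: assms yr_gen Rm_Rm tuples_length\<close>)

lemma yl_yr:
  assumes "y \<in> carrier (Y n)" "h \<in> carrier H" "g \<in> carrier H"
  shows "yl n h (yr n y g) = yr n (yl n h y) g"
proof (rule Y_hom_ext[OF Y_vs yl_lin2[OF _ yr_lin1[OF _ lin_id]] yr_lin1[OF _ yl_lin2[OF _ lin_id]] _ assms(1)])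
  fix xs assume xs: "xs \<in> tuples C n"
  have "(xs[n - 1 := Rm (xs ! (n - 1)) g])[0 := Lm h ((xs[n - 1 := Rm (xs ! (n - 1)) g]) ! 0)] =
      (xs[0 := Lm h (xs ! 0)])[n - 1 := Rm ((xs[0 := Lm h (xs ! 0)]) ! (n - 1)) g]"
    using n xs assms(2,3) tuples_length[OF xs] Lm_Rm[of "xs ! 0" h g]
    by (cases n; cases "n - 1") (simp_all add: list_update_swap)
  then show "yl n h (yr n (yg n xs) g) = yr n (yl n h (yg n xs)) g"
    using n xs assms(2,3) by (simp add: yl_gen yr_gen)
qed (use assms in simp_all)

end

section \<open>Prepending a factor to a balanced tensor\<close>

definition yc :: "nat \<Rightarrow> ('a \<times> 'h \<Rightarrow> 'k) set \<Rightarrow> (('a \<times> 'h \<Rightarrow> 'k) set list \<Rightarrow> 'k) set \<Rightarrow>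
    (('a \<times> 'h \<Rightarrow> 'k) set list \<Rightarrow> 'k) set" where
  "yc n c y = lift K (Y (Suc n)) (\<lambda>cs. yg (Suc n) (c # cs)) y"

lemma yc_bal: "c \<in> carrier C \<Longrightarrow> bal n (\<lambda>cs. yg (Suc n) (c # cs))"
  by (rule balI) (use balD[OF yg_bal, of "c # xs" "Suc n" "Suc i" for xs i] in simp)

lemma yc_gen: "c \<in> carrier C \<Longrightarrow> cs \<in> tuples C n \<Longrightarrow> yc n c (yg n cs) = yg (Suc n) (c # cs)"
  unfolding yc_def by (rule Y_lift_gen[OF Y_vs mlin_Cons_mlin[OF yg_mlin] yc_bal])

lemma yc_bilin: "bilin C (Y n) (Y (Suc n)) (yc n)"
  unfolding yc_def[abs_def]
  by (intro bilinI Y_lift_lin[OF Y_vs] Y_lift_param[OF C_vs Y_vs] mlin_Cons_mlin[OF yg_mlin] yc_bal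
      mlin_Cons_lin[OF yg_mlin _ C_vs])
    (simp_all add: yc_bal mlin_Cons_mlin[OF yg_mlin])

lemmas yc_lin1 = bilin_comp1[OF yc_bilin]
lemmas yc_lin2 = bilin_comp2[OF yc_bilin]

lemma yl_yc:
  assumes "h \<in> carrier H" "c \<in> carrier C" "y \<in> carrier (Y n)"
  shows "yl (Suc n) h (yc n c y) = yc n (Lm h c) y"
  by (rule Y_hom_ext[OF Y_vs yl_lin2[OF _ _ yc_lin2[OF _ lin_id]] yc_lin2[OF _ lin_id] _ assms(3)])
    (simp_all add: assms yc_gen yl_gen)

lemma yr_yc:
  assumes "0 < n" "h \<in> carrier H" "c \<in> carrier C" "y \<in> carrier (Y n)"
  shows "yr (Suc n) (yc n c y) h = yc n c (yr n y h)"
  by (rule Y_hom_ext[OF Y_vs yr_lin1[OF _ _ yc_lin2[OF _ lin_id]] yc_lin2[OF _ yr_lin1[OF _ _ lin_id]] _ assms(4)])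
    (use assms(1) in \<open>simp_all add: assms(2-) yc_gen yr_gen nth_Cons list_update.simps split: nat.splits\<close>)

lemma yc_balance:
  assumes "0 < n" "h \<in> carrier H" "c \<in> carrier C" "y \<in> carrier (Y n)"
  shows "yc n (Rm c h) y = yc n c (yl n h y)"
proof (rule Y_hom_ext[OF Y_vs yc_lin2[OF _ lin_id] yc_lin2[OF _ yl_lin2[OF _ _ lin_id]] _ assms(4)])
  fix xs assume xs: "xs \<in> tuples C n"
  show "yc n (Rm c h) (yg n xs) = yc n c (yl n h (yg n xs))"
    using balD[OF yg_bal, of "c # xs" "Suc n" 0 h] xs assms by (simp add: yc_gen yl_gen)
qed (use assms in simp_all)

section \<open>Coefficients with respect to a functional on the Hopf algebra\<close>

text \<open>
  Instead of an isomorphism onto \<open>X \<otimes> H\<close> we only construct its compositions with \<open>id \<otimes> \<xi>\<close> for the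
  linear functionals \<open>\<xi>\<close> on \<open>H\<close>.  Their values at the generators obey a recursion over lists.
\<close>

primrec pl :: "('a \<times> 'h \<Rightarrow> 'k) set list \<Rightarrow> ('h \<Rightarrow> 'k) \<Rightarrow> ('a list \<Rightarrow> 'k) set" where
  "pl [] \<xi> = \<xi> \<one>\<^bsub>H\<^esub> \<odot>\<^bsub>X 0\<^esub> tpow_gen K A []"
| "pl (c # cs) \<xi> = st (length cs) c (\<lambda>h. pl cs (\<lambda>k. \<xi> (h \<otimes>\<^bsub>H\<^esub> k)))"

abbreviation functional :: "('h \<Rightarrow> 'k) \<Rightarrow> bool" where
  "functional \<xi> \<equiv> lin H (ground K) \<xi>"

lemma functional_shift: "functional \<xi> \<Longrightarrow> h \<in> carrier H \<Longrightarrow> functional (\<lambda>k. \<xi> (h \<otimes>\<^bsub>H\<^esub> k))"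
  by (intro lin_comp[OF H_mult_lin2] lin_id)

lemma functional_shift_bilin: "functional \<xi> \<Longrightarrow> bilin H H (ground K) (\<lambda>h k. \<xi> (h \<otimes>\<^bsub>H\<^esub> k))"
  by (intro bilinI lin_comp[OF H_mult_lin2] lin_comp[OF H_mult_lin1] lin_id)

lemma bilin_shift:
  assumes "bilin H H (ground K) \<xi>" "h \<in> carrier H"
  shows "bilin H H (ground K) (\<lambda>u k. \<xi> u (h \<otimes>\<^bsub>H\<^esub> k))"
  using assms(2)
  by (intro bilinI bilin_comp2[OF assms(1)] bilin_comp1[OF assms(1)] H_mult_lin2 lin_id H_closed)

text \<open>The recursion uses \<open>st\<close>, which demands a family linear in \<open>h\<close>;
  that family is the coefficient of the tail for the shifted functionals. Hence multilinearity and
  linear dependence on a family of functionals go through one induction.\<close>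

lemma pl_lin:
  "(\<forall>\<xi>. functional \<xi> \<longrightarrow> mlin C n (X n) (\<lambda>cs. pl cs \<xi>)) \<and>
   (\<forall>cs\<in>tuples C n. \<forall>\<xi>. bilin H H (ground K) \<xi> \<longrightarrow> lin H (X n) (\<lambda>u. pl cs (\<xi> u)))"
proof (induction n)
  case 0
  have n: "tpow_gen K A [] \<in> carrier (X 0)"
    by (rule TP_gen_closed[OF A_lmod]) simp
  show ?case
  proof (intro conjI allI impI ballI)
    fix \<xi> assume "functional \<xi>"
    from lin_closed[OF this] show "mlin C 0 (X 0) (\<lambda>cs. pl cs \<xi>)"
      by (intro mlin_0) (simp add: n X_vs)
  next
    fix cs \<xi> assume cs: "cs \<in> tuples C 0" and \<xi>: "bilin H H (ground K) \<xi>"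
    from cs have "cs = []" by simp
    then show "lin H (X 0) (\<lambda>u. pl cs (\<xi> u))"
      by (simp add: smult_lin1[OF X_vs bilin_lin1[OF \<xi>]] n)
  qed
next
  case (Suc n)
  then have m: "\<And>\<xi>. functional \<xi> \<Longrightarrow> mlin C n (X n) (\<lambda>cs. pl cs \<xi>)"
    and l: "\<And>cs \<xi>. cs \<in> tuples C n \<Longrightarrow> bilin H H (ground K) \<xi> \<Longrightarrow> lin H (X n) (\<lambda>u. pl cs (\<xi> u))"
    by blast+
  have e: "lin H (X n) (\<lambda>h. pl cs (\<lambda>k. \<xi> (h \<otimes>\<^bsub>H\<^esub> k)))" if "cs \<in> tuples C n" "functional \<xi>" for cs \<xi>
    by (rule l[OF that(1) functional_shift_bilin[OF that(2)]])
  show ?case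
  proof (intro conjI allI impI ballI)
    fix \<xi> assume \<xi>: "functional \<xi>"
    show "mlin C (Suc n) (X (Suc n)) (\<lambda>cs. pl cs \<xi>)"
    proof (rule mlin_ConsI)
      fix cs assume cs: "cs \<in> tuples C n"
      show "lin C (X (Suc n)) (\<lambda>c. pl (c # cs) \<xi>)"
        using st_lin[OF e[OF cs \<xi>]] by (simp add: tuples_length[OF cs])
    next
      fix c assume c: "c \<in> carrier C"
      show "mlin C n (X (Suc n)) (\<lambda>cs. pl (c # cs) \<xi>)"
      proof (rule mlinI)
        fix cs assume cs: "cs \<in> tuples C n"
        show "pl (c # cs) \<xi> \<in> carrier (X (Suc n))"
          using lin_closed[OF st_lin[OF e[OF cs \<xi>]] c] by (simp add: tuples_length[OF cs])
        fix i assume i: "i < n"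
        have "lin C (X (Suc n)) (\<lambda>x. st n c (\<lambda>h. pl (cs[i := x]) (\<lambda>k. \<xi> (h \<otimes>\<^bsub>H\<^esub> k))))"
          by (rule st_param[OF C_vs _ c], rule bilinI)
            (simp_all add: e[OF _ \<xi>] cs mlin_lin[OF m[OF functional_shift[OF \<xi>]] cs i])
        then show "lin C (X (Suc n)) (\<lambda>x. pl (c # cs[i := x]) \<xi>)"
          by (simp add: tuples_length[OF cs])
      qed
    qed
  next
    fix cs \<xi> assume "cs \<in> tuples C (Suc n)" and \<xi>: "bilin H H (ground K) \<xi>"
    then obtain y ys where y: "cs = y # ys" "y \<in> carrier C" "ys \<in> tuples C n"
      by (elim tuples_SucE)
    have "lin H (X (Suc n)) (\<lambda>u. st n y (\<lambda>h. pl ys (\<lambda>k. \<xi> u (h \<otimes>\<^bsub>H\<^esub> k))))"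
      by (rule st_param[OF H_vs _ y(2)], rule bilinI)
        (simp_all add: e[OF y(3) bilin_lin2[OF \<xi>]] l[OF y(3) bilin_shift[OF \<xi>]])
    then show "lin H (X (Suc n)) (\<lambda>u. pl cs (\<xi> u))"
      by (simp add: y(1) tuples_length[OF y(3)])
  qed
qed

lemma pl_mlin: "functional \<xi> \<Longrightarrow> mlin C n (X n) (\<lambda>cs. pl cs \<xi>)"
  using pl_lin[of n] by blast

lemma pl_param: "cs \<in> tuples C n \<Longrightarrow> bilin H H (ground K) \<xi> \<Longrightarrow> lin H (X n) (\<lambda>u. pl cs (\<xi> u))"
  using pl_lin[of n] by blast

lemmas pl_shift_lin = pl_param[OF _ functional_shift_bilin]

text \<open>Only the values of \<xi> on the carrier matter. Later this serves to reassociate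
  products inside the argument of \<xi>.\<close>

lemma pl_cong:
  assumes "cs \<in> tuples C n" "functional \<xi>" "\<And>h. h \<in> carrier H \<Longrightarrow> \<xi> h = \<xi>' h"
  shows "pl cs \<xi> = pl cs \<xi>'"
  using assms
proof (induction cs arbitrary: n \<xi> \<xi>')
  case (Cons c cs)
  then obtain m where m: "n = Suc m" "c \<in> carrier C" "cs \<in> tuples C m"
    by (cases n) auto
  show ?case
    using st_cong[OF pl_shift_lin[OF m(3) Cons.prems(2)] _ m(2)]
      Cons.IH[OF m(3) functional_shift[OF Cons.prems(2)]] Cons.prems(3) m
    by (simp add: tuples_length)
qed (simp add: assms)

text \<open>This is \<open>st_Lm\<close> for the family of shifted functionals; the remaining
  difference is the bracketing of a triple product in \<open>H\<close>.\<close>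

lemma pl_Lm:
  assumes "c \<in> carrier C" "cs \<in> tuples C n" "h \<in> carrier H" "functional \<xi>"
  shows "pl (Lm h c # cs) \<xi> =
    sw (X (Suc n)) (\<lambda>b1 b2. act (X (Suc n)) b1 (pl (c # cs) (\<lambda>k. \<xi> (b2 \<otimes>\<^bsub>H\<^esub> k)))) h"
proof -
  have b: "bilin H H (X (Suc n)) (\<lambda>b1 b2. act (X (Suc n)) b1 (pl (c # cs) (\<lambda>k. \<xi> (b2 \<otimes>\<^bsub>H\<^esub> k))))"
    using pl_shift_lin[of "c # cs" "Suc n" \<xi>] assms
    by (intro bilinI X_act_lin1 X_act_lin2 lin_id mlin_closed[OF pl_mlin] functional_shift) auto
  have e: "st n c (\<lambda>h. pl cs (\<lambda>k. \<xi> (b \<otimes>\<^bsub>H\<^esub> (h \<otimes>\<^bsub>H\<^esub> k)))) =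
      st n c (\<lambda>h. pl cs (\<lambda>k. \<xi> (b \<otimes>\<^bsub>H\<^esub> h \<otimes>\<^bsub>H\<^esub> k)))" if b: "b \<in> carrier H" for b
  proof (rule st_cong[OF pl_shift_lin[OF assms(2) functional_shift[OF assms(4) b]] _ assms(1)])
    fix h assume h: "h \<in> carrier H"
    show "pl cs (\<lambda>k. \<xi> (b \<otimes>\<^bsub>H\<^esub> (h \<otimes>\<^bsub>H\<^esub> k))) = pl cs (\<lambda>k. \<xi> (b \<otimes>\<^bsub>H\<^esub> h \<otimes>\<^bsub>H\<^esub> k))"
      by (rule pl_cong[OF assms(2) functional_shift[OF functional_shift[OF assms(4) b] h]])
        (simp add: H_assoc b h)
  qed
  have "pl (Lm h c # cs) \<xi> = sw (X (Suc n)) (\<lambda>b1 b2. act (X (Suc n)) b1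
      (st n c (\<lambda>h. pl cs (\<lambda>k. \<xi> (b2 \<otimes>\<^bsub>H\<^esub> h \<otimes>\<^bsub>H\<^esub> k))))) h"
    using st_Lm[OF pl_shift_lin[OF assms(2,4)] assms(1,3)] by (simp add: tuples_length[OF assms(2)])
  also have "\<dots> = sw (X (Suc n)) (\<lambda>b1 b2. act (X (Suc n)) b1 (pl (c # cs) (\<lambda>k. \<xi> (b2 \<otimes>\<^bsub>H\<^esub> k)))) h"
    by (rule sw_cong[OF X_vs assms(3) b]) (simp add: tuples_length[OF assms(2)] e)
  finally show ?thesis .
qed

text \<open>A relation away from the first factor is the induction hypothesis under
  \<open>st\<close>. At the first two factors, \<open>st_Rm\<close> and \<open>pl_Lm\<close> produce
  the same Sweedler sum from the two ways of placing \<open>h\<close>, up to associativity in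
  \<open>H\<close>.\<close>

lemma pl_bal: "functional \<xi> \<Longrightarrow> bal n (\<lambda>cs. pl cs \<xi>)"
proof (induction n arbitrary: \<xi>)
  case (Suc n)
  show ?case
  proof (rule balI)
    fix xs i h assume "xs \<in> tuples C (Suc n)" and i: "Suc i < Suc n" and h: "h \<in> carrier H"
    then obtain c cs where c: "xs = c # cs" "c \<in> carrier C" "cs \<in> tuples C n"
      by (elim tuples_SucE)
    have len: "length cs = n"
      by (rule tuples_length[OF c(3)])
    show "pl (xs[i := Rm (xs ! i) h]) \<xi> = pl (xs[Suc i := Lm h (xs ! Suc i)]) \<xi>"
    proof (cases i)
      case (Suc j)
      with i have j: "Suc j < n" by simp
      have cs: "cs[j := Rm (cs ! j) h] \<in> tuples C n"
        using c j h by simp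
      have "st n c (\<lambda>k. pl (cs[j := Rm (cs ! j) h]) (\<lambda>l. \<xi> (k \<otimes>\<^bsub>H\<^esub> l))) =
          st n c (\<lambda>k. pl (cs[Suc j := Lm h (cs ! Suc j)]) (\<lambda>l. \<xi> (k \<otimes>\<^bsub>H\<^esub> l)))"
        by (rule st_cong[OF pl_shift_lin[OF cs Suc.prems] _ c(2)])
          (rule balD[OF Suc.IH[OF functional_shift[OF Suc.prems]] c(3) j h])
      then show ?thesis
        using Suc len c(1) by simp
    next
      case 0
      with i obtain m where m: "n = Suc m"
        by (cases n) auto
      then obtain d ds where d: "cs = d # ds" "d \<in> carrier C" "ds \<in> tuples C m"
        using c(3) tuples_SucE by blast
      have l: "lin H (X n) (\<lambda>k. pl cs (\<lambda>l. \<xi> (k \<otimes>\<^bsub>H\<^esub> l)))"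
        by (rule pl_shift_lin[OF c(3) Suc.prems])
      have l': "lin H (X n) (\<lambda>k. pl (Lm h d # ds) (\<lambda>l. \<xi> (k \<otimes>\<^bsub>H\<^esub> l)))"
        using d h m by (intro pl_shift_lin[OF _ Suc.prems]) simp
      \<comment> \<open>The element \<open>h\<close> is absorbed by the first factor here; the goal
        is to recognize the result as \<open>h\<close> acting on the second factor.\<close>
      have "pl (Rm c h # cs) \<xi> =
          st n c (\<lambda>k. sw (X n) (\<lambda>b1 b2. act (X n) b1 (pl cs (\<lambda>l. \<xi> (k \<otimes>\<^bsub>H\<^esub> b2 \<otimes>\<^bsub>H\<^esub> l)))) h)"
        using st_Rm[OF l c(2) h] len by simp
      also have "\<dots> = st n c (\<lambda>k. pl (Lm h d # ds) (\<lambda>l. \<xi> (k \<otimes>\<^bsub>H\<^esub> l)))"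
      proof (rule st_cong[OF l' _ c(2), symmetric])
        fix k assume k: "k \<in> carrier H"
        note f = functional_shift[OF Suc.prems k]
        have b: "bilin H H (X n) (\<lambda>b1 b2. act (X n) b1 (pl cs (\<lambda>l. \<xi> (k \<otimes>\<^bsub>H\<^esub> (b2 \<otimes>\<^bsub>H\<^esub> l)))))"
          using pl_shift_lin[OF c(3) f] mlin_closed[OF pl_mlin[OF functional_shift[OF f]] c(3)]
          by (intro bilinI X_act_lin1 X_act_lin2 lin_id) auto
        have "pl (Lm h d # ds) (\<lambda>l. \<xi> (k \<otimes>\<^bsub>H\<^esub> l)) =
            sw (X n) (\<lambda>b1 b2. act (X n) b1 (pl cs (\<lambda>l. \<xi> (k \<otimes>\<^bsub>H\<^esub> (b2 \<otimes>\<^bsub>H\<^esub> l))))) h"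
          using pl_Lm[OF d(2,3) h f] by (simp only: m d(1))
        also have "\<dots> = sw (X n) (\<lambda>b1 b2. act (X n) b1 (pl cs (\<lambda>l. \<xi> (k \<otimes>\<^bsub>H\<^esub> b2 \<otimes>\<^bsub>H\<^esub> l)))) h"
        proof (rule sw_cong'[OF X_vs h b])
          fix b1 b2 assume b12: "b1 \<in> carrier H" "b2 \<in> carrier H"
          have "pl cs (\<lambda>l. \<xi> (k \<otimes>\<^bsub>H\<^esub> (b2 \<otimes>\<^bsub>H\<^esub> l))) = pl cs (\<lambda>l. \<xi> (k \<otimes>\<^bsub>H\<^esub> b2 \<otimes>\<^bsub>H\<^esub> l))"
            by (rule pl_cong[OF c(3) functional_shift[OF f b12(2)]]) (simp add: H_assoc k b12)
          then show "act (X n) b1 (pl cs (\<lambda>l. \<xi> (k \<otimes>\<^bsub>H\<^esub> (b2 \<otimes>\<^bsub>H\<^esub> l)))) =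
              act (X n) b1 (pl cs (\<lambda>l. \<xi> (k \<otimes>\<^bsub>H\<^esub> b2 \<otimes>\<^bsub>H\<^esub> l)))"
            by simp
        qed
        finally show "pl (Lm h d # ds) (\<lambda>l. \<xi> (k \<otimes>\<^bsub>H\<^esub> l)) =
            sw (X n) (\<lambda>b1 b2. act (X n) b1 (pl cs (\<lambda>l. \<xi> (k \<otimes>\<^bsub>H\<^esub> b2 \<otimes>\<^bsub>H\<^esub> l)))) h" .
      qed
      also have "\<dots> = pl (c # Lm h d # ds) \<xi>"
        using len d(1) by simp
      finally show ?thesis
        using 0 c(1) d(1) by simp
    qed
  qed
qed (simp add: bal_def)

definition pc :: "nat \<Rightarrow> ('h \<Rightarrow> 'k) \<Rightarrow> (('a \<times> 'h \<Rightarrow> 'k) set list \<Rightarrow> 'k) set \<Rightarrow> ('a list \<Rightarrow> 'k) set" where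
  "pc n \<xi> = lift K (X n) (\<lambda>cs. pl cs \<xi>)"

lemma pc_lin: "functional \<xi> \<Longrightarrow> lin (Y n) (X n) (pc n \<xi>)"
  unfolding pc_def by (rule Y_lift_lin[OF X_vs pl_mlin pl_bal])

lemma pc_gen: "functional \<xi> \<Longrightarrow> cs \<in> tuples C n \<Longrightarrow> pc n \<xi> (yg n cs) = pl cs \<xi>"
  unfolding pc_def by (rule Y_lift_gen[OF X_vs pl_mlin pl_bal])

lemma pc_param:
  assumes "bilin H H (ground K) \<xi>" "y \<in> carrier (Y n)"
  shows "lin H (X n) (\<lambda>u. pc n (\<xi> u) y)"
  unfolding pc_def
  by (rule Y_lift_param[OF H_vs X_vs pl_mlin pl_bal pl_param[OF _ assms(1)] assms(2)])
    (simp_all add: bilin_lin2[OF assms(1)])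

text \<open>The recursive equation of \<open>pl\<close>, extended by linearity from generators to an
  arbitrary balanced tensor \<open>y\<close>.\<close>

lemma pc_yc:
  assumes "functional \<xi>" "c \<in> carrier C" "y \<in> carrier (Y n)"
  shows "pc (Suc n) \<xi> (yc n c y) = st n c (\<lambda>h. pc n (\<lambda>k. \<xi> (h \<otimes>\<^bsub>H\<^esub> k)) y)"
proof (rule Y_hom_ext[OF X_vs lin_comp[OF yc_lin2[OF assms(2) lin_id] pc_lin[OF assms(1)]] _ _ assms(3)])
  show "lin (Y n) (X (Suc n)) (\<lambda>y. st n c (\<lambda>h. pc n (\<lambda>k. \<xi> (h \<otimes>\<^bsub>H\<^esub> k)) y))"
    by (rule st_param[OF Y_vs _ assms(2)], rule bilinI)
      (simp_all add: pc_param[OF functional_shift_bilin[OF assms(1)]] pc_lin[OF functional_shift[OF assms(1)]])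
  fix cs assume cs: "cs \<in> tuples C n"
  have "st n c (\<lambda>h. pl cs (\<lambda>k. \<xi> (h \<otimes>\<^bsub>H\<^esub> k))) = st n c (\<lambda>h. pc n (\<lambda>k. \<xi> (h \<otimes>\<^bsub>H\<^esub> k)) (yg n cs))"
    by (rule st_cong[OF pl_shift_lin[OF cs assms(1)] _ assms(2)])
      (simp add: pc_gen[OF functional_shift[OF assms(1)] cs])
  then show "pc (Suc n) \<xi> (yc n c (yg n cs)) = st n c (\<lambda>h. pc n (\<lambda>k. \<xi> (h \<otimes>\<^bsub>H\<^esub> k)) (yg n cs))"
    using assms cs by (simp add: yc_gen pc_gen tuples_length)
qed

section \<open>The map from the tensor powers of \<open>A\<close> into those of
  \<open>C\<close>\<close>

definition jm :: "nat \<Rightarrow> ('a list \<Rightarrow> 'k) set \<Rightarrow> (('a \<times> 'h \<Rightarrow> 'k) set list \<Rightarrow> 'k) set" where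
  "jm n = lift K (Y n) (\<lambda>as. yg n (map (\<lambda>a. sm a \<one>\<^bsub>H\<^esub>) as))"

lemma map_sm_tuples: "as \<in> tuples A n \<Longrightarrow> map (\<lambda>a. sm a \<one>\<^bsub>H\<^esub>) as \<in> tuples C n"
  by (auto simp: tuples_def)

lemma jm_mlin: "mlin A n (Y n) (\<lambda>as. yg n (map (\<lambda>a. sm a \<one>\<^bsub>H\<^esub>) as))"
  by (rule mlinI)
    (simp_all add: map_update yg_closed map_sm_tuples
      lin_comp[OF sm_lin1[OF H_closed(1) lin_id] mlin_lin[OF yg_mlin map_sm_tuples]])

lemma jm_lin: "lin (X n) (Y n) (jm n)"
  unfolding jm_def by (rule same_space_lin1[OF TP_same tpow_lift_lin[OF A_vs Y_vs jm_mlin]])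

lemma jm_gen: "as \<in> tuples A n \<Longrightarrow> jm n (tpow_gen K A as) = yg n (map (\<lambda>a. sm a \<one>\<^bsub>H\<^esub>) as)"
  unfolding jm_def by (rule tpow_lift_gen[OF A_vs Y_vs jm_mlin])

lemmas jm_closed = lin_closed[OF jm_lin]

lemma jm_tcons:
  assumes "a \<in> carrier A" "x \<in> carrier (X n)"
  shows "jm (Suc n) (tcons A n a x) = yc n (sm a \<one>\<^bsub>H\<^esub>) (jm n x)"
  by (rule TP_hom_ext[OF A_lmod Y_vs lin_comp[OF X_tcons_lin2[OF assms(1) lin_id] jm_lin]
        lin_comp[OF jm_lin yc_lin2[OF _ lin_id]] _ assms(2)])
    (simp_all add: assms jm_gen tcons_gen[OF A_vs] yc_gen map_sm_tuples)

lemma X1_hom_ext: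
  assumes "vsp Z" "lin (X 1) Z f" "lin (X 1) Z g"
    "\<And>a. a \<in> carrier A \<Longrightarrow> f (tpow_gen K A [a]) = g (tpow_gen K A [a])" "x \<in> carrier (X 1)"
  shows "f x = g x"
proof (rule TP_hom_ext[OF A_lmod assms(1-3) _ assms(5)])
  fix xs assume "xs \<in> tuples A 1"
  then obtain a where "xs = [a]" "a \<in> carrier A"
    unfolding One_nat_def by (elim tuples_SucE) simp
  then show "f (tpow_gen K A xs) = g (tpow_gen K A xs)"
    using assms(4) by simp
qed

lemma X1_gen_closed: "a \<in> carrier A \<Longrightarrow> tpow_gen K A [a] \<in> carrier (X 1)"
  by (rule TP_gen_closed[OF A_lmod]) simp

lemma gen_singleton: "a \<in> carrier A \<Longrightarrow> tpow_gen K A [a] = tcons A 0 a (tpow_gen K A [])"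
  by (simp add: tcons_gen[OF A_vs])

text \<open>The diagonal action also applies a component of \<open>h\<close> to the empty tensor,
  through the counit; the counit axiom leaves the original action on \<open>a\<close>.\<close>

lemma X1_act_gen:
  assumes "h \<in> carrier H" "a \<in> carrier A"
  shows "act (X 1) h (tpow_gen K A [a]) = tpow_gen K A [act A h a]"
proof -
  let ?n = "tpow_gen K A []"
  have n: "?n \<in> carrier (X 0)"
    by (rule TP_gen_closed[OF A_lmod]) simp
  have l: "lin H (X 1) (\<lambda>h. tcons A 0 (act A h a) ?n)"
    unfolding One_nat_def by (intro X_tcons_lin1 A_act_lin1 lin_id assms n)
  have "act (X 1) h (tpow_gen K A [a]) = sw (X 1) (\<lambda>b1 b2. tcons A 0 (act A b1 a) (act (X 0) b2 ?n)) h"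
    unfolding gen_singleton[OF assms(2)] One_nat_def by (rule TP_act_tcons[OF A_lmod assms n])
  also have "\<dots> = sw (X 1) (\<lambda>b1 b2. counit H b2 \<odot>\<^bsub>X 1\<^esub> tcons A 0 (act A b1 a) ?n) h"
    by (rule sw_cong[OF X_vs assms(1) counit_smult_bilin(2)[OF X_vs l]])
      (simp add: TP_act_nil[OF A_lmod] lin_smult[OF bilin_lin2[OF TP_tcons[OF A_lmod]]] n assms A_act_closed)
  also have "\<dots> = tcons A 0 (act A h a) ?n"
    by (rule sw_counit_right[OF X_vs assms(1) l])
  finally show ?thesis
    by (simp add: gen_singleton assms A_act_closed)
qed

end

section \<open>Spaces with operators and direct summands\<close>

context ground_field
begin

lemma op_homI:
  "lin M N f \<Longrightarrow> (\<And>i x. i \<in> I \<Longrightarrow> x \<in> carrier M \<Longrightarrow> f (act M i x) = act N i (f x)) \<Longrightarrow> f \<in> op_hom K I M N"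
  by (simp add: op_hom_def)

lemma op_hom_lin: "f \<in> op_hom K I M N \<Longrightarrow> lin M N f"
  by (simp add: op_hom_def)

lemma op_hom_act: "f \<in> op_hom K I M N \<Longrightarrow> i \<in> I \<Longrightarrow> x \<in> carrier M \<Longrightarrow> f (act M i x) = act N i (f x)"
  by (simp add: op_hom_def)

lemma op_hom_closed: "f \<in> op_hom K I M N \<Longrightarrow> x \<in> carrier M \<Longrightarrow> f x \<in> carrier N"
  by (rule lin_closed[OF op_hom_lin])

lemma op_hom_comp:
  assumes "f \<in> op_hom K I M N" "g \<in> op_hom K I N L"
  shows "(\<lambda>x. g (f x)) \<in> op_hom K I M L"
  by (rule op_homI[OF lin_comp[OF op_hom_lin[OF assms(1)] op_hom_lin[OF assms(2)]]])
    (simp add: op_hom_act[OF assms(1)] op_hom_act[OF assms(2)] op_hom_closed[OF assms(1)])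

lemma op_hom_id: "(\<lambda>x. x) \<in> op_hom K I M M"
  by (rule op_homI) (auto intro: lin_id)

text \<open>Each operator is linear and no relations between operators are imposed, so one notion
  covers modules, bimodules, and their restrictions to fewer operators.\<close>

definition opm :: "'i set \<Rightarrow> ('k, 'v, 'i) opmod \<Rightarrow> bool" where
  "opm I M \<longleftrightarrow> vsp M \<and> (\<forall>i\<in>I. lin M M (act M i))"

lemma opm_vs: "opm I M \<Longrightarrow> vsp M"
  by (simp add: opm_def)

lemma opm_act: "opm I M \<Longrightarrow> i \<in> I \<Longrightarrow> lin M M (act M i)"
  by (simp add: opm_def)

lemma op_hom_zero: "opm I N \<Longrightarrow> (\<lambda>x. \<zero>\<^bsub>N\<^esub>) \<in> op_hom K I M N"
  by (intro op_homI lin_const_zero) (simp_all add: opm_vs lin_zero[OF opm_vs opm_vs opm_act])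

lemma op_hom_add:
  assumes "opm I N" "f \<in> op_hom K I M N" "g \<in> op_hom K I M N"
  shows "(\<lambda>x. f x \<oplus>\<^bsub>N\<^esub> g x) \<in> op_hom K I M N"
  by (rule op_homI[OF lin_add_fun[OF opm_vs[OF assms(1)] op_hom_lin[OF assms(2)] op_hom_lin[OF assms(3)]]])
    (simp add: op_hom_act[OF assms(2)] op_hom_act[OF assms(3)] lin_add[OF opm_act[OF assms(1)]]
      op_hom_closed[OF assms(2)] op_hom_closed[OF assms(3)])

text \<open>
  \<open>fac I M N L h\<close> says that \<open>h\<close> is a finite sum of composites \<open>M \<rightarrow> N \<rightarrow> L\<close> of homomorphisms.  The module
  \<open>M\<close> is a summand of some \<open>copies q N\<close> if and only if its identity is such a sum, a
  formulation preserved by every additive functor.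
\<close>

inductive fac ::
    "'i set \<Rightarrow> ('k, 'm, 'i) opmod \<Rightarrow> ('k, 'n, 'i) opmod \<Rightarrow> ('k, 'l, 'i) opmod \<Rightarrow> ('m \<Rightarrow> 'l) \<Rightarrow> bool"
  for I M N L where
  fac_zero: "(\<And>x. x \<in> carrier M \<Longrightarrow> h x = \<zero>\<^bsub>L\<^esub>) \<Longrightarrow> fac I M N L h"
| fac_step: "f \<in> op_hom K I M N \<Longrightarrow> g \<in> op_hom K I N L \<Longrightarrow> fac I M N L h \<Longrightarrow>
    (\<And>x. x \<in> carrier M \<Longrightarrow> h' x = g (f x) \<oplus>\<^bsub>L\<^esub> h x) \<Longrightarrow> fac I M N L h'"

lemma fac_closed:
  assumes "fac I M N L h" "vsp L" "x \<in> carrier M"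
  shows "h x \<in> carrier L"
  using assms(1)
proof induction
  case (fac_step f g h h')
  then show ?case
    using assms(2,3) by (simp add: op_hom_closed[OF fac_step.hyps(1)] op_hom_closed[OF fac_step.hyps(2)])
qed (use assms in simp)

lemma fac_cong:
  assumes "fac I M N L h" "\<And>x. x \<in> carrier M \<Longrightarrow> h' x = h x"
  shows "fac I M N L h'"
  using assms
proof (cases rule: fac.cases)
  case fac_zero
  then show ?thesis
    using assms(2) by (intro fac.fac_zero) simp
next
  case (fac_step f g k)
  show ?thesis
    by (rule fac.fac_step[OF fac_step(1-3)]) (simp add: assms(2) fac_step(4))
qed

lemma fac_single:
  assumes "vsp L" "f \<in> op_hom K I M N" "g \<in> op_hom K I N L" "\<And>x. x \<in> carrier M \<Longrightarrow> h x = g (f x)"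
  shows "fac I M N L h"
  by (rule fac_step[OF assms(2,3) fac_zero[of M "\<lambda>_. \<zero>\<^bsub>L\<^esub>" L]])
    (simp_all add: assms(1,4) op_hom_closed[OF assms(3)] op_hom_closed[OF assms(2)])

lemma fac_add:
  assumes "fac I M N L h" "fac I M N L k" "vsp L"
  shows "fac I M N L (\<lambda>x. h x \<oplus>\<^bsub>L\<^esub> k x)"
  using assms(1)
proof induction
  case (fac_zero h)
  show ?case
    by (rule fac_cong[OF assms(2)]) (simp add: fac_zero assms(3) fac_closed[OF assms(2,3)])
next
  case (fac_step f g h h')
  show ?case
    by (rule fac.fac_step[OF fac_step.hyps(1,2) fac_step.IH])
      (simp add: fac_step.hyps(4) vs_assoc[OF assms(3)] fac_closed[OF fac_step.hyps(3) assms(3)]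
        fac_closed[OF assms(2,3)] op_hom_closed[OF fac_step.hyps(1)] op_hom_closed[OF fac_step.hyps(2)])
qed

lemma fac_comp_left:
  assumes "fac I M N L h" "k \<in> op_hom K I L L'" "vsp L" "vsp L'"
  shows "fac I M N L' (\<lambda>x. k (h x))"
  using assms(1)
proof induction
  case (fac_zero h)
  show ?case
    by (rule fac.fac_zero) (simp add: fac_zero lin_zero[OF assms(3,4) op_hom_lin[OF assms(2)]])
next
  case (fac_step f g h h')
  show ?case
    by (rule fac.fac_step[OF fac_step.hyps(1) op_hom_comp[OF fac_step.hyps(2) assms(2)] fac_step.IH])
      (simp add: fac_step.hyps(4) lin_add[OF op_hom_lin[OF assms(2)]] fac_closed[OF fac_step.hyps(3) assms(3)]
        op_hom_closed[OF fac_step.hyps(1)] op_hom_closed[OF fac_step.hyps(2)])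
qed

lemma fac_comp_right:
  assumes "fac I M N L h" "k \<in> op_hom K I M' M"
  shows "fac I M' N L (\<lambda>x. h (k x))"
  using assms(1)
proof induction
  case (fac_zero h)
  show ?case
    by (rule fac.fac_zero) (simp add: fac_zero op_hom_closed[OF assms(2)])
next
  case (fac_step f g h h')
  show ?case
    by (rule fac.fac_step[OF op_hom_comp[OF assms(2) fac_step.hyps(1)] fac_step.hyps(2) fac_step.IH])
      (simp add: fac_step.hyps(4) op_hom_closed[OF assms(2)])
qed

definition divides :: "'i set \<Rightarrow> ('k, 'm, 'i) opmod \<Rightarrow> ('k, 'n, 'i) opmod \<Rightarrow> bool" where
  "divides I M N \<longleftrightarrow> fac I M N M (\<lambda>x. x)"

text \<open>The identity of \<open>N\<close> is a sum of maps through \<open>N'\<close>; inserting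
  it between \<open>f\<close> and \<open>g\<close> turns each summand into such a sum.\<close>

lemma fac_trans:
  assumes "fac I M N L h" "divides I N N'" "vsp L" "vsp N"
  shows "fac I M N' L h"
  using assms(1)
proof induction
  case (fac_step f g h h')
  have "fac I M N' L (\<lambda>x. g (f x))"
    using fac_comp_left[OF fac_comp_right[OF assms(2)[unfolded divides_def] fac_step.hyps(1)]
        fac_step.hyps(2) assms(4,3)] .
  then show ?case
    by (rule fac_cong[OF fac_add[OF _ fac_step.IH assms(3)]]) (rule fac_step.hyps(4))
qed (rule fac.fac_zero)

lemma divides_trans:
  "divides I M N \<Longrightarrow> divides I N L \<Longrightarrow> vsp M \<Longrightarrow> vsp N \<Longrightarrow> divides I M L"
  unfolding divides_def[of I M] by (rule fac_trans)

lemma divides_retract: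
  "vsp M \<Longrightarrow> f \<in> op_hom K I M N \<Longrightarrow> g \<in> op_hom K I N M \<Longrightarrow>
    (\<And>x. x \<in> carrier M \<Longrightarrow> g (f x) = x) \<Longrightarrow> divides I M N"
  unfolding divides_def by (rule fac_single, assumption+, rule sym, simp)

lemma divides_refl: "vsp M \<Longrightarrow> divides I M M"
  by (rule divides_retract[OF _ op_hom_id op_hom_id]) simp_all

section \<open>Direct sums\<close>

context
  fixes I :: "'i set" and J :: "'j set" and M :: "'j \<Rightarrow> ('k, 'v, 'i) opmod"
  assumes M: "\<And>j. j \<in> J \<Longrightarrow> opm I (M j)"
begin

lemma dsum_sel:
  "carrier (dsum J M) = (\<Pi>\<^sub>E j\<in>J. carrier (M j))"
  "zero (dsum J M) = (\<lambda>j\<in>J. \<zero>\<^bsub>M j\<^esub>)"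
  "add (dsum J M) = (\<lambda>x y. \<lambda>j\<in>J. x j \<oplus>\<^bsub>M j\<^esub> y j)"
  "smult (dsum J M) = (\<lambda>c x. \<lambda>j\<in>J. c \<odot>\<^bsub>M j\<^esub> x j)"
  "act (dsum J M) = (\<lambda>i x. \<lambda>j\<in>J. act (M j) i (x j))"
  by (simp_all add: dsum_def)

lemma dsum_component: "x \<in> carrier (dsum J M) \<Longrightarrow> j \<in> J \<Longrightarrow> x j \<in> carrier (M j)"
  by (auto simp: dsum_sel)

lemma dsum_eqI:
  "x \<in> carrier (dsum J M) \<Longrightarrow> y \<in> carrier (dsum J M) \<Longrightarrow> (\<And>j. j \<in> J \<Longrightarrow> x j = y j) \<Longrightarrow> x = y"
  unfolding dsum_sel by (rule PiE_ext)

lemma dsum_vs: "vsp (dsum J M)"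
proof (rule vsI, rule module_criteria, goal_cases)
  case 4
  show ?case
  proof
    fix x assume x: "x \<in> carrier (dsum J M)"
    have c: "\<ominus>\<^bsub>M j\<^esub> x j \<in> carrier (M j)" "x j \<oplus>\<^bsub>M j\<^esub> \<ominus>\<^bsub>M j\<^esub> x j = \<zero>\<^bsub>M j\<^esub>" if "j \<in> J" for j
      using dsum_component[OF x that] opm_vs[OF M[OF that]]
      by (simp_all add: abelian_group.a_inv_closed[OF vs_abelian_group]
          abelian_group.r_neg[OF vs_abelian_group])
    show "\<exists>y\<in>carrier (dsum J M). x \<oplus>\<^bsub>dsum J M\<^esub> y = \<zero>\<^bsub>dsum J M\<^esub>"
      by (rule bexI[of _ "\<lambda>j\<in>J. \<ominus>\<^bsub>M j\<^esub> x j"]) (auto simp: dsum_sel c)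
  qed
next
  case 8
  show ?case
  proof
    fix x assume x: "x \<in> carrier (dsum J M)"
    show "x \<oplus>\<^bsub>dsum J M\<^esub> \<zero>\<^bsub>dsum J M\<^esub> = x"
      by (rule dsum_eqI) (use x in \<open>auto simp: dsum_sel opm_vs[OF M] PiE_mem[OF x[unfolded dsum_sel]]\<close>)
  qed
next
  case 10
  show ?case
  proof
    fix x assume x: "x \<in> carrier (dsum J M)"
    show "\<one>\<^bsub>K\<^esub> \<odot>\<^bsub>dsum J M\<^esub> x = x"
      by (rule dsum_eqI) (use x in \<open>auto simp: dsum_sel opm_vs[OF M] PiE_mem[OF x[unfolded dsum_sel]]\<close>)
  qed
qed (auto simp: is_cring dsum_sel opm_vs[OF M] vs_assoc[OF opm_vs[OF M]]
    vs_lcomm[OF opm_vs[OF M]] vs_mult_smult[OF opm_vs[OF M]]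
    vs_add_smult[OF opm_vs[OF M]] vs_smult_add[OF opm_vs[OF M]] PiE_iff vs_comm[OF opm_vs[OF M]]
    intro!: restrict_ext)

lemma dsum_opm: "opm I (dsum J M)"
  unfolding opm_def
proof (intro conjI ballI dsum_vs linI)
  fix i x assume i: "i \<in> I" and x: "x \<in> carrier (dsum J M)"
  note a = opm_act[OF M i]
  show "act (dsum J M) i x \<in> carrier (dsum J M)"
    using x by (auto simp: dsum_sel lin_closed[OF a] PiE_iff)
  show "act (dsum J M) i (x \<oplus>\<^bsub>dsum J M\<^esub> y) = act (dsum J M) i x \<oplus>\<^bsub>dsum J M\<^esub> act (dsum J M) i y"
    if "y \<in> carrier (dsum J M)" for y
    using x that by (auto simp: dsum_sel lin_add[OF a] PiE_iff intro!: restrict_ext)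
  show "act (dsum J M) i (c \<odot>\<^bsub>dsum J M\<^esub> x) = c \<odot>\<^bsub>dsum J M\<^esub> act (dsum J M) i x" if "c \<in> carrier K" for c
    using x that by (auto simp: dsum_sel lin_smult[OF a] PiE_iff intro!: restrict_ext)
qed

lemma dsum_proj: "j \<in> J \<Longrightarrow> (\<lambda>x. x j) \<in> op_hom K I (dsum J M) (M j)"
  by (intro op_homI linI) (auto simp: dsum_sel)

definition dsum_inj :: "'j \<Rightarrow> 'v \<Rightarrow> 'j \<Rightarrow> 'v" where
  "dsum_inj j y = (\<lambda>i\<in>J. if i = j then y else \<zero>\<^bsub>M i\<^esub>)"

lemma dsum_inj_hom: "j \<in> J \<Longrightarrow> dsum_inj j \<in> op_hom K I (M j) (dsum J M)"
  by (intro op_homI linI)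
    (auto simp: dsum_sel dsum_inj_def opm_vs[OF M] lin_zero[OF opm_vs[OF M] opm_vs[OF M] opm_act[OF M]]
      intro!: restrict_ext)

lemma divides_dsum: "j \<in> J \<Longrightarrow> divides I (M j) (dsum J M)"
  by (rule divides_retract[OF opm_vs[OF M] dsum_inj_hom dsum_proj]) (simp_all add: dsum_inj_def)

text \<open>The identity of a finite direct sum is the sum of the maps that project to one component
  and include it again, and each of these passes through \<open>N\<close> by assumption.\<close>

lemma dsum_divides:
  assumes J: "finite J" and N: "\<And>j. j \<in> J \<Longrightarrow> divides I (M j) N"
  shows "divides I (dsum J M) N"
proof -
  \<comment> \<open>The induction is on the set \<open>J'\<close> of components already reached: the
    map is the identity there and zero elsewhere.\<close>
  have "fac I (dsum J M) N (dsum J M) (\<lambda>x. \<lambda>j\<in>J. if j \<in> J' then x j else \<zero>\<^bsub>M j\<^esub>)" if "J' \<subseteq> J" for J'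
    using finite_subset[OF that J] that
  proof (induction J' rule: finite_induct)
    case empty
    show ?case by (rule fac_zero) (simp add: dsum_sel restrict_def)
  next
    case (insert j J')
    have j: "j \<in> J" using insert by simp
    have s: "fac I (dsum J M) N (dsum J M) (\<lambda>x. dsum_inj j (x j))"
      by (rule fac_comp_left[OF fac_comp_right[OF N[OF j, unfolded divides_def] dsum_proj[OF j]]
            dsum_inj_hom[OF j] opm_vs[OF M[OF j]] dsum_vs])
    have J': "J' \<subseteq> J" using insert by simp
    show ?case
      by (rule fac_cong[OF fac_add[OF s insert.IH[OF J'] dsum_vs]]) (use insert.hyps(2) in
          \<open>auto simp: dsum_sel dsum_inj_def opm_vs[OF M] PiE_iff intro!: restrict_ext\<close>)
  qed
  from this[OF subset_refl] show ?thesis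
    unfolding divides_def
    by (rule fac_cong) (auto simp: dsum_sel PiE_iff extensional_def fun_eq_iff)
qed

end

section \<open>Divisibility and direct summands of copies\<close>

lemma copies_opm: "opm I N \<Longrightarrow> opm I (copies q N)"
  unfolding copies_def by (rule dsum_opm)

lemma copies_divides: "opm I N \<Longrightarrow> divides I (copies q N) N"
  unfolding copies_def by (rule dsum_divides) (auto intro: divides_refl opm_vs)

text \<open>Each summand of \<open>h\<close> gets its own coordinate: its first map fills the new
  coordinate and its second map reads it, while the earlier summands use the earlier
  coordinates.\<close>

lemma fac_through_copies:
  assumes "fac I M N L h" "opm I N" "opm I L"
  shows "\<exists>q>0. \<exists>F G. F \<in> op_hom K I M (copies q N) \<and> G \<in> op_hom K I (copies q N) L \<and>
    (\<forall>x\<in>carrier M. h x = G (F x))"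
  using assms(1)
proof induction
  case (fac_zero h)
  have "(\<lambda>x. \<zero>\<^bsub>copies 1 N\<^esub>) \<in> op_hom K I M (copies 1 N)"
    by (rule op_hom_zero[OF copies_opm[OF assms(2)]])
  moreover have "(\<lambda>x. \<zero>\<^bsub>L\<^esub>) \<in> op_hom K I (copies 1 N) L"
    by (rule op_hom_zero[OF assms(3)])
  ultimately show ?case
    using fac_zero by (intro exI[of _ 1]) auto
next
  case (fac_step f g h h')
  then obtain q F G where F: "F \<in> op_hom K I M (copies q N)" and G: "G \<in> op_hom K I (copies q N) L"
    and h: "\<And>x. x \<in> carrier M \<Longrightarrow> h x = G (F x)"
    by blast
  note f = fac_step.hyps(1) and g = fac_step.hyps(2)
  let ?F = "\<lambda>x. \<lambda>i\<in>{..<Suc q}. if i = q then f x else F x i"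
  let ?G = "\<lambda>d. g (d q) \<oplus>\<^bsub>L\<^esub> G (restrict d {..<q})"
  have r: "(\<lambda>d. restrict d {..<q}) \<in> op_hom K I (copies (Suc q) N) (copies q N)"
    by (intro op_homI linI) (auto simp: copies_def dsum_def PiE_iff intro!: restrict_ext)
  have p: "(\<lambda>d. d q) \<in> op_hom K I (copies (Suc q) N) N"
    unfolding copies_def by (rule dsum_proj) (use assms(2) in simp_all)
  have Fc: "F x \<in> (\<Pi>\<^sub>E i\<in>{..<q}. carrier N)" if "x \<in> carrier M" for x
    using op_hom_closed[OF F that] by (simp add: copies_def dsum_def)
  have "?F \<in> op_hom K I M (copies (Suc q) N)"
  proof (intro op_homI linI)
    fix x assume x: "x \<in> carrier M"
    show "?F x \<in> carrier (copies (Suc q) N)"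
      using Fc[OF x] op_hom_closed[OF f x] by (auto simp: copies_def dsum_def PiE_iff less_Suc_eq)
    show "?F (x \<oplus>\<^bsub>M\<^esub> y) = ?F x \<oplus>\<^bsub>copies (Suc q) N\<^esub> ?F y" if y: "y \<in> carrier M" for y
      using lin_add[OF op_hom_lin[OF F] x y] lin_add[OF op_hom_lin[OF f] x y]
      by (auto simp: copies_def dsum_def less_Suc_eq intro!: restrict_ext)
    show "?F (c \<odot>\<^bsub>M\<^esub> x) = c \<odot>\<^bsub>copies (Suc q) N\<^esub> ?F x" if c: "c \<in> carrier K" for c
      using lin_smult[OF op_hom_lin[OF F] c x] lin_smult[OF op_hom_lin[OF f] c x]
      by (auto simp: copies_def dsum_def less_Suc_eq intro!: restrict_ext)
    show "?F (act M i x) = act (copies (Suc q) N) i (?F x)" if i: "i \<in> I" for i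
      using op_hom_act[OF F i x] op_hom_act[OF f i x]
      by (auto simp: copies_def dsum_def less_Suc_eq intro!: restrict_ext)
  qed
  moreover have "?G \<in> op_hom K I (copies (Suc q) N) L"
    by (rule op_hom_add[OF assms(3) op_hom_comp[OF p g] op_hom_comp[OF r G]])
  moreover have "h' x = ?G (?F x)" if x: "x \<in> carrier M" for x
  proof -
    have "restrict (?F x) {..<q} = restrict (F x) {..<q}"
      by (rule restrict_ext) simp
    also have "\<dots> = F x"
      using PiE_restrict[OF Fc[OF x]] .
    finally have "?G (?F x) = g (f x) \<oplus>\<^bsub>L\<^esub> G (F x)"
      by (simp only: restrict_apply lessThan_iff lessI simp_thms if_True)
    then show ?thesis
      by (simp only: fac_step.hyps(4)[OF x] h[OF x])
  qed
  ultimately show ?case by (intro exI[of _ "Suc q"]) blast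
qed

text \<open>The identity of \<open>M\<close> factors as \<open>G\<close> after \<open>F\<close>
  through the copies, and the idempotent \<open>F\<close> after \<open>G\<close> splits them into
  the image of \<open>F\<close> and the kernel of \<open>G\<close>.\<close>

lemma divides_imp_summand:
  assumes "divides I M N" "opm I M" "opm I N"
  shows "\<exists>q>0. iso_to_summand K I M (copies q N)"
proof -
  obtain q F G where q: "q > 0" and F: "F \<in> op_hom K I M (copies q N)" and G: "G \<in> op_hom K I (copies q N) M"
    and GF: "\<And>x. x \<in> carrier M \<Longrightarrow> G (F x) = x"
    using fac_through_copies[OF assms(1)[unfolded divides_def] assms(3,2)] by metis
  define D where "D = copies q N"
  note F = F[folded D_def] and G = G[folded D_def]
  have D: "opm I D"
    unfolding D_def by (rule copies_opm[OF assms(3)])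
  note Dv = opm_vs[OF D] and Mv = opm_vs[OF assms(2)] and Fl = op_hom_lin[OF F] and Gl = op_hom_lin[OF G]
  let ?P = "F ` carrier M" and ?Q = "{d \<in> carrier D. G d = \<zero>\<^bsub>M\<^esub>}"
  have "subm ?P D"
  proof (rule submI[OF Dv])
    show "\<zero>\<^bsub>D\<^esub> \<in> ?P"
      using lin_zero[OF Mv Dv Fl] Mv by (metis imageI vs_closed(1))
    show "x \<oplus>\<^bsub>D\<^esub> y \<in> ?P" if "x \<in> ?P" "y \<in> ?P" for x y
      using that Mv by (auto simp: lin_add[OF Fl, symmetric])
    show "c \<odot>\<^bsub>D\<^esub> x \<in> ?P" if "c \<in> carrier K" "x \<in> ?P" for c x
      using that Mv by (auto simp: lin_smult[OF Fl, symmetric])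
  qed (use lin_closed[OF Fl] in auto)
  then have P: "op_submodule K I ?P D"
    unfolding op_submodule_def
    by (auto simp: op_hom_act[OF F, symmetric] intro!: imageI lin_closed[OF opm_act[OF assms(2)]])
  have Q: "op_submodule K I ?Q D"
    unfolding op_submodule_def
    by (auto simp: op_hom_act[OF G] lin_closed[OF opm_act[OF D]]
        lin_zero[OF Mv Mv opm_act[OF assms(2)]] intro!: subm_kernel[OF Dv Mv Gl])
  have z: "?P \<inter> ?Q = {\<zero>\<^bsub>D\<^esub>}"
  proof
    show "{\<zero>\<^bsub>D\<^esub>} \<subseteq> ?P \<inter> ?Q"
      using submD(2)[OF \<open>subm ?P D\<close>] Dv by (simp add: lin_zero[OF Dv Mv Gl])
    show "?P \<inter> ?Q \<subseteq> {\<zero>\<^bsub>D\<^esub>}"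
    proof clarify
      fix x assume "x \<in> carrier M" "G (F x) = \<zero>\<^bsub>M\<^esub>"
      then have "x = \<zero>\<^bsub>M\<^esub>"
        by (simp add: GF)
      then show "F x = \<zero>\<^bsub>D\<^esub>"
        by (simp add: lin_zero[OF Mv Dv Fl])
    qed
  qed
  have s: "set_add D ?P ?Q = carrier D"
  proof
    show "set_add D ?P ?Q \<subseteq> carrier D"
      using Dv lin_closed[OF Fl] by (auto simp: set_add_def set_mult_def)
    show "carrier D \<subseteq> set_add D ?P ?Q"
    proof
      fix d assume d: "d \<in> carrier D"
      let ?p = "F (G d)"
      have p: "?p \<in> ?P" "?p \<in> carrier D"
        using lin_closed[OF Gl d] lin_closed[OF Fl] by auto
      have q: "d \<ominus>\<^bsub>D\<^esub> ?p \<in> ?Q"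
        using d p Dv Mv lin_closed[OF Gl d] by (simp add: lin_minus[OF Dv Mv Gl] GF)
      have "d = ?p \<oplus>\<^bsub>D\<^esub> (d \<ominus>\<^bsub>D\<^esub> ?p)"
      proof -
        interpret G: abelian_group D by (rule vs_abelian_group[OF Dv])
        show ?thesis
          using d p by (simp add: a_minus_def G.a_lcomm G.r_neg)
      qed
      then show "d \<in> set_add D ?P ?Q"
        unfolding set_add_def set_mult_def
        by (intro UN_I[OF p(1)] UN_I[OF q]) simp
    qed
  qed
  have "F \<in> op_hom K I M (D\<lparr>carrier := ?P\<rparr>)"
    using F by (auto simp: op_hom_def LinearCombinations.module_hom_def)
  moreover have "inj_on F (carrier M)"
    by (rule inj_on_inverseI[of _ G]) (rule GF)
  ultimately have "op_isomorphic K I M (D\<lparr>carrier := ?P\<rparr>)"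
    unfolding op_isomorphic_def by (intro bexI[of _ F]) (auto simp: bij_betw_def)
  with P Q z s have "iso_to_summand K I M D"
    unfolding iso_to_summand_def by blast
  then show ?thesis
    unfolding D_def using q by blast
qed

text \<open>The projection along the complement \<open>Q\<close>, followed by the inverse of \<phi>,
  is a homomorphism that retracts \<open>D\<close> onto \<open>M\<close>.\<close>

lemma summand_imp_divides:
  assumes "iso_to_summand K I M D" "opm I M" "opm I D"
  shows "divides I M D"
proof -
  note Dv = opm_vs[OF assms(3)] and Mv = opm_vs[OF assms(2)]
  obtain P Q \<phi> where P: "op_submodule K I P D" and Q: "op_submodule K I Q D"
    and z: "P \<inter> Q = {\<zero>\<^bsub>D\<^esub>}" and s: "set_add D P Q = carrier D"
    and \<phi>: "\<phi> \<in> op_hom K I M (D\<lparr>carrier := P\<rparr>)" and bij: "bij_betw \<phi> (carrier M) P"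
    using assms(1) unfolding iso_to_summand_def op_isomorphic_def by auto
  have Ps: "subm P D" and Qs: "subm Q D"
    using P Q by (auto simp: op_submodule_def)
  note Pc = subsetD[OF submD(1)[OF Ps]] and Qc = subsetD[OF submD(1)[OF Qs]]
  have \<phi>D: "\<phi> \<in> op_hom K I M D"
    using \<phi> submD(1)[OF Ps] by (auto simp: op_hom_def LinearCombinations.module_hom_def)
  note \<phi>l = op_hom_lin[OF \<phi>D]
  have \<phi>P: "\<phi> x \<in> P" if "x \<in> carrier M" for x
    using bij that by (auto simp: bij_betw_def)
  \<comment> \<open>Two decompositions differ by an element of \<open>P\<close> that also lies in
    \<open>Q\<close>, hence by zero.\<close>
  have uniq: "x = x'" if "x \<in> carrier M" "x' \<in> carrier M" "q \<in> Q" "q' \<in> Q"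
    "\<phi> x \<oplus>\<^bsub>D\<^esub> q = \<phi> x' \<oplus>\<^bsub>D\<^esub> q'" for x x' q q'
  proof -
    interpret G: abelian_group D by (rule vs_abelian_group[OF Dv])
    note c = Pc[OF \<phi>P[OF that(1)]] Pc[OF \<phi>P[OF that(2)]] Qc[OF that(3)] Qc[OF that(4)]
    have "\<phi> x \<ominus>\<^bsub>D\<^esub> \<phi> x' = (\<phi> x \<oplus>\<^bsub>D\<^esub> q) \<oplus>\<^bsub>D\<^esub> (\<ominus>\<^bsub>D\<^esub> q \<oplus>\<^bsub>D\<^esub> \<ominus>\<^bsub>D\<^esub> \<phi> x')"
      using c by (simp add: a_minus_def G.a_assoc G.r_neg2)
    also have "\<dots> = (\<phi> x' \<oplus>\<^bsub>D\<^esub> q') \<oplus>\<^bsub>D\<^esub> (\<ominus>\<^bsub>D\<^esub> \<phi> x' \<oplus>\<^bsub>D\<^esub> \<ominus>\<^bsub>D\<^esub> q)"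
      using c by (simp add: that(5) G.a_comm)
    also have "\<dots> = q' \<ominus>\<^bsub>D\<^esub> q"
      using c G.r_neg2[of "\<phi> x'" "q' \<oplus>\<^bsub>D\<^esub> \<ominus>\<^bsub>D\<^esub> q"]
      by (simp add: a_minus_def G.a_assoc G.a_lcomm[of q'])
    finally have e: "\<phi> x \<ominus>\<^bsub>D\<^esub> \<phi> x' = q' \<ominus>\<^bsub>D\<^esub> q" .
    have "q' \<ominus>\<^bsub>D\<^esub> q \<in> Q"
      unfolding vs_minus[OF Dv c(4,3)] using submD[OF Qs] that by simp
    moreover have "\<phi> x \<ominus>\<^bsub>D\<^esub> \<phi> x' \<in> P"
      unfolding vs_minus[OF Dv c(1,2)] using submD[OF Ps] \<phi>P that by simp
    ultimately have "\<phi> x \<ominus>\<^bsub>D\<^esub> \<phi> x' \<in> P \<inter> Q"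
      by (simp add: e)
    then have "\<phi> x = \<phi> x'"
      by (simp add: z vs_eq_iff_minus[OF Dv c(1,2)])
    then show ?thesis
      using bij that by (auto simp: bij_betw_def inj_on_def)
  qed
  \<comment> \<open>The retraction picks the \<open>M\<close>-component of a decomposition;
    \<open>uniq\<close> makes the choice harmless, and its compatibility with all operations comes
    from decomposing both sides.\<close>
  define g where "g d = (SOME x. x \<in> carrier M \<and> (\<exists>q\<in>Q. d = \<phi> x \<oplus>\<^bsub>D\<^esub> q))" for d
  have g: "g (\<phi> x \<oplus>\<^bsub>D\<^esub> q) = x" if "x \<in> carrier M" "q \<in> Q" for x q
    unfolding g_def
  proof (rule some_equality)
    show "x \<in> carrier M \<and> (\<exists>q'\<in>Q. \<phi> x \<oplus>\<^bsub>D\<^esub> q = \<phi> x \<oplus>\<^bsub>D\<^esub> q')"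
      using that by blast
    show "y = x" if y: "y \<in> carrier M \<and> (\<exists>q'\<in>Q. \<phi> x \<oplus>\<^bsub>D\<^esub> q = \<phi> y \<oplus>\<^bsub>D\<^esub> q')" for y
      using uniq[OF \<open>x \<in> carrier M\<close> _ \<open>q \<in> Q\<close>] y by metis
  qed
  have dec: "\<exists>x\<in>carrier M. \<exists>q\<in>Q. d = \<phi> x \<oplus>\<^bsub>D\<^esub> q" if "d \<in> carrier D" for d
  proof -
    have "d \<in> set_add D P Q"
      using that s by simp
    then obtain p q where pq: "p \<in> P" "q \<in> Q" "d = p \<oplus>\<^bsub>D\<^esub> q"
      by (auto simp: set_add_def set_mult_def)
    have "p \<in> \<phi> ` carrier M"
      using bij pq(1) by (simp add: bij_betw_def)
    then obtain x where "x \<in> carrier M" "p = \<phi> x"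
      by blast
    with pq(2,3) show ?thesis
      by blast
  qed
  have "g \<in> op_hom K I D M"
  proof (intro op_homI linI)
    fix d assume "d \<in> carrier D"
    then obtain x q where x: "x \<in> carrier M" "q \<in> Q" and d: "d = \<phi> x \<oplus>\<^bsub>D\<^esub> q"
      using dec by blast
    note c = Pc[OF \<phi>P[OF x(1)]] Qc[OF x(2)]
    show "g d \<in> carrier M"
      using x by (simp add: d g)
    show "g (d \<oplus>\<^bsub>D\<^esub> d') = g d \<oplus>\<^bsub>M\<^esub> g d'" if "d' \<in> carrier D" for d'
    proof -
      obtain x' q' where x': "x' \<in> carrier M" "q' \<in> Q" and d': "d' = \<phi> x' \<oplus>\<^bsub>D\<^esub> q'"
        using dec \<open>d' \<in> carrier D\<close> by blast
      note c' = Pc[OF \<phi>P[OF x'(1)]] Qc[OF x'(2)]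
      have "d \<oplus>\<^bsub>D\<^esub> d' = \<phi> (x \<oplus>\<^bsub>M\<^esub> x') \<oplus>\<^bsub>D\<^esub> (q \<oplus>\<^bsub>D\<^esub> q')"
        using c c' x x' Dv by (simp add: d d' lin_add[OF \<phi>l] vs_assoc vs_lcomm)
      then show ?thesis
        using x x' Mv submD(3)[OF Qs] by (simp add: d d' g)
    qed
    show "g (c \<odot>\<^bsub>D\<^esub> d) = c \<odot>\<^bsub>M\<^esub> g d" if "c \<in> carrier K" for c
    proof -
      have "c \<odot>\<^bsub>D\<^esub> d = \<phi> (c \<odot>\<^bsub>M\<^esub> x) \<oplus>\<^bsub>D\<^esub> c \<odot>\<^bsub>D\<^esub> q"
        using c x that Dv by (simp add: d lin_smult[OF \<phi>l] vs_smult_add)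
      then show ?thesis
        using x that Mv submD(4)[OF Qs] by (simp add: d g)
    qed
    show "g (act D i d) = act M i (g d)" if i: "i \<in> I" for i
    proof -
      have "act D i d = \<phi> (act M i x) \<oplus>\<^bsub>D\<^esub> act D i q"
        using c x i by (simp add: d lin_add[OF opm_act[OF assms(3) i]] op_hom_act[OF \<phi>D])
      moreover have "act D i q \<in> Q"
        using Q i x by (auto simp: op_submodule_def)
      ultimately show ?thesis
        using x lin_closed[OF opm_act[OF assms(2) i]] by (simp add: d g)
    qed
  qed
  moreover have "g (\<phi> x) = x" if "x \<in> carrier M" for x
    using g[OF that submD(2)[OF Qs]] Pc[OF \<phi>P[OF that]] Dv by simp
  ultimately show ?thesis
    by (intro divides_retract[OF Mv \<phi>D]) auto
qed

lemma summand_iff_divides: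
  assumes "opm I M" "opm I N"
  shows "(\<exists>q. iso_to_summand K I M (copies q N)) \<longleftrightarrow> divides I M N"
    and "(\<exists>q>0. iso_to_summand K I M (copies q N)) \<longleftrightarrow> divides I M N"
  using divides_imp_summand[OF _ assms] summand_imp_divides[OF _ assms(1) copies_opm[OF assms(2)]]
    divides_trans[OF _ copies_divides[OF assms(2)] opm_vs[OF assms(1)] opm_vs[OF copies_opm[OF assms(2)]]]
  by blast+

lemma similar_iff_divides:
  assumes "opm I M" "opm I N"
  shows "similar K I M N \<longleftrightarrow> divides I M N \<and> divides I N M"
  by (simp add: similar_def summand_iff_divides(1) assms)

lemma isomorphic_retract:
  assumes "op_isomorphic K I M N" "opm I M" "vsp N"
  obtains f g where "f \<in> op_hom K I M N" "g \<in> op_hom K I N M"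
    "\<And>x. x \<in> carrier M \<Longrightarrow> g (f x) = x" "\<And>y. y \<in> carrier N \<Longrightarrow> f (g y) = y"
proof -
  obtain f where f: "f \<in> op_hom K I M N" and bij: "bij_betw f (carrier M) (carrier N)"
    using assms(1) by (auto simp: op_isomorphic_def)
  define g where "g = inv_into (carrier M) f"
  note fl = op_hom_lin[OF f] and Mv = opm_vs[OF assms(2)]
  have gf: "g (f x) = x" if "x \<in> carrier M" for x
    unfolding g_def using bij that by (simp add: bij_betw_def)
  have fg: "f (g y) = y" and gc: "g y \<in> carrier M" if "y \<in> carrier N" for y
    unfolding g_def using bij that
    by (simp_all add: bij_betw_def f_inv_into_f inv_into_into)
  have "g \<in> op_hom K I N M"
  proof (intro op_homI linI gc)
    fix y assume y: "y \<in> carrier N"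
    show "g (y \<oplus>\<^bsub>N\<^esub> z) = g y \<oplus>\<^bsub>M\<^esub> g z" if z: "z \<in> carrier N" for z
      using gf[of "g y \<oplus>\<^bsub>M\<^esub> g z"] y z Mv by (simp add: gc fg lin_add[OF fl])
    show "g (c \<odot>\<^bsub>N\<^esub> y) = c \<odot>\<^bsub>M\<^esub> g y" if "c \<in> carrier K" for c
      using gf[of "c \<odot>\<^bsub>M\<^esub> g y"] y that Mv by (simp add: gc fg lin_smult[OF fl])
    show "g (act N i y) = act M i (g y)" if "i \<in> I" for i
      using gf[of "act M i (g y)"] y that lin_closed[OF opm_act[OF assms(2) that]]
      by (simp add: gc fg op_hom_act[OF f])
  qed
  from that[OF f this gf fg] show thesis .
qed

section \<open>Dual bases\<close>

text \<open>Bases are indexed by an initial segment of the naturals because coordinate vectors must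
  land in \<open>copies q\<close>. For \<open>H\<close> the expansion serves to build induced maps,
  for \<open>A\<close> the coordinates give an isomorphism with copies of the trivial
  module.\<close>

lemma dual_basis:
  assumes "vsp V" "vectorspace.fin_dim K V"
  obtains q :: nat and b c where "\<And>i. i < q \<Longrightarrow> b i \<in> carrier V"
    "\<And>i. i < q \<Longrightarrow> lin V (ground K) (c i)"
    "\<And>v. v \<in> carrier V \<Longrightarrow> finsum V (\<lambda>i. c i v \<odot>\<^bsub>V\<^esub> b i) {..<q} = v"
    "\<And>x i. (\<And>i. i < q \<Longrightarrow> x i \<in> carrier K) \<Longrightarrow> i < q \<Longrightarrow>
      c i (finsum V (\<lambda>i. x i \<odot>\<^bsub>V\<^esub> b i) {..<q}) = x i"
proof -
  interpret V: vectorspace K V by fact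
  obtain \<beta> where fin: "finite \<beta>" and basis: "V.basis \<beta>"
    using V.finite_basis_exists[OF assms(2)] by blast
  have \<beta>: "\<beta> \<subseteq> carrier V"
    using basis by (simp add: V.basis_def)
  have ex1: "\<exists>!a. a \<in> \<beta> \<rightarrow>\<^sub>E carrier K \<and> V.lincomb a \<beta> = v" if "v \<in> carrier V" for v
    using V.basis_criterion[OF fin \<beta>] basis that by blast
  \<comment> \<open>Coordinate functions are taken undefined outside \<beta>; among those they are
    unique, and linearity follows from uniqueness.\<close>
  define cf where "cf v = (THE a. a \<in> \<beta> \<rightarrow>\<^sub>E carrier K \<and> V.lincomb a \<beta> = v)" for v
  have cf: "cf v \<in> \<beta> \<rightarrow>\<^sub>E carrier K" "V.lincomb (cf v) \<beta> = v" if "v \<in> carrier V" for v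
    using theI'[OF ex1[OF that]] unfolding cf_def by auto
  have lc: "V.lincomb a \<beta> = finsum V (\<lambda>v. a v \<odot>\<^bsub>V\<^esub> v) \<beta>" for a
    by (simp add: V.lincomb_def)
  have lc_closed: "finsum V (\<lambda>v. a v \<odot>\<^bsub>V\<^esub> v) \<beta> \<in> carrier V" if "\<And>v. v \<in> \<beta> \<Longrightarrow> a v \<in> carrier K" for a
    using \<beta> that assms(1) by (intro finsum_closed) auto
  have cfI: "cf v w = a w" if "\<And>v. v \<in> \<beta> \<Longrightarrow> a v \<in> carrier K"
    "finsum V (\<lambda>v. a v \<odot>\<^bsub>V\<^esub> v) \<beta> = v" "w \<in> \<beta>" for v w a
  proof -
    have v: "v \<in> carrier V"
      using lc_closed[of a] that by simp
    have "V.lincomb (restrict a \<beta>) \<beta> = v"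
      unfolding lc that(2)[symmetric]
      using \<beta> that(1) assms(1) by (intro finsum_cong) auto
    then have "restrict a \<beta> = cf v"
      using ex1[OF v] cf[OF v] that(1) by (metis restrict_PiE_iff)
    then show ?thesis
      using that(3) by (metis restrict_apply')
  qed
  have cfs: "finsum V (\<lambda>w. cf v w \<odot>\<^bsub>V\<^esub> w) \<beta> = v" if "v \<in> carrier V" for v
    using cf(2)[OF that] by (simp add: lc)
  have cfk: "cf v w \<in> carrier K" if "v \<in> carrier V" "w \<in> \<beta>" for v w
    using cf(1)[OF that(1)] that(2) by auto
  have cflin: "lin V (ground K) (\<lambda>v. cf v w)" if w: "w \<in> \<beta>" for w
  proof (rule linI)
    fix v assume v: "v \<in> carrier V"
    show "cf v w \<in> carrier (ground K)"
      using cfk[OF v w] by (simp add: ground_def)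
    show "cf (v \<oplus>\<^bsub>V\<^esub> u) w = cf v w \<oplus>\<^bsub>ground K\<^esub> cf u w" if u: "u \<in> carrier V" for u
    proof -
      have "finsum V (\<lambda>w. (cf v w \<oplus>\<^bsub>K\<^esub> cf u w) \<odot>\<^bsub>V\<^esub> w) \<beta> =
          finsum V (\<lambda>w. cf v w \<odot>\<^bsub>V\<^esub> w \<oplus>\<^bsub>V\<^esub> cf u w \<odot>\<^bsub>V\<^esub> w) \<beta>"
        using \<beta> cfk[OF u] cfk[OF v] assms(1)
        by (intro finsum_cong vs_add_smult) (auto intro!: vs_closed)
      also have "\<dots> = finsum V (\<lambda>w. cf v w \<odot>\<^bsub>V\<^esub> w) \<beta> \<oplus>\<^bsub>V\<^esub> finsum V (\<lambda>w. cf u w \<odot>\<^bsub>V\<^esub> w) \<beta>"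
        using \<beta> cfk[OF u] cfk[OF v] by (intro finsum_add assms(1) vs_closed(4)) auto
      also have "\<dots> = v \<oplus>\<^bsub>V\<^esub> u"
        by (simp only: cfs u v)
      finally show ?thesis
        using cfI[of "\<lambda>w. cf v w \<oplus>\<^bsub>K\<^esub> cf u w", OF _ _ w] cfk[OF u] cfk[OF v] by (simp add: ground_def)
    qed
    show "cf (c \<odot>\<^bsub>V\<^esub> v) w = c \<odot>\<^bsub>ground K\<^esub> cf v w" if c: "c \<in> carrier K" for c
    proof -
      have "finsum V (\<lambda>w. (c \<otimes>\<^bsub>K\<^esub> cf v w) \<odot>\<^bsub>V\<^esub> w) \<beta> = finsum V (\<lambda>w. c \<odot>\<^bsub>V\<^esub> (cf v w \<odot>\<^bsub>V\<^esub> w)) \<beta>"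
        using \<beta> cfk[OF v] c assms(1)
        by (intro finsum_cong vs_mult_smult) (auto intro!: vs_closed)
      also have "\<dots> = c \<odot>\<^bsub>V\<^esub> finsum V (\<lambda>w. cf v w \<odot>\<^bsub>V\<^esub> w) \<beta>"
        by (rule lin_finsum[OF assms(1) assms(1) lin_smult_fun[OF assms(1) c lin_id], symmetric])
          (use \<beta> cfk[OF v] assms(1) in auto)
      also have "\<dots> = c \<odot>\<^bsub>V\<^esub> v"
        by (simp only: cfs v)
      finally show ?thesis
        using cfI[of "\<lambda>w. c \<otimes>\<^bsub>K\<^esub> cf v w", OF _ _ w] cfk[OF v] c by (simp add: ground_def)
    qed
  qed
  obtain b where b: "bij_betw b {..<card \<beta>} \<beta>"
    using ex_bij_betw_nat_finite[OF fin] by (auto simp: atLeast0LessThan)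
  have b\<beta>: "b i \<in> \<beta>" if "i < card \<beta>" for i
    using b that by (auto simp: bij_betw_def)
  have reindex: "finsum V (\<lambda>i. a (b i) \<odot>\<^bsub>V\<^esub> b i) {..<card \<beta>} = finsum V (\<lambda>w. a w \<odot>\<^bsub>V\<^esub> w) \<beta>"
    if "\<And>w. w \<in> \<beta> \<Longrightarrow> a w \<in> carrier K" for a
  proof -
    have "finsum V (\<lambda>w. a w \<odot>\<^bsub>V\<^esub> w) (b ` {..<card \<beta>}) = finsum V (\<lambda>i. a (b i) \<odot>\<^bsub>V\<^esub> b i) {..<card \<beta>}"
      using b \<beta> that by (intro abelian_monoid.finsum_reindex[OF vs_abelian_monoid[OF assms(1)]])
        (auto simp: bij_betw_def assms(1) subset_iff)
    then show ?thesis
      using b by (simp add: bij_betw_def)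
  qed
  show thesis
  proof (rule that[of "card \<beta>" b "\<lambda>i v. cf v (b i)"])
    show "b i \<in> carrier V" if "i < card \<beta>" for i
      using b\<beta>[OF that] \<beta> by auto
    show "lin V (ground K) (\<lambda>v. cf v (b i))" if "i < card \<beta>" for i
      by (rule cflin[OF b\<beta>[OF that]])
    show "finsum V (\<lambda>i. cf v (b i) \<odot>\<^bsub>V\<^esub> b i) {..<card \<beta>} = v" if "v \<in> carrier V" for v
      using that by (simp add: reindex cfk cfs)
    fix x i assume x: "\<And>i. i < card \<beta> \<Longrightarrow> x i \<in> carrier K" and i: "i < card \<beta>"
    \<comment> \<open>The coordinates \<open>x\<close>, indexed by numbers, are transported back to
      basis vectors so that uniqueness of \<open>cf\<close> applies.\<close>
    define a where "a w = x (inv_into {..<card \<beta>} b w)" for w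
    have a: "a (b i) = x i" if "i < card \<beta>" for i
      using b that by (simp add: a_def bij_betw_def)
    have ak: "a w \<in> carrier K" if "w \<in> \<beta>" for w
    proof -
      from that obtain i where "i < card \<beta>" "w = b i"
        using b unfolding bij_betw_def by blast
      then show ?thesis
        by (simp add: a x)
    qed
    have "finsum V (\<lambda>i. x i \<odot>\<^bsub>V\<^esub> b i) {..<card \<beta>} = finsum V (\<lambda>i. a (b i) \<odot>\<^bsub>V\<^esub> b i) {..<card \<beta>}"
      using x b\<beta> \<beta> assms(1) by (intro finsum_cong) (auto simp: a)
    also have "\<dots> = finsum V (\<lambda>w. a w \<odot>\<^bsub>V\<^esub> w) \<beta>"
      by (rule reindex[OF ak])
    finally show "cf (finsum V (\<lambda>i. x i \<odot>\<^bsub>V\<^esub> b i) {..<card \<beta>}) (b i) = x i"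
      using cfI[of a _ "b i"] ak b\<beta>[OF i] a[OF i] by simp
  qed
qed

end

section \<open>Bimodules induced from modules\<close>

text \<open>
  \<open>Y\<close> is isomorphic to \<open>X \<otimes> H\<close> through \<open>x \<otimes> h \<mapsto> j(x).h\<close>; the assumption on functionals replaces the
  injectivity of this map, the one on submodules its surjectivity.
\<close>

locale induced_bimodule = hopf_ground K H for K :: "('k, 'r) ring_scheme" and H :: "('k, 'h) hopf" +
  fixes \<iota> :: "'h \<Rightarrow> 'c" and X :: "('k, 'x, 'h) opmod" and Y :: "('k, 'y, 'c + 'c) opmod" and j :: "'x \<Rightarrow> 'y"
  assumes X_lmod: "left_module K H X"
    and Y_vs: "vectorspace K Y"
    and L_lin: "h \<in> carrier H \<Longrightarrow> act Y (Inl (\<iota> h)) \<in> LinearCombinations.module_hom K Y Y"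
    and R_bilin: "ground_field.bilin K Y H Y (\<lambda>y h. act Y (Inr (\<iota> h)) y)"
    and R_one: "y \<in> carrier Y \<Longrightarrow> act Y (Inr (\<iota> \<one>\<^bsub>H\<^esub>)) y = y"
    and R_mult: "\<lbrakk>y \<in> carrier Y; g \<in> carrier H; h \<in> carrier H\<rbrakk> \<Longrightarrow>
      act Y (Inr (\<iota> h)) (act Y (Inr (\<iota> g)) y) = act Y (Inr (\<iota> (g \<otimes>\<^bsub>H\<^esub> h))) y"
    and L_R: "\<lbrakk>y \<in> carrier Y; g \<in> carrier H; h \<in> carrier H\<rbrakk> \<Longrightarrow>
      act Y (Inl (\<iota> h)) (act Y (Inr (\<iota> g)) y) = act Y (Inr (\<iota> g)) (act Y (Inl (\<iota> h)) y)"
    and j_lin: "j \<in> LinearCombinations.module_hom K X Y"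
    and coefficients: "\<xi> \<in> LinearCombinations.module_hom K H (ground K) \<Longrightarrow>
      \<exists>p\<in>LinearCombinations.module_hom K Y X.
        \<forall>x\<in>carrier X. \<forall>h\<in>carrier H. p (act Y (Inr (\<iota> h)) (j x)) = \<xi> h \<odot>\<^bsub>X\<^esub> x"
    and spanning: "\<lbrakk>LinearCombinations.submodule K U Y;
      \<And>x h. x \<in> carrier X \<Longrightarrow> h \<in> carrier H \<Longrightarrow> act Y (Inr (\<iota> h)) (j x) \<in> U\<rbrakk> \<Longrightarrow> carrier Y \<subseteq> U"
    and L_j: "\<lbrakk>h \<in> carrier H; x \<in> carrier X\<rbrakk> \<Longrightarrow> act Y (Inl (\<iota> h)) (j x) =
      sweedler K H Y (\<lambda>a b. act Y (Inr (\<iota> b)) (j (act X a x))) h"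
begin

abbreviation L where "L h y \<equiv> act Y (Inl (\<iota> h)) y"
abbreviation R where "R y h \<equiv> act Y (Inr (\<iota> h)) y"

lemmas Xv = lmod_vs[OF X_lmod]
lemmas Xact_lin1 = act_lin1[OF X_lmod]
lemmas Xact_lin2 = act_lin2[OF X_lmod]
lemmas Xact_closed = act_closed[OF X_lmod]
lemmas R_lin1 = bilin_comp1[OF R_bilin]
lemmas R_lin2 = bilin_comp2[OF R_bilin]
lemmas R_closed = bilin_closed[OF R_bilin]
lemmas j_closed = lin_closed[OF j_lin]

lemma Y_ext:
  assumes "vsp Z" "lin Y Z f" "lin Y Z g"
    "\<And>x h. x \<in> carrier X \<Longrightarrow> h \<in> carrier H \<Longrightarrow> f (R (j x) h) = g (R (j x) h)" "y \<in> carrier Y"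
  shows "f y = g y"
proof -
  have "carrier Y \<subseteq> {y \<in> carrier Y. f y = g y}"
    by (rule spanning[OF subm_equalizer[OF Y_vs assms(1-3)]]) (simp add: assms(4) R_closed j_closed)
  then show ?thesis
    using assms(5) by blast
qed

lemma Rj_bilin:
  assumes "x \<in> carrier X" "g \<in> carrier H"
  shows "bilin H H Y (\<lambda>a b. R (j (act X a x)) (b \<otimes>\<^bsub>H\<^esub> g))"
  using assms
  by (intro bilinI R_lin1 R_lin2 lin_comp[OF _ j_lin] Xact_lin1 H_mult_lin1 lin_id j_closed Xact_closed H_closed)

text \<open>\<open>L_j\<close> describes the left action on the image of \<open>j\<close>; commuting
  the actions extends the formula to its right translates, which span \<open>Y\<close>.\<close>

lemma L_Rj:
  assumes "x \<in> carrier X" "g \<in> carrier H" "h \<in> carrier H"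
  shows "L h (R (j x) g) = sw Y (\<lambda>a b. R (j (act X a x)) (b \<otimes>\<^bsub>H\<^esub> g)) h"
proof -
  have b: "bilin H H Y (\<lambda>a b. R (j (act X a x)) b)"
    using assms by (intro bilinI R_lin1 R_lin2 lin_comp[OF _ j_lin] Xact_lin1 lin_id j_closed Xact_closed)
  have "L h (R (j x) g) = R (sw Y (\<lambda>a b. R (j (act X a x)) b) h) g"
    using assms by (simp add: L_R j_closed L_j)
  also have "\<dots> = sw Y (\<lambda>a b. R (R (j (act X a x)) b) g) h"
    by (rule sw_hom[OF Y_vs Y_vs bilin_lin1[OF R_bilin assms(2)] assms(3) b])
  also have "\<dots> = sw Y (\<lambda>a b. R (j (act X a x)) (b \<otimes>\<^bsub>H\<^esub> g)) h"
    by (rule sw_cong[OF Y_vs assms(3) Rj_bilin[OF assms(1,2)]])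
      (simp add: R_mult j_closed Xact_closed assms)
  finally show ?thesis .
qed

text \<open>Under the identification with X \<otimes> H this is id \<otimes> \<epsilon>, the
  projection to Y \<otimes> k over H. A choice is made because the locale asserts only that
  coefficient maps exist.\<close>

definition pe :: "'y \<Rightarrow> 'x" where
  "pe = (SOME p. lin Y X p \<and> (\<forall>x\<in>carrier X. \<forall>h\<in>carrier H. p (R (j x) h) = counit H h \<odot>\<^bsub>X\<^esub> x))"

lemma pe: "lin Y X pe" "x \<in> carrier X \<Longrightarrow> h \<in> carrier H \<Longrightarrow> pe (R (j x) h) = counit H h \<odot>\<^bsub>X\<^esub> x"
proof -
  have "\<exists>p. lin Y X p \<and> (\<forall>x\<in>carrier X. \<forall>h\<in>carrier H. p (R (j x) h) = counit H h \<odot>\<^bsub>X\<^esub> x)"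
    using coefficients[OF counit_lin] by blast
  from someI_ex[OF this] show "lin Y X pe"
    "x \<in> carrier X \<Longrightarrow> h \<in> carrier H \<Longrightarrow> pe (R (j x) h) = counit H h \<odot>\<^bsub>X\<^esub> x"
    unfolding pe_def by blast+
qed

lemma pe_j: "x \<in> carrier X \<Longrightarrow> pe (j x) = x"
  using pe(2)[of x "\<one>\<^bsub>H\<^esub>"] by (simp add: R_one j_closed hopf_algebra.counit_one[OF hopf] Xv)

lemma pe_R:
  assumes "y \<in> carrier Y" "h \<in> carrier H"
  shows "pe (R y h) = counit H h \<odot>\<^bsub>X\<^esub> pe y"
  by (rule Y_ext[OF Xv lin_comp[OF R_lin1[OF assms(2) lin_id] pe(1)] lin_smult_fun[OF Xv _ pe(1)] _ assms(1)])
    (simp_all add: assms R_mult j_closed pe(2) hopf_algebra.counit_mult[OF hopf] vs_mult_smult[OF Xv]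
      vs_smult_commute[OF Xv])

text \<open>In the diagonal action on x \<otimes> g the counit swallows the component of
  \<open>h\<close> that multiplies \<open>g\<close>, and the counit axiom leaves \<open>h\<close>
  acting on \<open>x\<close>.\<close>

lemma pe_L:
  assumes "y \<in> carrier Y" "h \<in> carrier H"
  shows "pe (L h y) = act X h (pe y)"
proof (rule Y_ext[OF Xv lin_comp[OF L_lin[OF assms(2)] pe(1)] Xact_lin2[OF assms(2) pe(1)] _ assms(1)])
  fix x g assume x: "x \<in> carrier X" and g: "g \<in> carrier H"
  have l: "lin H X (\<lambda>a. counit H g \<odot>\<^bsub>X\<^esub> act X a x)"
    using x g by (intro lin_smult_fun[OF Xv] Xact_lin1 lin_id counit_closed)
  have "pe (L h (R (j x) g)) = sw X (\<lambda>a b. pe (R (j (act X a x)) (b \<otimes>\<^bsub>H\<^esub> g))) h"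
    unfolding L_Rj[OF x g assms(2)] by (rule sw_hom[OF Y_vs Xv pe(1) assms(2) Rj_bilin[OF x g]])
  also have "\<dots> = sw X (\<lambda>a b. counit H b \<odot>\<^bsub>X\<^esub> (counit H g \<odot>\<^bsub>X\<^esub> act X a x)) h"
    by (rule sw_cong[OF Xv assms(2) counit_smult_bilin(2)[OF Xv l]])
      (simp add: pe(2) x g Xact_closed hopf_algebra.counit_mult[OF hopf] vs_mult_smult[OF Xv])
  also have "\<dots> = counit H g \<odot>\<^bsub>X\<^esub> act X h x"
    by (rule sw_counit_right[OF Xv assms(2) l])
  also have "\<dots> = act X h (pe (R (j x) g))"
    using x g assms by (simp add: pe(2) lin_smult[OF bilin_lin2[OF lmod_bilin[OF X_lmod]]])
  finally show "pe (L h (R (j x) g)) = act X h (pe (R (j x) g))" .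
qed

abbreviation BB where "BB \<equiv> Sum_Type.Plus (\<iota> ` carrier H) (\<iota> ` carrier H)"

lemma Y_opm: "opm BB Y"
  unfolding opm_def using Y_vs L_lin bilin_lin1[OF R_bilin] by auto

lemma X_opm: "opm (carrier H) X"
  unfolding opm_def using Xv bilin_lin2[OF lmod_bilin[OF X_lmod]] by auto

end

section \<open>Homomorphisms between induced bimodules\<close>

locale induced_pair =
  P: induced_bimodule K H \<iota> X Y j + Q: induced_bimodule K H \<iota> X' Y' j'
  for K :: "('k, 'r) ring_scheme" and H :: "('k, 'h) hopf" and \<iota> :: "'h \<Rightarrow> 'c"
    and X :: "('k, 'x, 'h) opmod" and Y :: "('k, 'y, 'c + 'c) opmod" and j :: "'x \<Rightarrow> 'y"
    and X' :: "('k, 'x2, 'h) opmod" and Y' :: "('k, 'y2, 'c + 'c) opmod" and j' :: "'x2 \<Rightarrow> 'y2"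
begin

context
  fixes F :: "'y \<Rightarrow> 'y2"
  assumes F: "F \<in> op_hom K P.BB Y Y'"
begin

lemma bimodule_hom_L: "h \<in> carrier H \<Longrightarrow> y \<in> carrier Y \<Longrightarrow> F (P.L h y) = Q.L h (F y)"
  using P.op_hom_act[OF F] by auto

lemma bimodule_hom_R: "h \<in> carrier H \<Longrightarrow> y \<in> carrier Y \<Longrightarrow> F (P.R y h) = Q.R (F y) h"
  using P.op_hom_act[OF F] by auto

text \<open>
  This makes \<open>G \<mapsto> (\<lambda>x. pe' (G (j x)))\<close> compatible with composition, although \<open>j\<close> is not a
  bimodule map and \<open>j \<circ> pe\<close> is not the identity.
\<close>

lemma pe_hom:
  assumes "y \<in> carrier Y"
  shows "Q.pe (F (j (P.pe y))) = Q.pe (F y)"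
proof (rule P.Y_ext[OF Q.Xv _ P.lin_comp[OF P.op_hom_lin[OF F] Q.pe(1)] _ assms])
  show "P.lin Y X' (\<lambda>y. Q.pe (F (j (P.pe y))))"
    by (intro P.lin_comp[OF _ Q.pe(1)] P.lin_comp[OF _ P.op_hom_lin[OF F]] P.lin_comp[OF P.pe(1) P.j_lin])
  fix x h assume x: "x \<in> carrier X" and h: "h \<in> carrier H"
  have Fj: "F (j x) \<in> carrier Y'"
    by (rule P.op_hom_closed[OF F P.j_closed[OF x]])
  show "Q.pe (F (j (P.pe (P.R (j x) h)))) = Q.pe (F (P.R (j x) h))"
    using x h Fj
    by (simp add: P.pe(2) bimodule_hom_R P.j_closed Q.pe_R P.lin_smult[OF P.j_lin]
        P.lin_smult[OF P.op_hom_lin[OF F]] P.lin_smult[OF Q.pe(1)])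
qed

text \<open>The element \<open>act X h x\<close> is the projection of \<open>L h (j x)\<close>. By
  \<open>pe_hom\<close> the detour \<open>j (P.pe _)\<close> may be dropped under
  \<open>Q.pe\<close>, and then the left action passes through \<open>F\<close> and
  \<open>Q.pe\<close>.\<close>

lemma descend_hom: "(\<lambda>x. Q.pe (F (j x))) \<in> op_hom K (carrier H) X X'"
proof (rule P.op_homI)
  show "P.lin X X' (\<lambda>x. Q.pe (F (j x)))"
    by (intro P.lin_comp[OF _ Q.pe(1)] P.lin_comp[OF P.j_lin P.op_hom_lin[OF F]])
  fix h x assume h: "h \<in> carrier H" and x: "x \<in> carrier X"
  have jx: "j x \<in> carrier Y"
    by (rule P.j_closed[OF x])
  have "Q.pe (F (j (act X h x))) = Q.pe (F (j (P.pe (P.L h (j x)))))"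
    using x h jx by (simp add: P.pe_L P.pe_j)
  also have "\<dots> = Q.pe (Q.L h (F (j x)))"
    using h jx P.lin_closed[OF P.L_lin[OF h] jx] by (simp add: pe_hom bimodule_hom_L)
  also have "\<dots> = act X' h (Q.pe (F (j x)))"
    by (rule Q.pe_L[OF P.op_hom_closed[OF F jx] h])
  finally show "Q.pe (F (j (act X h x))) = act X' h (Q.pe (F (j x)))" .
qed

end

text \<open>The map is f \<otimes> id. Since \<open>Y\<close> is not literally a tensor product, it
  is assembled from the coordinates of a finite basis of \<open>H\<close>: read each coefficient,
  apply \<open>f\<close>, and multiply by the basis vector on the right.\<close>

lemma induce_hom:
  assumes f: "f \<in> op_hom K (carrier H) X X'" and fin: "vectorspace.fin_dim K H"
  shows "\<exists>F\<in>op_hom K P.BB Y Y'. \<forall>x\<in>carrier X. \<forall>h\<in>carrier H. F (P.R (j x) h) = Q.R (j' (f x)) h"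
proof -
  obtain q b c where b: "\<And>i. i < (q::nat) \<Longrightarrow> b i \<in> carrier H"
    and c: "\<And>i. i < q \<Longrightarrow> P.lin H (ground K) (c i)"
    and exp: "\<And>v. v \<in> carrier H \<Longrightarrow> finsum H (\<lambda>i. c i v \<odot>\<^bsub>H\<^esub> b i) {..<q} = v"
    by (rule P.dual_basis[OF P.H_vs fin]) blast
  have "\<forall>i\<in>{..<q}. \<exists>p. P.lin Y X p \<and> (\<forall>x\<in>carrier X. \<forall>h\<in>carrier H. p (P.R (j x) h) = c i h \<odot>\<^bsub>X\<^esub> x)"
    using P.coefficients[OF c] by blast
  from bchoice[OF this] obtain p where p: "\<And>i. i < q \<Longrightarrow> P.lin Y X (p i)"
    "\<And>i x h. i < q \<Longrightarrow> x \<in> carrier X \<Longrightarrow> h \<in> carrier H \<Longrightarrow> p i (P.R (j x) h) = c i h \<odot>\<^bsub>X\<^esub> x"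
    by auto
  \<comment> \<open>Here \<open>p i\<close> is id \<otimes> c for the \<open>i\<close>-th coordinate
    functional c of \<open>H\<close>.\<close>
  define F where "F y = finsum Y' (\<lambda>i. Q.R (j' (f (p i y))) (b i)) {..<q}" for y
  note fl = P.op_hom_lin[OF f] and fc = P.op_hom_closed[OF f]
  have Fl: "P.lin Y Y' F"
    unfolding F_def
    by (intro P.lin_finsum_fun[OF P.Y_vs Q.Y_vs] Q.R_lin1 P.lin_comp[OF _ Q.j_lin] P.lin_comp[OF p(1) fl])
      (simp_all add: b)
  have Fv: "F (P.R (j x) h) = Q.R (j' (f x)) h" if x: "x \<in> carrier X" and h: "h \<in> carrier H" for x h
  proof -
    have k: "c i h \<in> carrier K" if "i < q" for i
      using P.lin_closed[OF c[OF that] h] by simp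
    have jf: "j' (f x) \<in> carrier Y'"
      by (rule Q.j_closed[OF fc[OF x]])
    have "F (P.R (j x) h) = finsum Y' (\<lambda>i. Q.R (j' (f x)) (c i h \<odot>\<^bsub>H\<^esub> b i)) {..<q}"
      unfolding F_def
    proof (rule P.finsum_cong[OF Q.Y_vs refl])
      fix i assume "i \<in> {..<q}"
      then have i: "i < q" by simp
      show "Q.R (j' (f (p i (P.R (j x) h)))) (b i) = Q.R (j' (f x)) (c i h \<odot>\<^bsub>H\<^esub> b i)"
        using i x h jf b[OF i] k[OF i] fc[OF x]
        by (simp add: p(2) P.lin_smult[OF fl] P.lin_smult[OF Q.j_lin] P.lin_smult[OF P.bilin_lin1[OF Q.R_bilin]]
            P.lin_smult[OF P.bilin_lin2[OF Q.R_bilin]])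
      show "Q.R (j' (f x)) (c i h \<odot>\<^bsub>H\<^esub> b i) \<in> carrier Y'"
        using jf b[OF i] k[OF i] by (intro Q.R_closed) auto
    qed
    also have "\<dots> = Q.R (j' (f x)) (finsum H (\<lambda>i. c i h \<odot>\<^bsub>H\<^esub> b i) {..<q})"
      by (rule P.lin_finsum[OF P.H_vs Q.Y_vs P.bilin_lin2[OF Q.R_bilin jf], symmetric])
        (use b k in auto)
    finally show ?thesis
      by (simp only: exp[OF h])
  qed
  have FR: "F (P.R y g) = Q.R (F y) g" if y: "y \<in> carrier Y" and g: "g \<in> carrier H" for y g
    by (rule P.Y_ext[OF Q.Y_vs P.lin_comp[OF P.R_lin1[OF g P.lin_id] Fl] Q.R_lin1[OF g Fl] _ y])
      (simp add: P.R_mult P.j_closed Fv g Q.R_mult Q.j_closed fc)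
  have FL: "F (P.L h y) = Q.L h (F y)" if y: "y \<in> carrier Y" and h: "h \<in> carrier H" for y h
  proof (rule P.Y_ext[OF Q.Y_vs P.lin_comp[OF P.L_lin[OF h] Fl] P.lin_comp[OF Fl Q.L_lin[OF h]] _ y])
    fix x g assume x: "x \<in> carrier X" and g: "g \<in> carrier H"
    have "F (P.L h (P.R (j x) g)) = P.sw Y' (\<lambda>a b. F (P.R (j (act X a x)) (b \<otimes>\<^bsub>H\<^esub> g))) h"
      unfolding P.L_Rj[OF x g h] by (rule P.sw_hom[OF P.Y_vs Q.Y_vs Fl h P.Rj_bilin[OF x g]])
    also have "\<dots> = P.sw Y' (\<lambda>a b. Q.R (j' (act X' a (f x))) (b \<otimes>\<^bsub>H\<^esub> g)) h"
      by (rule P.sw_cong[OF Q.Y_vs h Q.Rj_bilin[OF fc[OF x] g]])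
        (simp add: Fv P.Xact_closed x g P.op_hom_act[OF f])
    also have "\<dots> = Q.L h (F (P.R (j x) g))"
      unfolding Fv[OF x g] by (rule Q.L_Rj[OF fc[OF x] g h, symmetric])
    finally show "F (P.L h (P.R (j x) g)) = Q.L h (F (P.R (j x) g))" .
  qed
  have "F \<in> op_hom K P.BB Y Y'"
    by (rule P.op_homI[OF Fl]) (auto simp: FL FR)
  with Fv show ?thesis by blast
qed

end

context induced_pair
begin

text \<open>The same pair with its roles exchanged, for the maps going back from \<open>Y'\<close>
  to \<open>Y\<close>.\<close>

interpretation S: induced_pair K H \<iota> X' Y' j' X Y j ..

text \<open>Descending respects sums because \<open>P.pe\<close> is additive, and composites because
  \<open>S.pe_hom\<close> absorbs the intermediate \<open>j'\<close> and
  \<open>Q.pe\<close>.\<close>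

lemma fac_descend:
  assumes "P.fac P.BB Y Y' Y h"
  shows "P.fac (carrier H) X X' X (\<lambda>x. P.pe (h (j x)))"
  using assms
proof induction
  case (fac_zero h)
  show ?case
    by (rule P.fac_zero) (simp add: fac_zero P.j_closed P.lin_zero[OF P.Y_vs P.Xv P.pe(1)])
next
  case (fac_step f g h h')
  show ?case
  proof (rule P.fac_step[OF descend_hom[OF fac_step.hyps(1)] S.descend_hom[OF fac_step.hyps(2)] fac_step.IH])
    fix x assume x: "x \<in> carrier X"
    have fj: "f (j x) \<in> carrier Y'"
      by (rule P.op_hom_closed[OF fac_step.hyps(1) P.j_closed[OF x]])
    show "P.pe (h' (j x)) = P.pe (g (j' (Q.pe (f (j x))))) \<oplus>\<^bsub>X\<^esub> P.pe (h (j x))"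
      using x fj P.op_hom_closed[OF fac_step.hyps(2) fj] P.fac_closed[OF fac_step.hyps(3) P.Y_vs]
      by (simp add: fac_step.hyps(4) P.j_closed P.lin_add[OF P.pe(1)] S.pe_hom[OF fac_step.hyps(2)])
  qed
qed

text \<open>The sum \<open>k\<close> is built together with its linearity and its values on the
  spanning elements, because these two data determine it.\<close>

lemma fac_induce:
  assumes "P.fac (carrier H) X X' X h" and fin: "vectorspace.fin_dim K H"
  shows "\<exists>k. P.fac P.BB Y Y' Y k \<and> P.lin Y Y k \<and>
    (\<forall>x\<in>carrier X. \<forall>g\<in>carrier H. k (P.R (j x) g) = P.R (j (h x)) g)"
  using assms(1)
proof induction
  case (fac_zero h)
  have "P.R (j (h x)) g = \<zero>\<^bsub>Y\<^esub>" if "x \<in> carrier X" "g \<in> carrier H" for x g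
    using that by (simp add: fac_zero P.lin_zero[OF P.Xv P.Y_vs P.j_lin]
        P.lin_zero[OF P.Y_vs P.Y_vs P.bilin_lin1[OF P.R_bilin]])
  then show ?case
    by (intro exI[of _ "\<lambda>_. \<zero>\<^bsub>Y\<^esub>"]) (simp add: P.fac_zero P.lin_const_zero[OF P.Y_vs])
next
  case (fac_step f g h h')
  obtain k where k: "P.fac P.BB Y Y' Y k" "P.lin Y Y k"
    "\<And>x g. x \<in> carrier X \<Longrightarrow> g \<in> carrier H \<Longrightarrow> k (P.R (j x) g) = P.R (j (h x)) g"
    using fac_step.IH by blast
  obtain F where F: "F \<in> op_hom K P.BB Y Y'"
    "\<And>x h. x \<in> carrier X \<Longrightarrow> h \<in> carrier H \<Longrightarrow> F (P.R (j x) h) = Q.R (j' (f x)) h"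
    using induce_hom[OF fac_step.hyps(1) fin] by blast
  obtain G where G: "G \<in> op_hom K P.BB Y' Y"
    "\<And>x h. x \<in> carrier X' \<Longrightarrow> h \<in> carrier H \<Longrightarrow> G (Q.R (j' x) h) = P.R (j (g x)) h"
    using S.induce_hom[OF fac_step.hyps(2) fin] by blast
  have "P.fac P.BB Y Y' Y (\<lambda>y. G (F y) \<oplus>\<^bsub>Y\<^esub> k y)"
    by (rule P.fac_step[OF F(1) G(1) k(1)]) simp
  moreover have "P.lin Y Y (\<lambda>y. G (F y) \<oplus>\<^bsub>Y\<^esub> k y)"
    by (rule P.lin_add_fun[OF P.Y_vs P.lin_comp[OF P.op_hom_lin[OF F(1)] P.op_hom_lin[OF G(1)]] k(2)])
  moreover have "G (F (P.R (j x) a)) \<oplus>\<^bsub>Y\<^esub> k (P.R (j x) a) = P.R (j (h' x)) a"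
    if x: "x \<in> carrier X" and a: "a \<in> carrier H" for x a
  proof -
    have fx: "f x \<in> carrier X'" and hx: "h x \<in> carrier X"
      using P.op_hom_closed[OF fac_step.hyps(1) x] P.fac_closed[OF fac_step.hyps(3) P.Xv x] by auto
    then have gx: "g (f x) \<in> carrier X"
      using P.op_hom_closed[OF fac_step.hyps(2)] by blast
    show ?thesis
      using x a fx hx gx
      by (simp add: F(2) G(2) k(3) fac_step.hyps(4) P.lin_add[OF P.j_lin] P.j_closed
          P.lin_add[OF P.bilin_lin1[OF P.R_bilin]])
  qed
  ultimately show ?case by blast
qed

text \<open>Descending the identity of \<open>Y\<close> gives the identity of \<open>X\<close> by
  \<open>pe_j\<close>. Inducing the identity of \<open>X\<close> gives a linear map fixing all
  spanning elements, hence the identity of \<open>Y\<close>.\<close>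

lemma divides_induced_iff:
  assumes "vectorspace.fin_dim K H"
  shows "P.divides P.BB Y Y' \<longleftrightarrow> P.divides (carrier H) X X'"
proof
  assume "P.divides P.BB Y Y'"
  from fac_descend[OF this[unfolded P.divides_def]] show "P.divides (carrier H) X X'"
    unfolding P.divides_def by (rule P.fac_cong) (simp add: P.pe_j)
next
  assume "P.divides (carrier H) X X'"
  then obtain k where k: "P.fac P.BB Y Y' Y k" "P.lin Y Y k"
    "\<And>x g. x \<in> carrier X \<Longrightarrow> g \<in> carrier H \<Longrightarrow> k (P.R (j x) g) = P.R (j x) g"
    unfolding P.divides_def using fac_induce[OF _ assms] by blast
  from k(1) show "P.divides P.BB Y Y'"
    unfolding P.divides_def
    by (rule P.fac_cong) (rule P.Y_ext[OF P.Y_vs P.lin_id k(2)], simp_all add: k(3))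
qed

end

context hopf_ground
begin

text \<open>The tensors sent into \<open>U\<close> by the lift of \<open>f\<close> form a subspace
  containing all pure tensors, so the coproduct of \<open>h\<close> is among them.\<close>

lemma sw_in_subm:
  assumes "vsp Z" "h \<in> carrier H" "bilin H H Z (\<lambda>a b. f a b)" "subm U Z"
    "\<And>a b. a \<in> carrier H \<Longrightarrow> b \<in> carrier H \<Longrightarrow> f a b \<in> U"
  shows "sw Z (\<lambda>a b. f a b) h \<in> U"
proof -
  let ?l = "lift K Z (\<lambda>(a, b). f a b)" and ?T = "tensor K H H"
  note l = tensor_lift_lin[OF H_vs H_vs assms(1,3)]
  have "subm {t \<in> carrier ?T. ?l t \<in> U} ?T"
    by (rule submI[OF HH_vs])
      (use submD[OF assms(4)] in \<open>simp_all add: lin_zero[OF HH_vs assms(1) l] lin_add[OF l] lin_smult[OF l]\<close>)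
  then have "carrier ?T \<subseteq> {t \<in> carrier ?T. ?l t \<in> U}"
    by (rule tensor_induct[OF H_vs H_vs])
      (simp add: tensor_lift_tens[OF H_vs H_vs assms(1,3)] assms(5) bilin_closed[OF tens_bilin[OF H_vs H_vs]])
  then show ?thesis
    using comult_closed[OF assms(2)] unfolding sweedler_def by blast
qed

lemma lmod_opm: "lmod W \<Longrightarrow> opm (carrier H) W"
  unfolding opm_def using lmod_vs bilin_lin2[OF lmod_bilin] by auto

section \<open>The trivial module\<close>

lemma trivial_same: "same_space (trivial_module K H) (ground K)"
  by (simp add: trivial_module_def)

lemma trivial_sel:
  "carrier (trivial_module K H) = carrier K" "zero (trivial_module K H) = \<zero>\<^bsub>K\<^esub>"
  "add (trivial_module K H) = add K" "smult (trivial_module K H) = mult K"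
  "act (trivial_module K H) = (\<lambda>h c. counit H h \<otimes>\<^bsub>K\<^esub> c)"
  using trivial_same by (simp_all add: same_space_def trivial_module_def)

lemma trivial_lmod: "lmod (trivial_module K H)"
proof (rule lmodI)
  show "vsp (trivial_module K H)"
    by (rule same_space_vsp[OF trivial_same ground_vs])
  show "bilin H (trivial_module K H) (trivial_module K H) (act (trivial_module K H))"
    unfolding trivial_sel(5)
    by (intro bilinI linI)
      (simp_all add: trivial_sel lin_add[OF counit_lin] lin_smult[OF counit_lin] l_distr r_distr m_ac)
qed (simp_all add: trivial_sel hopf_algebra.counit_mult[OF hopf] hopf_algebra.counit_one[OF hopf] m_assoc)

text \<open>On the trivial module \<open>h\<close> acts as the scalar given by the counit, and
  homomorphisms preserve this. For \<open>f\<close> the identity it says that a module dividing the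
  trivial one has trivial action.\<close>

lemma fac_trivial:
  assumes "fac (carrier H) M (trivial_module K H) N f" "lmod N" "h \<in> carrier H" "x \<in> carrier M"
  shows "act N h (f x) = counit H h \<odot>\<^bsub>N\<^esub> f x"
  using assms(1)
proof induction
  case (fac_zero f)
  show ?case
    using lmod_vs[OF assms(2)] assms(3,4)
    by (simp add: fac_zero lin_zero[OF lmod_vs[OF assms(2)] lmod_vs[OF assms(2)] bilin_lin2[OF lmod_bilin[OF assms(2)]]])
next
  case (fac_step f g k k')
  have c: "f x \<in> carrier (trivial_module K H)" "k x \<in> carrier N" "g (f x) \<in> carrier N"
    using op_hom_closed[OF fac_step.hyps(1) assms(4)] fac_closed[OF fac_step.hyps(3) lmod_vs[OF assms(2)] assms(4)]
      op_hom_closed[OF fac_step.hyps(2)] by auto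
  have "act N h (g (f x)) = g (act (trivial_module K H) h (f x))"
    by (simp add: op_hom_act[OF fac_step.hyps(2) assms(3) c(1)])
  also have "\<dots> = g (counit H h \<odot>\<^bsub>trivial_module K H\<^esub> f x)"
    by (simp add: trivial_sel)
  also have "\<dots> = counit H h \<odot>\<^bsub>N\<^esub> g (f x)"
    by (rule lin_smult[OF op_hom_lin[OF fac_step.hyps(2)] counit_closed[OF assms(3)] c(1)])
  finally show ?case
    using c assms(3) fac_step.IH
    by (simp add: fac_step.hyps(4)[OF assms(4)] lin_add[OF bilin_lin2[OF lmod_bilin[OF assms(2)] assms(3)]]
        vs_smult_add[OF lmod_vs[OF assms(2)]])
qed

end

context smash_ground
begin

section \<open>The tensor powers are induced bimodules\<close>

text \<open>The coefficient of a single factor is a multiple of the empty tensor, on which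
  \<open>H\<close> acts through the counit, so the sum in \<open>st\<close> collapses.\<close>

lemma pl_single:
  assumes "functional \<xi>" "a \<in> carrier A" "h \<in> carrier H"
  shows "pl [sm a h] \<xi> = \<xi> h \<odot>\<^bsub>X 1\<^esub> tpow_gen K A [a]"
proof -
  let ?n = "tpow_gen K A []"
  have n: "?n \<in> carrier (X 0)"
    by (rule TP_gen_closed[OF A_lmod]) simp
  have \<xi>c: "\<xi> k \<in> carrier K" if "k \<in> carrier H" for k
    using lin_closed[OF assms(1) that] by simp
  have e: "lin H (X 0) (\<lambda>k. \<xi> (k \<otimes>\<^bsub>H\<^esub> \<one>\<^bsub>H\<^esub>) \<odot>\<^bsub>X 0\<^esub> ?n)"
    by (intro smult_lin1[OF X_vs] lin_comp[OF H_mult_lin1 assms(1)] lin_id n H_closed)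
  have l: "lin H (X 1) (\<lambda>k. \<xi> k \<odot>\<^bsub>X 1\<^esub> tpow_gen K A [a])"
    by (intro smult_lin1[OF X_vs assms(1)] X1_gen_closed assms)
  have "pl [sm a h] \<xi> = st 0 (sm a h) (\<lambda>k. \<xi> (k \<otimes>\<^bsub>H\<^esub> \<one>\<^bsub>H\<^esub>) \<odot>\<^bsub>X 0\<^esub> ?n)"
    by simp
  also have "\<dots> = sw (X 1) (\<lambda>h1 h2. tcons A 0 a (act (X 0) h1 (\<xi> (h2 \<otimes>\<^bsub>H\<^esub> \<one>\<^bsub>H\<^esub>) \<odot>\<^bsub>X 0\<^esub> ?n))) h"
    unfolding One_nat_def by (rule st_sm[OF e assms(2,3)])
  also have "\<dots> = sw (X 1) (\<lambda>h1 h2. counit H h1 \<odot>\<^bsub>X 1\<^esub> (\<xi> h2 \<odot>\<^bsub>X 1\<^esub> tpow_gen K A [a])) h"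
  proof (rule sw_cong[OF X_vs assms(3) counit_smult_bilin(1)[OF X_vs l]])
    fix h1 h2 assume h12: "h1 \<in> carrier H" "h2 \<in> carrier H"
    show "tcons A 0 a (act (X 0) h1 (\<xi> (h2 \<otimes>\<^bsub>H\<^esub> \<one>\<^bsub>H\<^esub>) \<odot>\<^bsub>X 0\<^esub> ?n)) =
        counit H h1 \<odot>\<^bsub>X 1\<^esub> (\<xi> h2 \<odot>\<^bsub>X 1\<^esub> tpow_gen K A [a])"
      using h12 n assms X1_gen_closed[OF assms(2)]
      by (simp add: \<xi>c lin_smult[OF bilin_lin2[OF TP_act_bilin[OF A_lmod]]] TP_act_nil[OF A_lmod] X_vs
          lin_smult[OF bilin_lin2[OF TP_tcons[OF A_lmod]]] gen_singleton vs_smult_commute[OF X_vs])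
  qed
  also have "\<dots> = \<xi> h \<odot>\<^bsub>X 1\<^esub> tpow_gen K A [a]"
    by (rule sw_counit_left[OF X_vs assms(3) l])
  finally show ?thesis .
qed

text \<open>The element corresponds to x \<otimes> h, so its coefficient should be \<xi>(h) x. In
  the induction the new factor is a # 1; the coproduct of 1 has one term, and \<open>st\<close> only
  prepends \<open>a\<close>. The functional varies because the recursion shifts it, and the base is
  the one-factor power, where the two actions of \<open>H\<close> first make sense.\<close>

lemma pc_yr_jm:
  assumes "functional \<xi>" "h \<in> carrier H" "x \<in> carrier (X (Suc m))"
  shows "pc (Suc m) \<xi> (yr (Suc m) (jm (Suc m) x) h) = \<xi> h \<odot>\<^bsub>X (Suc m)\<^esub> x"
  using assms
proof (induction m arbitrary: x \<xi>)
  case 0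
  have \<xi>h: "\<xi> h \<in> carrier K"
    using lin_closed[OF 0(1,2)] by simp
  show ?case
  proof (rule X1_hom_ext[unfolded One_nat_def, OF X_vs lin_comp[OF yr_lin1[OF _ 0(2) jm_lin] pc_lin[OF 0(1)]]
        lin_smult_fun[OF X_vs \<xi>h lin_id] _ 0(3)])
    fix a assume a: "a \<in> carrier A"
    then have "jm (Suc 0) (tpow_gen K A [a]) = yg (Suc 0) [sm a \<one>\<^bsub>H\<^esub>]"
      by (simp add: jm_gen)
    then have "yr (Suc 0) (jm (Suc 0) (tpow_gen K A [a])) h = yg (Suc 0) [sm a h]"
      using a 0(2) by (simp add: yr_gen Rm_sm)
    then show "pc (Suc 0) \<xi> (yr (Suc 0) (jm (Suc 0) (tpow_gen K A [a])) h) = \<xi> h \<odot>\<^bsub>X (Suc 0)\<^esub> tpow_gen K A [a]"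
      using a 0(1,2) pl_single[OF 0(1) a 0(2)] by (simp add: pc_gen del: pl.simps)
  qed simp
next
  case (Suc m)
  let ?n = "Suc m"
  note \<xi> = Suc.prems(1) and h = Suc.prems(2)
  have \<xi>c: "\<xi> k \<in> carrier K" if "k \<in> carrier H" for k
    using lin_closed[OF \<xi> that] by simp
  show ?case
  proof (rule TP_Suc_hom_ext[OF A_lmod X_vs lin_comp[OF yr_lin1[OF _ h jm_lin] pc_lin[OF \<xi>]]
        lin_smult_fun[OF X_vs \<xi>c[OF h] lin_id] _ Suc.prems(3)])
    fix a x assume a: "a \<in> carrier A" and x: "x \<in> carrier (X ?n)"
    let ?y = "yr ?n (jm ?n x) h"
    have y: "?y \<in> carrier (Y ?n)"
      using x h by (intro yr_closed jm_closed) simp_all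
    have e: "lin H (X ?n) (\<lambda>k. \<xi> (k \<otimes>\<^bsub>H\<^esub> h) \<odot>\<^bsub>X ?n\<^esub> x)"
      by (intro smult_lin1[OF X_vs] lin_comp[OF H_mult_lin1 \<xi>] lin_id x h)
    have "pc (Suc ?n) \<xi> (yr (Suc ?n) (jm (Suc ?n) (tcons A ?n a x)) h) =
        st ?n (sm a \<one>\<^bsub>H\<^esub>) (\<lambda>k. pc ?n (\<lambda>l. \<xi> (k \<otimes>\<^bsub>H\<^esub> l)) ?y)"
      using a x h y by (simp add: jm_tcons yr_yc jm_closed pc_yc[OF \<xi>])
    also have "\<dots> = st ?n (sm a \<one>\<^bsub>H\<^esub>) (\<lambda>k. \<xi> (k \<otimes>\<^bsub>H\<^esub> h) \<odot>\<^bsub>X ?n\<^esub> x)"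
      by (rule st_cong[OF e _ sm_closed[OF a H_closed(1)], symmetric])
        (rule Suc.IH[OF functional_shift[OF \<xi>] h x, symmetric])
    also have "\<dots> = \<xi> h \<odot>\<^bsub>X (Suc ?n)\<^esub> tcons A ?n a x"
      using a x h \<xi>c[OF h]
      by (simp add: st_sm[OF e a H_closed(1)] sw_one[OF X_vs st_inner[OF e a]] X_vs
          left_module.act_one[OF TP_lmod[OF A_lmod]] lin_smult[OF bilin_lin2[OF TP_tcons[OF A_lmod]]])
    finally show "pc (Suc ?n) \<xi> (yr (Suc ?n) (jm (Suc ?n) (tcons A ?n a x)) h) =
        \<xi> h \<odot>\<^bsub>X (Suc ?n)\<^esub> tcons A ?n a x" .
  qed simp
qed

lemma yr_jm_bilin:
  assumes "0 < n" "x \<in> carrier (X n)"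
  shows "bilin H H (Y n) (\<lambda>a b. yr n (jm n (act (X n) a x)) b)"
  using assms
  by (intro bilinI yr_lin1 yr_lin2 lin_comp[OF X_act_lin1 jm_lin] lin_id jm_closed X_act_closed)

text \<open>Left multiplication turns the first factor a # 1 into h1.a # h2. The component h2 is
  moved across the tensor sign, acts on the remaining factors by induction, and coassociativity
  reassembles a diagonal action.\<close>

lemma yl_jm:
  assumes "h \<in> carrier H" "x \<in> carrier (X (Suc m))"
  shows "yl (Suc m) h (jm (Suc m) x) = sw (Y (Suc m)) (\<lambda>a b. yr (Suc m) (jm (Suc m) (act (X (Suc m)) a x)) b) h"
  using assms
proof (induction m arbitrary: x h)
  case 0
  show ?case
  proof (rule X1_hom_ext[unfolded One_nat_def, OF Y_vs yl_lin2[OF _ 0(1) jm_lin]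
        sw_param[OF X_vs Y_vs 0(1) yr_jm_bilin yr_lin1[OF _ _ lin_comp[OF X_act_lin2[OF _ lin_id] jm_lin]]] _ 0(2)])
    fix a assume a: "a \<in> carrier A"
    have g: "lin C (Y (Suc 0)) (\<lambda>c. yg (Suc 0) [c])"
      by (rule mlin_Cons_lin[OF yg_mlin _ C_vs]) simp
    have b: "bilin H H C (\<lambda>b1 b2. sm (act A b1 a) (b2 \<otimes>\<^bsub>H\<^esub> \<one>\<^bsub>H\<^esub>))"
      by (rule Lm_inner[OF a H_closed(1)])
    have "yl (Suc 0) h (jm (Suc 0) (tpow_gen K A [a])) = yg (Suc 0) [Lm h (sm a \<one>\<^bsub>H\<^esub>)]"
      using a 0(1) by (simp add: jm_gen yl_gen)
    also have "\<dots> = sw (Y (Suc 0)) (\<lambda>b1 b2. yg (Suc 0) [sm (act A b1 a) (b2 \<otimes>\<^bsub>H\<^esub> \<one>\<^bsub>H\<^esub>)]) h"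
      unfolding Lm_sm[OF 0(1) a H_closed(1)] by (rule sw_hom[OF C_vs Y_vs g 0(1) b])
    also have "\<dots> = sw (Y (Suc 0)) (\<lambda>b1 b2. yr (Suc 0) (jm (Suc 0) (act (X (Suc 0)) b1 (tpow_gen K A [a]))) b2) h"
      using a X1_gen_closed[OF a]
      by (intro sw_cong[OF Y_vs 0(1) yr_jm_bilin])
        (simp_all add: X1_act_gen[unfolded One_nat_def] jm_gen yr_gen Rm_sm A_act_closed)
    finally show "yl (Suc 0) h (jm (Suc 0) (tpow_gen K A [a])) =
        sw (Y (Suc 0)) (\<lambda>b1 b2. yr (Suc 0) (jm (Suc 0) (act (X (Suc 0)) b1 (tpow_gen K A [a]))) b2) h" .
  qed simp_all
next
  case (Suc m)
  let ?n = "Suc m" and ?N = "Suc (Suc m)"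
  note h = Suc.prems(1)
  show ?case
  proof (rule TP_Suc_hom_ext[OF A_lmod Y_vs yl_lin2[OF _ h jm_lin]
        sw_param[OF X_vs Y_vs h yr_jm_bilin yr_lin1[OF _ _ lin_comp[OF X_act_lin2[OF _ lin_id] jm_lin]]] _ Suc.prems(2)])
    fix a x assume a: "a \<in> carrier A" and x: "x \<in> carrier (X ?n)"
    let ?G = "\<lambda>u v w. yc ?n (sm (act A u a) \<one>\<^bsub>H\<^esub>) (yr ?n (jm ?n (act (X ?n) v x)) w)"
    have n: "0 < ?n" by simp
    have jx: "jm ?n x \<in> carrier (Y ?n)"
      by (rule jm_closed[OF x])
    note cl = A_act_closed X_act_closed jm_closed H_closed sm_closed yr_closed[OF n]
    have G: "trilin (Y ?N) ?G"
      using a x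
      by (intro trilinI yc_lin1 yc_lin2 sm_lin1 A_act_lin1 yr_lin1[OF n] yr_lin2[OF n]
          lin_comp[OF X_act_lin1 jm_lin] lin_id cl)
    have ycl: "lin C (Y ?N) (\<lambda>c. yc ?n c (jm ?n x))"
      by (rule yc_lin1[OF jx lin_id])
    have "yl ?N h (jm ?N (tcons A ?n a x)) = yc ?n (Lm h (sm a \<one>\<^bsub>H\<^esub>)) (jm ?n x)"
      using a x h jx by (simp add: jm_tcons yl_yc)
    also have "\<dots> = sw (Y ?N) (\<lambda>b1 b2. yc ?n (sm (act A b1 a) (b2 \<otimes>\<^bsub>H\<^esub> \<one>\<^bsub>H\<^esub>)) (jm ?n x)) h"
      unfolding Lm_sm[OF h a H_closed(1)] by (rule sw_hom[OF C_vs Y_vs ycl h Lm_inner[OF a H_closed(1)]])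
    also have "\<dots> = sw (Y ?N) (\<lambda>u b2. sw (Y ?N) (\<lambda>v w. ?G u v w) b2) h"
    proof (rule sw_cong[OF Y_vs h trilin_swR[OF Y_vs G]])
      fix u b2 assume u: "u \<in> carrier H" and b2: "b2 \<in> carrier H"
      have c: "sm (act A u a) \<one>\<^bsub>H\<^esub> \<in> carrier C"
        using u a by (intro cl)
      \<comment> \<open>The Hopf component of the first factor is a right multiplication of (u.a) #
        1, so balancing hands it to the next factor.\<close>
      have "yc ?n (sm (act A u a) (b2 \<otimes>\<^bsub>H\<^esub> \<one>\<^bsub>H\<^esub>)) (jm ?n x) = yc ?n (Rm (sm (act A u a) \<one>\<^bsub>H\<^esub>) b2) (jm ?n x)"
        using u b2 a by (simp add: Rm_sm A_act_closed)
      also have "\<dots> = yc ?n (sm (act A u a) \<one>\<^bsub>H\<^esub>) (yl ?n b2 (jm ?n x))"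
        by (rule yc_balance[OF n b2 c jx])
      also have "\<dots> = sw (Y ?N) (\<lambda>v w. ?G u v w) b2"
        unfolding Suc.IH[OF b2 x]
        by (rule sw_hom[OF Y_vs Y_vs yc_lin2[OF c lin_id] b2 yr_jm_bilin[OF n x]])
      finally show "yc ?n (sm (act A u a) (b2 \<otimes>\<^bsub>H\<^esub> \<one>\<^bsub>H\<^esub>)) (jm ?n x) = sw (Y ?N) (\<lambda>v w. ?G u v w) b2" .
    qed
    also have "\<dots> = sw (Y ?N) (\<lambda>b1 w. sw (Y ?N) (\<lambda>u v. ?G u v w) b1) h"
      by (rule sw_coassoc[OF Y_vs h G, symmetric])
    also have "\<dots> = sw (Y ?N) (\<lambda>b1 b2. yr ?N (jm ?N (act (X ?N) b1 (tcons A ?n a x))) b2) h"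
    proof (rule sw_cong[OF Y_vs h yr_jm_bilin[OF _ X_tcons_closed[OF a x]]])
      fix b1 w assume b1: "b1 \<in> carrier H" and w: "w \<in> carrier H"
      have l: "lin (X ?N) (Y ?N) (\<lambda>t. yr ?N (jm ?N t) w)"
        by (rule yr_lin1[OF _ w jm_lin]) simp
      have "yr ?N (jm ?N (act (X ?N) b1 (tcons A ?n a x))) w =
          sw (Y ?N) (\<lambda>u v. yr ?N (jm ?N (tcons A ?n (act A u a) (act (X ?n) v x))) w) b1"
        unfolding TP_act_tcons[OF A_lmod b1 a x]
        by (rule sw_hom[OF X_vs Y_vs l b1 TP_diag_bilin[OF A_lmod a x]])
      also have "\<dots> = sw (Y ?N) (\<lambda>u v. ?G u v w) b1"
        by (rule sw_cong[OF Y_vs b1 trilin_bilin(3)[OF G w]])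
          (simp add: jm_tcons yr_yc cl a x w)
      finally show "sw (Y ?N) (\<lambda>u v. ?G u v w) b1 = yr ?N (jm ?N (act (X ?N) b1 (tcons A ?n a x))) w" ..
    qed simp
    finally show "yl ?N h (jm ?N (tcons A ?n a x)) =
        sw (Y ?N) (\<lambda>b1 b2. yr ?N (jm ?N (act (X ?N) b1 (tcons A ?n a x))) b2) h" .
  qed simp_all
qed

text \<open>A factor a # h equals a # 1 multiplied by \<open>h\<close> on the right, so
  \<open>h\<close> can be pushed into the remaining factors. By induction these are spanned by right
  translates of the image of \<open>jm\<close>, and \<open>yl_jm\<close> tells how \<open>h\<close>
  acts on those.\<close>

lemma Y_spanning:
  assumes "subm U (Y (Suc m))"
    "\<And>x h. x \<in> carrier (X (Suc m)) \<Longrightarrow> h \<in> carrier H \<Longrightarrow> yr (Suc m) (jm (Suc m) x) h \<in> U"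
  shows "carrier (Y (Suc m)) \<subseteq> U"
  using assms
proof (induction m arbitrary: U)
  case 0
  have g: "lin C (Y (Suc 0)) (\<lambda>c. yg (Suc 0) [c])"
    by (rule mlin_Cons_lin[OF yg_mlin _ C_vs]) simp
  have "subm {c \<in> carrier C. yg (Suc 0) [c] \<in> U} C"
    by (rule submI[OF C_vs])
      (use submD[OF 0(1)] in \<open>simp_all add: lin_zero[OF C_vs Y_vs g] lin_add[OF g] lin_smult[OF g]\<close>)
  moreover have "yg (Suc 0) [sm a h] \<in> U" if "a \<in> carrier A" "h \<in> carrier H" for a h
    using 0(2)[OF X1_gen_closed[unfolded One_nat_def, OF that(1)] that(2)] that
    by (simp add: jm_gen yr_gen Rm_sm)
  ultimately have "carrier C \<subseteq> {c \<in> carrier C. yg (Suc 0) [c] \<in> U}"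
    by (intro C_induct) simp_all
  then show ?case
    by (intro Y_induct[OF 0(1)]) (auto elim!: tuples_SucE)
next
  case (Suc m)
  let ?n = "Suc m" and ?N = "Suc (Suc m)"
  note Us = submD[OF Suc.prems(1)]
  have n: "0 < ?n" by simp
  have sub: "subm {v \<in> carrier V. f v \<in> U} V" if "vsp V" "lin V (Y ?N) f"
    for V :: "('k, 'v, 'e) module_scheme" and f
    by (rule submI[OF that(1)])
      (use Us that(1) in \<open>simp_all add: lin_zero[OF that(1) Y_vs that(2)] lin_add[OF that(2)] lin_smult[OF that(2)]\<close>)
  have 1: "yc ?n (sm a h) y \<in> U" if a: "a \<in> carrier A" and h: "h \<in> carrier H" and y: "y \<in> carrier (Y ?n)" for a h y
  proof -
    have l: "lin (Y ?n) (Y ?N) (\<lambda>y. yc ?n (sm a h) y)"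
      by (rule yc_lin2[OF sm_closed[OF a h] lin_id])
    have c: "sm a \<one>\<^bsub>H\<^esub> \<in> carrier C"
      by (rule sm_closed[OF a H_closed(1)])
    have "yc ?n (sm a h) (yr ?n (jm ?n x) k) \<in> U" if x: "x \<in> carrier (X ?n)" and k: "k \<in> carrier H" for x k
    proof -
      have jx: "jm ?n x \<in> carrier (Y ?n)"
        by (rule jm_closed[OF x])
      have l': "lin (Y ?n) (Y ?N) (\<lambda>y. yc ?n (sm a \<one>\<^bsub>H\<^esub>) (yr ?n y k))"
        by (rule yc_lin2[OF c yr_lin1[OF n k lin_id]])
      \<comment> \<open>Here \<open>h\<close> crosses the tensor sign; the right action of
        \<open>k\<close> commutes with it and remains outermost.\<close>
      have "yc ?n (sm a h) (yr ?n (jm ?n x) k) = yc ?n (Rm (sm a \<one>\<^bsub>H\<^esub>) h) (yr ?n (jm ?n x) k)"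
        using a h by (simp add: Rm_sm)
      also have "\<dots> = yc ?n (sm a \<one>\<^bsub>H\<^esub>) (yr ?n (yl ?n h (jm ?n x)) k)"
        using yc_balance[OF n h c yr_closed[OF n jx k]] yl_yr[OF n jx h k] by simp
      also have "\<dots> = sw (Y ?N) (\<lambda>u v. yc ?n (sm a \<one>\<^bsub>H\<^esub>) (yr ?n (yr ?n (jm ?n (act (X ?n) u x)) v) k)) h"
        unfolding yl_jm[OF h x] by (rule sw_hom[OF Y_vs Y_vs l' h yr_jm_bilin[OF n x]])
      also have "\<dots> \<in> U"
      proof (rule sw_in_subm[OF Y_vs h bilin_lin_comp[OF yr_jm_bilin[OF n x] l'] Suc.prems(1)])
        fix u v assume uv: "u \<in> carrier H" "v \<in> carrier H"
        have ux: "act (X ?n) u x \<in> carrier (X ?n)"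
          by (rule X_act_closed[OF uv(1) x])
        have "yc ?n (sm a \<one>\<^bsub>H\<^esub>) (yr ?n (yr ?n (jm ?n (act (X ?n) u x)) v) k) =
            yr ?N (jm ?N (tcons A ?n a (act (X ?n) u x))) (v \<otimes>\<^bsub>H\<^esub> k)"
          using yr_yr[OF n jm_closed[OF ux] uv(2) k] yr_yc[OF n _ c jm_closed[OF ux]] uv k
          by (simp add: jm_tcons[OF a ux])
        also have "\<dots> \<in> U"
          using uv k by (intro Suc.prems(2) X_tcons_closed[OF a ux] H_closed)
        finally show "yc ?n (sm a \<one>\<^bsub>H\<^esub>) (yr ?n (yr ?n (jm ?n (act (X ?n) u x)) v) k) \<in> U" .
      qed
      finally show ?thesis .
    qed
    then have "carrier (Y ?n) \<subseteq> {y \<in> carrier (Y ?n). yc ?n (sm a h) y \<in> U}"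
      by (intro Suc.IH[OF sub[OF Y_vs l]]) (simp add: yr_closed[OF n] jm_closed)
    then show ?thesis
      using y by blast
  qed
  have 2: "yc ?n c y \<in> U" if "c \<in> carrier C" "y \<in> carrier (Y ?n)" for c y
  proof -
    have "carrier C \<subseteq> {c \<in> carrier C. yc ?n c y \<in> U}"
      by (rule C_induct[OF sub[OF C_vs yc_lin1[OF that(2) lin_id]]]) (simp add: 1 that(2))
    then show ?thesis
      using that(1) by blast
  qed
  show ?case
  proof (rule Y_induct[OF Suc.prems(1)])
    fix xs assume "xs \<in> tuples C ?N"
    then obtain c cs where c: "xs = c # cs" "c \<in> carrier C" "cs \<in> tuples C ?n"
      by (rule tuples_SucE)
    then show "yg ?N xs \<in> U"
      using 2[OF c(2) yg_closed[OF c(3)]] by (simp add: yc_gen)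
  qed
qed

lemma yr_one:
  assumes "0 < n" "y \<in> carrier (Y n)"
  shows "yr n y \<one>\<^bsub>H\<^esub> = y"
proof (rule Y_hom_ext[OF Y_vs yr_lin1[OF assms(1) H_closed(1) lin_id] lin_id _ assms(2)])
  fix xs assume xs: "xs \<in> tuples C n"
  have "Rm c \<one>\<^bsub>H\<^esub> = c" if "c \<in> carrier C" for c
    by (rule C_hom_ext[OF C_vs Rm_lin1[OF H_closed(1) lin_id] lin_id _ that]) (simp add: Rm_sm)
  then show "yr n (yg n xs) \<one>\<^bsub>H\<^esub> = yg n xs"
    using assms(1) xs by (simp add: yr_gen)
qed

lemma Y_induced:
  assumes "0 < n"
  shows "induced_bimodule K H (sm \<one>\<^bsub>A\<^esub>) (X n) (Y n) (jm n)"
proof -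
  obtain m where m: "n = Suc m"
    using assms by (cases n) auto
  show ?thesis
  proof (intro induced_bimodule.intro induced_bimodule_axioms.intro hopf_ground_axioms TP_lmod[OF A_lmod]
      Y_vs jm_lin; unfold yl_def[symmetric] yr_def[symmetric])
    show "lin (Y n) (Y n) (yl n h)" if "h \<in> carrier H" for h
      using bilin_lin2[OF yl_bilin[OF assms] that] .
    show "\<exists>p\<in>LinearCombinations.module_hom K (Y n) (X n). \<forall>x\<in>carrier (X n). \<forall>h\<in>carrier H.
        p (yr n (jm n x) h) = \<xi> h \<odot>\<^bsub>X n\<^esub> x" if "functional \<xi>" for \<xi>
      by (intro bexI[of _ "pc n \<xi>"] pc_lin[OF that] ballI) (simp only: m pc_yr_jm[OF that])
    show "carrier (Y n) \<subseteq> U" if "subm U (Y n)"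
      "\<And>x h. x \<in> carrier (X n) \<Longrightarrow> h \<in> carrier H \<Longrightarrow> yr n (jm n x) h \<in> U" for U
      using that unfolding m by (rule Y_spanning)
    show "yl n h (jm n x) = sw (Y n) (\<lambda>a b. yr n (jm n (act (X n) a x)) b) h"
      if "h \<in> carrier H" "x \<in> carrier (X n)" for h x
      using that unfolding m by (rule yl_jm)
  qed (simp_all add: yr_bilin[OF assms] yr_one[OF assms] yr_yr[OF assms] yl_yr[OF assms])
qed

end

context smash_ground
begin

section \<open>The zeroth tensor power as a bimodule\<close>

abbreviation B where "B \<equiv> smash_copy K H A"
abbreviation reg where "reg \<equiv> regular_bimodule C B"

lemma B_eq: "B = sm \<one>\<^bsub>A\<^esub> ` carrier H"
  by (simp add: smash_copy_def)

lemma B_mem: "x \<in> B \<longleftrightarrow> (\<exists>h\<in>carrier H. x = sm \<one>\<^bsub>A\<^esub> h)"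
  by (auto simp: B_eq)

lemma B_subm: "subm B C"
proof (rule submI[OF C_vs])
  note l = bilin_lin2[OF sm_bilin A_closed(1)]
  show "\<zero>\<^bsub>C\<^esub> \<in> B"
    unfolding B_eq using lin_zero[OF H_vs C_vs l] by (intro image_eqI[of _ _ "\<zero>\<^bsub>H\<^esub>"]) simp_all
  show "x \<oplus>\<^bsub>C\<^esub> y \<in> B" if "x \<in> B" "y \<in> B" for x y
    using that unfolding B_eq by (auto simp: lin_add[OF l, symmetric])
  show "c \<odot>\<^bsub>C\<^esub> x \<in> B" if "c \<in> carrier K" "x \<in> B" for c x
    using that unfolding B_eq by (auto simp: lin_smult[OF l, symmetric])
qed (auto simp: B_eq)

lemma reg_sel:
  "carrier reg = B" "zero reg = \<zero>\<^bsub>C\<^esub>" "add reg = add C" "smult reg = smult C"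
  "act reg (Inl b) x = b \<otimes>\<^bsub>C\<^esub> x" "act reg (Inr b) x = x \<otimes>\<^bsub>C\<^esub> b"
  using same_space_with_act[of "C\<lparr>carrier := B\<rparr>" "case_sum (\<lambda>b x. b \<otimes>\<^bsub>C\<^esub> x) (\<lambda>b x. x \<otimes>\<^bsub>C\<^esub> b)"]
  by (simp_all add: regular_bimodule_def same_space_def)

lemma reg_vs: "vsp reg"
proof (rule same_space_vsp)
  show "same_space reg (C\<lparr>carrier := B\<rparr>)"
    by (simp add: regular_bimodule_def)
  show "vsp (C\<lparr>carrier := B\<rparr>)"
    by (rule subm_vs[OF C_vs B_subm])
qed

lemma Rm_sm_one: "h \<in> carrier H \<Longrightarrow> g \<in> carrier H \<Longrightarrow> Rm (sm \<one>\<^bsub>A\<^esub> h) g = sm \<one>\<^bsub>A\<^esub> (h \<otimes>\<^bsub>H\<^esub> g)"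
  by (simp add: Rm_sm)

lemma Lm_sm_one: "h \<in> carrier H \<Longrightarrow> g \<in> carrier H \<Longrightarrow> Lm h (sm \<one>\<^bsub>A\<^esub> g) = sm \<one>\<^bsub>A\<^esub> (h \<otimes>\<^bsub>H\<^esub> g)"
  using Rm_sm_one[of h g] by (simp add: Lm_def Rm_def)

lemma lin_into_reg:
  assumes "lin V C f" "\<And>x. x \<in> carrier V \<Longrightarrow> f x \<in> B"
  shows "lin V reg f"
  by (rule linI) (simp_all add: assms(2) reg_sel lin_add[OF assms(1)] lin_smult[OF assms(1)])

lemma sm_one_lin: "lin H reg (sm \<one>\<^bsub>A\<^esub>)"
  by (rule lin_into_reg[OF bilin_lin2[OF sm_bilin A_closed(1)]]) (auto simp: B_mem)

lemma lin_from_reg: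
  assumes "lin C V f"
  shows "lin reg V f"
  by (rule linI)
    (simp_all add: reg_sel subsetD[OF submD(1)[OF B_subm]] lin_closed[OF assms] lin_add[OF assms]
      lin_smult[OF assms])

text \<open>The map a # h \<mapsto> \<xi>(h) a is defined on all of \<open>C\<close> and sends
  \<open>B\<close> into the line spanned by the unit of \<open>A\<close>. As that unit is nonzero,
  the scalar can be read off.\<close>

lemma reg_coefficient:
  assumes \<xi>: "functional \<xi>" and nz: "\<one>\<^bsub>A\<^esub> \<noteq> \<zero>\<^bsub>A\<^esub>"
  shows "\<exists>p. lin reg (trivial_module K H) p \<and> (\<forall>h\<in>carrier H. p (sm \<one>\<^bsub>A\<^esub> h) = \<xi> h)"
proof -
  have \<xi>c: "\<xi> k \<in> carrier K" if "k \<in> carrier H" for k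
    using lin_closed[OF \<xi> that] by simp
  have b: "bilin A H A (\<lambda>a h. \<xi> h \<odot>\<^bsub>A\<^esub> a)"
    by (intro bilinI smult_lin1[OF A_vs \<xi>] lin_smult_fun[OF A_vs] lin_id \<xi>c)
  \<comment> \<open>Going through \<open>A\<close> avoids having to invert h \<mapsto> 1 # h on
    \<open>B\<close>.\<close>
  define q where "q = lift K A (\<lambda>(a, h). \<xi> h \<odot>\<^bsub>A\<^esub> a)"
  have q: "q (sm \<one>\<^bsub>A\<^esub> h) = \<xi> h \<odot>\<^bsub>A\<^esub> \<one>\<^bsub>A\<^esub>" if "h \<in> carrier H" for h
    unfolding q_def using C_lift_sm[OF A_vs b A_closed(1) that] .
  have inj: "c = d" if "c \<in> carrier K" "d \<in> carrier K" "c \<odot>\<^bsub>A\<^esub> \<one>\<^bsub>A\<^esub> = d \<odot>\<^bsub>A\<^esub> \<one>\<^bsub>A\<^esub>" for c d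
  proof (rule ccontr)
    assume ne: "c \<noteq> d"
    let ?e = "c \<ominus>\<^bsub>K\<^esub> d"
    have e: "?e \<in> carrier K" "?e \<noteq> \<zero>\<^bsub>K\<^esub>"
      using that ne minus_equality[of c "\<ominus>\<^bsub>K\<^esub> d"] by (auto simp: a_minus_def)
    have "?e \<odot>\<^bsub>A\<^esub> \<one>\<^bsub>A\<^esub> = c \<odot>\<^bsub>A\<^esub> \<one>\<^bsub>A\<^esub> \<oplus>\<^bsub>A\<^esub> (\<ominus>\<^bsub>K\<^esub> d) \<odot>\<^bsub>A\<^esub> \<one>\<^bsub>A\<^esub>"
      using that by (simp add: a_minus_def vs_add_smult)
    also have "\<dots> = (d \<ominus>\<^bsub>K\<^esub> d) \<odot>\<^bsub>A\<^esub> \<one>\<^bsub>A\<^esub>"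
      unfolding that(3) using that(2) by (simp add: a_minus_def vs_add_smult)
    also have "\<dots> = \<zero>\<^bsub>A\<^esub>"
      using that(2) by (simp add: r_neg a_minus_def)
    finally have "inv\<^bsub>K\<^esub> ?e \<odot>\<^bsub>A\<^esub> (?e \<odot>\<^bsub>A\<^esub> \<one>\<^bsub>A\<^esub>) = \<zero>\<^bsub>A\<^esub>"
      using e by (simp add: field_Units)
    moreover have "inv\<^bsub>K\<^esub> ?e \<odot>\<^bsub>A\<^esub> (?e \<odot>\<^bsub>A\<^esub> \<one>\<^bsub>A\<^esub>) = (inv\<^bsub>K\<^esub> ?e \<otimes>\<^bsub>K\<^esub> ?e) \<odot>\<^bsub>A\<^esub> \<one>\<^bsub>A\<^esub>"
      using e by (intro vs_mult_smult[symmetric]) (simp_all add: field_Units)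
    ultimately show False
      using e nz by (simp add: field_Units)
  qed
  \<comment> \<open>Unique by \<open>inj\<close>; outside \<open>B\<close> the description may fail,
    but \<open>p\<close> is only used on \<open>B\<close>.\<close>
  define p where "p y = (THE c. c \<in> carrier K \<and> c \<odot>\<^bsub>A\<^esub> \<one>\<^bsub>A\<^esub> = q y)" for y
  have p: "p (sm \<one>\<^bsub>A\<^esub> h) = \<xi> h" if "h \<in> carrier H" for h
    unfolding p_def q[OF that] using \<xi>c[OF that] inj by (intro the_equality) blast+
  note l = sm_one_lin
  have "lin reg (trivial_module K H) p"
  proof (rule linI)
    fix x assume "x \<in> carrier reg"
    then obtain h where h: "h \<in> carrier H" "x = sm \<one>\<^bsub>A\<^esub> h"
      by (auto simp: reg_sel B_mem)
    show "p x \<in> carrier (trivial_module K H)"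
      using h by (simp add: p \<xi>c trivial_sel)
    show "p (x \<oplus>\<^bsub>reg\<^esub> y) = p x \<oplus>\<^bsub>trivial_module K H\<^esub> p y" if y: "y \<in> carrier reg" for y
    proof -
      obtain g where g: "g \<in> carrier H" "y = sm \<one>\<^bsub>A\<^esub> g"
        using y by (auto simp: reg_sel B_mem)
      show ?thesis
        using h g by (simp add: lin_add[OF l, symmetric] p lin_add[OF \<xi>] trivial_sel)
    qed
    show "p (c \<odot>\<^bsub>reg\<^esub> x) = c \<odot>\<^bsub>trivial_module K H\<^esub> p x" if "c \<in> carrier K" for c
      using h that by (simp add: lin_smult[OF l, symmetric] p lin_smult[OF \<xi>] trivial_sel)
  qed
  with p show ?thesis by blast
qed

text \<open>For the trivial module, k \<otimes> H is \<open>H\<close> itself with both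
  multiplications, realized as 1 # H inside \<open>C\<close>; the map \<open>j\<close> sends a
  scalar to that multiple of the unit. This puts depth 1 on the same footing as the higher odd
  depths.\<close>

lemma reg_induced:
  assumes nz: "\<one>\<^bsub>A\<^esub> \<noteq> \<zero>\<^bsub>A\<^esub>"
  shows "induced_bimodule K H (sm \<one>\<^bsub>A\<^esub>) (trivial_module K H) reg (\<lambda>c. c \<odot>\<^bsub>C\<^esub> sm \<one>\<^bsub>A\<^esub> \<one>\<^bsub>H\<^esub>)"
proof -
  let ?j = "\<lambda>c. c \<odot>\<^bsub>C\<^esub> sm \<one>\<^bsub>A\<^esub> \<one>\<^bsub>H\<^esub>"
  have L: "act reg (Inl (sm \<one>\<^bsub>A\<^esub> h)) y = Lm h y" and R: "act reg (Inr (sm \<one>\<^bsub>A\<^esub> h)) y = Rm y h" for h y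
    by (simp_all add: reg_sel Lm_def Rm_def)
  have BE: thesis if "y \<in> carrier reg" "\<And>h. h \<in> carrier H \<Longrightarrow> y = sm \<one>\<^bsub>A\<^esub> h \<Longrightarrow> thesis" for y thesis
    using that unfolding reg_sel B_mem by blast
  have Bc: "y \<in> carrier C" if "y \<in> carrier reg" for y
    using that submD(1)[OF B_subm] by (auto simp: reg_sel)
  have s1: "sm \<one>\<^bsub>A\<^esub> \<one>\<^bsub>H\<^esub> \<in> carrier C"
    by (rule sm_closed[OF A_closed(1) H_closed(1)])
  have jc: "?j c = sm \<one>\<^bsub>A\<^esub> (c \<odot>\<^bsub>H\<^esub> \<one>\<^bsub>H\<^esub>)" if "c \<in> carrier K" for c
    using lin_smult[OF bilin_lin2[OF sm_bilin A_closed(1)] that H_closed(1)] by simp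
  have Rj: "Rm (?j c) h = c \<odot>\<^bsub>C\<^esub> sm \<one>\<^bsub>A\<^esub> h" if "c \<in> carrier K" "h \<in> carrier H" for c h
    using that by (simp add: lin_smult[OF bilin_lin1[OF Rm_bilin]] s1 Rm_sm_one)
  have smB: "sm \<one>\<^bsub>A\<^esub> h \<in> B" if "h \<in> carrier H" for h
    using that by (simp add: B_eq)
  have jl: "lin (trivial_module K H) reg ?j"
  proof (rule lin_into_reg)
    show "lin (trivial_module K H) C ?j"
      using s1 by (intro same_space_lin1[OF trivial_same] smult_lin1[OF C_vs] lin_id)
  qed (simp add: trivial_sel submD(4)[OF B_subm] smB)
  show ?thesis
  proof (intro induced_bimodule.intro induced_bimodule_axioms.intro hopf_ground_axioms trivial_lmod
      reg_vs jl; unfold L R)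
    show "lin reg reg (Lm h)" if h: "h \<in> carrier H" for h
      by (rule lin_into_reg[OF lin_from_reg[OF bilin_lin2[OF Lm_bilin h]]])
        (elim BE, simp add: Lm_sm_one h smB)
    show "bilin reg H reg (\<lambda>y h. Rm y h)"
    proof (rule bilinI; rule lin_into_reg)
      show "lin H C (\<lambda>h. Rm y h)" if "y \<in> carrier reg" for y
        by (rule bilin_lin2[OF Rm_bilin Bc[OF that]])
      show "lin reg C (\<lambda>y. Rm y h)" if "h \<in> carrier H" for h
        by (rule lin_from_reg[OF bilin_lin1[OF Rm_bilin that]])
    qed (elim BE, simp add: Rm_sm_one smB)+
    show "Rm y \<one>\<^bsub>H\<^esub> = y" if "y \<in> carrier reg" for y
      using that by (elim BE) (simp add: Rm_sm_one)
    show "Rm (Rm y g) h = Rm y (g \<otimes>\<^bsub>H\<^esub> h)" if "y \<in> carrier reg" "g \<in> carrier H" "h \<in> carrier H" for y g h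
      by (rule Rm_Rm[OF Bc[OF that(1)] that(2,3)])
    show "Lm h (Rm y g) = Rm (Lm h y) g" if "y \<in> carrier reg" "g \<in> carrier H" "h \<in> carrier H" for y g h
      by (rule Lm_Rm[OF Bc[OF that(1)] that(3,2)])
    show "\<exists>p\<in>LinearCombinations.module_hom K reg (trivial_module K H). \<forall>x\<in>carrier (trivial_module K H).
        \<forall>h\<in>carrier H. p (Rm (?j x) h) = \<xi> h \<odot>\<^bsub>trivial_module K H\<^esub> x" if \<xi>: "functional \<xi>" for \<xi>
    proof -
      obtain p where p: "lin reg (trivial_module K H) p" "\<And>h. h \<in> carrier H \<Longrightarrow> p (sm \<one>\<^bsub>A\<^esub> h) = \<xi> h"
        using reg_coefficient[OF \<xi> nz] by blast
      have "p (Rm (?j x) h) = \<xi> h \<odot>\<^bsub>trivial_module K H\<^esub> x" if "x \<in> carrier K" "h \<in> carrier H" for x h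
        using that lin_smult[OF p(1) that(1), of "sm \<one>\<^bsub>A\<^esub> h"] smB[OF that(2)] lin_closed[OF \<xi> that(2)]
        by (simp add: Rj p(2) trivial_sel reg_sel m_comm)
      then show ?thesis
        by (intro bexI[OF _ p(1)]) (simp add: trivial_sel)
    qed
    show "carrier reg \<subseteq> U" if U: "subm U reg"
      "\<And>x h. x \<in> carrier (trivial_module K H) \<Longrightarrow> h \<in> carrier H \<Longrightarrow> Rm (?j x) h \<in> U" for U
    proof
      fix y assume "y \<in> carrier reg"
      then obtain h where h: "h \<in> carrier H" "y = sm \<one>\<^bsub>A\<^esub> h"
        by (elim BE)
      \<comment> \<open>The scalar 1 already reaches every element of \<open>B\<close> as a right
        translate.\<close>
      show "y \<in> U"
        using U(2)[of "\<one>\<^bsub>K\<^esub>" h] h s1 by (simp add: trivial_sel Rm_sm_one)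
    qed
    show "Lm h (?j x) = sw reg (\<lambda>a b. Rm (?j (act (trivial_module K H) a x)) b) h"
      if h: "h \<in> carrier H" and x: "x \<in> carrier (trivial_module K H)" for h x
    proof -
      have x': "x \<in> carrier K"
        using x by (simp add: trivial_sel)
      have l: "lin H reg (\<lambda>b. x \<odot>\<^bsub>reg\<^esub> sm \<one>\<^bsub>A\<^esub> b)"
        by (rule lin_smult_fun[OF reg_vs x' sm_one_lin])
      have "sw reg (\<lambda>a b. counit H a \<odot>\<^bsub>reg\<^esub> (x \<odot>\<^bsub>reg\<^esub> sm \<one>\<^bsub>A\<^esub> b)) h =
          sw reg (\<lambda>a b. Rm (?j (act (trivial_module K H) a x)) b) h"
        by (rule sw_cong'[OF reg_vs h counit_smult_bilin(1)[OF reg_vs l]])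
          (simp add: reg_sel trivial_sel vs_mult_smult[OF C_vs] lin_smult[OF bilin_lin1[OF Rm_bilin]] s1 x' Rm_sm_one)
      then have "sw reg (\<lambda>a b. Rm (?j (act (trivial_module K H) a x)) b) h = x \<odot>\<^bsub>C\<^esub> sm \<one>\<^bsub>A\<^esub> h"
        using sw_counit_left[OF reg_vs h l] by (simp add: reg_sel)
      then show ?thesis
        using h x' by (simp add: lin_smult[OF bilin_lin2[OF Lm_bilin]] s1 Lm_sm_one)
    qed
  qed
qed

section \<open>Depth\<close>

lemma A_opm: "opm (carrier H) A"
  by (rule lmod_opm[OF A_lmod])

lemma X_opm: "opm (carrier H) (X n)"
  by (rule lmod_opm[OF TP_lmod[OF A_lmod]])

lemma divides_Y_iff:
  assumes "0 < m" "0 < n" "vectorspace.fin_dim K H"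
  shows "divides (Sum_Type.Plus B B) (Y m) (Y n) \<longleftrightarrow> divides (carrier H) (X m) (X n)"
  by (rule induced_pair.divides_induced_iff[OF
        induced_pair.intro[OF Y_induced[OF assms(1)] Y_induced[OF assms(2)]] assms(3), folded B_eq])

lemma Y_opm: "0 < n \<Longrightarrow> opm (Sum_Type.Plus B B) (Y n)"
  by (rule induced_bimodule.Y_opm[OF Y_induced, folded B_eq])

lemma similar_Y_iff:
  assumes "0 < m" "0 < n" "vectorspace.fin_dim K H"
  shows "similar K (Sum_Type.Plus B B) (Y m) (Y n) \<longleftrightarrow>
    divides (carrier H) (X m) (X n) \<and> divides (carrier H) (X n) (X m)"
  by (simp add: similar_iff_divides Y_opm assms divides_Y_iff)

lemma similar_reg_iff:
  assumes "vectorspace.fin_dim K H" "\<one>\<^bsub>A\<^esub> \<noteq> \<zero>\<^bsub>A\<^esub>"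
  shows "similar K (Sum_Type.Plus B B) (Y 1) reg \<longleftrightarrow>
    divides (carrier H) (X 1) (trivial_module K H) \<and> divides (carrier H) (trivial_module K H) (X 1)"
proof -
  have Y1: "induced_bimodule K H (sm \<one>\<^bsub>A\<^esub>) (X 1) (Y 1) (jm 1)"
    by (rule Y_induced) simp
  note r = reg_induced[OF assms(2)]
  have "opm (Sum_Type.Plus B B) reg"
    by (rule induced_bimodule.Y_opm[OF r, folded B_eq])
  then show ?thesis
    using induced_pair.divides_induced_iff[OF induced_pair.intro[OF Y1 r] assms(1), folded B_eq]
      induced_pair.divides_induced_iff[OF induced_pair.intro[OF r Y1] assms(1), folded B_eq]
    by (simp add: similar_iff_divides Y_opm)
qed

text \<open>\<open>H\<close> acts on the unit of \<open>A\<close> through the counit, so in the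
  diagonal action the first component disappears by the counit axiom.\<close>

lemma unit_hom: "tcons A n \<one>\<^bsub>A\<^esub> \<in> op_hom K (carrier H) (X n) (X (Suc n))"
proof (rule op_homI)
  show "lin (X n) (X (Suc n)) (tcons A n \<one>\<^bsub>A\<^esub>)"
    using X_tcons_lin2[OF A_closed(1) lin_id] .
  fix h x assume h: "h \<in> carrier H" and x: "x \<in> carrier (X n)"
  have l: "lin H (X (Suc n)) (\<lambda>b. tcons A n \<one>\<^bsub>A\<^esub> (act (X n) b x))"
    by (intro X_tcons_lin2 X_act_lin1 lin_id x A_closed)
  have "act (X (Suc n)) h (tcons A n \<one>\<^bsub>A\<^esub> x) =
      sw (X (Suc n)) (\<lambda>a b. tcons A n (act A a \<one>\<^bsub>A\<^esub>) (act (X n) b x)) h"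
    by (rule TP_act_tcons[OF A_lmod h A_closed(1) x])
  also have "\<dots> = sw (X (Suc n)) (\<lambda>a b. counit H a \<odot>\<^bsub>X (Suc n)\<^esub> tcons A n \<one>\<^bsub>A\<^esub> (act (X n) b x)) h"
    by (rule sw_cong[OF X_vs h counit_smult_bilin(1)[OF X_vs l]])
      (simp add: module_algebra.act_unit[OF module_algebra] x X_act_closed
        lin_smult[OF bilin_lin1[OF TP_tcons[OF A_lmod]]])
  also have "\<dots> = tcons A n \<one>\<^bsub>A\<^esub> (act (X n) h x)"
    by (rule sw_counit_left[OF X_vs h l])
  finally show "tcons A n \<one>\<^bsub>A\<^esub> (act (X n) h x) = act (X (Suc n)) h (tcons A n \<one>\<^bsub>A\<^esub> x)" ..
qed

text \<open>Multiplication of the first two factors, which undoes prepending the unit. The nested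
  \<open>tlift\<close> reads off one factor at a time.\<close>

definition merge :: "nat \<Rightarrow> ('a list \<Rightarrow> 'k) set \<Rightarrow> ('a list \<Rightarrow> 'k) set" where
  "merge n = tlift A (X (Suc n)) (\<lambda>a. tlift A (X (Suc n)) (\<lambda>b. tcons A n (a \<otimes>\<^bsub>A\<^esub> b)))"

lemma merge_bilin: "a \<in> carrier A \<Longrightarrow> bilin A (tpow K A n) (X (Suc n)) (\<lambda>b. tcons A n (a \<otimes>\<^bsub>A\<^esub> b))"
  by (intro bilinI same_space_lin2[OF TP_same] tcons_lin1[OF A_vs] tcons_lin2[OF A_vs] A_mult_lin2 lin_id A_closed)

lemma merge_bilin2:
  "bilin A (tpow K A (Suc n)) (X (Suc n)) (\<lambda>a. tlift A (X (Suc n)) (\<lambda>b. tcons A n (a \<otimes>\<^bsub>A\<^esub> b)))"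
proof (rule bilinI)
  show "lin (tpow K A (Suc n)) (X (Suc n)) (\<lambda>t. tlift A (X (Suc n)) (\<lambda>b. tcons A n (a \<otimes>\<^bsub>A\<^esub> b)) t)"
    if "a \<in> carrier A" for a
    using tlift_lin[OF A_vs X_vs merge_bilin[OF that]] .
  show "lin A (X (Suc n)) (\<lambda>a. tlift A (X (Suc n)) (\<lambda>b. tcons A n (a \<otimes>\<^bsub>A\<^esub> b)) t)"
    if "t \<in> carrier (tpow K A (Suc n))" for t
    by (intro tlift_param[OF A_vs A_vs X_vs merge_bilin _ that] same_space_lin2[OF TP_same]
        tcons_lin1[OF A_vs] A_mult_lin1 lin_id)
qed

lemma merge_lin: "lin (X (Suc (Suc n))) (X (Suc n)) (merge n)"
  unfolding merge_def by (rule same_space_lin1[OF TP_same tlift_lin[OF A_vs X_vs merge_bilin2]])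

lemma merge_tcons:
  assumes "a \<in> carrier A" "b \<in> carrier A" "x \<in> carrier (X n)"
  shows "merge n (tcons A (Suc n) a (tcons A n b x)) = tcons A n (a \<otimes>\<^bsub>A\<^esub> b) x"
  using assms X_tcons_closed[OF assms(2,3)] unfolding merge_def TP_carrier
  by (simp add: tlift_tcons[OF A_vs X_vs merge_bilin2] tlift_tcons[OF A_vs X_vs merge_bilin])

lemma merge_hom: "merge n \<in> op_hom K (carrier H) (X (Suc (Suc n))) (X (Suc n))"
proof (rule op_homI[OF merge_lin])
  fix h y assume h: "h \<in> carrier H" and y: "y \<in> carrier (X (Suc (Suc n)))"
  let ?Z = "X (Suc n)" and ?W = "X (Suc (Suc n))"
  note act2 = bilin_lin2[OF TP_act_bilin[OF A_lmod] h]
  show "merge n (act ?W h y) = act ?Z h (merge n y)"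
  proof (rule TP_Suc_hom_ext[OF A_lmod X_vs lin_comp[OF act2 merge_lin] X_act_lin2[OF h merge_lin] _ y])
    fix a z assume a: "a \<in> carrier A" and z: "z \<in> carrier ?Z"
    have t: "lin ?Z ?W (\<lambda>z. tcons A (Suc n) a z)"
      by (rule X_tcons_lin2[OF a lin_id])
    show "merge n (act ?W h (tcons A (Suc n) a z)) = act ?Z h (merge n (tcons A (Suc n) a z))"
    proof (rule TP_Suc_hom_ext[OF A_lmod X_vs lin_comp[OF lin_comp[OF t act2] merge_lin]
          X_act_lin2[OF h lin_comp[OF t merge_lin]] _ z])
      fix b x assume b: "b \<in> carrier A" and x: "x \<in> carrier (X n)"
      let ?F = "\<lambda>u v w. tcons A n (act A u a \<otimes>\<^bsub>A\<^esub> act A v b) (act (X n) w x)"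
      note cl = A_act_closed X_act_closed A_closed X_tcons_closed
      have bx: "tcons A n b x \<in> carrier ?Z"
        by (rule X_tcons_closed[OF b x])
      have ab: "a \<otimes>\<^bsub>A\<^esub> b \<in> carrier A"
        using a b by simp
      have F: "trilin ?Z ?F"
        using a b x by (intro trilinI X_tcons_lin1 X_tcons_lin2 A_mult_lin1 A_mult_lin2 A_act_lin1 X_act_lin1 lin_id cl)
      have mb: "lin A A (\<lambda>c. act A u a \<otimes>\<^bsub>A\<^esub> c)" if "u \<in> carrier H" for u
        using that a by (intro A_mult_lin2 lin_id cl)
      have "merge n (act ?W h (tcons A (Suc n) a (tcons A n b x))) =
          sw ?Z (\<lambda>u v. merge n (tcons A (Suc n) (act A u a) (act ?Z v (tcons A n b x)))) h"
        unfolding TP_act_tcons[OF A_lmod h a bx]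
        by (rule sw_hom[OF X_vs X_vs merge_lin h TP_diag_bilin[OF A_lmod a bx]])
      also have "\<dots> = sw ?Z (\<lambda>u v. sw ?Z (\<lambda>v' w. ?F u v' w) v) h"
      proof (rule sw_cong[OF X_vs h trilin_swR[OF X_vs F]])
        fix u v assume u: "u \<in> carrier H" and v: "v \<in> carrier H"
        have l: "lin ?Z ?Z (\<lambda>z. merge n (tcons A (Suc n) (act A u a) z))"
          by (rule lin_comp[OF X_tcons_lin2[OF A_act_closed[OF u a] lin_id] merge_lin])
        show "merge n (tcons A (Suc n) (act A u a) (act ?Z v (tcons A n b x))) = sw ?Z (\<lambda>v' w. ?F u v' w) v"
          unfolding TP_act_tcons[OF A_lmod v b x] sw_hom[OF X_vs X_vs l v TP_diag_bilin[OF A_lmod b x]]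
          by (rule sw_cong[OF X_vs v trilin_bilin(1)[OF F u]]) (simp add: merge_tcons cl u a b x)
      qed
      also have "\<dots> = sw ?Z (\<lambda>u w. sw ?Z (\<lambda>u' v. ?F u' v w) u) h"
        by (rule sw_coassoc[OF X_vs h F, symmetric])
      also have "\<dots> = sw ?Z (\<lambda>u w. tcons A n (act A u (a \<otimes>\<^bsub>A\<^esub> b)) (act (X n) w x)) h"
      proof (rule sw_cong[OF X_vs h TP_diag_bilin[OF A_lmod ab x]])
        fix u w assume u: "u \<in> carrier H" and w: "w \<in> carrier H"
        have m: "bilin H H A (\<lambda>u v. act A u a \<otimes>\<^bsub>A\<^esub> act A v b)"
          using a b by (intro bilinI A_mult_lin1 A_mult_lin2 A_act_lin1 lin_id cl)
        show "sw ?Z (\<lambda>u' v. ?F u' v w) u = tcons A n (act A u (a \<otimes>\<^bsub>A\<^esub> b)) (act (X n) w x)"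
          unfolding module_algebra.act_product[OF module_algebra u a b]
          by (rule sw_hom[OF A_vs X_vs X_tcons_lin1[OF X_act_closed[OF w x] lin_id] u m, symmetric])
      qed
      also have "\<dots> = act ?Z h (merge n (tcons A (Suc n) a (tcons A n b x)))"
        by (simp add: merge_tcons a b x TP_act_tcons[OF A_lmod h ab x])
      finally show "merge n (act ?W h (tcons A (Suc n) a (tcons A n b x))) =
          act ?Z h (merge n (tcons A (Suc n) a (tcons A n b x)))" .
    qed
  qed
qed

text \<open>Prepending the unit and then multiplying the first two factors is the identity. The
  multiplication needs a factor to act on, hence the positive \<open>n\<close>.\<close>

lemma divides_X_Suc:
  assumes "0 < n"
  shows "divides (carrier H) (X n) (X (Suc n))"
proof -
  obtain m where m: "n = Suc m"
    using assms by (cases n) auto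
  have "merge m (tcons A (Suc m) \<one>\<^bsub>A\<^esub> x) = x" if "x \<in> carrier (X (Suc m))" for x
    by (rule TP_Suc_hom_ext[OF A_lmod X_vs lin_comp[OF op_hom_lin[OF unit_hom] merge_lin] lin_id _ that])
      (simp add: merge_tcons)
  then show ?thesis
    unfolding m by (rule divides_retract[OF X_vs unit_hom merge_hom])
qed

lemma divides_X_le: "0 < i \<Longrightarrow> i \<le> n \<Longrightarrow> divides (carrier H) (X i) (X n)"
proof (induction n rule: nat_induct)
  case (Suc n)
  show ?case
  proof (cases "i = Suc n")
    case False
    with Suc show ?thesis
      by (intro divides_trans[OF Suc.IH divides_X_Suc X_vs X_vs]) simp_all
  qed (simp add: divides_refl X_vs)
qed simp

text \<open>Every positive power up to \<open>n\<close> divides the \<open>n\<close>-th one, so the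
  truncated tensor sum and its top power divide each other; the sum can be replaced by
  \<open>X n\<close>.\<close>

lemma truncated_divides_iff:
  assumes "0 < n"
  shows "divides (carrier H) (truncated_tensor K H A (n + 1)) (truncated_tensor K H A n) \<longleftrightarrow>
    divides (carrier H) (X (Suc n)) (X n)"
proof
  have v: "vsp (truncated_tensor K H A k)" for k
    unfolding truncated_tensor_def by (rule dsum_vs[OF X_opm])
  have le: "divides (carrier H) (truncated_tensor K H A n) (X n)"
    unfolding truncated_tensor_def by (rule dsum_divides[OF X_opm]) (auto intro: divides_X_le)
  have in_dsum: "divides (carrier H) (X i) (truncated_tensor K H A k)" if "i \<in> {1..k}" for i k
    unfolding truncated_tensor_def by (rule divides_dsum[OF X_opm that])
  {
    assume "divides (carrier H) (truncated_tensor K H A (n + 1)) (truncated_tensor K H A n)"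
    then show "divides (carrier H) (X (Suc n)) (X n)"
      by (intro divides_trans[OF in_dsum[of "Suc n" "n + 1"] divides_trans[OF _ le v v] X_vs v]) simp_all
  }
  assume d: "divides (carrier H) (X (Suc n)) (X n)"
  have nn: "divides (carrier H) (X n) (truncated_tensor K H A n)"
    using assms by (intro in_dsum) simp
  have "divides (carrier H) (X i) (truncated_tensor K H A n)" if "i \<in> {1..n + 1}" for i
    using that in_dsum[of i n] divides_trans[OF d nn X_vs X_vs] by (cases "i = Suc n") auto
  then show "divides (carrier H) (truncated_tensor K H A (n + 1)) (truncated_tensor K H A n)"
    unfolding truncated_tensor_def[of K H A "n + 1"] by (intro dsum_divides[OF X_opm]) simp_all
qed

end

section \<open>Restriction of scalars and minimum depths\<close>

lemma iso_to_summand_index_mono: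
  assumes "iso_to_summand K I M N" "I' \<subseteq> I"
  shows "iso_to_summand K I' M N"
proof -
  have s: "op_submodule K I P N \<Longrightarrow> op_submodule K I' P N" for P
    using assms(2) by (auto simp: op_submodule_def)
  have h: "op_hom K I M (N\<lparr>carrier := P\<rparr>) \<subseteq> op_hom K I' M (N\<lparr>carrier := P\<rparr>)" for P
    using assms(2) by (auto simp: op_hom_def)
  have i: "op_isomorphic K I M (N\<lparr>carrier := P\<rparr>) \<Longrightarrow> op_isomorphic K I' M (N\<lparr>carrier := P\<rparr>)" for P
    unfolding op_isomorphic_def using h[of P] by (auto dest: subsetD)
  obtain P Q where "op_submodule K I P N" "op_submodule K I Q N" "P \<inter> Q = {\<zero>\<^bsub>N\<^esub>}"
    "set_add N P Q = carrier N" "op_isomorphic K I M (N\<lparr>carrier := P\<rparr>)"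
    using assms(1) unfolding iso_to_summand_def by auto
  with s i show ?thesis
    unfolding iso_to_summand_def by (intro exI[of _ P] exI[of _ Q]) simp
qed

lemma similar_index_mono:
  assumes "similar K I M N" "I' \<subseteq> I"
  shows "similar K I' M N"
  using assms(1) iso_to_summand_index_mono[OF _ assms(2)] unfolding similar_def by metis

text \<open>Whichever side carries the full algebra \<open>C\<close>, its operators include those of
  \<open>B\<close>, so the similarity restricts to \<open>B\<close>-\<open>B\<close>-bimodules with
  the same tensor powers.\<close>

lemma has_depth_Suc_of_even:
  assumes "has_depth K B C (2 * n)" "1 \<le> n" "B \<subseteq> carrier C"
  shows "has_depth K B C (2 * n + 1)"
proof -
  \<comment> \<open>Parity eliminates the clauses for odd depths from
    \<open>has_depth\<close>.\<close>
  have *: "2 * n = 2 * k + 1 \<longleftrightarrow> False" "2 * n = 2 * k \<longleftrightarrow> n = k" "2 * n = 1 \<longleftrightarrow> False" for k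
    by presburger+
  have "similar K (Sum_Type.Plus B (carrier C)) (tpow_over K C B (n + 1)) (tpow_over K C B n) \<or>
      similar K (Sum_Type.Plus (carrier C) B) (tpow_over K C B (n + 1)) (tpow_over K C B n)"
    using assms(1) unfolding has_depth_def * by blast
  then have "similar K (Sum_Type.Plus B B) (tpow_over K C B (n + 1)) (tpow_over K C B n)"
    using assms(3) by (auto elim!: similar_index_mono)
  then show ?thesis
    using assms(2) unfolding has_depth_def by blast
qed

lemma Inf_enat_Least: "Inf {enat n | n. P n} = (if \<exists>n. P n then enat (LEAST n. P n) else \<infinity>)"
proof (cases "\<exists>n. P n")
  case True
  then have "P (LEAST n. P n)"
    by (rule LeastI_ex)
  then show ?thesis
    using True by (auto intro!: antisym Inf_lower Inf_greatest Least_le)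
next
  case False
  then show ?thesis
    by (simp add: top_enat_def)
qed

text \<open>If \<open>n\<close> is least with \<open>P n\<close>, then depth
  \<open>2 * n + 1\<close> holds, while any smaller depth, odd or even, would give
  \<open>P k\<close> for the \<open>k\<close> below it by halving. The least depth is thus
  \<open>2 * n\<close> or \<open>2 * n + 1\<close>.\<close>

lemma odd_min_depth_eq:
  assumes odd: "\<And>n. has_depth K B C (2 * n + 1) \<longleftrightarrow> P n"
    and even: "\<And>n. 1 \<le> n \<Longrightarrow> has_depth K B C (2 * n) \<Longrightarrow> has_depth K B C (2 * n + 1)"
  shows "odd_min_depth K B C = 2 * Inf {enat n | n. P n} + 1"
proof (cases "\<exists>n. P n")
  case False
  have "\<not> (1 \<le> m \<and> has_depth K B C m)" for m
  proof (cases "Parity.even m")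
    case True
    then obtain k where "m = 2 * k" by (elim evenE)
    then show ?thesis
      using even[of k] odd[of k] False by auto
  next
    case False
    then obtain k where "m = 2 * k + 1" by (elim oddE)
    then show ?thesis
      using odd[of k] \<open>\<nexists>n. P n\<close> by auto
  qed
  then have "min_depth K B C = \<infinity>"
    unfolding min_depth_def Inf_enat_Least by simp
  then show ?thesis
    using False by (simp add: odd_min_depth_def top_enat_def imult_infinity_right)
next
  case True
  define n where "n = (LEAST n. P n)"
  define m where "m = (LEAST m. 1 \<le> m \<and> has_depth K B C m)"
  have n: "P n"
    unfolding n_def by (rule LeastI_ex[OF True])
  have nle: "n \<le> k" if "P k" for k
    unfolding n_def by (rule Least_le[of P, OF that])
  have h: "1 \<le> 2 * n + 1 \<and> has_depth K B C (2 * n + 1)"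
    using n odd by simp
  have m: "1 \<le> m" "has_depth K B C m"
    using LeastI[of "\<lambda>m. 1 \<le> m \<and> has_depth K B C m", OF h] by (simp_all add: m_def)
  have mle: "m \<le> 2 * n + 1"
    unfolding m_def by (rule Least_le[of "\<lambda>m. 1 \<le> m \<and> has_depth K B C m", OF h])
  have "m = 2 * n + 1 \<or> m = 2 * n"
  proof (cases "Parity.even m")
    case True
    then obtain k where k: "m = 2 * k" by (elim evenE)
    then have "P k"
      using even[of k] odd[of k] m by auto
    then show ?thesis
      using nle[of k] k mle by linarith
  next
    case False
    then obtain k where k: "m = 2 * k + 1" by (elim oddE)
    then have "P k"
      using odd[of k] m by simp
    then show ?thesis
      using nle[of k] k mle by linarith
  qed
  \<comment> \<open>The quotient is \<open>n\<close> in the odd case and \<open>n - 1/2\<close> in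
    the even case; both round up to \<open>n\<close>.\<close>
  then have "\<lceil>(real m - 1) / 2\<rceil> = int n"
    by (intro ceiling_unique) auto
  then have c: "nat \<lceil>(real m - 1) / 2\<rceil> = n"
    by simp
  have "min_depth K B C = enat m"
    unfolding min_depth_def Inf_enat_Least m_def[symmetric] using m by auto
  moreover have "Inf {enat n | n. P n} = enat n"
    unfolding Inf_enat_Least n_def[symmetric] using True by simp
  ultimately show ?thesis
    by (simp add: odd_min_depth_def c numeral_eq_enat one_enat_def)
qed

context smash_ground
begin

section \<open>Depth zero and the comparison of odd depths\<close>

lemma gen_hom: "(\<lambda>a. tpow_gen K A [a]) \<in> op_hom K (carrier H) A (X 1)"
proof (rule op_homI)
  show "lin A (X 1) (\<lambda>a. tpow_gen K A [a])"
    unfolding One_nat_def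
    by (rule same_space_lin2[OF TP_same mlin_Cons_lin[OF tpow_gen_mlin[OF A_vs] _ A_vs]]) simp
qed (simp add: X1_act_gen[unfolded One_nat_def])

lemma hd_mlin: "mlin A 1 A hd"
  unfolding One_nat_def by (rule mlin_ConsI) (auto intro: lin_id mlin_0)

lemma ungen_lin: "lin (X 1) A (lift K A hd)"
  by (rule same_space_lin1[OF TP_same tpow_lift_lin[OF A_vs A_vs hd_mlin]])

lemma ungen_gen: "a \<in> carrier A \<Longrightarrow> lift K A hd (tpow_gen K A [a]) = a"
  by (subst tpow_lift_gen[OF A_vs A_vs hd_mlin]) simp_all

lemma ungen_hom: "lift K A hd \<in> op_hom K (carrier H) (X 1) A"
proof (rule op_homI[OF ungen_lin])
  fix h x assume h: "h \<in> carrier H" and x: "x \<in> carrier (X 1)"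
  show "lift K A hd (act (X 1) h x) = act A h (lift K A hd x)"
    by (rule X1_hom_ext[OF A_vs lin_comp[OF X_act_lin2[OF h lin_id] ungen_lin] A_act_lin2[OF h ungen_lin] _ x])
      (use X1_act_gen h in \<open>simp add: ungen_gen A_act_closed\<close>)
qed

text \<open>Depth zero speaks of \<open>A\<close> itself, whereas the bimodules are induced from
  powers whose elements are cosets. Divisibility in both directions is enough to exchange
  \<open>A\<close> and \<open>X 1\<close>.\<close>

lemma A_divides_X1: "divides (carrier H) A (X 1)"
  by (rule divides_retract[OF A_vs gen_hom ungen_hom]) (rule ungen_gen)

lemma X1_divides_A: "divides (carrier H) (X 1) A"
proof (rule divides_retract[OF X_vs ungen_hom gen_hom])
  fix x assume x: "x \<in> carrier (X 1)"
  show "tpow_gen K A [lift K A hd x] = x"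
    by (rule X1_hom_ext[OF X_vs lin_comp[OF ungen_lin op_hom_lin[OF gen_hom]] lin_id _ x])
      (simp add: ungen_gen)
qed

text \<open>A sum of trivial modules isomorphic to the nonzero \<open>A\<close> has at least one
  summand, which gives divisibility both ways. Conversely, dividing the trivial module forces the
  action to be trivial, and any basis of \<open>A\<close> then gives an isomorphism of
  modules.\<close>

lemma isomorphic_trivial_iff:
  assumes fin: "vectorspace.fin_dim K A" and nz: "\<one>\<^bsub>A\<^esub> \<noteq> \<zero>\<^bsub>A\<^esub>"
  shows "(\<exists>q. op_isomorphic K (carrier H) A (copies q (trivial_module K H))) \<longleftrightarrow>
    divides (carrier H) A (trivial_module K H) \<and> divides (carrier H) (trivial_module K H) A"
proof
  let ?k = "trivial_module K H" and ?I = "carrier H"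
  have kv: "vsp ?k" and k: "opm ?I ?k"
    using lmod_vs[OF trivial_lmod] lmod_opm[OF trivial_lmod] by auto
  note Dv = opm_vs[OF copies_opm[OF k]]
  {
    assume "\<exists>q. op_isomorphic K ?I A (copies q ?k)"
    then obtain q where "op_isomorphic K ?I A (copies q ?k)" by blast
    from isomorphic_retract[OF this A_opm Dv] obtain f g where
      f: "f \<in> op_hom K ?I A (copies q ?k)" and g: "g \<in> op_hom K ?I (copies q ?k) A"
      and gf: "\<And>x. x \<in> carrier A \<Longrightarrow> g (f x) = x"
      and fg: "\<And>y. y \<in> carrier (copies q ?k) \<Longrightarrow> f (g y) = y"
      by metis
    \<comment> \<open>An empty direct sum has one element only, so \<open>f\<close> could not
      separate the unit of \<open>A\<close> from zero.\<close>
    have "q \<noteq> 0"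
    proof
      assume "q = 0"
      then have "x = y" if "x \<in> carrier (copies q ?k)" "y \<in> carrier (copies q ?k)" for x y
        using that by (simp add: copies_def dsum_def)
      then have "f \<one>\<^bsub>A\<^esub> = f \<zero>\<^bsub>A\<^esub>"
        by (simp add: op_hom_closed[OF f])
      then show False
        using gf[of "\<one>\<^bsub>A\<^esub>"] gf[of "\<zero>\<^bsub>A\<^esub>"] nz by simp
    qed
    then have "divides ?I ?k (copies q ?k)"
      unfolding copies_def by (intro divides_dsum[of "{..<q}" ?I "\<lambda>_. ?k" 0] k) simp
    moreover have "divides ?I A (copies q ?k)"
      by (rule divides_retract[OF A_vs f g]) (rule gf)
    moreover have "divides ?I (copies q ?k) A"
      by (rule divides_retract[OF Dv g f]) (rule fg)
    ultimately show "divides ?I A ?k \<and> divides ?I ?k A"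
      using divides_trans[OF _ copies_divides[OF k] A_vs Dv] divides_trans[OF _ _ kv Dv] by blast
  }
  assume d: "divides ?I A ?k \<and> divides ?I ?k A"
  \<comment> \<open>With \<open>h\<close> acting as a scalar, every linear map out of
    \<open>A\<close> into a trivial module is a homomorphism; in particular the coordinates of a
    basis are.\<close>
  then have triv: "act A h a = counit H h \<odot>\<^bsub>A\<^esub> a" if "h \<in> carrier H" "a \<in> carrier A" for h a
    using fac_trivial[of A A "\<lambda>x. x", OF _ A_lmod that] by (simp add: divides_def)
  obtain q b c where b: "\<And>i. i < (q::nat) \<Longrightarrow> b i \<in> carrier A"
    and c: "\<And>i. i < q \<Longrightarrow> lin A (ground K) (c i)"
    and exp: "\<And>v. v \<in> carrier A \<Longrightarrow> finsum A (\<lambda>i. c i v \<odot>\<^bsub>A\<^esub> b i) {..<q} = v"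
    and coef: "\<And>x i. (\<And>i. i < q \<Longrightarrow> x i \<in> carrier K) \<Longrightarrow> i < q \<Longrightarrow>
      c i (finsum A (\<lambda>i. x i \<odot>\<^bsub>A\<^esub> b i) {..<q}) = x i"
    by (rule dual_basis[OF A_vs fin]) blast
  let ?f = "\<lambda>v. \<lambda>i\<in>{..<q}. c i v"
  have ck: "c i v \<in> carrier K" if "i < q" "v \<in> carrier A" for i v
    using lin_closed[OF c[OF that(1)] that(2)] by simp
  have D: "carrier (copies q ?k) = (\<Pi>\<^sub>E i\<in>{..<q}. carrier K)"
    by (simp add: copies_def dsum_def trivial_sel)
  have f: "?f \<in> op_hom K ?I A (copies q ?k)"
  proof (intro op_homI linI)
    fix v assume v: "v \<in> carrier A"
    show "?f v \<in> carrier (copies q ?k)"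
      unfolding D using ck v by simp
    show "?f (v \<oplus>\<^bsub>A\<^esub> w) = ?f v \<oplus>\<^bsub>copies q ?k\<^esub> ?f w" if "w \<in> carrier A" for w
      using lin_add[OF c v that] by (auto simp: copies_def dsum_def trivial_sel intro!: restrict_ext)
    have s: "c i (r \<odot>\<^bsub>A\<^esub> v) = r \<otimes>\<^bsub>K\<^esub> c i v" if "i < q" "r \<in> carrier K" for i r
      using lin_smult[OF c[OF that(1)] that(2) v] by simp
    show "?f (r \<odot>\<^bsub>A\<^esub> v) = r \<odot>\<^bsub>copies q ?k\<^esub> ?f v" if "r \<in> carrier K" for r
      using s[OF _ that] by (auto simp: copies_def dsum_def trivial_sel intro!: restrict_ext)
    show "?f (act A h v) = act (copies q ?k) h (?f v)" if "h \<in> carrier H" for h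
      using s[OF _ counit_closed[OF that]]
      by (auto simp: triv[OF that v] copies_def dsum_def trivial_sel intro!: restrict_ext)
  qed
  have "bij_betw ?f (carrier A) (carrier (copies q ?k))"
    unfolding bij_betw_def
  proof
    show "inj_on ?f (carrier A)"
    proof (rule inj_onI)
      fix v w assume vw: "v \<in> carrier A" "w \<in> carrier A" "?f v = ?f w"
      have "c i v = c i w" if "i < q" for i
        using fun_cong[OF vw(3), of i] that by simp
      then have "finsum A (\<lambda>i. c i v \<odot>\<^bsub>A\<^esub> b i) {..<q} = finsum A (\<lambda>i. c i w \<odot>\<^bsub>A\<^esub> b i) {..<q}"
        using vw b ck by (intro finsum_cong) auto
      then show "v = w"
        by (simp only: exp vw(1,2))
    qed
    show "?f ` carrier A = carrier (copies q ?k)"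
    proof
      show "?f ` carrier A \<subseteq> carrier (copies q ?k)"
        using op_hom_closed[OF f] by blast
      show "carrier (copies q ?k) \<subseteq> ?f ` carrier A"
      proof
        fix x assume "x \<in> carrier (copies q ?k)"
        then have x: "x \<in> (\<Pi>\<^sub>E i\<in>{..<q}. carrier K)"
          by (simp only: D)
        then have xk: "x i \<in> carrier K" if "i < q" for i
          using that by auto
        let ?v = "finsum A (\<lambda>i. x i \<odot>\<^bsub>A\<^esub> b i) {..<q}"
        have "?v \<in> carrier A"
          using xk b by (intro finsum_closed) auto
        moreover have "?f ?v = x"
        proof (rule PiE_ext[OF _ x])
          show "?f ?v \<in> (\<Pi>\<^sub>E i\<in>{..<q}. carrier K)"
            using ck \<open>?v \<in> carrier A\<close> by simp
          show "?f ?v i = x i" if "i \<in> {..<q}" for i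
            using that coef[of x i, OF xk] by simp
        qed
        ultimately show "x \<in> ?f ` carrier A"
          by (intro image_eqI[of x ?f ?v]) simp_all
      qed
    qed
  qed
  with f show "\<exists>q. op_isomorphic K ?I A (copies q ?k)"
    unfolding op_isomorphic_def by blast
qed

lemma has_module_depth_iff:
  assumes "0 < n"
  shows "has_module_depth K H A n \<longleftrightarrow> divides (carrier H) (X (Suc n)) (X n)"
proof -
  have "opm (carrier H) (truncated_tensor K H A k)" for k
    unfolding truncated_tensor_def by (rule dsum_opm[OF X_opm])
  then show ?thesis
    using assms by (simp add: has_module_depth_def summand_iff_divides(2) truncated_divides_iff[simplified])
qed

text \<open>Similarity asks for two divisibilities. For positive \<open>n\<close> one of them is
  \<open>divides_X_Suc\<close> and the other is module depth \<open>n\<close>; for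
  \<open>n = 0\<close> both appear in \<open>isomorphic_trivial_iff\<close>, after exchanging
  \<open>X 1\<close> with \<open>A\<close>.\<close>

lemma has_depth_odd_iff:
  assumes finH: "vectorspace.fin_dim K H" and finA: "vectorspace.fin_dim K A" and nz: "\<one>\<^bsub>A\<^esub> \<noteq> \<zero>\<^bsub>A\<^esub>"
  shows "has_depth K B C (2 * n + 1) \<longleftrightarrow> has_module_depth K H A n"
proof (cases "n = 0")
  case True
  have "has_depth K B C 1 \<longleftrightarrow> similar K (Sum_Type.Plus B B) (Y 1) reg"
  proof -
    have "(1::nat) = 2 * k + 1 \<longleftrightarrow> k = 0" "(1::nat) = 2 * k \<longleftrightarrow> False" for k
      by presburger+
    then show ?thesis
      unfolding has_depth_def by simp
  qed
  also have "\<dots> \<longleftrightarrow> divides (carrier H) A (trivial_module K H) \<and> divides (carrier H) (trivial_module K H) A"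
    unfolding similar_reg_iff[OF finH nz]
    using divides_trans[OF A_divides_X1 _ A_vs X_vs] divides_trans[OF X1_divides_A _ X_vs A_vs]
      divides_trans[OF _ A_divides_X1 lmod_vs[OF trivial_lmod] A_vs]
      divides_trans[OF _ X1_divides_A lmod_vs[OF trivial_lmod] X_vs]
    by blast
  finally show ?thesis
    using True isomorphic_trivial_iff[OF finA nz] by (simp add: has_module_depth_def)
next
  case False
  have *: "2 * n + 1 = 2 * k + 1 \<longleftrightarrow> k = n" "2 * n + 1 = 2 * k \<longleftrightarrow> False" "2 * n + 1 = 1 \<longleftrightarrow> n = 0" for k
    by presburger+
  have "1 \<le> n"
    using False by simp
  then have "has_depth K B C (2 * n + 1) \<longleftrightarrow> similar K (Sum_Type.Plus B B) (Y (n + 1)) (Y n)"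
    unfolding has_depth_def * using False by blast
  also have "\<dots> \<longleftrightarrow> divides (carrier H) (X (Suc n)) (X n)"
    using False finH divides_X_Suc[of n] by (simp add: similar_Y_iff)
  finally show ?thesis
    using False by (simp add: has_module_depth_iff)
qed

end

theorem theorem6p2:
  fixes K :: "('k, 'r) ring_scheme"
    and H :: "('k, 'h) hopf"
    and A :: "('k, 'a, 'h) opmod"
  assumes "field K"
    and "hopf_algebra K H" and "vectorspace.fin_dim K H"
    and "module_algebra K H A" and "vectorspace.fin_dim K A"
    and "\<one>\<^bsub>A\<^esub> \<noteq> \<zero>\<^bsub>A\<^esub>"
  shows "odd_min_depth K (smash_copy K H A) (smash K H A) = 2 * module_depth K H A + 1"
proof -
  interpret smash_ground K H A
    by (intro smash_ground.intro hopf_ground.intro ground_field.intro hopf_ground_axioms.intro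
        smash_ground_axioms.intro assms(1,2,4))
  show ?thesis
    unfolding module_depth_def
  proof (rule odd_min_depth_eq)
    show "has_depth K (smash_copy K H A) (smash K H A) (2 * n + 1) \<longleftrightarrow> has_module_depth K H A n" for n
      by (rule has_depth_odd_iff) (fact assms)+
    show "has_depth K (smash_copy K H A) (smash K H A) (2 * n + 1)"
      if "1 \<le> n" "has_depth K (smash_copy K H A) (smash K H A) (2 * n)" for n
      by (rule has_depth_Suc_of_even[OF that(2,1) submD(1)[OF B_subm]])
  qed
qed

end
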